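(* Assume that: (a) there exists a neighborhood $\mathcal{N}$ of $\zeta_0$ such that $P(\mathcal{R}(\zeta)>0)\to 1$ as $n\to\infty$ for any $\zeta\in\mathcal{N}$; (b) the distribution $G_X$ has bounded support $\mathcal{X}$; (c) the conditional distribution function $F_X(t)$ of $Y$ given $X$ is twice continuously differentiable in $t$ for all $X\in\mathcal{X}$; (d) at any $X\in\mathcal{X}$, the conditional density $f_X(t)=F_X'(t)$ satisfies $f_X(t)>0$ for $t$ in a neighborhood of $F_X^{-1}(\tau_d)$, for each $d=1,\ldots,k$; (e) $E\{m(X,Y,\zeta_0)m(X,Y,\zeta_0)^\top\}$ is positive definite; (f) $\log\{p_0(\zeta)\}$ has bounded first derivative in a neighborhood of $\zeta_0$, where $p_0$ is the (fixed) prior density. Then the posterior density $p(\zeta|D)\propto p_0(\zeta)\mathcal{R}(\zeta)$ has the following expansion on any sequence of sets $\{\zeta:\ \zeta-\zeta_0=O(n^{-1/2})\}$: $$p(\zeta|D)\propto\exp\Bigl\{-\tfrac12(\zeta-\hat\zeta)^\top J_n(\zeta-\hat\zeta)+R_n\Bigr\},$$ where $\hat\zeta$ is the maximum empirical likelihood estimator, $$J_n=nV_{12}^\top V_{11}^{-1}V_{12},\qquad V_{11}=\Psi\otimes E(XX^\top),\qquad V_{12}=-\frac{\partial E\{m(X,Y,\zeta)\}}{\partial\zeta}\Big|_{\zeta=\zeta_0},$$ and $R_n=o_p(1)$. Moreover, when $J_n$ is positive definite, $J_n^{1/2}(\zeta-\hat\zeta)$, with $\zeta$ distributed according to the posterior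 $p(\cdot|D)$, converges in distribution to $N(0,I)$.
   Context: Let $D=\{(X_i,Y_i), i=1,\ldots,n\}$ be a random (i.i.d.) sample of $(X,Y)$, where $X=(x_0,x_1,\ldots,x_p)^\top\in\mathbb{R}^{p+1}$ with $x_0=1$ (intercept) and $p$ random covariates with distribution $G_X$ (support $\mathcal{X}$), and $Y\in\mathbb{R}$. Fix $0<\tau_1<\cdots<\tau_k<1$. The $\tau_d$-th conditional quantile of $Y$ given $X$ is $Q_{\tau_d}(Y|X)=X^\top\beta_0(\tau_d)$ with $\beta_0(\tau_d)\in\mathbb{R}^{p+1}$. $F_X$ denotes the conditional distribution function of $Y$ given $X$. The true parameter is $\zeta_0=(\beta_0(\tau_1),\ldots,\beta_0(\tau_k))\in\mathbb{R}^{k(p+1)}$ and a generic parameter is $\zeta=(\beta(\tau_1),\ldots,\beta(\tau_k))$. The $k(p+1)$-dimensional estimating function $m(X,Y,\zeta)$ has components $$m_{d(p+1)+j}(X,Y,\zeta)=\psi_{\tau_{d+1}}\bigl(Y-X^\top\beta(\tau_{d+1})\bigr)\,x_j,\qquad d=0,\ldots,k-1,\ j=0,\ldots,p,$$ where $\psi_\tau(u)=1_{\{u<0\}}-\tau$ if $u\ne 0$ and $\psi_\tau(0)=0$. The profile empirical likelihood ratio is $$\mathcal{R}(\zeta)=\max\Bigl\{\prod_{i=1}^n (n\omega_i)\ \Big|\ \sum_{i=1}^n\omega_i m(X_i,Y_i,\zeta)=0,\ \omega_i\ge 0,\ \sum_{i=1}^n\omega_i=1\Bigr\},$$ with $\mathcal{R}(\zeta)=0$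 if the constraint set is empty. Standing assumption: $\zeta_0$ lies in a compact set of the parameter space, and the optimization is carried out over this compact set. The maximum empirical likelihood estimator (MELE) is $\hat\zeta=\arg\max\mathcal{R}(\zeta)$ over this compact set (any maximizer). $\Psi$ is the $k\times k$ matrix with entries $\Psi_{ij}=\tau_i\wedge\tau_j-\tau_i\tau_j$, and $\otimes$ is the Kronecker product. The "posterior" density with prior density $p_0$ (not depending on $n$) is defined by $p(\zeta|D)\propto p_0(\zeta)\mathcal{R}(\zeta)$; proportionality is with respect to $\zeta$ (constants not depending on $\zeta$ are dropped).
   Formalization: The true parameter ζ0 is assumed to lie in the interior of the compact set (the claim fails e.g. for the set {ζ0}); E m(X,Y,ζ) is assumed differentiable at ζ0 so that V12 exists, and p0 is a proper density, positive near ζ0. *)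

theory Defs
  imports "HOL-Probability.Probability"
begin

text \<open>
  Conventions: \<open>'k\<close> indexes the quantile levels and \<open>'q\<close> the \<open>p + 1\<close> coordinates of \<open>X\<close>
  (intercept included), so a parameter is a vector in \<open>real ^ ('k \<times> 'q)\<close>; the pair \<open>(d, j)\<close>
  plays the role of the position \<open>d(p+1)+j\<close>. A sample of size \<open>n\<close> is indexed by \<open>i < n\<close>.
\<close>

subsection \<open>Matrices\<close>

definition outer :: "real ^ 'n \<Rightarrow> real ^ 'm \<Rightarrow> real ^ 'm ^ 'n" where
  "outer u v = (\<chi> i j. u $ i * v $ j)"

definition kronecker ::
  "real ^ ('b::finite) ^ ('a::finite) \<Rightarrow> real ^ ('d::finite) ^ ('c::finite) \<Rightarrow> real ^ ('b \<times> 'd) ^ ('a \<times> 'c)" where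
  "kronecker A B = (\<chi> r s. A $ fst r $ fst s * B $ snd r $ snd s)"

definition pos_semidef :: "real ^ 'n ^ 'n \<Rightarrow> bool" where
  "pos_semidef A \<longleftrightarrow> transpose A = A \<and> (\<forall>v. 0 \<le> v \<bullet> (A *v v))"

definition pos_def :: "real ^ 'n ^ 'n \<Rightarrow> bool" where
  "pos_def A \<longleftrightarrow> transpose A = A \<and> (\<forall>v. v \<noteq> 0 \<longrightarrow> 0 < v \<bullet> (A *v v))"

text \<open>Unique for positive semidefinite \<open>A\<close>; unspecified otherwise.\<close>
definition matrix_sqrt :: "real ^ 'n ^ 'n \<Rightarrow> real ^ 'n ^ 'n" where
  "matrix_sqrt A = (THE S. pos_semidef S \<and> S ** S = A)"


subsection \<open>Distributions\<close>

definition msupport :: "'a::topological_space measure \<Rightarrow> 'a set" where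
  "msupport \<mu> = {x. \<forall>U. open U \<and> x \<in> U \<longrightarrow> 0 < emeasure \<mu> U}"

text \<open>\<open>PY x\<close> is a (regular) conditional distribution of \<open>Y\<close> given \<open>X = x\<close>, where \<open>(X, Y) \<sim> P\<close>;
  the conditional distribution function is then \<open>cdf (PY x)\<close>.\<close>
definition is_cond_dist ::
  "('a::second_countable_topology \<times> real) measure \<Rightarrow> ('a \<Rightarrow> real measure) \<Rightarrow> bool" where
  "is_cond_dist P PY \<longleftrightarrow>
     PY \<in> borel \<rightarrow>\<^sub>M prob_algebra borel \<and>
     (\<forall>A\<in>sets borel. \<forall>B\<in>sets borel.
        emeasure P (A \<times> B) = (\<integral>\<^sup>+x\<in>A. emeasure (PY x) B \<partial>distr P borel fst))"

definition quantile :: "real measure \<Rightarrow> real \<Rightarrow> real" where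
  "quantile \<mu> \<tau> = Inf {t. \<tau> \<le> cdf \<mu> t}"

definition twice_cont_diff :: "(real \<Rightarrow> real) \<Rightarrow> bool" where
  "twice_cont_diff F \<longleftrightarrow>
     (\<forall>t. F differentiable at t) \<and> (\<forall>t. deriv F differentiable at t) \<and>
     continuous_on UNIV (deriv (deriv F))"

definition std_normal_vec :: "(real ^ 'n) measure" where
  "std_normal_vec = density lborel (\<lambda>z. ennreal (\<Prod>i\<in>UNIV. std_normal_density (z $ i)))"


subsection \<open>Convergence in probability\<close>

text \<open>Outer probability is used because \<open>A n\<close> may involve a supremum over uncountably many
  parameters or a non-measurable choice of maximizer; it agrees with \<open>emeasure\<close> on measurable sets.\<close>
definition prob_vanishes :: "'w measure \<Rightarrow> (nat \<Rightarrow> 'w \<Rightarrow> bool) \<Rightarrow> bool" where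
  "prob_vanishes M A \<longleftrightarrow> (\<lambda>n. outer_measure_of M {\<omega> \<in> space M. A n \<omega>}) \<longlonglongrightarrow> 0"

definition small_op1_on ::
  "'w measure \<Rightarrow> (nat \<Rightarrow> 'z set) \<Rightarrow> (nat \<Rightarrow> 'w \<Rightarrow> 'z \<Rightarrow> real) \<Rightarrow> bool" where
  "small_op1_on M S r \<longleftrightarrow>
     (\<forall>\<epsilon>>0. prob_vanishes M (\<lambda>n \<omega>. \<exists>z\<in>S n. \<epsilon> < \<bar>r n \<omega> z\<bar>))"

text \<open>Convergence in distribution, in probability, of the random measures \<open>\<mu> n \<omega>\<close> to \<open>\<nu>\<close>.\<close>
definition weak_conv_in_prob ::
  "'w measure \<Rightarrow> (nat \<Rightarrow> 'w \<Rightarrow> 'a::topological_space measure) \<Rightarrow> 'a measure \<Rightarrow> bool" where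
  "weak_conv_in_prob M \<mu> \<nu> \<longleftrightarrow>
     (\<forall>g :: 'a \<Rightarrow> real. continuous_on UNIV g \<and> bounded (range g) \<longrightarrow>
        (\<forall>\<epsilon>>0. prob_vanishes M
          (\<lambda>n \<omega>. \<epsilon> < \<bar>(\<integral>z. g z \<partial>\<mu> n \<omega>) - (\<integral>z. g z \<partial>\<nu>)\<bar>)))"


subsection \<open>Empirical likelihood for quantile regression\<close>

definition \<psi> :: "real \<Rightarrow> real \<Rightarrow> real" where
  "\<psi> \<tau> u = (if u = 0 then 0 else (if u < 0 then 1 else 0) - \<tau>)"

definition beta :: "real ^ ('k::finite \<times> 'q::finite) \<Rightarrow> 'k \<Rightarrow> real ^ 'q" where
  "beta \<zeta> d = (\<chi> j. \<zeta> $ (d, j))"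

definition m_est ::
  "('k::finite \<Rightarrow> real) \<Rightarrow> real ^ 'q \<Rightarrow> real \<Rightarrow> real ^ ('k \<times> 'q) \<Rightarrow> real ^ ('k \<times> 'q)" where
  "m_est \<tau> x y \<zeta> = (\<chi> r. \<psi> (\<tau> (fst r)) (y - x \<bullet> beta \<zeta> (fst r)) * x $ snd r)"

definition el_weights ::
  "('k::finite \<Rightarrow> real) \<Rightarrow> nat \<Rightarrow> (nat \<Rightarrow> real ^ 'q) \<Rightarrow> (nat \<Rightarrow> real) \<Rightarrow> real ^ ('k \<times> 'q)
     \<Rightarrow> (nat \<Rightarrow> real) set" where
  "el_weights \<tau> n x y \<zeta> =
     {w. (\<Sum>i<n. w i *\<^sub>R m_est \<tau> (x i) (y i) \<zeta>) = 0 \<and> (\<forall>i<n. 0 \<le> w i) \<and> (\<Sum>i<n. w i) = 1}"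

text \<open>The supremum is a maximum: the feasible weights restricted to \<open>{..<n}\<close> form a compact set.\<close>
definition el_ratio ::
  "('k::finite \<Rightarrow> real) \<Rightarrow> nat \<Rightarrow> (nat \<Rightarrow> real ^ 'q) \<Rightarrow> (nat \<Rightarrow> real) \<Rightarrow> real ^ ('k \<times> 'q) \<Rightarrow> real" where
  "el_ratio \<tau> n x y \<zeta> =
     (if el_weights \<tau> n x y \<zeta> = {} then 0
      else (SUP w \<in> el_weights \<tau> n x y \<zeta>. \<Prod>i<n. real n * w i))"

text \<open>Identically zero in the degenerate case where the normalizing integral vanishes.\<close>
definition posterior_density ::
  "(real ^ ('k::finite \<times> 'q::finite) \<Rightarrow> real) \<Rightarrow> ('k \<Rightarrow> real) \<Rightarrow> nat \<Rightarrow> (nat \<Rightarrow> real ^ 'q) \<Rightarrow> (nat \<Rightarrow> real)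
     \<Rightarrow> real ^ ('k \<times> 'q) \<Rightarrow> real" where
  "posterior_density p0 \<tau> n x y \<zeta> =
     p0 \<zeta> * el_ratio \<tau> n x y \<zeta> / (\<integral>\<xi>. p0 \<xi> * el_ratio \<tau> n x y \<xi> \<partial>lborel)"

definition posterior ::
  "(real ^ ('k::finite \<times> 'q::finite) \<Rightarrow> real) \<Rightarrow> ('k \<Rightarrow> real) \<Rightarrow> nat \<Rightarrow> (nat \<Rightarrow> real ^ 'q) \<Rightarrow> (nat \<Rightarrow> real)
     \<Rightarrow> (real ^ ('k \<times> 'q)) measure" where
  "posterior p0 \<tau> n x y = density lborel (\<lambda>\<zeta>. ennreal (posterior_density p0 \<tau> n x y \<zeta>))"

definition Psi_mat :: "('k::finite \<Rightarrow> real) \<Rightarrow> real ^ 'k ^ 'k" where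
  "Psi_mat \<tau> = (\<chi> d e. min (\<tau> d) (\<tau> e) - \<tau> d * \<tau> e)"

definition V11 :: "((real ^ 'q) \<times> real) measure \<Rightarrow> ('k::finite \<Rightarrow> real) \<Rightarrow> real ^ ('k \<times> 'q) ^ ('k \<times> 'q)" where
  "V11 P \<tau> = kronecker (Psi_mat \<tau>) (\<integral>z. outer (fst z) (fst z) \<partial>P)"

definition J_mat ::
  "((real ^ 'q) \<times> real) measure \<Rightarrow> ('k::finite \<Rightarrow> real) \<Rightarrow> real ^ ('k \<times> 'q) ^ ('k \<times> 'q) \<Rightarrow> nat
     \<Rightarrow> real ^ ('k \<times> 'q) ^ ('k \<times> 'q)" where
  "J_mat P \<tau> V12 n = real n *\<^sub>R (transpose V12 ** matrix_inv (V11 P \<tau>) ** V12)"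

end

theory Submission
  imports Defs
begin

text \<open>
  With \<open>mbar \<zeta>\<close> the sample mean of \<open>m (X, Y, \<zeta>)\<close>, the empirical likelihood ratio satisfies
  \<open>ln R \<zeta> = - n/2 mbar \<zeta> \<bullet> V11\<^sup>-\<^sup>1 mbar \<zeta> + o(1)\<close> wherever \<open>mbar \<zeta> = O(n\<^sup>-\<^sup>1\<^sup>/\<^sup>2)\<close>: the upper bound comes from
  weak duality with multiplier \<open>V11\<^sup>-\<^sup>1 mbar\<close>, the lower bound from the explicit weights
  \<open>(1 - a \<bullet> (m i - mbar)) / n\<close>. On a ball of radius \<open>s\<close> the increments of \<open>mbar\<close> are uniformly close to
  those of their mean: a finite grid suffices, because the oscillation of \<open>m\<close> in a small ball is at most an
  indicator of \<open>\<bar>Y - X\<^sup>T\<beta>\<bar> \<le> \<rho>\<close>, whose mean is controlled by the derivative of \<open>E m\<close> in the intercept direction.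
  Hence \<open>ln R\<close> is quadratic at scale \<open>n\<^sup>-\<^sup>1\<^sup>/\<^sup>2\<close>. Since \<open>u \<bullet> m (X, Y, \<zeta> + t u)\<close> increases in \<open>t\<close>, applying the
  same bound along dyadic radii gives \<open>R \<zeta> \<le> exp (- c n min(\<bar>\<zeta> - \<zeta>0\<bar>, \<delta>)\<^sup>2)\<close> outside that scale, also at infinity.
  This localises the maximizer and the posterior mass, and Laplace's method yields the normal limit.
\<close>

section \<open>The empirical likelihood ratio of a finite set of vectors\<close>

text \<open>The estimating function is a step function of \<zeta>, so the log-ratio has no
  derivatives to expand. Only its mean is differentiable, at the single point \<zeta>0 and without a
  rate, and so every error is an arbitrary \<epsilon>. Chebyshev's inequality on a finite grid is
  strong enough because the oscillation is bounded with mean O(s) on a ball of radius s: its second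
  moment is O(s) too, so a deviation of size \<epsilon> s has probability O(1/(n s)). This is
  O(n^(-1/2)) at s = C / sqrt n and summable over dyadic radii. The expansion has a natural centre,
  the zero of the linearised sample mean. The maximiser is an arbitrary, perhaps non-measurable
  choice; it takes over as centre by a comparison of two values of the ratio, on an event chosen
  without reference to it. The posterior is normalised over the whole space and not over the compact
  set, hence the tail bound everywhere. Coercivity of the derivative of the mean is not among the
  hypotheses: it comes from positive densities through Fatou's lemma, since nothing dominates the
  densities.\<close>

definition elw :: "nat \<Rightarrow> (nat \<Rightarrow> 'a::real_vector) \<Rightarrow> (nat \<Rightarrow> real) set" where
  "elw n m = {w. (\<Sum>i<n. w i *\<^sub>R m i) = 0 \<and> (\<forall>i<n. 0 \<le> w i) \<and> (\<Sum>i<n. w i) = 1}"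

definition elr :: "nat \<Rightarrow> (nat \<Rightarrow> 'a::real_vector) \<Rightarrow> real" where
  "elr n m = (if elw n m = {} then 0 else (SUP w \<in> elw n m. \<Prod>i<n. real n * w i))"

lemma el_ratio_eq_elr: "el_ratio \<tau> n x y \<zeta> = elr n (\<lambda>i. m_est \<tau> (x i) (y i) \<zeta>)"
  unfolding el_ratio_def elr_def el_weights_def elw_def by simp

lemma elr_cong: "(\<And>i. i < n \<Longrightarrow> m i = m' i) \<Longrightarrow> elr n m = elr n m'"
proof -
  assume "\<And>i. i < n \<Longrightarrow> m i = m' i"
  then have "elw n m = elw n m'" unfolding elw_def
    using sum.cong[of "{..<n}" "{..<n}" "\<lambda>i. w i *\<^sub>R m i" "\<lambda>i. w i *\<^sub>R m' i" for w] by auto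
  then show ?thesis by (simp add: elr_def)
qed

section \<open>Logarithm bounds and weak duality\<close>

text \<open>The difference f has derivative \<open>t\<^sup>2 / (1 + t)\<close>, which lies between 0
  and \<open>2 * t\<^sup>2\<close> for t \<ge> -1/2. Hence f and \<open>x ^ 3 - f x\<close> are both
  nondecreasing there and vanish at 0, which bounds f on either side of 0.\<close>

lemma ln_one_plus_taylor2:
  fixes x :: real
  assumes "\<bar>x\<bar> \<le> 1/2"
  shows "\<bar>ln (1 + x) - x + x\<^sup>2 / 2\<bar> \<le> \<bar>x\<bar> ^ 3"
proof -
  define f :: "real \<Rightarrow> real" where "f = (\<lambda>x. ln (1 + x) - x + x\<^sup>2 / 2)"
  have df: "(f has_real_derivative t\<^sup>2 / (1 + t)) (at t)" if "- (1/2) \<le> t" for t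
    unfolding f_def using that
    by (auto intro!: derivative_eq_intros simp: field_simps power2_eq_square)
  have mono: "f a \<le> f b \<and> b ^ 3 - f b \<ge> a ^ 3 - f a" if "- (1/2) \<le> a" "a \<le> b" for a b
  proof
    show "f a \<le> f b"
    proof (rule DERIV_nonneg_imp_nondecreasing[OF that(2)])
      fix t assume "a \<le> t"
      then show "\<exists>y. (f has_real_derivative y) (at t) \<and> 0 \<le> y"
        using that df[of t] by (intro exI[of _ "t\<^sup>2 / (1 + t)"]) auto
    qed
    show "b ^ 3 - f b \<ge> a ^ 3 - f a"
    proof (rule DERIV_nonneg_imp_nondecreasing[OF that(2)])
      fix t assume t: "a \<le> t" "t \<le> b"
      then have t2: "- (1/2) \<le> t" using that by simp
      have "((\<lambda>x. x ^ 3 - f x) has_real_derivative 3 * t\<^sup>2 - t\<^sup>2 / (1 + t)) (at t)"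
        using df[OF t2] by (auto intro!: derivative_eq_intros)
      moreover have "t\<^sup>2 / (1 + t) \<le> t\<^sup>2 / (1/2)"
        by (rule divide_left_mono) (use t2 in auto)
      ultimately show "\<exists>y. ((\<lambda>x. x ^ 3 - f x) has_real_derivative y) (at t) \<and> 0 \<le> y"
        by (intro exI[of _ "3 * t\<^sup>2 - t\<^sup>2 / (1 + t)"] conjI) (auto intro: order_trans)
    qed
  qed
  have f0: "f 0 = 0" by (simp add: f_def)
  show ?thesis
  proof (cases "0 \<le> x")
    case True
    then show ?thesis using mono[of 0 x] f0 unfolding f_def by simp
  next
    case False
    then show ?thesis using mono[of x 0] f0 assms unfolding f_def by (simp add: power3_eq_cube abs_mult)
  qed
qed

lemma ln_one_plus_lower: 
  assumes "\<bar>x\<bar> \<le> (1/2::real)"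
  shows "x - 2 * x\<^sup>2 \<le> ln (1 + x)"
proof -
  have "\<bar>x\<bar> ^ 3 \<le> x\<^sup>2"
    using mult_left_mono[of "\<bar>x\<bar>" 1 "x\<^sup>2"] assms by (simp add: power3_eq_cube power2_eq_square)
  then show ?thesis using ln_one_plus_taylor2[OF assms] zero_le_power2[of x] unfolding abs_le_iff by linarith
qed

text \<open>Each factor \<open>n * w i * (1 + g i)\<close> is at most the exponential of itself
  minus 1, and these exponents add up to n times the sum of \<open>w i * g i\<close>, a nonpositive
  number.\<close>

lemma prod_weights_le:
  fixes g :: "nat \<Rightarrow> real"
  assumes w: "w \<in> elw n m" and s: "(\<Sum>i<n. w i * g i) \<le> 0" and g: "\<And>i. i < n \<Longrightarrow> 0 < 1 + g i"
  shows "(\<Prod>i<n. real n * w i) \<le> exp (- (\<Sum>i<n. ln (1 + g i)))"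
proof -
  have w0: "\<And>i. i < n \<Longrightarrow> 0 \<le> w i" and w1: "(\<Sum>i<n. w i) = 1" using w by (auto simp: elw_def)
  have "(\<Prod>i<n. real n * w i) * (\<Prod>i<n. 1 + g i) = (\<Prod>i<n. real n * w i * (1 + g i))"
    by (simp add: prod.distrib)
  also have "\<dots> \<le> (\<Prod>i<n. exp (real n * w i * (1 + g i) - 1))"
  proof (rule prod_mono)
    fix i assume "i \<in> {..<n}"
    then show "0 \<le> real n * w i * (1 + g i) \<and> real n * w i * (1 + g i) \<le> exp (real n * w i * (1 + g i) - 1)"
      using w0[of i] g[of i] exp_ge_add_one_self[of "real n * w i * (1 + g i) - 1"] by auto
  qed
  also have "\<dots> = exp (\<Sum>i<n. real n * w i * (1 + g i) - 1)" by (simp add: exp_sum)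
  also have "(\<Sum>i<n. real n * w i * (1 + g i) - 1) = real n * (\<Sum>i<n. w i * g i)"
    using w1 by (simp add: algebra_simps sum.distrib sum_subtractf flip: sum_distrib_left)
  also have "exp \<dots> \<le> 1" using s by (simp add: mult_nonneg_nonpos)
  finally have *: "(\<Prod>i<n. real n * w i) * (\<Prod>i<n. 1 + g i) \<le> 1" by simp
  have "exp (\<Sum>i<n. ln (1 + g i)) = (\<Prod>i<n. 1 + g i)" using g by (simp add: exp_sum)
  moreover have "0 < (\<Prod>i<n. 1 + g i)" using g by (intro prod_pos) auto
  ultimately show ?thesis using * by (simp add: exp_minus field_simps)
qed

lemma elr_le_exp:
  fixes g :: "nat \<Rightarrow> real"
  assumes "\<And>w. w \<in> elw n m \<Longrightarrow> (\<Sum>i<n. w i * g i) \<le> 0" and "\<And>i. i < n \<Longrightarrow> 0 < 1 + g i"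
  shows "elr n m \<le> exp (- (\<Sum>i<n. ln (1 + g i)))"
proof (cases "elw n m = {}")
  case False
  have "(SUP w \<in> elw n m. \<Prod>i<n. real n * w i) \<le> exp (- (\<Sum>i<n. ln (1 + g i)))"
    by (rule cSUP_least[OF False]) (rule prod_weights_le[OF _ assms])
  then show ?thesis using False by (simp add: elr_def)
qed (simp add: elr_def)

lemma elr_le_1: "elr n m \<le> 1"
  using elr_le_exp[of n m "\<lambda>_. 0"] by simp

text \<open>Weights with index at least n are unconstrained, so \<open>elw\<close> is not compact;
  that the supremum is finite comes from duality with g = 0, which bounds every product by
  1.\<close>

lemma elr_ge:
  assumes "w \<in> elw n m"
  shows "(\<Prod>i<n. real n * w i) \<le> elr n m"
proof -
  have "bdd_above ((\<lambda>w. \<Prod>i<n. real n * w i) ` elw n m)"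
    by (rule bdd_aboveI2[of _ _ 1]) (use prod_weights_le[of _ n m "\<lambda>_. 0"] in simp)
  then show ?thesis unfolding elr_def using assms by (auto intro!: cSUP_upper)
qed

lemma elr_nonneg: "0 \<le> elr n m"
proof (cases "elw n m = {}")
  case False
  then obtain w where w: "w \<in> elw n m" by auto
  then have "0 \<le> (\<Prod>i<n. real n * w i)" by (intro prod_nonneg) (auto simp: elw_def)
  then show ?thesis using elr_ge[OF w] by simp
qed (simp add: elr_def)

text \<open>The dual test is built from m while the constraint concerns m': weights that annihilate
  m' make the weighted sum of the smaller numbers u . m i nonpositive. A bound computed at one
  parameter is thereby carried to parameters farther out on the same ray.\<close>

lemma elr_tail:
  fixes m m' :: "nat \<Rightarrow> 'a::real_inner"
  assumes n: "n > 0" and B: "B > 0" and b: "\<And>i. i < n \<Longrightarrow> \<bar>u \<bullet> m i\<bar> \<le> B"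
    and le: "\<And>i. i < n \<Longrightarrow> u \<bullet> m i \<le> u \<bullet> m' i"
    and \<gamma>: "0 \<le> \<gamma>" "real n * \<gamma> \<le> (\<Sum>i<n. u \<bullet> m i)"
  shows "elr n m' \<le> exp (- real n * \<gamma>\<^sup>2 / (8 * B\<^sup>2))"
proof -
  have "(\<Sum>i<n. u \<bullet> m i) \<le> real n * B" using sum_bounded_above[of "{..<n}" "\<lambda>i. u \<bullet> m i" B] b by (simp add: abs_le_iff)
  then have gB: "\<gamma> \<le> B" using \<gamma> n by (meson mult_le_cancel_left_pos of_nat_0_less_iff order_trans)
  \<comment> \<open>Maximiser of \<open>l * \<gamma> - 2 * (l * B)\<^sup>2\<close>, the bound per
    observation, with value \<open>\<gamma>\<^sup>2 / (8 * B\<^sup>2)\<close>. Since \<gamma> \<le>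
    B, it keeps l B within 1/4.\<close>
  define l where "l = \<gamma> / (4 * B\<^sup>2)"
  have l0: "0 \<le> l" using \<gamma> by (simp add: l_def)
  have lB: "l * B \<le> 1/4" using gB B by (simp add: l_def field_simps power2_eq_square)
  have x: "\<bar>l * (u \<bullet> m i)\<bar> \<le> 1/4" if "i < n" for i
    using mult_left_mono[OF b[OF that] l0] lB l0 by (simp add: abs_mult)
  have "elr n m' \<le> exp (- (\<Sum>i<n. ln (1 + l * (u \<bullet> m i))))"
  proof (rule elr_le_exp)
    fix w assume w: "w \<in> elw n m'"
    have "(\<Sum>i<n. w i * (l * (u \<bullet> m i))) \<le> (\<Sum>i<n. w i * (l * (u \<bullet> m' i)))"
      using w le l0 by (intro sum_mono mult_left_mono) (auto simp: elw_def)
    also have "\<dots> = l * (u \<bullet> (\<Sum>i<n. w i *\<^sub>R m' i))"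
      by (simp add: inner_sum_right sum_distrib_left algebra_simps)
    also have "\<dots> = 0" using w by (simp add: elw_def)
    finally show "(\<Sum>i<n. w i * (l * (u \<bullet> m i))) \<le> 0" .
  next
    fix i assume "i < n" then show "0 < 1 + l * (u \<bullet> m i)" using x[of i] by (auto simp: abs_le_iff)
  qed
  also have "\<dots> \<le> exp (- (\<Sum>i<n. l * (u \<bullet> m i) - 2 * (l * B)\<^sup>2))"
  proof (intro exp_le_cancel_iff[THEN iffD2] le_imp_neg_le sum_mono)
    fix i assume i: "i \<in> {..<n}"
    have "\<bar>l * (u \<bullet> m i)\<bar> \<le> l * B" using i b l0 by (simp add: abs_mult mult_left_mono)
    then have "(l * (u \<bullet> m i))\<^sup>2 \<le> (l * B)\<^sup>2" by (rule abs_le_square_iff[THEN iffD1, OF order_trans[OF _ abs_ge_self]])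
    then show "l * (u \<bullet> m i) - 2 * (l * B)\<^sup>2 \<le> ln (1 + l * (u \<bullet> m i))"
      using ln_one_plus_lower[of "l * (u \<bullet> m i)"] x[of i] i by auto
  qed
  also have "(\<Sum>i<n. l * (u \<bullet> m i) - 2 * (l * B)\<^sup>2) = l * (\<Sum>i<n. u \<bullet> m i) - real n * (2 * (l * B)\<^sup>2)"
    by (simp add: sum_subtractf sum_distrib_left)
  also have "exp (- \<dots>) \<le> exp (- (l * (real n * \<gamma>) - real n * (2 * (l * B)\<^sup>2)))"
    using mult_left_mono[OF \<gamma>(2) l0] by simp
  also have "l * (real n * \<gamma>) - real n * (2 * (l * B)\<^sup>2) = real n * \<gamma>\<^sup>2 / (8 * B\<^sup>2)"
    using B by (simp add: l_def field_simps power2_eq_square)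
  finally show ?thesis by simp
qed

section \<open>Two-sided quadratic expansion\<close>

text \<open>Purely deterministic, so that on one event it applies to all parameters at once. The two
  bounds are governed by different linear systems, \<open>V l = mbar\<close> with the limit V and
  \<open>T a = mbar\<close> with the sample covariance T; the distance of T from V is at most
  \<delta> plus C^2 / n for the centring. The hypotheses \<open>small\<close> make T coercive with
  constant \<kappa> / 2 and put every argument of the logarithm into [1/2, 3/2].\<close>

lemma elr_expansion:
  fixes V Vi :: "'a::euclidean_space \<Rightarrow> 'a" and m :: "nat \<Rightarrow> 'a" and n :: nat
  defines "mbar \<equiv> (1 / real n) *\<^sub>R (\<Sum>i<n. m i)"
  assumes V: "linear V" "\<And>u v. u \<bullet> V v = V u \<bullet> v" and \<kappa>: "\<kappa> > 0" "\<And>v. \<kappa> * (norm v)\<^sup>2 \<le> v \<bullet> V v"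
    and Vi: "\<And>x. V (Vi x) = x"
    and n: "n > 0" and B: "B > 0" "\<And>i. i < n \<Longrightarrow> norm (m i) \<le> B"
    and C: "norm mbar \<le> C / sqrt (real n)"
    and \<delta>: "\<And>u v. \<bar>(\<Sum>i<n. (u \<bullet> m i) * (v \<bullet> m i)) / real n - u \<bullet> V v\<bar> \<le> \<delta> * norm u * norm v"
    and small: "\<delta> + C\<^sup>2 / real n \<le> \<kappa> / 2" "4 * B * C / (\<kappa> * sqrt (real n)) \<le> 1 / 2"
  shows "0 < elr n m"
    and "\<bar>ln (elr n m) + real n / 2 * (mbar \<bullet> Vi mbar)\<bar>
           \<le> (\<delta> + C\<^sup>2 / real n) * C\<^sup>2 / \<kappa>\<^sup>2 * 2 + real n * (4 * B * C / (\<kappa> * sqrt (real n))) ^ 3"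
proof -
  \<comment> \<open>Common bound for both choices of multiplier: |l . m i| is at most c B /
    \<kappa>, and |x i| at most (2 c / \<kappa>) (2 B), because T has half the coercivity and
    centring doubles the norm.\<close>
  define \<xi> where "\<xi> = 4 * B * C / (\<kappa> * sqrt (real n))"
  define c where "c = C / sqrt (real n)"
  have c0: "0 \<le> c" using C norm_ge_zero[of mbar] unfolding c_def by linarith
  have cc: "c\<^sup>2 = C\<^sup>2 / real n" using n by (simp add: c_def power_divide)
  have nc: "real n * c\<^sup>2 = C\<^sup>2" using n by (simp add: cc)
  have \<xi>c: "\<xi> = 4 * B * c / \<kappa>" by (simp add: \<xi>_def c_def)
  have \<xi>: "0 \<le> \<xi>" "\<xi> \<le> 1/2" using B(1) \<kappa>(1) c0 small(2) by (auto simp: \<xi>c \<xi>_def[symmetric])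
  have mb: "norm mbar \<le> c" using C by (simp add: c_def)
  have sm: "(\<Sum>i<n. m i) = real n *\<^sub>R mbar" using n by (simp add: mbar_def)
  have \<delta>0: "0 \<le> \<delta>"
  proof -
    obtain b :: 'a where "b \<in> Basis" using nonempty_Basis by blast
    then show ?thesis using \<delta>[of b b] by (simp add: abs_le_iff norm_Basis)
  qed
  \<comment> \<open>Coercivity as a bound on the solution of a linear system; t = 1 serves V and t =
    1/2 serves T.\<close>
  have ninv: "norm a \<le> c / (\<kappa> * t)" if "\<kappa> * t * (norm a)\<^sup>2 \<le> a \<bullet> mbar" "t > 0" for a t
  proof (cases "a = 0")
    case False
    have "\<kappa> * t * (norm a)\<^sup>2 \<le> norm a * c"
      using that(1) norm_cauchy_schwarz[of a mbar] mult_left_mono[OF mb norm_ge_zero[of a]] by linarith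
    then have "\<kappa> * t * norm a \<le> c" using False
      by (simp add: power2_eq_square mult.assoc)
    then show ?thesis using \<kappa>(1) that(2) by (simp add: field_simps)
  qed (use c0 \<kappa>(1) that in simp)
  define l where "l = Vi mbar"
  have Vl: "V l = mbar" by (simp add: l_def Vi)
  have nl: "norm l \<le> c / \<kappa>" using ninv[of 1 l] \<kappa>(2)[of l] Vl by simp
  have xl: "\<bar>l \<bullet> m i\<bar> \<le> \<xi>" if "i < n" for i
  proof -
    have "\<bar>l \<bullet> m i\<bar> \<le> norm l * norm (m i)" by (rule Cauchy_Schwarz_ineq2)
    also have "\<dots> \<le> c / \<kappa> * B" using nl B(2)[OF that] c0 \<kappa>(1) by (intro mult_mono) auto
    also have "\<dots> \<le> \<xi>" using c0 \<kappa>(1) B(1) by (simp add: \<xi>c field_simps)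
    finally show ?thesis .
  qed
  have cube: "\<bar>\<Sum>i<n. (ln (1 + x i) - x i + (x i)\<^sup>2 / 2)\<bar> \<le> real n * \<xi> ^ 3" if "\<And>i. i < n \<Longrightarrow> \<bar>x i\<bar> \<le> \<xi>" for x
  proof -
    have "\<bar>\<Sum>i<n. (ln (1 + x i) - x i + (x i)\<^sup>2 / 2)\<bar> \<le> (\<Sum>i<n. \<bar>ln (1 + x i) - x i + (x i)\<^sup>2 / 2\<bar>)" by (rule sum_abs)
    also have "\<dots> \<le> (\<Sum>i<n. \<xi> ^ 3)"
    proof (rule sum_mono)
      fix i assume "i \<in> {..<n}"
      then have "\<bar>x i\<bar> \<le> \<xi>" using that by simp
      then show "\<bar>ln (1 + x i) - x i + (x i)\<^sup>2 / 2\<bar> \<le> \<xi> ^ 3"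
        using ln_one_plus_taylor2[of "x i"] \<xi>(2) power_mono[of "\<bar>x i\<bar>" \<xi> 3] by linarith
    qed
    finally show ?thesis by simp
  qed
  have sl: "(\<Sum>i<n. l \<bullet> m i) = real n * (l \<bullet> mbar)" using sm by (simp flip: inner_sum_right)
  have up: "elr n m \<le> exp (- (\<Sum>i<n. ln (1 + l \<bullet> m i)))"
  proof (rule elr_le_exp)
    fix w assume w: "w \<in> elw n m"
    have "(\<Sum>i<n. w i * (l \<bullet> m i)) = l \<bullet> (\<Sum>i<n. w i *\<^sub>R m i)" by (simp add: inner_sum_right)
    then show "(\<Sum>i<n. w i * (l \<bullet> m i)) \<le> 0" using w by (simp add: elw_def)
  next
    fix i assume "i < n" then show "0 < 1 + l \<bullet> m i" using xl[of i] \<xi> by linarith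
  qed
  have sl2: "(\<Sum>i<n. (l \<bullet> m i)\<^sup>2) \<le> real n * (l \<bullet> mbar) + \<delta> * C\<^sup>2 / \<kappa>\<^sup>2"
  proof -
    have "(\<Sum>i<n. (l \<bullet> m i)\<^sup>2) / real n \<le> l \<bullet> mbar + \<delta> * norm l * norm l"
      using \<delta>[of l l] by (simp add: Vl power2_eq_square abs_le_iff)
    also have "\<delta> * norm l * norm l \<le> \<delta> * (c / \<kappa>)\<^sup>2"
      using mult_left_mono[OF mult_mono[OF nl nl _ norm_ge_zero] \<delta>0] c0 \<kappa>(1)
      by (simp add: power2_eq_square mult.assoc)
    finally have "(\<Sum>i<n. (l \<bullet> m i)\<^sup>2) \<le> real n * (l \<bullet> mbar) + real n * (\<delta> * (c / \<kappa>)\<^sup>2)"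
      using n by (simp add: field_simps)
    also have "real n * (\<delta> * (c / \<kappa>)\<^sup>2) = \<delta> * C\<^sup>2 / \<kappa>\<^sup>2" using nc by (simp add: power_divide mult.assoc mult.left_commute)
    finally show ?thesis .
  qed
  have upper: "elr n m \<le> exp (- real n / 2 * (l \<bullet> mbar) + \<delta> * C\<^sup>2 / \<kappa>\<^sup>2 + real n * \<xi> ^ 3)"
  proof -
    have "(\<Sum>i<n. (ln (1 + l \<bullet> m i) - l \<bullet> m i + (l \<bullet> m i)\<^sup>2 / 2))
        = (\<Sum>i<n. ln (1 + l \<bullet> m i)) - real n * (l \<bullet> mbar) + (\<Sum>i<n. (l \<bullet> m i)\<^sup>2) / 2"
      by (simp add: sum.distrib sum_subtractf sl sum_divide_distrib)
    moreover have "0 \<le> \<delta> * C\<^sup>2 / \<kappa>\<^sup>2" using \<delta>0 by simp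
    ultimately have "- (\<Sum>i<n. ln (1 + l \<bullet> m i)) \<le> - real n / 2 * (l \<bullet> mbar) + \<delta> * C\<^sup>2 / \<kappa>\<^sup>2 + real n * \<xi> ^ 3"
      using cube[of "\<lambda>i. l \<bullet> m i", OF xl] sl2 unfolding abs_le_iff by linarith
    then show ?thesis using up by (meson exp_le_cancel_iff order_trans)
  qed
  \<comment> \<open>Sample covariance operator. Solving with T in place of V makes the weights below
    satisfy the constraint exactly.\<close>
  define T where "T = (\<lambda>a. (1 / real n) *\<^sub>R (\<Sum>i<n. ((m i - mbar) \<bullet> a) *\<^sub>R (m i - mbar)))"
  have linT: "linear T"
    unfolding T_def by (rule linearI)
      (simp_all add: inner_add_right scaleR_add_left sum.distrib scaleR_add_right scaleR_sum_right mult.left_commute)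
  have T: "u \<bullet> T v = (\<Sum>i<n. (u \<bullet> m i) * (v \<bullet> m i)) / real n - (u \<bullet> mbar) * (v \<bullet> mbar)" for u v
  proof -
    have "u \<bullet> T v = (\<Sum>i<n. ((m i - mbar) \<bullet> v) * (u \<bullet> (m i - mbar))) / real n"
      by (simp add: T_def inner_sum_right)
    also have "(\<Sum>i<n. ((m i - mbar) \<bullet> v) * (u \<bullet> (m i - mbar)))
        = (\<Sum>i<n. (u \<bullet> m i) * (v \<bullet> m i) - (u \<bullet> m i) * (v \<bullet> mbar) - (u \<bullet> mbar) * (v \<bullet> m i) + (u \<bullet> mbar) * (v \<bullet> mbar))"
      by (rule sum.cong) (auto simp: inner_diff_right inner_diff_left inner_commute algebra_simps)
    also have "\<dots> = (\<Sum>i<n. (u \<bullet> m i) * (v \<bullet> m i)) - (\<Sum>i<n. u \<bullet> m i) * (v \<bullet> mbar)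
       - (u \<bullet> mbar) * (\<Sum>i<n. v \<bullet> m i) + real n * ((u \<bullet> mbar) * (v \<bullet> mbar))"
      by (simp add: sum.distrib sum_subtractf sum_distrib_left sum_distrib_right)
    also have "\<dots> = (\<Sum>i<n. (u \<bullet> m i) * (v \<bullet> m i)) - real n * ((u \<bullet> mbar) * (v \<bullet> mbar))"
      using sm by (simp flip: inner_sum_right)
    finally show ?thesis using n by (simp add: diff_divide_distrib)
  qed
  define \<delta>' where "\<delta>' = \<delta> + C\<^sup>2 / real n"
  have \<delta>': "\<bar>u \<bullet> T v - u \<bullet> V v\<bar> \<le> \<delta>' * norm u * norm v" for u v
  proof -
    have "\<bar>(u \<bullet> mbar) * (v \<bullet> mbar)\<bar> \<le> (norm u * c) * (norm v * c)"
      unfolding abs_mult using c0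
      by (intro mult_mono order_trans[OF Cauchy_Schwarz_ineq2 mult_left_mono[OF mb]]) auto
    also have "\<dots> = C\<^sup>2 / real n * norm u * norm v" unfolding cc[symmetric] by (simp add: power2_eq_square)
    finally show ?thesis using \<delta>[of u v] unfolding T \<delta>'_def by (simp add: algebra_simps abs_le_iff)
  qed
  have \<delta>'0: "0 \<le> \<delta>'" using \<delta>0 by (simp add: \<delta>'_def)
  have Tpd: "\<kappa> * (1/2) * (norm v)\<^sup>2 \<le> v \<bullet> T v" for v
  proof -
    have "\<delta>' * (norm v)\<^sup>2 \<le> \<kappa> / 2 * (norm v)\<^sup>2" using small(1) by (intro mult_right_mono) (auto simp: \<delta>'_def)
    then show ?thesis using \<kappa>(2)[of v] \<delta>'[of v v] by (simp add: abs_le_iff power2_eq_square algebra_simps)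
  qed
  have "inj T" unfolding linear_injective_0[OF linT]
  proof (intro allI impI)
    fix v assume "T v = 0"
    then have "\<kappa> * (1/2) * (norm v)\<^sup>2 \<le> 0" using Tpd[of v] by simp
    then show "v = 0" using \<kappa>(1) by (simp add: mult_le_0_iff)
  qed
  then have "surj T" using linear_injective_imp_surjective[OF linT] by simp
  then obtain a where a: "T a = mbar" by (metis surjD)
  have na: "norm a \<le> 2 * c / \<kappa>" using ninv[of "1/2" a] Tpd[of a] a by (simp add: mult.commute)
  \<comment> \<open>These numbers sum to 0, and they weight the vectors m i - mbar to - n T a = - n
    mbar, which cancels the sum of the m i.\<close>
  define x where "x = (\<lambda>i. - (a \<bullet> (m i - mbar)))"
  have xb: "\<bar>x i\<bar> \<le> \<xi>" if "i < n" for i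
  proof -
    have "norm mbar \<le> B"
    proof -
      have "norm (\<Sum>i<n. m i) \<le> (\<Sum>i<n. B)" by (intro sum_norm_le) (use B(2) in auto)
      then show ?thesis using n by (simp add: mbar_def field_simps)
    qed
    then have "norm (m i - mbar) \<le> 2 * B" using B(2)[OF that] norm_triangle_ineq4[of "m i" mbar] by simp
    moreover have "\<bar>x i\<bar> \<le> norm a * norm (m i - mbar)" unfolding x_def using Cauchy_Schwarz_ineq2 by simp
    moreover have "norm a * norm (m i - mbar) \<le> (2 * c / \<kappa>) * (2 * B)"
      using na calculation(1) c0 \<kappa>(1) by (intro mult_mono) auto
    ultimately show ?thesis by (simp add: \<xi>c mult.commute mult.left_commute)
  qed
  have sx: "(\<Sum>i<n. x i) = 0" using sm by (simp add: x_def sum_negf sum_subtractf inner_diff_right flip: inner_sum_right)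
  have sx2: "(\<Sum>i<n. (x i)\<^sup>2) = real n * (a \<bullet> mbar)"
  proof -
    have "real n * (a \<bullet> T a) = (\<Sum>i<n. (x i)\<^sup>2)"
      using n by (simp add: T_def x_def inner_sum_right power2_eq_square inner_commute)
    then show ?thesis by (simp add: a)
  qed
  define w where "w = (\<lambda>i. (1 + x i) / real n)"
  have pos: "0 < 1 + x i" if "i < n" for i using xb[OF that] \<xi> by linarith
  have w: "w \<in> elw n m"
  proof -
    have "(\<Sum>i<n. w i *\<^sub>R m i) = 0"
    proof -
      have "(\<Sum>i<n. x i *\<^sub>R m i) = (\<Sum>i<n. x i *\<^sub>R (m i - mbar)) + (\<Sum>i<n. x i) *\<^sub>R mbar"
        by (simp add: scaleR_diff_right sum_subtractf scaleR_sum_left)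
      also have "(\<Sum>i<n. x i *\<^sub>R (m i - mbar)) = - real n *\<^sub>R T a" using n
        by (simp add: T_def x_def sum_negf inner_commute)
      finally have "(\<Sum>i<n. (1 + x i) *\<^sub>R m i) = 0" by (simp add: scaleR_add_left sum.distrib sm a sx)
      moreover have "(\<Sum>i<n. w i *\<^sub>R m i) = (1 / real n) *\<^sub>R (\<Sum>i<n. (1 + x i) *\<^sub>R m i)"
        by (simp add: w_def scaleR_sum_right)
      ultimately show ?thesis by simp
    qed
    moreover have "(\<Sum>i<n. w i) = 1" using n by (simp add: w_def sum.distrib sx flip: sum_divide_distrib)
    ultimately show ?thesis using pos by (auto simp: elw_def w_def intro!: divide_nonneg_nonneg less_imp_le)
  qed
  have "exp (\<Sum>i<n. ln (1 + x i)) = (\<Prod>i<n. real n * w i)"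
    using pos n by (simp add: exp_sum w_def)
  then have low: "exp (\<Sum>i<n. ln (1 + x i)) \<le> elr n m" using elr_ge[OF w] by simp
  show pos: "0 < elr n m" using low exp_gt_zero less_le_trans by blast
  have lower: "(\<Sum>i<n. ln (1 + x i)) \<ge> - real n / 2 * (a \<bullet> mbar) - real n * \<xi> ^ 3"
  proof -
    have "(\<Sum>i<n. (ln (1 + x i) - x i + (x i)\<^sup>2 / 2)) = (\<Sum>i<n. ln (1 + x i)) + real n * (a \<bullet> mbar) / 2"
      by (simp add: sum.distrib sum_subtractf sx sx2 flip: sum_divide_distrib)
    then show ?thesis using cube[of x, OF xb] unfolding abs_le_iff by linarith
  qed
  \<comment> \<open>Symmetry of V turns the difference into l . (V - T) a. Both l and a are of order
    n^(-1/2), so after multiplication by n only the distance of T from V is left.\<close>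
  have al: "real n * \<bar>a \<bullet> mbar - l \<bullet> mbar\<bar> \<le> 2 * (\<delta>' * C\<^sup>2 / \<kappa>\<^sup>2)"
  proof -
    have "a \<bullet> mbar - l \<bullet> mbar = V l \<bullet> a - l \<bullet> T a" by (simp add: Vl a inner_commute)
    also have "\<dots> = l \<bullet> V a - l \<bullet> T a" by (simp add: V(2))
    finally have "\<bar>a \<bullet> mbar - l \<bullet> mbar\<bar> \<le> \<delta>' * norm l * norm a" using \<delta>'[of l a] by (simp add: abs_minus_commute)
    also have "\<dots> \<le> \<delta>' * (c / \<kappa>) * (2 * c / \<kappa>)" using nl na \<delta>'0 c0 \<kappa>(1) by (intro mult_mono) auto
    finally have "real n * \<bar>a \<bullet> mbar - l \<bullet> mbar\<bar> \<le> real n * (\<delta>' * (c / \<kappa>) * (2 * c / \<kappa>))" by (rule mult_left_mono) simp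
    also have "\<dots> = 2 * (\<delta>' * (real n * c\<^sup>2) / \<kappa>\<^sup>2)" by (simp add: power2_eq_square)
    finally show ?thesis by (simp add: nc)
  qed
  have "(\<Sum>i<n. ln (1 + x i)) \<le> ln (elr n m)" using low pos by (simp add: ln_ge_iff)
  moreover have "ln (elr n m) \<le> - real n / 2 * (l \<bullet> mbar) + \<delta> * C\<^sup>2 / \<kappa>\<^sup>2 + real n * \<xi> ^ 3"
    using upper pos by (metis ln_exp ln_le_cancel_iff exp_gt_zero)
  moreover have "\<delta> * C\<^sup>2 / \<kappa>\<^sup>2 \<le> 2 * (\<delta>' * C\<^sup>2 / \<kappa>\<^sup>2)"
  proof -
    have "\<delta> * (C\<^sup>2 / \<kappa>\<^sup>2) \<le> (2 * \<delta>') * (C\<^sup>2 / \<kappa>\<^sup>2)" using \<delta>0 by (intro mult_right_mono) (auto simp: \<delta>'_def)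
    then show ?thesis by simp
  qed
  moreover have "\<bar>real n * (a \<bullet> mbar) - real n * (l \<bullet> mbar)\<bar> \<le> 2 * (\<delta>' * C\<^sup>2 / \<kappa>\<^sup>2)"
    using al by (simp add: abs_mult flip: right_diff_distrib)
  moreover have "0 \<le> \<delta>' * C\<^sup>2 / \<kappa>\<^sup>2" using \<delta>'0 by simp
  ultimately have "\<bar>ln (elr n m) + real n / 2 * (l \<bullet> mbar)\<bar> \<le> 2 * (\<delta>' * C\<^sup>2 / \<kappa>\<^sup>2) + real n * \<xi> ^ 3"
    using lower unfolding abs_le_iff by linarith
  then show "\<bar>ln (elr n m) + real n / 2 * (mbar \<bullet> Vi mbar)\<bar>
           \<le> (\<delta> + C\<^sup>2 / real n) * C\<^sup>2 / \<kappa>\<^sup>2 * 2 + real n * (4 * B * C / (\<kappa> * sqrt (real n))) ^ 3"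
    by (simp add: l_def \<delta>'_def \<xi>_def inner_commute algebra_simps)
qed

section \<open>Independent samples and increments of the estimating function\<close>

locale iid_sample = prob_space M for M :: "'w measure" +
  fixes N :: "'z measure" and P :: "'z measure" and Z :: "nat \<Rightarrow> 'w \<Rightarrow> 'z"
  assumes indep: "indep_vars (\<lambda>_. N) Z UNIV"
    and law: "\<And>i. distr M N (Z i) = P"
begin

lemma Z_measurable [measurable]: "Z i \<in> measurable M N"
  using indep by (auto simp: indep_vars_def)

lemma sets_P [measurable_cong]: "sets P = sets N"
  using law[of 0] by auto

lemma prob_space_P: "prob_space P"
  using prob_space_distr[OF Z_measurable[of 0]] by (simp add: law)

lemma expectation_Z:
  fixes f :: "'z \<Rightarrow> real"
  assumes [measurable]: "f \<in> borel_measurable N"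
  shows "(\<integral>\<omega>. f (Z i \<omega>) \<partial>M) = (\<integral>z. f z \<partial>P)"
  using integral_distr[of "Z i" M N f] by (simp add: law)

lemma integrable_Z:
  fixes f :: "'z \<Rightarrow> real"
  assumes [measurable]: "f \<in> borel_measurable N" and "integrable P f"
  shows "integrable M (\<lambda>\<omega>. f (Z i \<omega>))"
  using integrable_distr_eq[of "Z i" M N f] assms(2) by (simp add: law)

definition dev :: "('z \<Rightarrow> real) \<Rightarrow> nat \<Rightarrow> real \<Rightarrow> 'w set" where
  "dev f n a = {\<omega> \<in> space M. a \<le> \<bar>(\<Sum>i<n. f (Z i \<omega>)) / real n - (\<integral>z. f z \<partial>P)\<bar>}"

lemma dev_event:
  assumes [measurable]: "f \<in> borel_measurable N"
  shows "dev f n a \<in> events"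
  unfolding dev_def by measurable

text \<open>Independence kills the cross terms of the centred variables and leaves the variance over
  n. The second moment stands in place of the variance because it is the quantity that the
  applications estimate.\<close>

lemma chebyshev_mean:
  assumes f[measurable]: "f \<in> borel_measurable N" and f2: "integrable P (\<lambda>z. (f z)\<^sup>2)"
    and n: "n > 0" and a: "a > 0"
  shows "prob (dev f n a) \<le> (\<integral>z. (f z)\<^sup>2 \<partial>P) / (real n * a\<^sup>2)"
proof -
  interpret P: prob_space P by (rule prob_space_P)
  have fP[measurable]: "f \<in> borel_measurable P" using f measurable_cong_sets[OF sets_P refl] by blast
  have intf: "integrable P f" using P.square_integrable_imp_integrable[OF fP f2] .
  define g where "g = (\<lambda>z. f z - (\<integral>z. f z \<partial>P))"
  have g[measurable]: "g \<in> borel_measurable N" unfolding g_def by measurable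
  have intg: "integrable P g" unfolding g_def using intf by simp
  have g0: "(\<integral>z. g z \<partial>P) = 0" unfolding g_def using intf by (simp add: P.prob_space)
  have intg2: "integrable P (\<lambda>z. (g z)\<^sup>2)"
    unfolding g_def power2_diff using intf f2 by simp
  have g2: "(\<integral>z. (g z)\<^sup>2 \<partial>P) \<le> (\<integral>z. (f z)\<^sup>2 \<partial>P)"
    using P.variance_eq[OF intf f2] by (simp add: g_def)
  have cross: "integrable M (\<lambda>\<omega>. g (Z i \<omega>) * g (Z j \<omega>)) \<and>
      (\<integral>\<omega>. g (Z i \<omega>) * g (Z j \<omega>) \<partial>M) = (if i = j then (\<integral>z. (g z)\<^sup>2 \<partial>P) else 0)" for i j
  proof (cases "i = j")
    case True
    then show ?thesis using integrable_Z[of "\<lambda>z. (g z)\<^sup>2" i] expectation_Z[of "\<lambda>z. (g z)\<^sup>2" i] intg2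
      by (simp add: power2_eq_square)
  next
    case False
    have iv: "indep_vars (\<lambda>_. borel) (\<lambda>i \<omega>. g (Z i \<omega>)) {i, j}"
      by (rule indep_vars_compose2[OF indep_vars_subset[OF indep]]) auto
    have I: "\<And>k. k \<in> {i, j} \<Longrightarrow> integrable M (\<lambda>\<omega>. g (Z k \<omega>))" using integrable_Z[OF g intg] by simp
    show ?thesis using indep_vars_lebesgue_integral[OF _ iv I] indep_vars_integrable[OF _ iv I] False
      by (simp add: expectation_Z g0)
  qed
  define W where "W = (\<lambda>\<omega>. (\<Sum>i<n. g (Z i \<omega>)) / real n)"
  have W2: "(W \<omega>)\<^sup>2 = (\<Sum>i<n. \<Sum>j<n. g (Z i \<omega>) * g (Z j \<omega>)) / (real n)\<^sup>2" for \<omega>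
    by (simp add: W_def power_divide power2_eq_square sum_product)
  have intW2: "integrable M (\<lambda>\<omega>. (W \<omega>)\<^sup>2)" unfolding W2 using cross by simp
  have EW2: "expectation (\<lambda>\<omega>. (W \<omega>)\<^sup>2) = (\<integral>z. (g z)\<^sup>2 \<partial>P) / real n"
    unfolding W2 using cross n by (simp add: power2_eq_square)
  have "prob {\<omega> \<in> space M. a \<le> \<bar>W \<omega>\<bar>} \<le> expectation (\<lambda>\<omega>. (W \<omega>)\<^sup>2) / a\<^sup>2"
    by (rule second_moment_method) (use intW2 a in \<open>simp_all add: W_def\<close>)
  also have "\<dots> \<le> (\<integral>z. (f z)\<^sup>2 \<partial>P) / real n / a\<^sup>2"
    unfolding EW2 using g2 by (intro divide_right_mono) auto
  also have "{\<omega> \<in> space M. a \<le> \<bar>W \<omega>\<bar>} = dev f n a"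
    using n by (simp add: W_def dev_def g_def sum_subtractf diff_divide_distrib)
  finally show ?thesis by simp
qed

end

section \<open>Estimating functions with controlled oscillation\<close>

text \<open>What the asymptotics have to know about the model. \<open>osc z \<zeta> r\<close>
  majorises the variation of \<open>m z\<close> within distance r of \<zeta>. Assumption
  \<open>L\<close> makes its mean at most linear in the radius, for exactly those balls that are the
  cells of a grid of mesh \<epsilon> in the ball of radius s, with L independent of \<epsilon>.
  \<open>G\<close> is a set of full measure on which m is bounded and monotone; \<open>Vi\<close> is
  postulated as a right inverse of V.\<close>

locale el_sample = iid_sample M N P Z for M :: "'w measure" and N P :: "'z measure" and Z +
  fixes m :: "'z \<Rightarrow> 'a::euclidean_space \<Rightarrow> 'a" and osc :: "'z \<Rightarrow> 'a \<Rightarrow> real \<Rightarrow> real"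
    and G :: "'z set" and B Bo L :: real and \<zeta>0 :: 'a and D V Vi :: "'a \<Rightarrow> 'a" and \<kappa> \<kappa>V :: real
  assumes G: "G \<in> sets N" "AE z in P. z \<in> G"
    and m_measurable: "\<And>\<zeta>. (\<lambda>z. m z \<zeta>) \<in> borel_measurable N"
    and B: "0 < B" "\<And>z \<zeta>. z \<in> G \<Longrightarrow> norm (m z \<zeta>) \<le> B"
    and m_mono: "\<And>z \<zeta> u s t. z \<in> G \<Longrightarrow> s \<le> t \<Longrightarrow> u \<bullet> m z (\<zeta> + s *\<^sub>R u) \<le> u \<bullet> m z (\<zeta> + t *\<^sub>R u)"
    and osc_measurable: "\<And>\<zeta> r. (\<lambda>z. osc z \<zeta> r) \<in> borel_measurable N"
    and osc: "\<And>z \<zeta> \<zeta>' r. z \<in> G \<Longrightarrow> norm (\<zeta>' - \<zeta>) \<le> r \<Longrightarrow> norm (m z \<zeta>' - m z \<zeta>) \<le> osc z \<zeta> r"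
    and Bo: "0 < Bo" "\<And>z \<zeta> r. 0 \<le> osc z \<zeta> r" "\<And>z \<zeta> r. osc z \<zeta> r \<le> Bo"
    and L: "0 < L" "\<And>\<epsilon>. 0 < \<epsilon> \<Longrightarrow> \<epsilon> \<le> 1 \<Longrightarrow>
          \<exists>\<delta>>0. \<forall>s c. 0 < s \<longrightarrow> s \<le> \<delta> \<longrightarrow> norm c \<le> 1 \<longrightarrow> (\<integral>z. osc z (\<zeta>0 + s *\<^sub>R c) (\<epsilon> * s) \<partial>P) \<le> L * \<epsilon> * s"
    and mean_derivative: "((\<lambda>\<zeta>. \<integral>z. m z \<zeta> \<partial>P) has_derivative D) (at \<zeta>0)"
    and mean0: "(\<integral>z. m z \<zeta>0 \<partial>P) = 0"
    and \<kappa>: "0 < \<kappa>" "\<And>h. \<kappa> * (norm h)\<^sup>2 \<le> h \<bullet> D h"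
    and second_moment: "\<And>u v. (\<integral>z. (u \<bullet> m z \<zeta>0) * (v \<bullet> m z \<zeta>0) \<partial>P) = u \<bullet> V v"
    and V: "linear V" "\<And>u v. u \<bullet> V v = V u \<bullet> v" "\<And>x. V (Vi x) = x"
    and \<kappa>V: "0 < \<kappa>V" "\<And>v. \<kappa>V * (norm v)\<^sup>2 \<le> v \<bullet> V v"
begin

declare m_measurable [measurable] osc_measurable [measurable] G(1) [measurable]

text \<open>One null event for the whole sequence: off it the pointwise bounds on \<open>G\<close>
  hold for all observations simultaneously.\<close>

definition bad :: "'w set" where "bad = {\<omega> \<in> space M. \<exists>i. Z i \<omega> \<notin> G}"

lemma bad_event: "bad \<in> events" unfolding bad_def by measurable

lemma bad_null: "prob bad = 0"
proof -
  have "AE \<omega> in M. Z i \<omega> \<in> G" for i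
  proof -
    have "AE z in distr M N (Z i). z \<in> G" unfolding law by (rule G(2))
    then show ?thesis by (subst (asm) AE_distr_iff) measurable
  qed
  then have "AE \<omega> in M. \<forall>i. Z i \<omega> \<in> G" by (simp add: AE_all_countable)
  then have "AE \<omega> in M. \<omega> \<notin> bad" by (rule AE_mp) (auto simp: bad_def)
  then show ?thesis using prob_eq_0[OF bad_event] by simp
qed

lemma good: "\<omega> \<in> space M - bad \<Longrightarrow> Z i \<omega> \<in> G"
  by (auto simp: bad_def)

definition avg :: "nat \<Rightarrow> 'w \<Rightarrow> 'a \<Rightarrow> 'a" where
  "avg n \<omega> \<zeta> = (1 / real n) *\<^sub>R (\<Sum>i<n. m (Z i \<omega>) \<zeta>)"

definition mu :: "'a \<Rightarrow> 'a" where "mu \<zeta> = (\<integral>z. m z \<zeta> \<partial>P)"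

lemma inner_avg: "b \<bullet> avg n \<omega> \<zeta> = (\<Sum>i<n. b \<bullet> m (Z i \<omega>) \<zeta>) / real n"
  by (simp add: avg_def inner_sum_right)

lemma m_measurable_P [measurable]: "(\<lambda>z. m z \<zeta>) \<in> borel_measurable P"
  using m_measurable measurable_cong_sets[OF sets_P refl] by blast

lemma osc_measurable_P [measurable]: "(\<lambda>z. osc z \<zeta> r) \<in> borel_measurable P"
  using osc_measurable measurable_cong_sets[OF sets_P refl] by blast

lemma integrable_bounded:
  fixes f :: "'z \<Rightarrow> 'b::{banach, second_countable_topology}"
  assumes [measurable]: "f \<in> borel_measurable P" and "\<And>z. z \<in> G \<Longrightarrow> norm (f z) \<le> C"
  shows "integrable P f"
proof -
  interpret P: prob_space P by (rule prob_space_P)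
  show ?thesis by (rule P.integrable_const_bound[of _ C]) (rule eventually_mono[OF G(2) assms(2)], assumption, rule assms(1))
qed

lemma integral_G_mono:
  fixes f g :: "'z \<Rightarrow> real"
  assumes "f \<in> borel_measurable P" "g \<in> borel_measurable P" "\<And>z. z \<in> G \<Longrightarrow> \<bar>f z\<bar> \<le> C" "\<And>z. z \<in> G \<Longrightarrow> \<bar>g z\<bar> \<le> C'"
    and "\<And>z. z \<in> G \<Longrightarrow> f z \<le> g z"
  shows "(\<integral>z. f z \<partial>P) \<le> (\<integral>z. g z \<partial>P)"
proof (rule integral_mono_AE)
  show "integrable P f" using assms(3) by (intro integrable_bounded[OF assms(1), of C]) simp
  show "integrable P g" using assms(4) by (intro integrable_bounded[OF assms(2), of C']) simp
  show "AE z in P. f z \<le> g z" by (rule eventually_mono[OF G(2) assms(5)])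
qed

lemma inner_m_bound: "z \<in> G \<Longrightarrow> \<bar>b \<bullet> m z \<zeta>\<bar> \<le> norm b * B"
  using Cauchy_Schwarz_ineq2[of b "m z \<zeta>"] mult_left_mono[OF B(2)[of z \<zeta>] norm_ge_zero[of b]] by simp

lemma inner_mu: "b \<bullet> mu \<zeta> = (\<integral>z. b \<bullet> m z \<zeta> \<partial>P)"
proof -
  have "integrable P (\<lambda>z. m z \<zeta>)" by (rule integrable_bounded[of _ B]) (use B in auto)
  then show ?thesis by (simp add: mu_def)
qed

lemma dev_prob_le:
  assumes [measurable]: "f \<in> borel_measurable N" and b: "\<And>z. z \<in> G \<Longrightarrow> \<bar>f z\<bar> \<le> C" and n: "n > 0" and a: "a > 0"
    and E: "(\<integral>z. (f z)\<^sup>2 \<partial>P) \<le> E"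
  shows "prob (dev f n a) \<le> E / (real n * a\<^sup>2)"
proof -
  have fP[measurable]: "f \<in> borel_measurable P" using assms(1) measurable_cong_sets[OF sets_P refl] by blast
  have "integrable P (\<lambda>z. (f z)\<^sup>2)"
    by (rule integrable_bounded[of _ "C\<^sup>2"]) (use power_mono[OF b abs_ge_zero, of _ 2] in simp_all)
  then have "prob (dev f n a) \<le> (\<integral>z. (f z)\<^sup>2 \<partial>P) / (real n * a\<^sup>2)"
    by (rule chebyshev_mean[OF assms(1) _ n a])
  also have "\<dots> \<le> E / (real n * a\<^sup>2)" using E by (intro divide_right_mono) auto
  finally show ?thesis .
qed

lemma norm_le_coordinates:
  fixes x :: 'a
  assumes "\<And>b. b \<in> Basis \<Longrightarrow> \<bar>b \<bullet> x\<bar> \<le> a / DIM('a)"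
  shows "norm x \<le> a"
proof -
  have "norm x \<le> (\<Sum>b\<in>Basis. \<bar>x \<bullet> b\<bar>)" by (rule norm_le_l1)
  also have "\<dots> \<le> (\<Sum>b\<in>(Basis::'a set). a / DIM('a))" by (rule sum_mono) (use assms in \<open>simp add: inner_commute\<close>)
  finally show ?thesis by simp
qed

text \<open>The mean vanishes at \<zeta>0, so this is Chebyshev coordinate by coordinate; the level
  is divided by the dimension because the norm is estimated by the sum of the coordinates.\<close>

lemma avg_at_true:
  "\<exists>K>0. \<forall>C>0. \<forall>n>0. \<exists>A\<in>events. prob A \<le> K / C\<^sup>2 \<and> (\<forall>\<omega>\<in>space M - A. norm (avg n \<omega> \<zeta>0) \<le> C / sqrt (real n))"
proof (intro exI conjI allI impI)
  define d where "d = real DIM('a)"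
  have d: "0 < d" by (simp add: d_def)
  show "0 < d * (B\<^sup>2 * d\<^sup>2)" using B d by simp
  fix C :: real and n :: nat assume C: "C > 0" and n: "n > 0"
  define a where "a = C / sqrt (real n) / d"
  have a: "0 < a" using C n d by (simp add: a_def)
  define A where "A = (\<Union>b\<in>Basis. dev (\<lambda>z. b \<bullet> m z \<zeta>0) n a)"
  have [measurable]: "dev (\<lambda>z. b \<bullet> m z \<zeta>0) n a \<in> events" for b by (rule dev_event) measurable
  have "prob A \<le> (\<Sum>b\<in>Basis. prob (dev (\<lambda>z. b \<bullet> m z \<zeta>0) n a))"
    unfolding A_def by (rule finite_measure_subadditive_finite) auto
  also have "\<dots> \<le> (\<Sum>b\<in>(Basis::'a set). B\<^sup>2 / (real n * a\<^sup>2))"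
  proof (intro sum_mono)
    fix b :: 'a assume b: "b \<in> Basis"
    interpret P: prob_space P by (rule prob_space_P)
    show "prob (dev (\<lambda>z. b \<bullet> m z \<zeta>0) n a) \<le> B\<^sup>2 / (real n * a\<^sup>2)"
    proof (rule dev_prob_le[OF _ _ n a])
      show "\<bar>b \<bullet> m z \<zeta>0\<bar> \<le> B" if "z \<in> G" for z using inner_m_bound[OF that, of b \<zeta>0] b by simp
      then have "(\<integral>z. (b \<bullet> m z \<zeta>0)\<^sup>2 \<partial>P) \<le> (\<integral>z. B\<^sup>2 \<partial>P)"
        by (intro integral_G_mono[of _ _ "B\<^sup>2" "B\<^sup>2"]) (auto simp: abs_le_square_iff[symmetric] B(1) less_imp_le)
      then show "(\<integral>z. (b \<bullet> m z \<zeta>0)\<^sup>2 \<partial>P) \<le> B\<^sup>2" by (simp add: P.prob_space)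
    qed measurable
  qed
  also have "\<dots> = d * (B\<^sup>2 / (real n * a\<^sup>2))" by (simp add: d_def)
  also have "\<dots> = d * (B\<^sup>2 * d\<^sup>2) / C\<^sup>2" using n d C by (simp add: a_def power_divide field_simps)
  finally have pA: "prob A \<le> d * (B\<^sup>2 * d\<^sup>2) / C\<^sup>2" .
  have "norm (avg n \<omega> \<zeta>0) \<le> C / sqrt (real n)" if "\<omega> \<in> space M - A" for \<omega>
  proof (rule norm_le_coordinates)
    fix b :: 'a assume "b \<in> Basis"
    then have "\<omega> \<notin> dev (\<lambda>z. b \<bullet> m z \<zeta>0) n a" using that by (auto simp: A_def)
    then have "\<bar>b \<bullet> avg n \<omega> \<zeta>0 - b \<bullet> mu \<zeta>0\<bar> < a" using that by (simp add: dev_def inner_avg inner_mu)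
    then show "\<bar>b \<bullet> avg n \<omega> \<zeta>0\<bar> \<le> C / sqrt (real n) / DIM('a)" by (simp add: mu_def mean0 a_def d_def)
  qed
  then show "\<exists>A\<in>events. prob A \<le> d * (B\<^sup>2 * d\<^sup>2) / C\<^sup>2 \<and> (\<forall>\<omega>\<in>space M - A. norm (avg n \<omega> \<zeta>0) \<le> C / sqrt (real n))"
    using pA by (intro bexI[of _ A]) (auto simp: A_def)
qed

text \<open>Boundedness trades one factor \<open>osc\<close> for \<open>Bo\<close>, so the second
  moment inherits the order s of the mean. This is the source of the probability 1/(n s)
  below.\<close>

lemma osc_second_moment:
  assumes "(\<integral>z. osc z \<zeta> r \<partial>P) \<le> E"
  shows "(\<integral>z. (osc z \<zeta> r)\<^sup>2 \<partial>P) \<le> Bo * E"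
proof -
  have "(\<integral>z. (osc z \<zeta> r)\<^sup>2 \<partial>P) \<le> (\<integral>z. Bo * osc z \<zeta> r \<partial>P)"
    by (rule integral_G_mono[of _ _ "Bo * Bo" "Bo * Bo"])
      (use Bo in \<open>auto simp: power2_eq_square abs_mult intro!: mult_mono\<close>)
  also have "\<dots> = Bo * (\<integral>z. osc z \<zeta> r \<partial>P)" by simp
  finally show ?thesis using mult_left_mono[OF assms less_imp_le[OF Bo(1)]] by linarith
qed

section \<open>Uniformity over shrinking balls\<close>

text \<open>A deviation of size \<epsilon> s against a second moment of order s has probability of
  order 1/(n s), small as soon as n s is large, in particular for s of order n^(-1/2). The constants
  depend on \<epsilon> alone. The null event \<open>bad\<close> is included in A so that the
  pointwise bounds are available together with the estimate.\<close>

lemma increments: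
  assumes \<epsilon>: "0 < \<epsilon>"
  shows "\<exists>K>0. \<exists>\<delta>>0. \<forall>s n. 0 < s \<longrightarrow> s \<le> \<delta> \<longrightarrow> 0 < n \<longrightarrow> (\<exists>A\<in>events. prob A \<le> K / (real n * s) \<and> bad \<subseteq> A \<and>
     (\<forall>\<omega>\<in>space M - A. \<forall>h. norm h \<le> 1 \<longrightarrow>
        norm (avg n \<omega> (\<zeta>0 + s *\<^sub>R h) - avg n \<omega> \<zeta>0 - s *\<^sub>R D h) \<le> \<epsilon> * s))"
proof -
  interpret P: prob_space P by (rule prob_space_P)
  have D: "bounded_linear D" using mean_derivative by (rule has_derivative_bounded_linear)
  obtain KD where KD: "KD > 0" "\<And>x. norm (D x) \<le> norm x * KD" using bounded_linear.pos_bounded[OF D] by blast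
  \<comment> \<open>Mesh of the grid: it keeps the mean oscillation in a cell below \<epsilon> s / 8
    and the change of D across a cell below \<epsilon> / 8; e \<le> 1 is demanded by assumption
    \<open>L\<close>.\<close>
  define e where "e = min 1 (min (\<epsilon> / (8 * L)) (\<epsilon> / (8 * KD)))"
  have e: "0 < e" "e \<le> 1" "L * e \<le> \<epsilon> / 8" "e * KD \<le> \<epsilon> / 8"
  proof -
    show "0 < e" "e \<le> 1" using \<epsilon> L(1) KD(1) by (auto simp: e_def)
    have 1: "e \<le> \<epsilon> / (8 * L)" by (simp add: e_def)
    have 2: "e \<le> \<epsilon> / (8 * KD)" by (simp add: e_def)
    show "L * e \<le> \<epsilon> / 8" using mult_left_mono[OF 1 less_imp_le[OF L(1)]] L(1) by simp
    show "e * KD \<le> \<epsilon> / 8" using mult_left_mono[OF 2 less_imp_le[OF KD(1)]] KD(1) by (simp add: mult.commute)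
  qed
  \<comment> \<open>A net of the unit ball, to be scaled by s: its size depends on e alone, hence K
    is uniform in s and n.\<close>
  obtain T where T: "finite T" "T \<subseteq> cball (0::'a) 1" "cball (0::'a) 1 \<subseteq> (\<Union>c\<in>T. ball c e)"
    using seq_compact_imp_totally_bounded[OF compact_imp_seq_compact[OF compact_cball[of "0::'a" 1]], rule_format, OF e(1)]
    by (elim exE conjE)
  obtain \<delta>1 where \<delta>1: "\<delta>1 > 0" "\<And>s c. 0 < s \<Longrightarrow> s \<le> \<delta>1 \<Longrightarrow> norm c \<le> 1 \<Longrightarrow> (\<integral>z. osc z (\<zeta>0 + s *\<^sub>R c) (e * s) \<partial>P) \<le> L * e * s"
    using L(2)[OF e(1,2)] by blast
  \<comment> \<open>Mesh 1, used with c = 0: the oscillation about \<zeta>0 itself at radius s,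
    which dominates the increments from \<zeta>0 to the grid points.\<close>
  obtain \<delta>2 where \<delta>2: "\<delta>2 > 0" "\<And>s c. 0 < s \<Longrightarrow> s \<le> \<delta>2 \<Longrightarrow> norm (c::'a) \<le> 1 \<Longrightarrow> (\<integral>z. osc z (\<zeta>0 + s *\<^sub>R c) s \<partial>P) \<le> L * s"
    using L(2)[of 1] by (metis mult.right_neutral mult_1 order_refl zero_less_one)
  obtain \<delta>3 where \<delta>3: "\<delta>3 > 0" "\<And>y. norm (y - \<zeta>0) < \<delta>3 \<Longrightarrow> norm (mu y - mu \<zeta>0 - D (y - \<zeta>0)) \<le> \<epsilon> / 8 * norm (y - \<zeta>0)"
    using mean_derivative[unfolded has_derivative_at_alt] \<epsilon> unfolding mu_def by (metis zero_less_divide_iff zero_less_numeral)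
  define \<delta> where "\<delta> = min \<delta>1 (min \<delta>2 (\<delta>3 / 2))"
  have \<delta>: "\<delta> > 0" "\<delta> \<le> \<delta>1" "\<delta> \<le> \<delta>2" "\<delta> < \<delta>3" using \<delta>1(1) \<delta>2(1) \<delta>3(1) by (auto simp: \<delta>_def min_def)
  define d where "d = real DIM('a)"
  have d: "0 < d" by (simp add: d_def)
  define K1 where "K1 = Bo * L * 64 / \<epsilon>\<^sup>2"
  define K2 where "K2 = Bo * L * 64 * d\<^sup>2 / \<epsilon>\<^sup>2"
  have K12: "0 < K1" "0 < K2" using Bo(1) L(1) \<epsilon> d by (auto simp: K1_def K2_def)
  \<comment> \<open>Chebyshev costs K1 / (n s) per cell and K2 / (n s) per cell and coordinate; the
    summand 1 guarantees positivity.\<close>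
  define K where "K = 1 + real (card T) * (K1 + d * K2)"
  have K: "K > 0" using K12 d by (auto simp: K_def intro!: add_pos_nonneg mult_nonneg_nonneg)
  show ?thesis
  proof (rule exI[of _ K], rule conjI[OF K], rule exI[of _ \<delta>], rule conjI[OF \<delta>(1)], intro allI impI)
    fix s :: real and n :: nat
    assume s: "0 < s" "s \<le> \<delta>" and n: "0 < n"
    \<comment> \<open>\<open>f1\<close> controls the passage from a grid point to its cell,
      \<open>f2\<close> a coordinate of the increment from \<zeta>0 to the grid point.\<close>
    define f1 where "f1 = (\<lambda>c z. osc z (\<zeta>0 + s *\<^sub>R c) (e * s))"
    define f2 where "f2 = (\<lambda>c b z. b \<bullet> (m z (\<zeta>0 + s *\<^sub>R c) - m z \<zeta>0))"
    have f1m[measurable]: "f1 c \<in> borel_measurable N" for c unfolding f1_def by measurable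
    have f2m[measurable]: "f2 c b \<in> borel_measurable N" for c b unfolding f2_def by measurable
    define a1 where "a1 = \<epsilon> * s / 8"
    define a2 where "a2 = \<epsilon> * s / 8 / d"
    have a12: "0 < a1" "0 < a2" using \<epsilon> s d by (auto simp: a1_def a2_def)
    define A where "A = (\<Union>c\<in>T. dev (f1 c) n a1 \<union> (\<Union>b\<in>Basis. dev (f2 c b) n a2)) \<union> bad"
    have ev1: "dev (f1 c) n a1 \<in> events" "dev (f2 c b) n a2 \<in> events" for c b by (auto intro!: dev_event)
    have ev2: "(\<Union>b\<in>Basis. dev (f2 c b) n a2) \<in> events" for c by (intro sets.finite_UN) (auto simp: ev1)
    have ev: "A \<in> events" unfolding A_def using T(1) ev1 ev2 bad_event by (intro sets.Un sets.finite_UN) auto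
    have p1: "prob (dev (f1 c) n a1) \<le> K1 / (real n * s)" if "c \<in> T" for c
    proof -
      have nc: "norm c \<le> 1" using that T(2) by auto
      have i: "(\<integral>z. osc z (\<zeta>0 + s *\<^sub>R c) (e * s) \<partial>P) \<le> L * s"
      proof -
        have "L * e * s \<le> L * 1 * s" using e s L(1) by (intro mult_right_mono mult_left_mono) auto
        then show ?thesis using \<delta>1(2)[of s c] s \<delta> nc by simp
      qed
      have "prob (dev (f1 c) n a1) \<le> (Bo * (L * s)) / (real n * a1\<^sup>2)"
        by (rule dev_prob_le[of _ Bo]) (use n a12 Bo osc_second_moment[OF i] in \<open>auto simp: f1_def\<close>)
      also have "\<dots> = K1 / (real n * s)" using s n \<epsilon> by (simp add: K1_def a1_def power2_eq_square field_simps)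
      finally show ?thesis .
    qed
    have p2: "prob (dev (f2 c b) n a2) \<le> K2 / (real n * s)" if "c \<in> T" "b \<in> Basis" for c b
    proof -
      have nc: "norm c \<le> 1" using that T(2) by auto
      have f2le: "\<bar>f2 c b z\<bar> \<le> osc z (\<zeta>0 + s *\<^sub>R 0) s" if "z \<in> G" for z
      proof -
        have "\<bar>f2 c b z\<bar> \<le> norm b * norm (m z (\<zeta>0 + s *\<^sub>R c) - m z \<zeta>0)"
          unfolding f2_def by (rule Cauchy_Schwarz_ineq2)
        also have "\<dots> \<le> osc z \<zeta>0 s" using osc[OF that, of "\<zeta>0 + s *\<^sub>R c" \<zeta>0 s] nc s \<open>b \<in> Basis\<close> by simp
        finally show ?thesis by simp
      qed
      have "(\<integral>z. (f2 c b z)\<^sup>2 \<partial>P) \<le> (\<integral>z. (osc z (\<zeta>0 + s *\<^sub>R 0) s)\<^sup>2 \<partial>P)"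
      proof (rule integral_G_mono[of _ _ "Bo\<^sup>2" "Bo\<^sup>2"])
        fix z assume z: "z \<in> G"
        have o: "\<bar>osc z (\<zeta>0 + s *\<^sub>R 0) s\<bar> \<le> Bo" using Bo by simp
        show 1: "(f2 c b z)\<^sup>2 \<le> (osc z (\<zeta>0 + s *\<^sub>R 0) s)\<^sup>2"
          using power_mono[OF f2le[OF z] abs_ge_zero, of 2] by simp
        show 2: "\<bar>(osc z (\<zeta>0 + s *\<^sub>R 0) s)\<^sup>2\<bar> \<le> Bo\<^sup>2" using power_mono[OF o abs_ge_zero, of 2] by simp
        show "\<bar>(f2 c b z)\<^sup>2\<bar> \<le> Bo\<^sup>2" using 1 2 by simp
      qed (auto simp: f2_def)
      also have "\<dots> \<le> Bo * (L * s)" by (rule osc_second_moment) (use \<delta>2(2)[of s 0] s \<delta> in simp)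
      finally have E: "(\<integral>z. (f2 c b z)\<^sup>2 \<partial>P) \<le> Bo * (L * s)" .
      have "\<bar>f2 c b z\<bar> \<le> Bo" if "z \<in> G" for z using f2le[OF that] Bo(3)[of z "\<zeta>0 + s *\<^sub>R 0" s] by simp
      then have "prob (dev (f2 c b) n a2) \<le> (Bo * (L * s)) / (real n * a2\<^sup>2)"
        by (intro dev_prob_le[of _ Bo] f2m n a12 E)
      also have "\<dots> = K2 / (real n * s)" using s n \<epsilon> d by (simp add: K2_def a2_def power2_eq_square field_simps)
      finally show ?thesis .
    qed
    have "prob A \<le> prob (\<Union>c\<in>T. dev (f1 c) n a1 \<union> (\<Union>b\<in>Basis. dev (f2 c b) n a2)) + prob bad"
      unfolding A_def by (rule measure_Un_le) (use T(1) ev1 ev2 bad_event in \<open>auto intro!: sets.finite_UN\<close>)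
    also have "\<dots> \<le> (\<Sum>c\<in>T. prob (dev (f1 c) n a1 \<union> (\<Union>b\<in>Basis. dev (f2 c b) n a2))) + 0"
      unfolding bad_null by (intro add_mono finite_measure_subadditive_finite T(1) order_refl) (use ev1 ev2 in auto)
    also have "\<dots> \<le> (\<Sum>c\<in>T. prob (dev (f1 c) n a1) + (\<Sum>b\<in>Basis. prob (dev (f2 c b) n a2)))"
    proof -
      have sub: "prob (dev (f1 c) n a1 \<union> (\<Union>b\<in>Basis. dev (f2 c b) n a2))
          \<le> prob (dev (f1 c) n a1) + (\<Sum>b\<in>Basis. prob (dev (f2 c b) n a2))" for c
      proof -
        have "prob (\<Union>b\<in>Basis. dev (f2 c b) n a2) \<le> (\<Sum>b\<in>Basis. prob (dev (f2 c b) n a2))"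
          by (rule finite_measure_subadditive_finite) (use ev1 in auto)
        then show ?thesis using measure_Un_le[OF ev1(1)[of c] ev2[of c]] by linarith
      qed
      show ?thesis unfolding add_0_right by (rule sum_mono) (rule sub)
    qed
    also have "\<dots> \<le> (\<Sum>c\<in>T. K1 / (real n * s) + (\<Sum>b\<in>(Basis::'a set). K2 / (real n * s)))"
      by (intro sum_mono add_mono p1 p2)
    also have "\<dots> = real (card T) * (K1 + d * K2) / (real n * s)"
      by (simp add: d_def flip: add_divide_distrib)
    also have "\<dots> \<le> K / (real n * s)" unfolding K_def using s n by (intro divide_right_mono) auto
    finally have pA: "prob A \<le> K / (real n * s)" .
    have main: "norm (avg n \<omega> (\<zeta>0 + s *\<^sub>R h) - avg n \<omega> \<zeta>0 - s *\<^sub>R D h) \<le> \<epsilon> * s"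
      if \<omega>: "\<omega> \<in> space M - A" and h: "norm h \<le> 1" for \<omega> h
    proof -
      have gz: "Z i \<omega> \<in> G" for i using good[of \<omega> i] \<omega> by (auto simp: A_def)
      obtain c where c: "c \<in> T" "norm (h - c) < e" using T(3) h by (auto simp: dist_norm norm_minus_commute subset_iff)
      have nc: "norm c \<le> 1" using c T(2) by auto
      have d1: "\<omega> \<notin> dev (f1 c) n a1" and d2: "\<And>b. b \<in> Basis \<Longrightarrow> \<omega> \<notin> dev (f2 c b) n a2"
        using \<omega> c(1) by (auto simp: A_def)
      have t1: "norm (avg n \<omega> (\<zeta>0 + s *\<^sub>R h) - avg n \<omega> (\<zeta>0 + s *\<^sub>R c)) \<le> \<epsilon> * s / 4"
      proof -
        have dist: "norm ((\<zeta>0 + s *\<^sub>R h) - (\<zeta>0 + s *\<^sub>R c)) \<le> e * s"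
        proof -
          have "(\<zeta>0 + s *\<^sub>R h) - (\<zeta>0 + s *\<^sub>R c) = s *\<^sub>R (h - c)" by (simp add: algebra_simps)
          then show ?thesis using c(2) s by (simp add: mult.commute)
        qed
        have "norm (\<Sum>i<n. m (Z i \<omega>) (\<zeta>0 + s *\<^sub>R h) - m (Z i \<omega>) (\<zeta>0 + s *\<^sub>R c)) \<le> (\<Sum>i<n. f1 c (Z i \<omega>))"
          by (intro sum_norm_le) (use osc[OF gz dist] in \<open>simp add: f1_def\<close>)
        then have "norm (avg n \<omega> (\<zeta>0 + s *\<^sub>R h) - avg n \<omega> (\<zeta>0 + s *\<^sub>R c)) \<le> (\<Sum>i<n. f1 c (Z i \<omega>)) / real n"
          using n by (simp add: avg_def sum_subtractf divide_right_mono flip: scaleR_diff_right)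
        moreover have "(\<integral>z. f1 c z \<partial>P) \<le> L * e * s" using \<delta>1(2)[of s c] s \<delta> nc by (simp add: f1_def)
        moreover have "\<bar>(\<Sum>i<n. f1 c (Z i \<omega>)) / real n - (\<integral>z. f1 c z \<partial>P)\<bar> < a1" using d1 \<omega> by (simp add: dev_def)
        moreover have "L * e * s \<le> \<epsilon> / 8 * s" using e(3) s by (intro mult_right_mono) auto
        ultimately show ?thesis unfolding a1_def by linarith
      qed
      have t2: "norm (avg n \<omega> (\<zeta>0 + s *\<^sub>R c) - avg n \<omega> \<zeta>0 - mu (\<zeta>0 + s *\<^sub>R c)) \<le> \<epsilon> * s / 8"
      proof (rule norm_le_coordinates)
        fix b :: 'a assume b: "b \<in> Basis"
        have "(\<integral>z. f2 c b z \<partial>P) = b \<bullet> mu (\<zeta>0 + s *\<^sub>R c) - b \<bullet> mu \<zeta>0"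
          unfolding f2_def inner_diff_right inner_mu
          by (rule Bochner_Integration.integral_diff) (rule integrable_bounded[of _ "norm b * B"]; use inner_m_bound in simp)+
        moreover have "(\<Sum>i<n. f2 c b (Z i \<omega>)) / real n = b \<bullet> avg n \<omega> (\<zeta>0 + s *\<^sub>R c) - b \<bullet> avg n \<omega> \<zeta>0"
          by (simp add: f2_def inner_diff_right inner_avg sum_subtractf diff_divide_distrib)
        ultimately show "\<bar>b \<bullet> (avg n \<omega> (\<zeta>0 + s *\<^sub>R c) - avg n \<omega> \<zeta>0 - mu (\<zeta>0 + s *\<^sub>R c))\<bar> \<le> \<epsilon> * s / 8 / DIM('a)"
          using d2[OF b] \<omega> by (simp add: dev_def inner_diff_right mu_def mean0 a2_def d_def)
      qed
      have t3: "norm (mu (\<zeta>0 + s *\<^sub>R c) - s *\<^sub>R D c) \<le> \<epsilon> * s / 8"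
      proof -
        have ns: "norm (s *\<^sub>R c) \<le> s" using nc s by simp
        then have "norm (mu (\<zeta>0 + s *\<^sub>R c) - mu \<zeta>0 - D (s *\<^sub>R c)) \<le> \<epsilon> / 8 * norm (s *\<^sub>R c)"
          using \<delta>3(2)[of "\<zeta>0 + s *\<^sub>R c"] le_less_trans[OF ns le_less_trans[OF s(2) \<delta>(4)]] by simp
        also have "\<dots> \<le> \<epsilon> / 8 * s" using ns \<epsilon> by (intro mult_left_mono) auto
        finally show ?thesis by (simp add: mu_def mean0 linear_cmul[OF bounded_linear.linear[OF D]])
      qed
      have t4: "norm (s *\<^sub>R D c - s *\<^sub>R D h) \<le> \<epsilon> * s / 8"
      proof -
        have "s *\<^sub>R D c - s *\<^sub>R D h = s *\<^sub>R D (c - h)" by (simp add: linear_diff[OF bounded_linear.linear[OF D]] scaleR_diff_right)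
        moreover have "norm (D (c - h)) \<le> e * KD"
by (rule order_trans[OF KD(2) mult_right_mono]) (use c(2) KD(1) in \<open>auto simp: norm_minus_commute\<close>)
        ultimately show ?thesis using e(4) s mult_left_mono[of "norm (D (c - h))" "\<epsilon> / 8" s] by simp
      qed
      \<comment> \<open>Four errors: variation in the cell, sampling error at the grid point,
        linearisation of the mean, variation of D in the cell. Together they make 5/8 of \<epsilon>
        s.\<close>
      have "avg n \<omega> (\<zeta>0 + s *\<^sub>R h) - avg n \<omega> \<zeta>0 - s *\<^sub>R D h =
         (avg n \<omega> (\<zeta>0 + s *\<^sub>R h) - avg n \<omega> (\<zeta>0 + s *\<^sub>R c)) + (avg n \<omega> (\<zeta>0 + s *\<^sub>R c) - avg n \<omega> \<zeta>0 - mu (\<zeta>0 + s *\<^sub>R c))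
         + (mu (\<zeta>0 + s *\<^sub>R c) - s *\<^sub>R D c) + (s *\<^sub>R D c - s *\<^sub>R D h)" by simp
      also have "norm \<dots> \<le> \<epsilon> * s / 4 + \<epsilon> * s / 8 + \<epsilon> * s / 8 + \<epsilon> * s / 8"
        by (intro norm_triangle_le add_mono t1 t2 t3 t4)
      also have "\<dots> \<le> \<epsilon> * s" using \<epsilon> s by simp
      finally show ?thesis .
    qed
    show "\<exists>A\<in>events. prob A \<le> K / (real n * s) \<and> bad \<subseteq> A \<and>
     (\<forall>\<omega>\<in>space M - A. \<forall>h. norm h \<le> 1 \<longrightarrow>
        norm (avg n \<omega> (\<zeta>0 + s *\<^sub>R h) - avg n \<omega> \<zeta>0 - s *\<^sub>R D h) \<le> \<epsilon> * s)"
      by (intro bexI[of _ A] ev conjI pA ballI allI impI main) (auto simp: A_def)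
  qed
qed

text \<open>Replacing \<zeta>0 by a nearby parameter changes a product of two linear forms in m by
  at most 2 B times the oscillation, so only the mean oscillation and the moments at \<zeta>0 have
  to concentrate. The permitted error does not shrink with s, hence a bound K / n free of s;
  bilinearity lets one event serve all u and v.\<close>

lemma moments_stable:
  assumes \<epsilon>: "0 < \<epsilon>"
  shows "\<exists>K>0. \<exists>\<delta>>0. \<forall>s n. 0 < s \<longrightarrow> s \<le> \<delta> \<longrightarrow> 0 < n \<longrightarrow> (\<exists>A\<in>events. prob A \<le> K / real n \<and>
     (\<forall>\<omega>\<in>space M - A. \<forall>h u v. norm h \<le> 1 \<longrightarrow>
        \<bar>(\<Sum>i<n. (u \<bullet> m (Z i \<omega>) (\<zeta>0 + s *\<^sub>R h)) * (v \<bullet> m (Z i \<omega>) (\<zeta>0 + s *\<^sub>R h))) / real n - u \<bullet> V v\<bar>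
          \<le> \<epsilon> * norm u * norm v))"
proof -
  interpret P: prob_space P by (rule prob_space_P)
  define d where "d = real DIM('a)"
  have d: "0 < d" by (simp add: d_def)
  obtain \<delta>1 where \<delta>1: "\<delta>1 > 0" "\<And>s. 0 < s \<Longrightarrow> s \<le> \<delta>1 \<Longrightarrow> (\<integral>z. osc z (\<zeta>0 + s *\<^sub>R 0) s \<partial>P) \<le> L * s"
    using L(2)[of 1] by (metis mult.right_neutral mult_1 order_refl zero_less_one norm_zero zero_le_one)
  define \<delta> where "\<delta> = min \<delta>1 (\<epsilon> / (8 * B * L))"
  have \<delta>: "0 < \<delta>" "\<delta> \<le> \<delta>1" using \<delta>1(1) \<epsilon> B(1) L(1) by (auto simp: \<delta>_def)
  define a1 where "a1 = \<epsilon> / (8 * B)"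
  define a2 where "a2 = \<epsilon> / (2 * d\<^sup>2)"
  have a12: "0 < a1" "0 < a2" using \<epsilon> B(1) d by (auto simp: a1_def a2_def)
  define K where "K = Bo\<^sup>2 / a1\<^sup>2 + d * (d * ((B\<^sup>2)\<^sup>2 / a2\<^sup>2))"
  have K: "K > 0" using Bo(1) a12 d B(1) by (auto simp: K_def intro!: add_pos_pos)
  show ?thesis
  proof (rule exI[of _ K], rule conjI[OF K], rule exI[of _ \<delta>], rule conjI[OF \<delta>(1)], intro allI impI)
    fix s :: real and n :: nat
    assume s: "0 < s" "s \<le> \<delta>" and n: "0 < n"
    define f1 where "f1 = (\<lambda>z. osc z \<zeta>0 s)"
    define f2 where "f2 = (\<lambda>b c z. (b \<bullet> m z \<zeta>0) * (c \<bullet> m z \<zeta>0))"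
    have f1m[measurable]: "f1 \<in> borel_measurable N" unfolding f1_def by measurable
    have f2m[measurable]: "f2 b c \<in> borel_measurable N" for c b unfolding f2_def by measurable
    define A where "A = dev f1 n a1 \<union> (\<Union>b\<in>Basis. \<Union>c\<in>Basis. dev (f2 b c) n a2) \<union> bad"
    have ev1: "dev f1 n a1 \<in> events" "dev (f2 b c) n a2 \<in> events" for b c by (auto intro!: dev_event)
    have ev2: "(\<Union>c\<in>Basis. dev (f2 b c) n a2) \<in> events" for b by (intro sets.finite_UN) (auto simp: ev1)
    have ev3: "(\<Union>b\<in>Basis. \<Union>c\<in>Basis. dev (f2 b c) n a2) \<in> events" by (rule sets.finite_UN[OF finite_Basis ev2])
    have ev: "A \<in> events" unfolding A_def by (intro sets.Un ev1 ev3 bad_event)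
    have p1: "prob (dev f1 n a1) \<le> Bo\<^sup>2 / (real n * a1\<^sup>2)"
    proof (rule dev_prob_le[OF f1m _ n a12(1)])
      show "\<bar>f1 z\<bar> \<le> Bo" for z using Bo by (simp add: f1_def)
      then have "(\<integral>z. (f1 z)\<^sup>2 \<partial>P) \<le> (\<integral>z. Bo\<^sup>2 \<partial>P)"
        by (intro integral_G_mono[of _ _ "Bo\<^sup>2" "Bo\<^sup>2"]) (auto simp: f1_def abs_le_square_iff[symmetric] Bo abs_of_pos[OF Bo(1)])
      then show "(\<integral>z. (f1 z)\<^sup>2 \<partial>P) \<le> Bo\<^sup>2" by (simp add: P.prob_space)
    qed
    have f2b: "\<bar>f2 b c z\<bar> \<le> B\<^sup>2" if "b \<in> Basis" "c \<in> Basis" "z \<in> G" for b c z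
      unfolding f2_def abs_mult power2_eq_square
      using inner_m_bound[OF that(3), of b \<zeta>0] inner_m_bound[OF that(3), of c \<zeta>0] that B(1) by (intro mult_mono) auto
    have p2: "prob (dev (f2 b c) n a2) \<le> (B\<^sup>2)\<^sup>2 / (real n * a2\<^sup>2)" if bc: "b \<in> Basis" "c \<in> Basis" for b c
    proof (rule dev_prob_le[OF f2m _ n a12(2)])
      show b: "\<bar>f2 b c z\<bar> \<le> B\<^sup>2" if "z \<in> G" for z using f2b[OF bc that] .
      have "(\<integral>z. (f2 b c z)\<^sup>2 \<partial>P) \<le> (\<integral>z. (B\<^sup>2)\<^sup>2 \<partial>P)"
      proof (rule integral_G_mono[of _ _ "(B\<^sup>2)\<^sup>2" "(B\<^sup>2)\<^sup>2"])
        fix z assume z: "z \<in> G"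
        show 1: "(f2 b c z)\<^sup>2 \<le> (B\<^sup>2)\<^sup>2" using power_mono[OF b[OF z] abs_ge_zero, of 2] by simp
        show "\<bar>(f2 b c z)\<^sup>2\<bar> \<le> (B\<^sup>2)\<^sup>2" using 1 by simp
      qed (auto simp: f2_def)
      then show "(\<integral>z. (f2 b c z)\<^sup>2 \<partial>P) \<le> (B\<^sup>2)\<^sup>2" by (simp add: P.prob_space)
    qed
    have "prob A \<le> prob (dev f1 n a1 \<union> (\<Union>b\<in>Basis. \<Union>c\<in>Basis. dev (f2 b c) n a2)) + prob bad"
      unfolding A_def by (rule measure_Un_le) (use ev1 ev3 bad_event in auto)
    also have "\<dots> \<le> prob (dev f1 n a1) + prob (\<Union>b\<in>Basis. \<Union>c\<in>Basis. dev (f2 b c) n a2)"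
      using measure_Un_le[OF ev1(1) ev3] by (simp add: bad_null)
    also have "prob (\<Union>b\<in>Basis. \<Union>c\<in>Basis. dev (f2 b c) n a2) \<le> (\<Sum>b\<in>Basis. prob (\<Union>c\<in>Basis. dev (f2 b c) n a2))"
      by (rule finite_measure_subadditive_finite) (use ev2 in auto)
    also have "\<dots> \<le> (\<Sum>b\<in>Basis. \<Sum>c\<in>Basis. prob (dev (f2 b c) n a2))"
      by (intro sum_mono finite_measure_subadditive_finite) (use ev1 in auto)
    also have "\<dots> \<le> (\<Sum>b\<in>(Basis::'a set). \<Sum>c\<in>(Basis::'a set). (B\<^sup>2)\<^sup>2 / (real n * a2\<^sup>2))"
      by (intro sum_mono p2)
    also have "prob (dev f1 n a1) + \<dots> \<le> Bo\<^sup>2 / (real n * a1\<^sup>2) + d * (d * ((B\<^sup>2)\<^sup>2 / (real n * a2\<^sup>2)))"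
      using p1 by (simp add: d_def)
    also have "\<dots> = K / real n" by (simp add: K_def add_divide_distrib mult.commute)
    finally have pA: "prob A \<le> K / real n" by simp
    have main: "\<bar>(\<Sum>i<n. (u \<bullet> m (Z i \<omega>) (\<zeta>0 + s *\<^sub>R h)) * (v \<bullet> m (Z i \<omega>) (\<zeta>0 + s *\<^sub>R h))) / real n - u \<bullet> V v\<bar>
          \<le> \<epsilon> * norm u * norm v"
      if \<omega>: "\<omega> \<in> space M - A" and h: "norm h \<le> 1" for \<omega> h u v
    proof -
      have gz: "Z i \<omega> \<in> G" for i using good[of \<omega> i] \<omega> by (auto simp: A_def)
      define x where "x = (\<lambda>i. m (Z i \<omega>) (\<zeta>0 + s *\<^sub>R h))"
      define y where "y = (\<lambda>i. m (Z i \<omega>) \<zeta>0)"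
      have d1: "\<omega> \<notin> dev f1 n a1" and d2: "\<And>b c. b \<in> Basis \<Longrightarrow> c \<in> Basis \<Longrightarrow> \<omega> \<notin> dev (f2 b c) n a2"
        using \<omega> by (auto simp: A_def)
      have xy: "\<bar>(u \<bullet> x i) * (v \<bullet> x i) - (u \<bullet> y i) * (v \<bullet> y i)\<bar> \<le> 2 * B * norm u * norm v * f1 (Z i \<omega>)" for i
      proof -
        have o: "norm (x i - y i) \<le> f1 (Z i \<omega>)"
          unfolding x_def y_def f1_def by (rule osc[OF gz]) (use h s in simp)
        have "(u \<bullet> x i) * (v \<bullet> x i) - (u \<bullet> y i) * (v \<bullet> y i) = (u \<bullet> (x i - y i)) * (v \<bullet> x i) + (u \<bullet> y i) * (v \<bullet> (x i - y i))"
          by (simp add: inner_diff_right algebra_simps)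
        also have "\<bar>\<dots>\<bar> \<le> (norm u * f1 (Z i \<omega>)) * (norm v * B) + (norm u * B) * (norm v * f1 (Z i \<omega>))"
        proof (rule order_trans[OF abs_triangle_ineq], unfold abs_mult, intro add_mono mult_mono)
          show "\<bar>u \<bullet> (x i - y i)\<bar> \<le> norm u * f1 (Z i \<omega>)" "\<bar>v \<bullet> (x i - y i)\<bar> \<le> norm v * f1 (Z i \<omega>)"
            by (auto intro!: order_trans[OF Cauchy_Schwarz_ineq2 mult_left_mono[OF o]])
          show "\<bar>v \<bullet> x i\<bar> \<le> norm v * B" "\<bar>u \<bullet> y i\<bar> \<le> norm u * B"
            using inner_m_bound[OF gz] by (auto simp: x_def y_def)
        qed (use Bo(2) B(1) in \<open>auto simp: f1_def\<close>)
        finally show ?thesis by (simp add: mult.commute mult.left_commute)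
      qed
      have "\<bar>(\<Sum>i<n. (u \<bullet> x i) * (v \<bullet> x i)) - (\<Sum>i<n. (u \<bullet> y i) * (v \<bullet> y i))\<bar> \<le> (\<Sum>i<n. 2 * B * norm u * norm v * f1 (Z i \<omega>))"
        unfolding sum_subtractf[symmetric] by (rule order_trans[OF sum_abs sum_mono]) (rule xy)
      then have "\<bar>(\<Sum>i<n. (u \<bullet> x i) * (v \<bullet> x i)) - (\<Sum>i<n. (u \<bullet> y i) * (v \<bullet> y i))\<bar> / real n
          \<le> 2 * B * norm u * norm v * (\<Sum>i<n. f1 (Z i \<omega>)) / real n"
        unfolding sum_distrib_left by (intro divide_right_mono) auto
      also have "\<dots> = 2 * B * norm u * norm v * ((\<Sum>i<n. f1 (Z i \<omega>)) / real n)" by simp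
      also have "(\<Sum>i<n. f1 (Z i \<omega>)) / real n \<le> \<epsilon> / (4 * B)"
      proof -
        have "(\<integral>z. f1 z \<partial>P) \<le> L * s" using \<delta>1(2)[of s] s \<delta> by (simp add: f1_def)
        also have "\<dots> \<le> L * (\<epsilon> / (8 * B * L))" using s L(1) by (intro mult_left_mono) (auto simp: \<delta>_def)
        also have "\<dots> = \<epsilon> / (8 * B)" using L(1) by simp
        finally have "(\<integral>z. f1 z \<partial>P) \<le> \<epsilon> / (8 * B)" .
        moreover have "\<bar>(\<Sum>i<n. f1 (Z i \<omega>)) / real n - (\<integral>z. f1 z \<partial>P)\<bar> < \<epsilon> / (8 * B)" using d1 \<omega> by (simp add: dev_def a1_def)
        moreover have "\<epsilon> / (4 * B) = \<epsilon> / (8 * B) + \<epsilon> / (8 * B)" by simp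
        ultimately show ?thesis by linarith
      qed
      finally have t1: "\<bar>(\<Sum>i<n. (u \<bullet> x i) * (v \<bullet> x i)) / real n - (\<Sum>i<n. (u \<bullet> y i) * (v \<bullet> y i)) / real n\<bar> \<le> \<epsilon> / 2 * norm u * norm v"
        using B(1) n by (simp add: mult_left_mono abs_divide flip: diff_divide_distrib)
      \<comment> \<open>The sampling error as a bilinear form: bounds on pairs of basis vectors
        extend to all u and v at the price of the factor d^2, which is built into
        \<open>a2\<close>.\<close>
      define q where "q = (\<lambda>b c. (\<Sum>i<n. (b \<bullet> y i) * (c \<bullet> y i)) / real n - b \<bullet> V c)"
      have qbc: "\<bar>q b c\<bar> \<le> a2" if "b \<in> Basis" "c \<in> Basis" for b c
        using d2[OF that] \<omega> by (simp add: q_def y_def dev_def f2_def second_moment)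
      have ub: "z \<bullet> w = (\<Sum>b\<in>Basis. (z \<bullet> b) * (b \<bullet> w))" for z w :: 'a
        by (subst euclidean_inner) (simp add: inner_commute)
      have Vlin: "V v = (\<Sum>c\<in>Basis. (v \<bullet> c) *\<^sub>R V c)"
        using linear_sum[OF V(1), of "\<lambda>c. (v \<bullet> c) *\<^sub>R c" Basis] by (simp add: euclidean_representation linear_cmul[OF V(1)])
      have "q u v = (\<Sum>b\<in>Basis. \<Sum>c\<in>Basis. (u \<bullet> b) * (v \<bullet> c) * q b c)"
      proof -
        have 1: "(u \<bullet> y i) * (v \<bullet> y i) = (\<Sum>b\<in>Basis. \<Sum>c\<in>Basis. (u \<bullet> b) * (v \<bullet> c) * ((b \<bullet> y i) * (c \<bullet> y i)))" for i
          by (subst ub[of u], subst ub[of v]) (simp add: sum_product mult.commute mult.left_commute)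
        have "(\<Sum>i<n. (u \<bullet> y i) * (v \<bullet> y i)) = (\<Sum>b\<in>Basis. \<Sum>c\<in>Basis. (u \<bullet> b) * (v \<bullet> c) * (\<Sum>i<n. (b \<bullet> y i) * (c \<bullet> y i)))"
          unfolding 1 by (subst sum.swap, rule sum.cong[OF refl], subst sum.swap) (simp add: sum_distrib_left)
        moreover have "u \<bullet> V v = (\<Sum>b\<in>Basis. \<Sum>c\<in>Basis. (u \<bullet> b) * (v \<bullet> c) * (b \<bullet> V c))"
          by (subst ub[of u], subst Vlin) (simp add: inner_sum_right sum_distrib_left mult.assoc)
        moreover define S where "S \<equiv> (\<lambda>b c. \<Sum>i<n. (b \<bullet> y i) * (c \<bullet> y i))"
        moreover have "(\<Sum>b\<in>Basis. \<Sum>c\<in>Basis. (u \<bullet> b) * (v \<bullet> c) * T b c) / real n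
            = (\<Sum>b\<in>Basis. \<Sum>c\<in>Basis. (u \<bullet> b) * (v \<bullet> c) * (T b c / real n))" for T :: "'a \<Rightarrow> 'a \<Rightarrow> real"
          by (simp add: sum_divide_distrib)
        ultimately show ?thesis unfolding q_def
          by (simp add: right_diff_distrib sum_subtractf)
      qed
      also have "\<bar>\<dots>\<bar> \<le> (\<Sum>b\<in>(Basis::'a set). \<Sum>c\<in>(Basis::'a set). norm u * norm v * a2)"
      proof (intro order_trans[OF sum_abs] sum_mono)
        fix b c :: 'a assume bc: "b \<in> Basis" "c \<in> Basis"
        show "\<bar>(u \<bullet> b) * (v \<bullet> c) * q b c\<bar> \<le> norm u * norm v * a2"
          unfolding abs_mult using Basis_le_norm[OF bc(1), of u] Basis_le_norm[OF bc(2), of v] qbc[OF bc] by (intro mult_mono) auto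
      qed
      also have "\<dots> = norm u * norm v * (d\<^sup>2 * a2)" by (simp add: d_def power2_eq_square mult.commute mult.left_commute)
      also have "d\<^sup>2 * a2 = \<epsilon> / 2" using d by (simp add: a2_def)
      finally have t2: "\<bar>q u v\<bar> \<le> \<epsilon> / 2 * norm u * norm v" by (simp add: mult.commute mult.left_commute)
      have "\<epsilon> * norm u * norm v = \<epsilon> / 2 * norm u * norm v + \<epsilon> / 2 * norm u * norm v" by simp
      then show ?thesis using t1 t2 unfolding q_def x_def by linarith
    qed
    show "\<exists>A\<in>events. prob A \<le> K / real n \<and>
     (\<forall>\<omega>\<in>space M - A. \<forall>h u v. norm h \<le> 1 \<longrightarrow>
        \<bar>(\<Sum>i<n. (u \<bullet> m (Z i \<omega>) (\<zeta>0 + s *\<^sub>R h)) * (v \<bullet> m (Z i \<omega>) (\<zeta>0 + s *\<^sub>R h))) / real n - u \<bullet> V v\<bar>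
          \<le> \<epsilon> * norm u * norm v)"
      by (intro bexI[of _ A] ev conjI pA ballI allI impI main)
  qed
qed

end

section \<open>Quadratic expansion and tails of the empirical likelihood ratio\<close>

context el_sample
begin

section \<open>Dyadic tail bound\<close>

definition ratio :: "nat \<Rightarrow> 'w \<Rightarrow> 'a \<Rightarrow> real" where
  "ratio n \<omega> \<zeta> = elr n (\<lambda>i. m (Z i \<omega>) \<zeta>)"

abbreviation rescaled :: "nat \<Rightarrow> 'w \<Rightarrow> 'a \<Rightarrow> real" where
  "rescaled n \<omega> h \<equiv> ratio n \<omega> (\<zeta>0 + (1 / sqrt (real n)) *\<^sub>R h)"

abbreviation tail_bounded :: "real \<Rightarrow> real \<Rightarrow> real \<Rightarrow> nat \<Rightarrow> 'w \<Rightarrow> bool" where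
  "tail_bounded c \<delta> C n \<omega> \<equiv>
    (\<forall>\<zeta>. C / sqrt (real n) \<le> norm (\<zeta> - \<zeta>0) \<longrightarrow> ratio n \<omega> \<zeta> \<le> exp (- c * real n * (min (norm (\<zeta> - \<zeta>0)) \<delta>)\<^sup>2))"

text \<open>The failure probability at radius \<open>s j\<close> decreases like 2^(-j), so the union
  over all dyadic radii costs only twice the bound at the smallest one. For \<zeta> in a given
  direction, the sample mean is evaluated at the largest dyadic radius not exceeding min t \<delta>,
  where t is the distance of \<zeta>, and monotonicity along the ray carries the estimate to
  \<zeta>. The bound on the mean at \<zeta>0 remains a premise on \<omega>, so that
  \<open>C1\<close> can be adapted to the desired probability.\<close>

lemma ratio_tail:
  "\<exists>c>0. \<exists>\<delta>>0. \<exists>a>0. \<exists>K>0. \<forall>n C C1. 0 < n \<longrightarrow> 0 < C1 \<longrightarrow> a * C1 \<le> C \<longrightarrow> C / sqrt (real n) \<le> \<delta> \<longrightarrow>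
     (\<exists>A\<in>events. prob A \<le> K / (C * sqrt (real n)) \<and> (\<forall>\<omega>\<in>space M - A. norm (avg n \<omega> \<zeta>0) \<le> C1 / sqrt (real n) \<longrightarrow>
        tail_bounded c \<delta> C n \<omega>))"
proof -
  obtain K \<delta> where K: "K > 0" and \<delta>: "\<delta> > 0" and
    inc: "\<And>s n. 0 < s \<Longrightarrow> s \<le> \<delta> \<Longrightarrow> 0 < n \<Longrightarrow> \<exists>A\<in>events. prob A \<le> K / (real n * s) \<and> bad \<subseteq> A \<and>
     (\<forall>\<omega>\<in>space M - A. \<forall>h. norm h \<le> 1 \<longrightarrow>
        norm (avg n \<omega> (\<zeta>0 + s *\<^sub>R h) - avg n \<omega> \<zeta>0 - s *\<^sub>R D h) \<le> \<kappa> / 4 * s)"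
    using increments[of "\<kappa> / 4"] \<kappa>(1) by (metis zero_less_divide_iff zero_less_numeral)
  \<comment> \<open>The projected mean at radius s j is at least \<kappa> s j / 2, while min t
    \<delta> < 2 s j; expressed through the latter, the exponent of \<open>elr_tail\<close> has this
    constant.\<close>
  define c where "c = (\<kappa> / 4)\<^sup>2 / (8 * B\<^sup>2)"
  have c: "c > 0" using \<kappa>(1) B(1) by (simp add: c_def)
  \<comment> \<open>The factor by which C exceeds C1: the mean at \<zeta>0 is then at most \<kappa>
    / 4 times the smallest radius.\<close>
  have a: "4 / \<kappa> > 0" using \<kappa>(1) by simp
  have K2: "2 * K > 0" using K by simp
  show ?thesis
  proof (rule exI[of _ c], rule conjI[OF c], rule exI[of _ \<delta>], rule conjI[OF \<delta>], rule exI[of _ "4 / \<kappa>"], rule conjI[OF a],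
      rule exI[of _ "2 * K"], rule conjI[OF K2], intro allI impI)
    fix n :: nat and C C1 :: real
    assume n: "0 < n" and C1: "0 < C1" and C: "4 / \<kappa> * C1 \<le> C" and C\<delta>: "C / sqrt (real n) \<le> \<delta>"
    have C0: "0 < C" using C C1 a by (meson less_le_trans mult_pos_pos)
    define s where "s = (\<lambda>j. 2 ^ j * (C / sqrt (real n)))"
    have s0: "0 < s j" for j using C0 n by (simp add: s_def)
    have sS: "s (Suc j) = 2 * s j" for j by (simp add: s_def)
    have smono: "s i \<le> s j" if "i \<le> j" for i j
      unfolding s_def using that C0 by (intro mult_right_mono power_increasing) auto
    \<comment> \<open>Finitely many radii suffice, because the exponent is capped at
      \<delta>.\<close>
    obtain J where J: "\<delta> < s J"
    proof -
      obtain J where "\<delta> / (C / sqrt (real n)) < 2 ^ J" using real_arch_pow[of 2] by auto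
      then have "\<delta> < s J" using C0 n by (simp add: s_def field_simps)
      then show thesis by (rule that)
    qed
    have "\<forall>j. \<exists>A\<in>events. prob A \<le> K / (real n * s j) \<and> (s j \<le> \<delta> \<longrightarrow> bad \<subseteq> A \<and>
     (\<forall>\<omega>\<in>space M - A. \<forall>h. norm h \<le> 1 \<longrightarrow>
        norm (avg n \<omega> (\<zeta>0 + s j *\<^sub>R h) - avg n \<omega> \<zeta>0 - s j *\<^sub>R D h) \<le> \<kappa> / 4 * s j))"
    proof
      fix j
      show "\<exists>A\<in>events. prob A \<le> K / (real n * s j) \<and> (s j \<le> \<delta> \<longrightarrow> bad \<subseteq> A \<and>
       (\<forall>\<omega>\<in>space M - A. \<forall>h. norm h \<le> 1 \<longrightarrow>
        norm (avg n \<omega> (\<zeta>0 + s j *\<^sub>R h) - avg n \<omega> \<zeta>0 - s j *\<^sub>R D h) \<le> \<kappa> / 4 * s j))"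
      proof (cases "s j \<le> \<delta>")
        case True
        from inc[OF s0 True n] show ?thesis by blast
      next
        \<comment> \<open>Radii beyond \<delta> receive the empty event, so that the family can be
          chosen for all j at once.\<close>
        case False
        then show ?thesis using K s0[of j] n by (intro bexI[of _ "{}"]) auto
      qed
    qed
    then obtain A where A: "\<And>j. A j \<in> events" "\<And>j. prob (A j) \<le> K / (real n * s j)" "\<And>j. s j \<le> \<delta> \<Longrightarrow> bad \<subseteq> A j"
      "\<And>j \<omega> h. s j \<le> \<delta> \<Longrightarrow> \<omega> \<in> space M - A j \<Longrightarrow> norm h \<le> 1 \<Longrightarrow>
        norm (avg n \<omega> (\<zeta>0 + s j *\<^sub>R h) - avg n \<omega> \<zeta>0 - s j *\<^sub>R D h) \<le> \<kappa> / 4 * s j"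
      by metis
    have ev: "(\<Union>j<J. A j) \<in> events" using A(1) by auto
    have "prob (\<Union>j<J. A j) \<le> (\<Sum>j<J. prob (A j))" by (rule finite_measure_subadditive_finite) (use A(1) in auto)
    also have "\<dots> \<le> (\<Sum>j<J. K / (real n * s j))" by (intro sum_mono A(2))
    also have "\<dots> = K / (C * sqrt (real n)) * (\<Sum>j<J. (1/2) ^ j)"
    proof -
      have "K / (real n * s j) = K / (C * sqrt (real n)) * (1/2) ^ j" for j
      proof -
        have "real n * (C / sqrt (real n)) = C * sqrt (real n)"
          using n real_sqrt_mult_self[of "real n"] by (simp add: field_simps)
        then have "real n * s j = 2 ^ j * (C * sqrt (real n))" unfolding s_def by (subst mult.left_commute) simp
        then show ?thesis by (simp add: power_one_over field_simps)
      qed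
      then show ?thesis by (simp add: sum_distrib_left)
    qed
    also have "(\<Sum>j<J. (1/2::real) ^ j) \<le> 2" by (simp add: sum_gp_strict)
    finally have pA: "prob (\<Union>j<J. A j) \<le> 2 * K / (C * sqrt (real n))"
      using K C0 by (simp add: mult_left_mono divide_right_mono mult.commute)
    have main: "ratio n \<omega> \<zeta> \<le> exp (- c * real n * (min (norm (\<zeta> - \<zeta>0)) \<delta>)\<^sup>2)"
      if \<omega>: "\<omega> \<in> space M - (\<Union>j<J. A j)" and b: "norm (avg n \<omega> \<zeta>0) \<le> C1 / sqrt (real n)"
        and z: "C / sqrt (real n) \<le> norm (\<zeta> - \<zeta>0)" for \<omega> \<zeta>
    proof -
      define t where "t = norm (\<zeta> - \<zeta>0)"
      have t: "t > 0" using z C0 n unfolding t_def by (meson divide_pos_pos less_le_trans of_nat_0_less_iff real_sqrt_gt_zero)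
      define u where "u = (1 / t) *\<^sub>R (\<zeta> - \<zeta>0)"
      have u: "norm u = 1" "\<zeta> = \<zeta>0 + t *\<^sub>R u" using t by (auto simp: u_def t_def)
      have sz: "s 0 \<le> min t \<delta>" using z C\<delta> by (simp add: s_def t_def)
      have fin: "\<exists>j. min t \<delta> < s j" using J by (intro exI[of _ J]) auto
      \<comment> \<open>The smallest dyadic radius above min t \<delta>; its predecessor lies below
        min t \<delta> by a factor of less than 2.\<close>
      define j1 where "j1 = (LEAST j. min t \<delta> < s j)"
      have j1: "min t \<delta> < s j1" "\<And>j. j < j1 \<Longrightarrow> s j \<le> min t \<delta>"
        unfolding j1_def using LeastI_ex[OF fin] not_less_Least by (force simp: not_less)+
      then have "j1 \<noteq> 0" using sz by (metis not_less)
      then obtain j where j: "j1 = Suc j" by (cases j1) auto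
      have sj: "s j \<le> min t \<delta>" "min t \<delta> < 2 * s j" using j1(2)[of j] j1(1) j sS by auto
      have jJ: "j < J"
      proof (rule ccontr)
        assume "\<not> j < J" then have "s J \<le> s j" by (intro smono) simp
        then show False using sj(1) J by simp
      qed
      have \<omega>j: "\<omega> \<in> space M - A j" using \<omega> jJ by auto
      have gz: "Z i \<omega> \<in> G" for i using good[of \<omega> i] A(3)[of j] \<omega>j sj(1) by auto
      \<comment> \<open>Coercivity contributes \<kappa> s j; the linearisation error and the mean at
        \<zeta>0 each take away at most a quarter of it.\<close>
      have lower: "\<kappa> / 2 * s j \<le> u \<bullet> avg n \<omega> (\<zeta>0 + s j *\<^sub>R u)"
      proof -
        define e where "e = avg n \<omega> (\<zeta>0 + s j *\<^sub>R u) - avg n \<omega> \<zeta>0 - s j *\<^sub>R D u"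
        have e: "norm e \<le> \<kappa> / 4 * s j" unfolding e_def by (rule A(4)) (use sj \<omega>j u in auto)
        have "avg n \<omega> (\<zeta>0 + s j *\<^sub>R u) = avg n \<omega> \<zeta>0 + s j *\<^sub>R D u + e" by (simp add: e_def)
        then have "u \<bullet> avg n \<omega> (\<zeta>0 + s j *\<^sub>R u) = u \<bullet> avg n \<omega> \<zeta>0 + s j * (u \<bullet> D u) + u \<bullet> e"
          by (simp add: inner_add_right)
        moreover have "s j * \<kappa> \<le> s j * (u \<bullet> D u)" using \<kappa>(2)[of u] u s0[of j] by (intro mult_left_mono) auto
        moreover have "\<bar>u \<bullet> e\<bar> \<le> \<kappa> / 4 * s j" using Cauchy_Schwarz_ineq2[of u e] u e by simp
        moreover have "\<bar>u \<bullet> avg n \<omega> \<zeta>0\<bar> \<le> \<kappa> / 4 * s j"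
        proof -
          have "C1 \<le> \<kappa> / 4 * C" using C \<kappa>(1) by (simp add: field_simps)
          then have "C1 / sqrt (real n) \<le> \<kappa> / 4 * C / sqrt (real n)" by (intro divide_right_mono) auto
          also have "\<dots> = \<kappa> / 4 * s 0" by (simp add: s_def)
          also have "\<dots> \<le> \<kappa> / 4 * s j" using smono[of 0 j] \<kappa>(1) by (intro mult_left_mono) auto
          finally show ?thesis using Cauchy_Schwarz_ineq2[of u "avg n \<omega> \<zeta>0"] b unfolding u(1) mult_1_left by linarith
        qed
        ultimately show ?thesis by (simp add: abs_le_iff algebra_simps)
      qed
      have "ratio n \<omega> \<zeta> \<le> exp (- real n * (\<kappa> / 2 * s j)\<^sup>2 / (8 * B\<^sup>2))"
        unfolding ratio_def
      proof (rule elr_tail[OF n B(1)])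
        show "\<bar>u \<bullet> m (Z i \<omega>) (\<zeta>0 + s j *\<^sub>R u)\<bar> \<le> B" for i using inner_m_bound[OF gz, of u] u by simp
        show "u \<bullet> m (Z i \<omega>) (\<zeta>0 + s j *\<^sub>R u) \<le> u \<bullet> m (Z i \<omega>) \<zeta>" for i
          unfolding u(2) by (rule m_mono[OF gz]) (use sj in auto)
        show "0 \<le> \<kappa> / 2 * s j" using \<kappa>(1) s0[of j] by simp
        show "real n * (\<kappa> / 2 * s j) \<le> (\<Sum>i<n. u \<bullet> m (Z i \<omega>) (\<zeta>0 + s j *\<^sub>R u))"
          using lower n by (simp add: inner_avg field_simps)
      qed
      also have "\<dots> \<le> exp (- c * real n * (min t \<delta>)\<^sup>2)"
      proof -
        have "(min t \<delta>)\<^sup>2 \<le> (2 * s j)\<^sup>2" using sj(2) t \<delta> by (intro power_mono) auto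
        then have "c * real n * (min t \<delta>)\<^sup>2 \<le> c * real n * (2 * s j)\<^sup>2" using c by (intro mult_left_mono) auto
        also have "\<dots> = real n * (\<kappa> / 2 * s j)\<^sup>2 / (8 * B\<^sup>2)" by (simp add: c_def power2_eq_square)
        finally show ?thesis by simp
      qed
      finally show ?thesis by (simp add: t_def)
    qed
    show "\<exists>A\<in>events. prob A \<le> 2 * K / (C * sqrt (real n)) \<and> (\<forall>\<omega>\<in>space M - A. norm (avg n \<omega> \<zeta>0) \<le> C1 / sqrt (real n) \<longrightarrow>
        tail_bounded c \<delta> C n \<omega>)"
      by (rule bexI[OF _ ev], rule conjI[OF pA]) (intro ballI impI allI main)
  qed
qed

section \<open>The limiting quadratic form\<close>

lemma bounded_linear_D: "bounded_linear D"
  using mean_derivative by (rule has_derivative_bounded_linear)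

lemma norm_D_ge: "\<kappa> * norm h \<le> norm (D h)"
proof (cases "h = 0")
  case False
  have "\<kappa> * (norm h)\<^sup>2 \<le> norm h * norm (D h)" using \<kappa>(2)[of h] norm_cauchy_schwarz[of h "D h"] by linarith
  then have "norm h * (\<kappa> * norm h) \<le> norm h * norm (D h)" by (simp add: power2_eq_square mult.left_commute)
  then show ?thesis using False by simp
qed simp

text \<open>Provides the natural centre \<open>hs\<close> of the local expansion, a solution of
  \<open>D hs = - sqrt (real n) *\<^sub>R avg n \<omega> \<zeta>0\<close>; in finite dimension the
  injectivity given by coercivity is enough.\<close>

lemma surj_D: "\<exists>h. D h = x"
proof -
  have lin: "linear D" using bounded_linear_D by (rule bounded_linear.linear)
  have "h = 0" if "D h = 0" for h
  proof (rule ccontr)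
    assume "h \<noteq> 0"
    then have "0 < \<kappa> * norm h" using \<kappa>(1) by simp
    then show False using norm_D_ge[of h] that by simp
  qed
  then have "inj D" unfolding linear_injective_0[OF lin] by blast
  then show ?thesis using linear_injective_imp_surjective[OF lin] by (metis surjD)
qed

lemma norm_Vi_le: "norm (Vi x) \<le> norm x / \<kappa>V"
proof (cases "Vi x = 0")
  case False
  have "\<kappa>V * (norm (Vi x))\<^sup>2 \<le> norm (Vi x) * norm x"
    using \<kappa>V(2)[of "Vi x"] norm_cauchy_schwarz[of "Vi x" x] V(3)[of x] by simp
  then have "norm (Vi x) * (\<kappa>V * norm (Vi x)) \<le> norm (Vi x) * norm x" by (simp add: power2_eq_square mult.left_commute)
  then have "\<kappa>V * norm (Vi x) \<le> norm x" using False by simp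
  then show ?thesis using \<kappa>V(1) by (simp add: field_simps)
qed (use \<kappa>V in simp)

lemma inj_V: "V x = V y \<Longrightarrow> x = y"
proof -
  assume "V x = V y"
  then have "V (x - y) = 0" by (simp add: linear_diff[OF V(1)])
  then have "\<kappa>V * (norm (x - y))\<^sup>2 \<le> 0" using \<kappa>V(2)[of "x - y"] by simp
  then show "x = y" using \<kappa>V(1) by (simp add: mult_le_0_iff)
qed

text \<open>V is injective by coercivity, so identities for its right inverse may be checked after
  applying V.\<close>

lemma linear_Vi: "linear Vi"
proof (rule linearI)
  show "Vi (x + y) = Vi x + Vi y" for x y by (rule inj_V) (simp add: V(3) linear_add[OF V(1)])
  show "Vi (c *\<^sub>R x) = c *\<^sub>R Vi x" for c x by (rule inj_V) (simp add: V(3) linear_cmul[OF V(1)])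
qed

lemma Vi_sym: "x \<bullet> Vi y = Vi x \<bullet> y"
  using V(2)[of "Vi x" "Vi y"] by (simp add: V(3))

text \<open>With D = - V12 and \<open>Vi\<close> the inverse of V11 this is the quadratic form of J
  n / n.\<close>

definition qf :: "'a \<Rightarrow> real" where "qf h = D h \<bullet> Vi (D h)"

text \<open>All that the posterior analysis uses about a sample. The expansion is relative to the
  value at the maximiser and centred there, in coordinates magnified by sqrt n; the lower bound exp
  (-1) keeps division by that value harmless.\<close>

abbreviation localised :: "(nat \<Rightarrow> 'w \<Rightarrow> 'a) \<Rightarrow> real \<Rightarrow> real \<Rightarrow> real \<Rightarrow> real \<Rightarrow> real \<Rightarrow> nat \<Rightarrow> 'w \<Rightarrow> bool" where
  "localised zhat c \<delta> C0 C \<epsilon> n \<omega> \<equiv>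
    norm (zhat n \<omega> - \<zeta>0) \<le> C0 / sqrt (real n) \<and> exp (- 1) \<le> ratio n \<omega> (zhat n \<omega>) \<and>
    (\<forall>h. norm h \<le> C \<longrightarrow> 0 < rescaled n \<omega> h \<and>
      \<bar>ln (rescaled n \<omega> h) - ln (ratio n \<omega> (zhat n \<omega>)) + qf (h - sqrt (real n) *\<^sub>R (zhat n \<omega> - \<zeta>0)) / 2\<bar> \<le> \<epsilon>) \<and>
    tail_bounded c \<delta> C0 n \<omega>"

text \<open>The order of quantifiers matters: \<open>C0\<close> depends on the probability \<eta>
  alone, whereas the radius C and the accuracy \<epsilon> are chosen afterwards, C large compared
  with \<open>C0\<close>.\<close>

abbreviation mostly_localised :: "(nat \<Rightarrow> 'w \<Rightarrow> 'a) \<Rightarrow> real \<Rightarrow> real \<Rightarrow> real \<Rightarrow> real \<Rightarrow> bool" where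
  "mostly_localised zhat c \<delta> \<eta> C0 \<equiv> (\<forall>C \<epsilon>. 0 < C \<longrightarrow> 0 < \<epsilon> \<longrightarrow>
    (\<forall>\<^sub>F n in sequentially. \<exists>A\<in>events. prob A < \<eta> \<and> (\<forall>\<omega>\<in>space M - A. localised zhat c \<delta> C0 C \<epsilon> n \<omega>)))"

text \<open>By symmetry of \<open>Vi\<close> the difference of squares factors as (x - y) . Vi (x +
  y).\<close>

lemma Vi_form_diff: "\<bar>x \<bullet> Vi x - y \<bullet> Vi y\<bar> \<le> norm (x - y) * (norm x + norm y) / \<kappa>V"
proof -
  have "x \<bullet> Vi y = y \<bullet> Vi x" using Vi_sym[of x y] by (simp add: inner_commute)
  then have "x \<bullet> Vi x - y \<bullet> Vi y = (x - y) \<bullet> Vi (x + y)"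
    by (simp add: linear_add[OF linear_Vi] inner_add_right inner_diff_left)
  also have "\<bar>\<dots>\<bar> \<le> norm (x - y) * norm (Vi (x + y))" by (rule Cauchy_Schwarz_ineq2)
  also have "\<dots> \<le> norm (x - y) * ((norm x + norm y) / \<kappa>V)"
    using \<kappa>V(1)
    by (intro mult_left_mono order_trans[OF norm_Vi_le] divide_right_mono norm_triangle_ineq) auto
  finally show ?thesis by simp
qed

text \<open>For the lower bound the form is w . V w with w = Vi (D h), and the norm of w is at least
  \<kappa> / KV times that of h because V w = D h.\<close>

lemma qf_bounds: "\<exists>\<alpha>>0. \<exists>\<beta>>0. (\<forall>h. \<alpha> * (norm h)\<^sup>2 \<le> qf h) \<and> (\<forall>h k. \<bar>qf h - qf k\<bar> \<le> \<beta> * norm (h - k) * (norm h + norm k))"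
proof -
  obtain KD where KD: "KD > 0" "\<And>x. norm (D x) \<le> norm x * KD"
    using bounded_linear.pos_bounded[OF bounded_linear_D] by blast
  obtain KV where KV: "KV > 0" "\<And>x. norm (V x) \<le> KV * norm x" using linear_bounded_pos[OF V(1)] by blast
  define \<alpha> where "\<alpha> = \<kappa>V * (\<kappa> / KV)\<^sup>2"
  define \<beta> where "\<beta> = KD * KD / \<kappa>V"
  have "\<alpha> * (norm h)\<^sup>2 \<le> qf h" for h
  proof -
    have "\<kappa> * norm h \<le> KV * norm (Vi (D h))" using norm_D_ge[of h] KV(2)[of "Vi (D h)"] V(3)[of "D h"] by simp
    then have "\<kappa> / KV * norm h \<le> norm (Vi (D h))" using KV(1) by (simp add: field_simps)
    then have "(\<kappa> / KV * norm h)\<^sup>2 \<le> (norm (Vi (D h)))\<^sup>2" using \<kappa>(1) KV(1) by (intro power_mono) auto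
    then have "\<kappa>V * (\<kappa> / KV * norm h)\<^sup>2 \<le> \<kappa>V * (norm (Vi (D h)))\<^sup>2" using \<kappa>V(1) by (intro mult_left_mono) auto
    also have "\<dots> \<le> Vi (D h) \<bullet> V (Vi (D h))" by (rule \<kappa>V(2))
    also have "\<dots> = qf h" by (simp add: V(3) qf_def inner_commute)
    finally show ?thesis by (simp add: \<alpha>_def power_mult_distrib power_divide mult.assoc)
  qed
  moreover have "\<bar>qf h - qf k\<bar> \<le> \<beta> * norm (h - k) * (norm h + norm k)" for h k
  proof -
    have "\<bar>qf h - qf k\<bar> \<le> norm (D (h - k)) * (norm (D h) + norm (D k)) / \<kappa>V"
      using Vi_form_diff[of "D h" "D k"] by (simp add: qf_def linear_diff[OF bounded_linear.linear[OF bounded_linear_D]])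
    also have "\<dots> \<le> (norm (h - k) * KD) * (norm h * KD + norm k * KD) / \<kappa>V"
      using KD \<kappa>V(1) by (intro divide_right_mono mult_mono add_mono) auto
    also have "\<dots> = \<beta> * norm (h - k) * (norm h + norm k)" by (simp add: \<beta>_def algebra_simps)
    finally show ?thesis .
  qed
  moreover have "\<alpha> > 0" "\<beta> > 0" using \<kappa>(1) \<kappa>V(1) KD(1) KV(1) by (auto simp: \<alpha>_def \<beta>_def)
  ultimately show ?thesis by blast
qed

section \<open>Local expansion and position of the maximiser\<close>

lemma eventually_div_sqrt_le:
  assumes "0 < e"
  shows "\<forall>\<^sub>F n in sequentially. c / sqrt (real n) \<le> e"
proof -
  have "filterlim (\<lambda>n. sqrt (real n)) at_top sequentially"
    by (rule filterlim_compose[OF sqrt_at_top filterlim_real_sequentially])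
  then have "(\<lambda>n. c / sqrt (real n)) \<longlonglongrightarrow> 0"
    by (rule tendsto_divide_0[OF tendsto_const filterlim_at_top_imp_at_infinity])
  then have "\<forall>\<^sub>F n in sequentially. c / sqrt (real n) < e" using assms by (rule order_tendstoD)
  then show ?thesis by (rule eventually_mono) simp
qed

lemma ratio_local:
  assumes C: "0 < C" and C1: "0 < C1" and \<epsilon>: "0 < \<epsilon>"
  shows "\<exists>K>0. \<forall>\<^sub>F n in sequentially. \<exists>A\<in>events. prob A \<le> K / sqrt (real n) \<and>
     (\<forall>\<omega>\<in>space M - A. \<forall>hs. norm (avg n \<omega> \<zeta>0) \<le> C1 / sqrt (real n) \<longrightarrow> D hs = - sqrt (real n) *\<^sub>R avg n \<omega> \<zeta>0 \<longrightarrow>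
       (\<forall>h. norm h \<le> C \<longrightarrow> 0 < rescaled n \<omega> h \<and>
          \<bar>ln (rescaled n \<omega> h) + qf (h - hs) / 2\<bar> \<le> \<epsilon>))"
proof -
  have linD: "linear D" using bounded_linear_D by (rule bounded_linear.linear)
  obtain KD where KD: "KD > 0" "\<And>x. norm (D x) \<le> norm x * KD"
    using bounded_linear.pos_bounded[OF bounded_linear_D] by blast
  define Cb where "Cb = C1 + C * KD + 1"
  have Cb: "1 \<le> Cb" using C1 C KD(1) by (simp add: Cb_def)
  \<comment> \<open>Replacing sqrt n avg by D (h - hs) in the quadratic form costs at most
    \<open>\<epsilon>1 * (2 * Cb + 1) / \<kappa>V\<close>.\<close>
  define \<epsilon>1 where "\<epsilon>1 = min 1 (\<epsilon> * \<kappa>V / (2 * Cb + 1))"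
  have \<epsilon>1: "0 < \<epsilon>1" "\<epsilon>1 \<le> 1" "\<epsilon>1 * (2 * Cb + 1) / \<kappa>V \<le> \<epsilon>"
  proof -
    show "0 < \<epsilon>1" "\<epsilon>1 \<le> 1" using \<epsilon> \<kappa>V(1) Cb by (auto simp: \<epsilon>1_def)
    have "\<epsilon>1 \<le> \<epsilon> * \<kappa>V / (2 * Cb + 1)" by (simp add: \<epsilon>1_def)
    then show "\<epsilon>1 * (2 * Cb + 1) / \<kappa>V \<le> \<epsilon>" using \<kappa>V(1) Cb by (simp add: field_simps)
  qed
  define F where "F = Cb\<^sup>2 / \<kappa>V\<^sup>2 * 2"
  have F: "0 < F" using Cb \<kappa>V(1) by (simp add: F_def)
  \<comment> \<open>Half of the allowance \<kappa>V / 2 of \<open>elr_expansion\<close>, the other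
    half being left to Cb^2 / n, and an eighth of the error budget.\<close>
  define \<epsilon>2 where "\<epsilon>2 = min (\<kappa>V / 4) (\<epsilon> / (8 * F))"
  have \<epsilon>2: "0 < \<epsilon>2" "\<epsilon>2 \<le> \<kappa>V / 4" "\<epsilon>2 * F \<le> \<epsilon> / 8"
  proof -
    show "0 < \<epsilon>2" "\<epsilon>2 \<le> \<kappa>V / 4" using \<epsilon> \<kappa>V(1) F by (auto simp: \<epsilon>2_def)
    have "\<epsilon>2 \<le> \<epsilon> / (8 * F)" by (simp add: \<epsilon>2_def)
    then show "\<epsilon>2 * F \<le> \<epsilon> / 8" using F by (simp add: field_simps)
  qed
  obtain K1 \<delta>1 where K1: "K1 > 0" and \<delta>1: "\<delta>1 > 0" and
    inc: "\<forall>s n. 0 < s \<longrightarrow> s \<le> \<delta>1 \<longrightarrow> 0 < n \<longrightarrow> (\<exists>A\<in>events. prob A \<le> K1 / (real n * s) \<and> bad \<subseteq> A \<and>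
     (\<forall>\<omega>\<in>space M - A. \<forall>h. norm h \<le> 1 \<longrightarrow>
        norm (avg n \<omega> (\<zeta>0 + s *\<^sub>R h) - avg n \<omega> \<zeta>0 - s *\<^sub>R D h) \<le> \<epsilon>1 / C * s))"
    using increments[OF divide_pos_pos[OF \<epsilon>1(1) C]] by (elim exE conjE) (rule that)
  obtain K2 \<delta>2 where K2: "K2 > 0" and \<delta>2: "\<delta>2 > 0" and
    mom: "\<forall>s n. 0 < s \<longrightarrow> s \<le> \<delta>2 \<longrightarrow> 0 < n \<longrightarrow> (\<exists>A\<in>events. prob A \<le> K2 / real n \<and>
     (\<forall>\<omega>\<in>space M - A. \<forall>h u v. norm h \<le> 1 \<longrightarrow>
        \<bar>(\<Sum>i<n. (u \<bullet> m (Z i \<omega>) (\<zeta>0 + s *\<^sub>R h)) * (v \<bullet> m (Z i \<omega>) (\<zeta>0 + s *\<^sub>R h))) / real n - u \<bullet> V v\<bar>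
          \<le> \<epsilon>2 * norm u * norm v))"
    using moments_stable[OF \<epsilon>2(1)] by (elim exE conjE) (rule that)
  define K where "K = K1 / C + K2"
  have K: "K > 0" using K1 K2 C by (simp add: K_def add_pos_pos)
  \<comment> \<open>The cubic remainder n (4 B Cb / (\<kappa>V sqrt n))^3 equals E / sqrt n.\<close>
  define E where "E = (4 * B * Cb / \<kappa>V) ^ 3"
  show ?thesis
  proof (rule exI[of _ K], rule conjI[OF K])
    have "\<forall>\<^sub>F n in sequentially. 0 < n" by (rule eventually_gt_at_top)
    moreover have "\<forall>\<^sub>F n in sequentially. C / sqrt (real n) \<le> min \<delta>1 \<delta>2" by (rule eventually_div_sqrt_le) (use \<delta>1 \<delta>2 in simp)
    moreover have "\<forall>\<^sub>F n in sequentially. Cb\<^sup>2 / sqrt (real n) \<le> \<kappa>V / 4" by (rule eventually_div_sqrt_le) (use \<kappa>V in simp)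
    moreover have "\<forall>\<^sub>F n in sequentially. (4 * B * Cb / \<kappa>V) / sqrt (real n) \<le> 1 / 2" by (rule eventually_div_sqrt_le) simp
    moreover have "\<forall>\<^sub>F n in sequentially. (Cb\<^sup>2 * F) / sqrt (real n) \<le> \<epsilon> / 8" by (rule eventually_div_sqrt_le) (use \<epsilon> in simp)
    moreover have "\<forall>\<^sub>F n in sequentially. E / sqrt (real n) \<le> \<epsilon> / 4" by (rule eventually_div_sqrt_le) (use \<epsilon> in simp)
    ultimately show "\<forall>\<^sub>F n in sequentially. \<exists>A\<in>events. prob A \<le> K / sqrt (real n) \<and>
     (\<forall>\<omega>\<in>space M - A. \<forall>hs. norm (avg n \<omega> \<zeta>0) \<le> C1 / sqrt (real n) \<longrightarrow> D hs = - sqrt (real n) *\<^sub>R avg n \<omega> \<zeta>0 \<longrightarrow>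
       (\<forall>h. norm h \<le> C \<longrightarrow> 0 < rescaled n \<omega> h \<and>
          \<bar>ln (rescaled n \<omega> h) + qf (h - hs) / 2\<bar> \<le> \<epsilon>))"
    proof eventually_elim
      fix n :: nat
      assume n: "0 < n" and ns: "C / sqrt (real n) \<le> min \<delta>1 \<delta>2" and n1: "Cb\<^sup>2 / sqrt (real n) \<le> \<kappa>V / 4"
        and n2: "(4 * B * Cb / \<kappa>V) / sqrt (real n) \<le> 1 / 2" and n3: "(Cb\<^sup>2 * F) / sqrt (real n) \<le> \<epsilon> / 8"
        and n4: "E / sqrt (real n) \<le> \<epsilon> / 4"
      define r where "r = sqrt (real n)"
      have r: "1 \<le> r" "r * r = real n" "r\<^sup>2 = real n" using n by (auto simp: r_def)
      have r0: "0 < r" using r by simp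
      have rn: "r \<le> real n" using r mult_left_mono[of 1 r r] by simp
      define s where "s = C / r"
      have s: "0 < s" "s \<le> \<delta>1" "s \<le> \<delta>2" using C r0 ns by (auto simp: s_def r_def)
      obtain A1 where A1: "A1 \<in> events" "prob A1 \<le> K1 / (real n * s)" "bad \<subseteq> A1"
        "\<And>\<omega> h. \<omega> \<in> space M - A1 \<Longrightarrow> norm h \<le> 1 \<Longrightarrow>
        norm (avg n \<omega> (\<zeta>0 + s *\<^sub>R h) - avg n \<omega> \<zeta>0 - s *\<^sub>R D h) \<le> \<epsilon>1 / C * s"
        using inc[rule_format, OF s(1,2) n] by blast
      obtain A2 where A2: "A2 \<in> events" "prob A2 \<le> K2 / real n"
        "\<And>\<omega> h u v. \<omega> \<in> space M - A2 \<Longrightarrow> norm h \<le> 1 \<Longrightarrow>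
        \<bar>(\<Sum>i<n. (u \<bullet> m (Z i \<omega>) (\<zeta>0 + s *\<^sub>R h)) * (v \<bullet> m (Z i \<omega>) (\<zeta>0 + s *\<^sub>R h))) / real n - u \<bullet> V v\<bar>
          \<le> \<epsilon>2 * norm u * norm v"
        using mom[rule_format, OF s(1,3) n] by blast
      have "prob (A1 \<union> A2) \<le> K1 / (real n * s) + K2 / real n"
        using measure_Un_le[OF A1(1) A2(1)] A1(2) A2(2) by linarith
      also have "K1 / (real n * s) = K1 / C / r" using r0 C by (simp add: s_def r(2)[symmetric])
      also have "K2 / real n \<le> K2 / r" using K2 rn r0 by (intro divide_left_mono) auto
      finally have pA: "prob (A1 \<union> A2) \<le> K / sqrt (real n)" by (simp add: K_def add_divide_distrib r_def)
      have main: "0 < ratio n \<omega> (\<zeta>0 + (1 / r) *\<^sub>R h) \<and>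
          \<bar>ln (ratio n \<omega> (\<zeta>0 + (1 / r) *\<^sub>R h)) + qf (h - hs) / 2\<bar> \<le> \<epsilon>"
        if \<omega>: "\<omega> \<in> space M - (A1 \<union> A2)" and b: "norm (avg n \<omega> \<zeta>0) \<le> C1 / r" and hs: "D hs = - r *\<^sub>R avg n \<omega> \<zeta>0"
          and h: "norm h \<le> C" for \<omega> hs h
      proof -
        have gz: "Z i \<omega> \<in> G" for i using good[of \<omega> i] \<omega> A1(3) by auto
        define h' where "h' = (1 / C) *\<^sub>R h"
        have h': "norm h' \<le> 1" using h C by (simp add: h'_def field_simps)
        have sh: "s *\<^sub>R h' = (1 / r) *\<^sub>R h" using C by (simp add: s_def h'_def)
        define \<zeta> where "\<zeta> = \<zeta>0 + (1 / r) *\<^sub>R h"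
        define e where "e = r *\<^sub>R (avg n \<omega> \<zeta> - avg n \<omega> \<zeta>0 - s *\<^sub>R D h')"
        have e: "norm e \<le> \<epsilon>1"
        proof -
          have "norm (avg n \<omega> (\<zeta>0 + s *\<^sub>R h') - avg n \<omega> \<zeta>0 - s *\<^sub>R D h') \<le> \<epsilon>1 / C * s"
            by (rule A1(4)) (use \<omega> h' in auto)
          then have "norm (avg n \<omega> \<zeta> - avg n \<omega> \<zeta>0 - s *\<^sub>R D h') \<le> \<epsilon>1 / C * s" by (simp only: sh \<zeta>_def)
          also have "\<dots> = \<epsilon>1 / r" using C by (simp add: s_def)
          finally have "r * norm (avg n \<omega> \<zeta> - avg n \<omega> \<zeta>0 - s *\<^sub>R D h') \<le> r * (\<epsilon>1 / r)" using r0 by (intro mult_left_mono) auto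
          then show ?thesis using r0 by (simp only: e_def norm_scaleR abs_of_pos[OF r0]) simp
        qed
        have rs: "r *\<^sub>R s *\<^sub>R D h' = D h"
        proof -
          have "r * s = C" using r0 by (simp add: s_def)
          moreover have "C *\<^sub>R h' = h" using C by (simp add: h'_def)
          ultimately show ?thesis using linear_cmul[OF linD, of C h'] by (metis scaleR_scaleR)
        qed
        \<comment> \<open>The defining equation of \<open>hs\<close> absorbs the mean at \<zeta>0
          into the linear term.\<close>
        have x: "r *\<^sub>R avg n \<omega> \<zeta> = D (h - hs) + e"
          by (simp add: e_def scaleR_diff_right rs[unfolded scaleR_scaleR] linear_diff[OF linD] hs)
        have nD: "norm (D (h - hs)) \<le> C1 + C * KD"
        proof -
          have "norm (D hs) = r * norm (avg n \<omega> \<zeta>0)" using r0 by (simp add: hs)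
          also have "\<dots> \<le> r * (C1 / r)" using b r0 by (intro mult_left_mono) auto
          finally have 1: "norm (D hs) \<le> C1" using r0 by simp
          have "norm (D h) \<le> C * KD" using KD(2)[of h] mult_right_mono[OF h less_imp_le[OF KD(1)]] by linarith
          then show ?thesis using 1 norm_triangle_ineq4[of "D h" "D hs"] by (simp add: linear_diff[OF linD])
        qed
        have nx: "norm (r *\<^sub>R avg n \<omega> \<zeta>) \<le> Cb"
          unfolding x using norm_triangle_ineq[of "D (h - hs)" e] nD e \<epsilon>1(2) unfolding Cb_def by linarith
        then have nb: "norm (avg n \<omega> \<zeta>) \<le> Cb / sqrt (real n)" using r0 by (simp add: r_def field_simps)
        have small1: "\<epsilon>2 + Cb\<^sup>2 / real n \<le> \<kappa>V / 2"
        proof -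
          have "Cb\<^sup>2 / real n \<le> Cb\<^sup>2 / r" using rn r0 by (intro divide_left_mono) auto
          then show ?thesis using n1 \<epsilon>2(2) unfolding r_def by linarith
        qed
        have small2: "4 * B * Cb / (\<kappa>V * sqrt (real n)) \<le> 1 / 2" using n2 by simp
        have mm: "\<bar>(\<Sum>i<n. (u \<bullet> m (Z i \<omega>) \<zeta>) * (v \<bullet> m (Z i \<omega>) \<zeta>)) / real n - u \<bullet> V v\<bar> \<le> \<epsilon>2 * norm u * norm v" for u v
          using A2(3)[of \<omega> h' u v] \<omega> h' unfolding sh \<zeta>_def by blast
        note exp = elr_expansion[OF V(1,2) \<kappa>V V(3) n B(1) B(2)[OF gz] nb[unfolded avg_def] mm small1 small2]
        have pos: "0 < ratio n \<omega> \<zeta>" unfolding ratio_def by (rule exp(1))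
        have "\<bar>ln (ratio n \<omega> \<zeta>) + real n / 2 * (avg n \<omega> \<zeta> \<bullet> Vi (avg n \<omega> \<zeta>))\<bar>
            \<le> (\<epsilon>2 + Cb\<^sup>2 / real n) * Cb\<^sup>2 / \<kappa>V\<^sup>2 * 2 + real n * (4 * B * Cb / (\<kappa>V * sqrt (real n))) ^ 3"
          unfolding ratio_def avg_def by (rule exp(2))
        also have "(\<epsilon>2 + Cb\<^sup>2 / real n) * Cb\<^sup>2 / \<kappa>V\<^sup>2 * 2 = \<epsilon>2 * F + Cb\<^sup>2 * F / real n"
          by (simp add: F_def algebra_simps add_divide_distrib)
        also have "\<dots> \<le> \<epsilon> / 8 + \<epsilon> / 8"
        proof -
          have "Cb\<^sup>2 * F / real n \<le> Cb\<^sup>2 * F / r" using rn r0 F by (intro divide_left_mono) auto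
          then show ?thesis using n3 \<epsilon>2(3) unfolding r_def by linarith
        qed
        also have "real n * (4 * B * Cb / (\<kappa>V * sqrt (real n))) ^ 3 = E / r"
          using r0 unfolding r_def[symmetric] r(2)[symmetric] by (simp add: E_def power3_eq_cube)
        also have "E / r \<le> \<epsilon> / 4" using n4 by (simp add: r_def)
        finally have l1: "\<bar>ln (ratio n \<omega> \<zeta>) + real n / 2 * (avg n \<omega> \<zeta> \<bullet> Vi (avg n \<omega> \<zeta>))\<bar> \<le> \<epsilon> / 2" by simp
        have "real n * (avg n \<omega> \<zeta> \<bullet> Vi (avg n \<omega> \<zeta>)) = (r *\<^sub>R avg n \<omega> \<zeta>) \<bullet> Vi (r *\<^sub>R avg n \<omega> \<zeta>)"
          by (simp add: linear_cmul[OF linear_Vi] r(2)[symmetric])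
        moreover have "\<bar>(r *\<^sub>R avg n \<omega> \<zeta>) \<bullet> Vi (r *\<^sub>R avg n \<omega> \<zeta>) - qf (h - hs)\<bar> \<le> \<epsilon>"
        proof -
          have "\<bar>(r *\<^sub>R avg n \<omega> \<zeta>) \<bullet> Vi (r *\<^sub>R avg n \<omega> \<zeta>) - qf (h - hs)\<bar>
            \<le> norm (r *\<^sub>R avg n \<omega> \<zeta> - D (h - hs)) * (norm (r *\<^sub>R avg n \<omega> \<zeta>) + norm (D (h - hs))) / \<kappa>V"
            unfolding qf_def by (rule Vi_form_diff)
          also have "\<dots> \<le> \<epsilon>1 * (2 * Cb + 1) / \<kappa>V"
          proof (intro divide_right_mono mult_mono)
            show "norm (r *\<^sub>R avg n \<omega> \<zeta> - D (h - hs)) \<le> \<epsilon>1" using e by (simp add: x)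
            show "norm (r *\<^sub>R avg n \<omega> \<zeta>) + norm (D (h - hs)) \<le> 2 * Cb + 1" using nx nD Cb_def by linarith
          qed (use \<epsilon>1 \<kappa>V(1) in auto)
          finally show ?thesis using \<epsilon>1(3) by linarith
        qed
        ultimately have "\<bar>ln (ratio n \<omega> \<zeta>) + qf (h - hs) / 2\<bar> \<le> \<epsilon>" using l1 unfolding abs_le_iff by linarith
        then show ?thesis using pos by (simp add: \<zeta>_def)
      qed
      have ev: "A1 \<union> A2 \<in> events" using A1(1) A2(1) by auto
      show "\<exists>A\<in>events. prob A \<le> K / sqrt (real n) \<and>
     (\<forall>\<omega>\<in>space M - A. \<forall>hs. norm (avg n \<omega> \<zeta>0) \<le> C1 / sqrt (real n) \<longrightarrow> D hs = - sqrt (real n) *\<^sub>R avg n \<omega> \<zeta>0 \<longrightarrow>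
       (\<forall>h. norm h \<le> C \<longrightarrow> 0 < rescaled n \<omega> h \<and>
          \<bar>ln (rescaled n \<omega> h) + qf (h - hs) / 2\<bar> \<le> \<epsilon>))"
        by (rule bexI[OF _ ev], rule conjI[OF pA]) (intro ballI impI allI main[unfolded r_def])
    qed
  qed
qed

text \<open>The quadratic form vanishes at its centre, so \<zeta>0 + hs / sqrt n has log-ratio
  within \<epsilon>' of 0, and it lies in U for large n. The maximiser does at least as well. This
  is incompatible with the tail bound exp (-2), which places it within C0 / sqrt n of \<zeta>0;
  there the expansion forces \<open>qf (hh - hs) \<le> 4 * \<epsilon>'\<close>, so \<open>hs\<close>
  may be exchanged for the magnified maximiser \<open>hh\<close>.\<close>

lemma posterior_ingredients:
  fixes zhat :: "nat \<Rightarrow> 'w \<Rightarrow> 'a" and U :: "'a set"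
  assumes U: "\<zeta>0 \<in> interior U"
    and zhat: "\<forall>n. \<forall>\<omega>\<in>space M. \<forall>\<zeta>\<in>U. ratio n \<omega> \<zeta> \<le> ratio n \<omega> (zhat n \<omega>)"
  shows "\<exists>c>0. \<exists>\<delta>>0. \<forall>\<eta>>0. \<exists>C0>0. mostly_localised zhat c \<delta> \<eta> C0"
proof -
  obtain \<rho> where \<rho>: "\<rho> > 0" "ball \<zeta>0 \<rho> \<subseteq> U" using U by (meson mem_interior)
  obtain \<alpha> \<beta> where \<alpha>: "\<alpha> > 0" "\<And>h. \<alpha> * (norm h)\<^sup>2 \<le> qf h" and \<beta>: "\<beta> > 0" "\<And>h k. \<bar>qf h - qf k\<bar> \<le> \<beta> * norm (h - k) * (norm h + norm k)"
    using qf_bounds by blast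
  obtain c \<delta> a Kt where c: "c > 0" and \<delta>: "\<delta> > 0" and a: "a > 0" and Kt: "Kt > 0" and
    tail: "\<forall>n C C1. 0 < n \<longrightarrow> 0 < C1 \<longrightarrow> a * C1 \<le> C \<longrightarrow> C / sqrt (real n) \<le> \<delta> \<longrightarrow>
     (\<exists>A\<in>events. prob A \<le> Kt / (C * sqrt (real n)) \<and> (\<forall>\<omega>\<in>space M - A. norm (avg n \<omega> \<zeta>0) \<le> C1 / sqrt (real n) \<longrightarrow>
        tail_bounded c \<delta> C n \<omega>))"
    using ratio_tail by (elim exE conjE) (rule that)
  obtain Ka where Ka: "Ka > 0" and
    av: "\<forall>C>0. \<forall>n>0. \<exists>A\<in>events. prob A \<le> Ka / C\<^sup>2 \<and> (\<forall>\<omega>\<in>space M - A. norm (avg n \<omega> \<zeta>0) \<le> C / sqrt (real n))"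
    using avg_at_true by (elim exE conjE) (rule that)
  show ?thesis
  proof (rule exI[of _ c], rule conjI[OF c], rule exI[of _ \<delta>], rule conjI[OF \<delta>], intro allI impI)
    fix \<eta> :: real assume \<eta>: "\<eta> > 0"
    \<comment> \<open>Makes the Chebyshev bound Ka / C1^2 for the mean at \<zeta>0 equal to \<eta> /
      4.\<close>
    define C1 where "C1 = sqrt (4 * Ka / \<eta>)"
    have C1: "C1 > 0" "Ka / C1\<^sup>2 = \<eta> / 4" using Ka \<eta> by (auto simp: C1_def)
    \<comment> \<open>Three demands: the threshold of the tail bound, the bound C1 / \<kappa> on the
      norm of \<open>hs\<close>, and c C0^2 \<ge> 2, which yields exp (-2) beyond C0 / sqrt
      n.\<close>
    define C0 where "C0 = max (max (a * C1) (C1 / \<kappa>)) (sqrt (2 / c))"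
    have C0: "C0 > 0" "a * C1 \<le> C0" "C1 / \<kappa> \<le> C0"
      using a C1 by (auto simp: C0_def less_max_iff_disj)
    have cC0: "2 \<le> c * C0\<^sup>2"
    proof -
      have "(sqrt (2 / c))\<^sup>2 \<le> C0\<^sup>2" using c by (intro power_mono) (auto simp: C0_def)
      then show ?thesis using c by (simp add: field_simps)
    qed
    show "\<exists>C0>0. mostly_localised zhat c \<delta> \<eta> C0"
    proof (rule exI[of _ C0], rule conjI[OF C0(1)], intro allI impI)
      fix C \<epsilon> :: real assume C: "0 < C" and \<epsilon>: "0 < \<epsilon>"
      define C' where "C' = max C C0"
      have C': "0 < C'" "C \<le> C'" "C0 \<le> C'" using C by (auto simp: C'_def)
      \<comment> \<open>Moving the centre by e2 changes the form by at most \<beta> e2 (4 C') =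
        \<epsilon> / 2.\<close>
      define e2 where "e2 = \<epsilon> / (8 * \<beta> * C')"
      have e2: "0 < e2" using \<epsilon> \<beta>(1) C' by (simp add: e2_def)
      \<comment> \<open>The bound 1/2 contradicts exp (-2) and gives exp (-1); \<epsilon> / 4 fits
        the error budget; the last bound brings \<open>hh\<close> within e2 of
        \<open>hs\<close>.\<close>
      define \<epsilon>' where "\<epsilon>' = min (1/2) (min (\<epsilon> / 4) (\<alpha> * e2\<^sup>2 / 4))"
      have \<epsilon>': "0 < \<epsilon>'" "\<epsilon>' \<le> 1/2" "\<epsilon>' \<le> \<epsilon> / 4" "\<epsilon>' \<le> \<alpha> * e2\<^sup>2 / 4"
        using \<epsilon> \<alpha>(1) e2 by (auto simp: \<epsilon>'_def)
      obtain Kl where Kl: "Kl > 0" and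
        loc: "\<forall>\<^sub>F n in sequentially. \<exists>A\<in>events. prob A \<le> Kl / sqrt (real n) \<and>
     (\<forall>\<omega>\<in>space M - A. \<forall>hs. norm (avg n \<omega> \<zeta>0) \<le> C1 / sqrt (real n) \<longrightarrow> D hs = - sqrt (real n) *\<^sub>R avg n \<omega> \<zeta>0 \<longrightarrow>
       (\<forall>h. norm h \<le> C' \<longrightarrow> 0 < rescaled n \<omega> h \<and>
          \<bar>ln (rescaled n \<omega> h) + qf (h - hs) / 2\<bar> \<le> \<epsilon>'))"
        using ratio_local[OF C'(1) C1(1) \<epsilon>'(1)] by (elim exE conjE) (rule that)
      have "\<forall>\<^sub>F n in sequentially. 0 < n" by (rule eventually_gt_at_top)
      moreover note loc
      moreover have "\<forall>\<^sub>F n in sequentially. Kl / sqrt (real n) \<le> \<eta> / 4" by (rule eventually_div_sqrt_le) (use \<eta> in simp)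
      moreover have "\<forall>\<^sub>F n in sequentially. (Kt / C0) / sqrt (real n) \<le> \<eta> / 4" by (rule eventually_div_sqrt_le) (use \<eta> in simp)
      moreover have "\<forall>\<^sub>F n in sequentially. C0 / sqrt (real n) \<le> min \<delta> (\<rho> / 2)" by (rule eventually_div_sqrt_le) (use \<delta> \<rho> in simp)
      moreover have "\<forall>\<^sub>F n in sequentially. sqrt (2 / c) / sqrt (real n) \<le> \<delta>" by (rule eventually_div_sqrt_le) (use \<delta> in simp)
      ultimately show "\<forall>\<^sub>F n in sequentially. \<exists>A\<in>events. prob A < \<eta> \<and>
    (\<forall>\<omega>\<in>space M - A. localised zhat c \<delta> C0 C \<epsilon> n \<omega>)"
      proof eventually_elim
        fix n :: nat
        assume n: "0 < n"
          and loc: "\<exists>A\<in>events. prob A \<le> Kl / sqrt (real n) \<and>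
     (\<forall>\<omega>\<in>space M - A. \<forall>hs. norm (avg n \<omega> \<zeta>0) \<le> C1 / sqrt (real n) \<longrightarrow> D hs = - sqrt (real n) *\<^sub>R avg n \<omega> \<zeta>0 \<longrightarrow>
       (\<forall>h. norm h \<le> C' \<longrightarrow> 0 < rescaled n \<omega> h \<and>
          \<bar>ln (rescaled n \<omega> h) + qf (h - hs) / 2\<bar> \<le> \<epsilon>'))"
          and n1: "Kl / sqrt (real n) \<le> \<eta> / 4" and n2: "(Kt / C0) / sqrt (real n) \<le> \<eta> / 4"
          and n3: "C0 / sqrt (real n) \<le> min \<delta> (\<rho> / 2)" and n4: "sqrt (2 / c) / sqrt (real n) \<le> \<delta>"
        define r where "r = sqrt (real n)"
        have r0: "0 < r" and rr: "r\<^sup>2 = real n" using n by (auto simp: r_def)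
        obtain A1 where A1: "A1 \<in> events" "prob A1 \<le> Kl / r"
          "\<And>\<omega> hs h. \<omega> \<in> space M - A1 \<Longrightarrow> norm (avg n \<omega> \<zeta>0) \<le> C1 / r \<Longrightarrow> D hs = - r *\<^sub>R avg n \<omega> \<zeta>0 \<Longrightarrow> norm h \<le> C' \<Longrightarrow>
             0 < ratio n \<omega> (\<zeta>0 + (1 / r) *\<^sub>R h) \<and> \<bar>ln (ratio n \<omega> (\<zeta>0 + (1 / r) *\<^sub>R h)) + qf (h - hs) / 2\<bar> \<le> \<epsilon>'"
          using loc unfolding r_def[symmetric] by blast
        have n3': "C0 / sqrt (real n) \<le> \<delta>" using n3 by simp
        obtain A2 where A2: "A2 \<in> events" "prob A2 \<le> Kt / (C0 * r)"
          "\<And>\<omega> \<zeta>. \<omega> \<in> space M - A2 \<Longrightarrow> norm (avg n \<omega> \<zeta>0) \<le> C1 / r \<Longrightarrow> C0 / r \<le> norm (\<zeta> - \<zeta>0) \<Longrightarrow>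
             ratio n \<omega> \<zeta> \<le> exp (- c * real n * (min (norm (\<zeta> - \<zeta>0)) \<delta>)\<^sup>2)"
          using tail[rule_format, OF n C1(1) C0(2) n3'] unfolding r_def[symmetric] by blast
        obtain A3 where A3: "A3 \<in> events" "prob A3 \<le> Ka / C1\<^sup>2" "\<And>\<omega>. \<omega> \<in> space M - A3 \<Longrightarrow> norm (avg n \<omega> \<zeta>0) \<le> C1 / r"
          using av[rule_format, OF C1(1) n] unfolding r_def[symmetric] by blast
        define A where "A = A1 \<union> A2 \<union> A3"
        have ev: "A \<in> events" using A1(1) A2(1) A3(1) by (auto simp: A_def)
        have "prob A \<le> prob A1 + prob A2 + prob A3"
          using measure_Un_le[OF A1(1) A2(1)] measure_Un_le[OF sets.Un[OF A1(1) A2(1)] A3(1)] unfolding A_def by linarith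
        also have "\<dots> \<le> \<eta> / 4 + \<eta> / 4 + \<eta> / 4"
        proof (intro add_mono)
          show "prob A1 \<le> \<eta> / 4" using A1(2) n1 unfolding r_def by linarith
          show "prob A2 \<le> \<eta> / 4" using A2(2) n2 unfolding r_def divide_divide_eq_left by linarith
          show "prob A3 \<le> \<eta> / 4" using A3(2) C1(2) by linarith
        qed
        finally have pA: "prob A < \<eta>" using \<eta> by simp
        have main: "norm (zhat n \<omega> - \<zeta>0) \<le> C0 / r \<and> exp (- 1) \<le> ratio n \<omega> (zhat n \<omega>) \<and>
           (\<forall>h. norm h \<le> C \<longrightarrow> 0 < ratio n \<omega> (\<zeta>0 + (1 / r) *\<^sub>R h) \<and>
              \<bar>ln (ratio n \<omega> (\<zeta>0 + (1 / r) *\<^sub>R h)) - ln (ratio n \<omega> (zhat n \<omega>)) + qf (h - r *\<^sub>R (zhat n \<omega> - \<zeta>0)) / 2\<bar> \<le> \<epsilon>) \<and>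
           (\<forall>\<zeta>. C0 / r \<le> norm (\<zeta> - \<zeta>0) \<longrightarrow> ratio n \<omega> \<zeta> \<le> exp (- c * real n * (min (norm (\<zeta> - \<zeta>0)) \<delta>)\<^sup>2))"
          if \<omega>: "\<omega> \<in> space M - A" for \<omega>
        proof -
          have \<omega>': "\<omega> \<in> space M" "\<omega> \<in> space M - A1" "\<omega> \<in> space M - A2" "\<omega> \<in> space M - A3" using \<omega> by (auto simp: A_def)
          have b: "norm (avg n \<omega> \<zeta>0) \<le> C1 / r" by (rule A3(3)[OF \<omega>'(4)])
          obtain hs where hs: "D hs = - r *\<^sub>R avg n \<omega> \<zeta>0" using surj_D by blast
          note loc = A1(3)[OF \<omega>'(2) b hs]
          note tl = A2(3)[OF \<omega>'(3) b]
          have nhs: "norm hs \<le> C0"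
          proof -
            have "\<kappa> * norm hs \<le> r * norm (avg n \<omega> \<zeta>0)" using norm_D_ge[of hs] r0 by (simp add: hs)
            also have "\<dots> \<le> r * (C1 / r)" using b r0 by (intro mult_left_mono) auto
            finally have "norm hs \<le> C1 / \<kappa>" using r0 \<kappa>(1) by (simp add: field_simps)
            then show ?thesis using C0(3) by simp
          qed
          define zs where "zs = \<zeta>0 + (1 / r) *\<^sub>R hs"
          have "norm ((1 / r) *\<^sub>R hs) \<le> C0 / r" using nhs r0 by (simp add: field_simps)
          also have "\<dots> < \<rho>" using n3 \<rho>(1) unfolding r_def by linarith
          finally have "zs \<in> U" using \<rho>(2) by (auto simp: zs_def dist_norm subset_iff)
          then have ge: "ratio n \<omega> zs \<le> ratio n \<omega> (zhat n \<omega>)" by (rule zhat[rule_format, OF \<omega>'(1)])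
          have lzs: "0 < ratio n \<omega> zs" "\<bar>ln (ratio n \<omega> zs)\<bar> \<le> \<epsilon>'"
            using loc[of hs] nhs C'(3) by (auto simp: zs_def qf_def linear_0[OF bounded_linear.linear[OF bounded_linear_D]])
          have pos: "0 < ratio n \<omega> (zhat n \<omega>)" using ge lzs(1) by simp
          have lge: "- \<epsilon>' \<le> ln (ratio n \<omega> (zhat n \<omega>))"
          proof -
            have "ln (ratio n \<omega> zs) \<le> ln (ratio n \<omega> (zhat n \<omega>))" using ge lzs(1) pos by simp
            then show ?thesis using lzs(2) by linarith
          qed
          define hh where "hh = r *\<^sub>R (zhat n \<omega> - \<zeta>0)"
          have zh: "zhat n \<omega> = \<zeta>0 + (1 / r) *\<^sub>R hh" using r0 by (simp add: hh_def)
          have near: "norm (zhat n \<omega> - \<zeta>0) < C0 / r"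
          proof (rule ccontr)
            assume "\<not> norm (zhat n \<omega> - \<zeta>0) < C0 / r"
            then have far: "C0 / r \<le> norm (zhat n \<omega> - \<zeta>0)" by simp
            have "sqrt (2 / c) / r \<le> min (norm (zhat n \<omega> - \<zeta>0)) \<delta>"
            proof -
              have "sqrt (2 / c) / r \<le> C0 / r" using r0 by (intro divide_right_mono) (auto simp: C0_def)
              then show ?thesis using far n4 by (simp add: r_def)
            qed
            then have "(sqrt (2 / c) / r)\<^sup>2 \<le> (min (norm (zhat n \<omega> - \<zeta>0)) \<delta>)\<^sup>2" using c r0 by (intro power_mono) auto
            then have "c * real n * (sqrt (2 / c) / r)\<^sup>2 \<le> c * real n * (min (norm (zhat n \<omega> - \<zeta>0)) \<delta>)\<^sup>2" using c by (intro mult_left_mono) auto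
            moreover have "c * real n * (sqrt (2 / c) / r)\<^sup>2 = 2" using c n by (simp add: power_divide rr)
            ultimately have "ratio n \<omega> (zhat n \<omega>) \<le> exp (- 2)"
              using order_trans[OF tl[OF far]] by simp
            then have "ln (ratio n \<omega> (zhat n \<omega>)) \<le> - 2" using pos by (metis ln_exp ln_le_cancel_iff exp_gt_zero)
            then show False using lge \<epsilon>'(2) by simp
          qed
          have nhh: "norm hh \<le> C0"       proof -
            have "norm hh = r * norm (zhat n \<omega> - \<zeta>0)" using r0 by (simp add: hh_def)
            then show ?thesis using near r0 by (simp add: pos_less_divide_eq mult.commute)
          qed
          have lh: "\<bar>ln (ratio n \<omega> (zhat n \<omega>)) + qf (hh - hs) / 2\<bar> \<le> \<epsilon>'" using loc[of hh] nhh C'(3) by (simp add: zh[symmetric])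
          have q0: "0 \<le> qf h" for h using \<alpha>(2)[of h] \<alpha>(1) by (meson mult_nonneg_nonneg less_imp_le order_trans zero_le_power2)
          have dist: "norm (hh - hs) \<le> e2"
          proof -
            have "\<alpha> * (norm (hh - hs))\<^sup>2 \<le> 4 * \<epsilon>'" using \<alpha>(2)[of "hh - hs"] lh lge unfolding abs_le_iff by linarith
            also have "\<dots> \<le> \<alpha> * e2\<^sup>2" using \<epsilon>'(4) by simp
            finally have "(norm (hh - hs))\<^sup>2 \<le> e2\<^sup>2" using \<alpha>(1) by simp
            then show ?thesis using e2 by (meson abs_le_square_iff less_imp_le power2_le_imp_le)
          qed
          have e1: "exp (- 1) \<le> ratio n \<omega> (zhat n \<omega>)"
          proof -
            have "- 1 \<le> ln (ratio n \<omega> (zhat n \<omega>))" using lge \<epsilon>'(2) by linarith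
            then show ?thesis using pos by (simp add: ln_ge_iff)
          qed
          have loc2: "0 < ratio n \<omega> (\<zeta>0 + (1 / r) *\<^sub>R h) \<and>
              \<bar>ln (ratio n \<omega> (\<zeta>0 + (1 / r) *\<^sub>R h)) - ln (ratio n \<omega> (zhat n \<omega>)) + qf (h - hh) / 2\<bar> \<le> \<epsilon>"
            if h: "norm h \<le> C" for h
          proof -
            have l: "0 < ratio n \<omega> (\<zeta>0 + (1 / r) *\<^sub>R h)" "\<bar>ln (ratio n \<omega> (\<zeta>0 + (1 / r) *\<^sub>R h)) + qf (h - hs) / 2\<bar> \<le> \<epsilon>'"
              using loc[of h] h C'(2) by auto
            have "\<bar>qf (h - hh) - qf (h - hs)\<bar> \<le> \<beta> * norm ((h - hh) - (h - hs)) * (norm (h - hh) + norm (h - hs))" by (rule \<beta>(2))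
            also have "\<dots> \<le> \<beta> * e2 * (4 * C')"
            proof (intro mult_mono)
              show "norm ((h - hh) - (h - hs)) \<le> e2" using dist by (simp add: norm_minus_commute)
              show "norm (h - hh) + norm (h - hs) \<le> 4 * C'"
                using norm_triangle_ineq4[of h hh] norm_triangle_ineq4[of h hs] h nhh nhs C' by linarith
            qed (use \<beta>(1) e2 in auto)
            also have "\<dots> = \<epsilon> / 2" using \<beta>(1) C'(1) by (simp add: e2_def)
            finally have "\<bar>qf (h - hh) - qf (h - hs)\<bar> \<le> \<epsilon> / 2" .
            moreover have "ln (ratio n \<omega> (zhat n \<omega>)) \<le> \<epsilon>'" using lh q0[of "hh - hs"] unfolding abs_le_iff by linarith
            ultimately show ?thesis using l lge \<epsilon>'(3) unfolding abs_le_iff by linarith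
          qed
          show ?thesis using near e1 loc2 tl unfolding hh_def by (intro conjI allI impI) auto
        qed
        show "\<exists>A\<in>events. prob A < \<eta> \<and>
    (\<forall>\<omega>\<in>space M - A. localised zhat c \<delta> C0 C \<epsilon> n \<omega>)"
          by (rule bexI[OF _ ev], rule conjI[OF pA]) (intro ballI main[unfolded r_def])
      qed
    qed
  qed
qed

end

section \<open>Gaussian integrals and the Laplace approximation\<close>

lemma nn_integral_lborel_translate:
  fixes f :: "'a::euclidean_space \<Rightarrow> ennreal"
  assumes [measurable]: "f \<in> borel_measurable borel"
  shows "(\<integral>\<^sup>+x. f (a + x) \<partial>lborel) = (\<integral>\<^sup>+x. f x \<partial>lborel)"
proof -
  have "(\<integral>\<^sup>+x. f x \<partial>lborel) = (\<integral>\<^sup>+x. f x \<partial>(distr lborel borel ((+) a)))" by (simp add: lborel_distr_plus)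
  also have "\<dots> = (\<integral>\<^sup>+x. f (a + x) \<partial>lborel)" by (rule nn_integral_distr) auto
  finally show ?thesis by simp
qed

text \<open>Both sides equal the double integral of \<open>G (S h + y) * E y\<close>, by translation invariance; this replaces
  the determinant in a linear change of variables.\<close>
lemma linear_substitution_ratio:
  fixes S :: "'a::euclidean_space \<Rightarrow> 'a" and G E :: "'a \<Rightarrow> ennreal"
  assumes S: "linear S" "\<And>y. S (T y) = y"
    and [measurable]: "G \<in> borel_measurable borel" "E \<in> borel_measurable borel" and even: "\<And>y. E (- y) = E y"
  shows "(\<integral>\<^sup>+h. G (S h) \<partial>lborel) * (\<integral>\<^sup>+y. E y \<partial>lborel) = (\<integral>\<^sup>+y. G y \<partial>lborel) * (\<integral>\<^sup>+h. E (S h) \<partial>lborel)"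
proof -
  have [measurable]: "S \<in> borel_measurable borel"
    using linear_continuous_on[of S UNIV] S(1) by (auto intro!: borel_measurable_continuous_onI linear_conv_bounded_linear[THEN iffD1])
  have shift: "(\<integral>\<^sup>+h. F (S h + y) \<partial>lborel) = (\<integral>\<^sup>+h. F (S h) \<partial>lborel)" if [measurable]: "F \<in> borel_measurable borel" for F :: "'a \<Rightarrow> ennreal" and y
  proof -
    have "(\<integral>\<^sup>+h. F (S h + y) \<partial>lborel) = (\<integral>\<^sup>+h. F (S (T y + h)) \<partial>lborel)"
      by (simp add: linear_add[OF S(1)] S(2) add.commute)
    also have "\<dots> = (\<integral>\<^sup>+h. F (S h) \<partial>lborel)" by (rule nn_integral_lborel_translate[of "\<lambda>h. F (S h)"]) measurable
    finally show ?thesis .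
  qed
  have "(\<integral>\<^sup>+h. G (S h) \<partial>lborel) * (\<integral>\<^sup>+y. E y \<partial>lborel) = (\<integral>\<^sup>+y. (\<integral>\<^sup>+h. G (S h + y) * E y \<partial>lborel) \<partial>lborel)"
    by (simp add: nn_integral_multc shift nn_integral_cmult)
  also have "\<dots> = (\<integral>\<^sup>+h. (\<integral>\<^sup>+y. G (S h + y) * E y \<partial>lborel) \<partial>lborel)"
    by (rule lborel_pair.Fubini') measurable
  also have "\<dots> = (\<integral>\<^sup>+h. (\<integral>\<^sup>+z. G z * E (S h + - z) \<partial>lborel) \<partial>lborel)"
  proof (rule nn_integral_cong)
    fix h
    have "(\<integral>\<^sup>+y. G (S h + y) * E y \<partial>lborel) = (\<integral>\<^sup>+y. (\<lambda>z. G z * E (S h + - z)) (S h + y) \<partial>lborel)"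
      using even by simp
    also have "\<dots> = (\<integral>\<^sup>+z. G z * E (S h + - z) \<partial>lborel)" by (rule nn_integral_lborel_translate) measurable
    finally show "(\<integral>\<^sup>+y. G (S h + y) * E y \<partial>lborel) = (\<integral>\<^sup>+z. G z * E (S h + - z) \<partial>lborel)" .
  qed
  also have "\<dots> = (\<integral>\<^sup>+z. (\<integral>\<^sup>+h. G z * E (S h + - z) \<partial>lborel) \<partial>lborel)"
    by (rule lborel_pair.Fubini') measurable
  also have "\<dots> = (\<integral>\<^sup>+y. G y \<partial>lborel) * (\<integral>\<^sup>+h. E (S h) \<partial>lborel)"
  proof -
    have "(\<integral>\<^sup>+h. G z * E (S h + - z) \<partial>lborel) = G z * (\<integral>\<^sup>+h. E (S h) \<partial>lborel)" for z
      using shift[of E "- z"] by (simp add: nn_integral_cmult)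
    then show ?thesis by (simp add: nn_integral_multc)
  qed
  finally show ?thesis .
qed

lemma nn_integral_gauss:
  assumes c: "0 < c"
  shows "(\<integral>\<^sup>+h. ennreal (exp (- c * (norm (h::'a::euclidean_space))\<^sup>2)) \<partial>lborel) = ennreal (sqrt (pi / c) ^ DIM('a))"
proof -
  define \<sigma> where "\<sigma> = 1 / sqrt (2 * c)"
  have \<sigma>: "0 < \<sigma>" "\<sigma>\<^sup>2 = 1 / (2 * c)" using c by (auto simp: \<sigma>_def power_divide)
  have one: "(\<integral>\<^sup>+x. ennreal (exp (- c * x\<^sup>2)) \<partial>lborel) = ennreal (sqrt (pi / c))"
  proof -
    have e: "exp (- c * x\<^sup>2) = sqrt (pi / c) * normal_density 0 \<sigma> x" for x
      using c by (simp add: normal_density_def \<sigma>(2) real_sqrt_divide)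
    have "(\<integral>\<^sup>+x. ennreal (exp (- c * x\<^sup>2)) \<partial>lborel) = (\<integral>\<^sup>+x. ennreal (sqrt (pi / c)) * ennreal (normal_density 0 \<sigma> x) \<partial>lborel)"
      unfolding e using c by (intro nn_integral_cong) (simp add: ennreal_mult')
    also have "\<dots> = ennreal (sqrt (pi / c)) * (\<integral>\<^sup>+x. ennreal (normal_density 0 \<sigma> x) \<partial>lborel)"
      by (rule nn_integral_cmult) simp
    also have "(\<integral>\<^sup>+x. ennreal (normal_density 0 \<sigma> x) \<partial>lborel) = 1"
      using \<sigma>(1) by (subst nn_integral_eq_integral) auto
    finally show ?thesis by simp
  qed
  have n2: "(norm h)\<^sup>2 = (\<Sum>b\<in>Basis. (h \<bullet> b)\<^sup>2)" for h :: 'a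
    unfolding power2_norm_eq_inner by (subst euclidean_inner) (simp add: power2_eq_square)
  have "ennreal (exp (- c * (norm h)\<^sup>2)) = (\<Prod>b\<in>Basis. ennreal (exp (- c * (h \<bullet> b)\<^sup>2)))" for h :: 'a
    unfolding n2 by (simp add: sum_distrib_left exp_sum prod_ennreal flip: sum_negf)
  then have "(\<integral>\<^sup>+h. ennreal (exp (- c * (norm (h::'a))\<^sup>2)) \<partial>lborel)
      = (\<integral>\<^sup>+h. (\<Prod>b\<in>(Basis::'a set). ennreal (exp (- c * (h \<bullet> b)\<^sup>2))) \<partial>lborel)" by simp
  also have "\<dots> = (\<Prod>b\<in>(Basis::'a set). (\<integral>\<^sup>+x. ennreal (exp (- c * x\<^sup>2)) \<partial>lborel))"
    by (rule nn_integral_lborel_prod) auto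
  also have "\<dots> = ennreal (sqrt (pi / c) ^ DIM('a))"
    unfolding one using c by (simp add: prod_ennreal ennreal_power)
  finally show ?thesis .
qed

lemma integrable_gauss:
  assumes c: "0 < c"
  shows "integrable lborel (\<lambda>h::'a::euclidean_space. exp (- c * (norm h)\<^sup>2))"
  by (rule integrableI_nonneg) (auto simp: nn_integral_gauss[OF c, unfolded mult_minus_left])

lemma integral_gauss:
  assumes c: "0 < c"
  shows "(\<integral>h. exp (- c * (norm (h::'a::euclidean_space))\<^sup>2) \<partial>lborel) = sqrt (pi / c) ^ DIM('a)"
  by (subst integral_eq_nn_integral) (use c in \<open>auto simp: nn_integral_gauss[OF c, unfolded mult_minus_left]\<close>)

lemma gauss_tail:
  assumes c: "0 < c" and e: "0 < e"
  shows "\<exists>C0>0. \<forall>C\<ge>C0. (\<integral>h. indicator {h. C < norm h} h * exp (- c * (norm (h::'a::euclidean_space))\<^sup>2) \<partial>lborel) \<le> e"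
proof -
  define f where "f = (\<lambda>C h::'a. indicator {h. C < norm h} h * exp (- c * (norm h)\<^sup>2) :: real)"
  have int: "integrable lborel (f C)" for C
    unfolding f_def by (rule Bochner_Integration.integrable_bound[OF integrable_gauss[OF c]]) (auto simp: indicator_def)
  have "(\<lambda>n. \<integral>h. f (real n) h \<partial>lborel) \<longlonglongrightarrow> (\<integral>h. 0 \<partial>(lborel::'a measure))"
  proof (rule integral_dominated_convergence[where w = "\<lambda>h. exp (- c * (norm h)\<^sup>2)"])
    show "AE h in lborel. (\<lambda>n. f (real n) h) \<longlonglongrightarrow> 0"
    proof (rule AE_I2)
      fix h :: 'a
      have "\<forall>\<^sub>F n in sequentially. norm h \<le> real n"
        using filterlim_real_sequentially by (simp add: filterlim_at_top)
      then have "\<forall>\<^sub>F n in sequentially. f (real n) h = 0" by (rule eventually_mono) (simp add: f_def)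
      then show "(\<lambda>n. f (real n) h) \<longlonglongrightarrow> 0" by (rule tendsto_eventually)
    qed
  qed (auto simp: f_def indicator_def integrable_gauss[OF c, unfolded mult_minus_left])
  then have "\<forall>\<^sub>F n in sequentially. (\<integral>h. f (real n) h \<partial>lborel) < e" using e by (simp add: order_tendsto_iff)
  then obtain n where n: "(\<integral>h. f (real n) h \<partial>lborel) < e" by (meson eventually_sequentially order_refl)
  have "(\<integral>h. f C h \<partial>lborel) \<le> e" if "real n + 1 \<le> C" for C
  proof -
    have "(\<integral>h. f C h \<partial>lborel) \<le> (\<integral>h. f (real n) h \<partial>lborel)"
      using that by (intro integral_mono int) (auto simp: f_def indicator_def)
    then show ?thesis using n by simp
  qed
  then show ?thesis unfolding f_def by (intro exI[of _ "real n + 1"]) auto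
qed

lemma
  fixes f :: "'a::euclidean_space \<Rightarrow> real"
  assumes f: "f \<in> borel_measurable borel" and r: "0 < r"
  shows integral_lborel_rescale: "(\<integral>x. f x \<partial>lborel) = (\<integral>h. f (a + (1 / r) *\<^sub>R h) \<partial>lborel) / r ^ DIM('a)"
    and integrable_lborel_rescale: "integrable lborel (\<lambda>h. f (a + (1 / r) *\<^sub>R h)) \<longleftrightarrow> integrable lborel f"
proof -
  note [measurable] = f
  have eq: "(lborel::'a measure) = density (distr lborel borel (\<lambda>x::'a. a + (1 / r) *\<^sub>R x)) (\<lambda>_. ennreal (\<bar>1 / r\<bar> ^ DIM('a)))"
    using lborel_affine[of "1 / r" a] r by simp
  have "(\<integral>x. f x \<partial>lborel) = (\<integral>x. \<bar>1 / r\<bar> ^ DIM('a) *\<^sub>R f x \<partial>distr lborel borel (\<lambda>x::'a. a + (1 / r) *\<^sub>R x))"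
    by (subst eq, subst integral_density) auto
  also have "\<dots> = \<bar>1 / r\<bar> ^ DIM('a) * (\<integral>h. f (a + (1 / r) *\<^sub>R h) \<partial>lborel)"
    by (subst integral_distr) auto
  finally show "(\<integral>x. f x \<partial>lborel) = (\<integral>h. f (a + (1 / r) *\<^sub>R h) \<partial>lborel) / r ^ DIM('a)"
    using r by (simp add: power_divide)
  have "integrable lborel f \<longleftrightarrow> integrable (distr lborel borel (\<lambda>x::'a. a + (1 / r) *\<^sub>R x)) (\<lambda>x. \<bar>1 / r\<bar> ^ DIM('a) *\<^sub>R f x)"
    by (subst eq, subst integrable_density) auto
  also have "\<dots> \<longleftrightarrow> integrable lborel (\<lambda>h. f (a + (1 / r) *\<^sub>R h))"
    using r by (subst integrable_distr_eq) auto
  finally show "integrable lborel (\<lambda>h. f (a + (1 / r) *\<^sub>R h)) \<longleftrightarrow> integrable lborel f" by simp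
qed

text \<open>Adding the bound b makes g nonnegative, so that the identity for nonnegative integrals
  applies; the terms containing b agree on both sides and cancel.\<close>

lemma linear_substitution_ratio_real:
  fixes S :: "'a::euclidean_space \<Rightarrow> 'a" and g E :: "'a \<Rightarrow> real"
  assumes S: "linear S" "\<And>y. S (T y) = y"
    and g: "g \<in> borel_measurable borel" "\<And>y. \<bar>g y\<bar> \<le> b"
    and E: "E \<in> borel_measurable borel" "\<And>y. 0 \<le> E y" "\<And>y. E (- y) = E y"
    and int: "integrable lborel E" "integrable lborel (\<lambda>h. E (S h))"
  shows "(\<integral>h. g (S h) * E (S h) \<partial>lborel) * (\<integral>y. E y \<partial>lborel) = (\<integral>y. g y * E y \<partial>lborel) * (\<integral>h. E (S h) \<partial>lborel)"
proof -
  have [measurable]: "S \<in> borel_measurable borel"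
    using linear_continuous_on[of S UNIV] S(1) by (auto intro!: borel_measurable_continuous_onI linear_conv_bounded_linear[THEN iffD1])
  note [measurable] = g(1) E(1)
  have b: "0 \<le> b" using g(2)[of 0] by simp
  have i1: "integrable lborel (\<lambda>y. g y * E y)"
    by (rule Bochner_Integration.integrable_bound[of _ "\<lambda>y. b * E y"])
      (use int(1) g(2) E(2) b in \<open>auto simp: abs_mult intro!: mult_right_mono\<close>)
  have i2: "integrable lborel (\<lambda>h. g (S h) * E (S h))"
    by (rule Bochner_Integration.integrable_bound[of _ "\<lambda>h. b * E (S h)"])
      (use int(2) g(2) E(2) b in \<open>auto simp: abs_mult intro!: mult_right_mono\<close>)
  have nn: "0 \<le> (g y + b) * E y" for y using g(2)[of y] E(2)[of y] by (intro mult_nonneg_nonneg) (auto simp: abs_le_iff)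
  have j1: "integrable lborel (\<lambda>y. (g y + b) * E y)" using i1 int(1) by (simp add: distrib_right)
  have j2: "integrable lborel (\<lambda>h. (g (S h) + b) * E (S h))" using i2 int(2) by (simp add: distrib_right)
  have "(\<integral>\<^sup>+h. ennreal ((g (S h) + b) * E (S h)) \<partial>lborel) * (\<integral>\<^sup>+y. ennreal (E y) \<partial>lborel)
      = (\<integral>\<^sup>+y. ennreal ((g y + b) * E y) \<partial>lborel) * (\<integral>\<^sup>+h. ennreal (E (S h)) \<partial>lborel)"
    by (rule linear_substitution_ratio[OF S]) (use E(3) in \<open>simp_all\<close>)
  moreover have "(\<integral>\<^sup>+h. ennreal ((g (S h) + b) * E (S h)) \<partial>lborel) = ennreal (\<integral>h. (g (S h) + b) * E (S h) \<partial>lborel)"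
    by (rule nn_integral_eq_integral[OF j2 AE_I2[OF nn]])
  moreover have "(\<integral>\<^sup>+y. ennreal ((g y + b) * E y) \<partial>lborel) = ennreal (\<integral>y. (g y + b) * E y \<partial>lborel)"
    by (rule nn_integral_eq_integral[OF j1 AE_I2[OF nn]])
  moreover have "(\<integral>\<^sup>+y. ennreal (E y) \<partial>lborel) = ennreal (\<integral>y. E y \<partial>lborel)"
    by (rule nn_integral_eq_integral[OF int(1) AE_I2[OF E(2)]])
  moreover have "(\<integral>\<^sup>+h. ennreal (E (S h)) \<partial>lborel) = ennreal (\<integral>h. E (S h) \<partial>lborel)"
    by (rule nn_integral_eq_integral[OF int(2) AE_I2[OF E(2)]])
  ultimately have "ennreal ((\<integral>h. (g (S h) + b) * E (S h) \<partial>lborel) * (\<integral>y. E y \<partial>lborel))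
      = ennreal ((\<integral>y. (g y + b) * E y \<partial>lborel) * (\<integral>h. E (S h) \<partial>lborel))"
    using nn E(2) by (simp only: ennreal_mult Bochner_Integration.integral_nonneg)
  then have "(\<integral>h. (g (S h) + b) * E (S h) \<partial>lborel) * (\<integral>y. E y \<partial>lborel)
      = (\<integral>y. (g y + b) * E y \<partial>lborel) * (\<integral>h. E (S h) \<partial>lborel)"
    using nn E(2) by (simp add: Bochner_Integration.integral_nonneg mult_nonneg_nonneg)
  then show ?thesis using i1 i2 int by (simp add: distrib_right algebra_simps)
qed

text \<open>The quotient of unnormalised Gaussian integrals is the form on which the substitution
  lemma acts.\<close>

lemma integral_std_normal_vec:
  fixes g :: "real ^ 'n \<Rightarrow> real"
  assumes [measurable]: "g \<in> borel_measurable borel"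
  shows "(\<integral>z. g z \<partial>std_normal_vec) = (\<integral>z. g z * exp (- (1/2) * (norm z)\<^sup>2) \<partial>lborel) / (\<integral>z. exp (- (1/2) * (norm (z :: real ^ 'n))\<^sup>2) \<partial>lborel)"
proof -
  define I where "I = sqrt (2 * pi) ^ CARD('n)"
  have I: "0 < I" "(\<integral>z. exp (- (1/2) * (norm (z :: real ^ 'n))\<^sup>2) \<partial>lborel) = I"
    using integral_gauss[of "1/2", where 'a = "real ^ 'n"] by (simp_all add: I_def mult.commute)
  have d: "(\<Prod>i\<in>UNIV. std_normal_density (z $ i)) = exp (- (1/2) * (norm z)\<^sup>2) / I" for z :: "real ^ 'n"
  proof -
    have "(norm z)\<^sup>2 = (\<Sum>i\<in>UNIV. (z $ i)\<^sup>2)"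
      unfolding power2_norm_eq_inner inner_vec_def by (simp add: power2_eq_square)
    then have "exp (- (1/2) * (norm z)\<^sup>2) = (\<Prod>i\<in>UNIV. exp (- (z $ i)\<^sup>2 / 2))"
      by (simp add: sum_distrib_left flip: exp_sum sum_negf)
    then show ?thesis by (simp add: std_normal_density_def prod.distrib I_def power_one_over prod_dividef)
  qed
  have "(\<integral>z. g z \<partial>std_normal_vec) = (\<integral>z. (exp (- (1/2) * (norm z)\<^sup>2) / I) * g z \<partial>lborel)"
    unfolding std_normal_vec_def d using I(1) by (subst integral_real_density) auto
  also have "\<dots> = (\<integral>z. (g z * exp (- (1/2) * (norm z)\<^sup>2)) / I \<partial>lborel)" by (simp add: mult.commute)
  finally show ?thesis unfolding I(2) by simp
qed

section \<open>Comparison of normalised weights\<close>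

lemma abs_exp_minus_one_le:
  fixes x :: real
  assumes "\<bar>x\<bar> \<le> 1/2"
  shows "\<bar>exp x - 1\<bar> \<le> 2 * \<bar>x\<bar>"
proof -
  have "exp x \<le> 1 + 2 * \<bar>x\<bar>" using exp_bound_lemma[of x] assms by simp
  moreover have "1 + x \<le> exp x" by (rule exp_ge_add_one_self)
  ultimately show ?thesis by linarith
qed

text \<open>The difference of the quotients splits into (GW - GI) / I and (GW / W) (I - W) / I, each
  at most b / I times the L1 distance of the two weights.\<close>

lemma ratio_of_integrals:
  fixes G w \<phi> :: "'a \<Rightarrow> real"
  assumes [measurable]: "G \<in> borel_measurable N" and G: "\<And>x. \<bar>G x\<bar> \<le> b"
    and w: "integrable N w" "\<And>x. 0 \<le> w x" and \<phi>: "integrable N \<phi>" "\<And>x. 0 \<le> \<phi> x" "0 < (\<integral>x. \<phi> x \<partial>N)"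
  shows "\<bar>(\<integral>x. G x * w x \<partial>N) / (\<integral>x. w x \<partial>N) - (\<integral>x. G x * \<phi> x \<partial>N) / (\<integral>x. \<phi> x \<partial>N)\<bar>
      \<le> 2 * b * (\<integral>x. \<bar>w x - \<phi> x\<bar> \<partial>N) / (\<integral>x. \<phi> x \<partial>N)"
proof -
  note [measurable] = borel_measurable_integrable[OF w(1)] borel_measurable_integrable[OF \<phi>(1)]
  have b: "0 \<le> b" using G[of undefined] by simp
  have iG: "integrable N (\<lambda>x. G x * f x)" if f: "integrable N f" for f
  proof (rule Bochner_Integration.integrable_bound[of _ "\<lambda>x. b * \<bar>f x\<bar>"])
    show "integrable N (\<lambda>x. b * \<bar>f x\<bar>)" using f by simp
    show "(\<lambda>x. G x * f x) \<in> borel_measurable N" using borel_measurable_integrable[OF f] by simp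
    show "AE x in N. norm (G x * f x) \<le> norm (b * \<bar>f x\<bar>)"
      using G b by (auto simp: abs_mult intro!: mult_right_mono)
  qed
  have bG: "\<bar>\<integral>x. G x * f x \<partial>N\<bar> \<le> b * (\<integral>x. \<bar>f x\<bar> \<partial>N)" if f: "integrable N f" for f
  proof -
    have "\<bar>\<integral>x. G x * f x \<partial>N\<bar> \<le> (\<integral>x. \<bar>G x * f x\<bar> \<partial>N)" by (rule integral_abs_bound)
    also have "\<dots> \<le> (\<integral>x. b * \<bar>f x\<bar> \<partial>N)"
    proof (rule integral_mono)
      show "integrable N (\<lambda>x. \<bar>G x * f x\<bar>)" using iG[OF f] by (rule integrable_abs)
      show "integrable N (\<lambda>x. b * \<bar>f x\<bar>)" using f by simp
      show "\<bar>G x * f x\<bar> \<le> b * \<bar>f x\<bar>" for x using G by (simp add: abs_mult mult_right_mono)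
    qed
    finally show ?thesis by simp
  qed
  define d where "d = (\<integral>x. \<bar>w x - \<phi> x\<bar> \<partial>N)"
  define W where "W = (\<integral>x. w x \<partial>N)"
  define I where "I = (\<integral>x. \<phi> x \<partial>N)"
  define GW where "GW = (\<integral>x. G x * w x \<partial>N)"
  define GI where "GI = (\<integral>x. G x * \<phi> x \<partial>N)"
  have I: "0 < I" using \<phi>(3) by (simp add: I_def)
  have wd: "integrable N (\<lambda>x. w x - \<phi> x)" using w(1) \<phi>(1) by simp
  have 1: "\<bar>GW - GI\<bar> \<le> b * d"
    using bG[OF wd] iG[OF w(1)] iG[OF \<phi>(1)] by (simp add: GW_def GI_def d_def right_diff_distrib)
  have 2: "\<bar>W - I\<bar> \<le> d"
    using integral_abs_bound[of N "\<lambda>x. w x - \<phi> x"] w(1) \<phi>(1) by (simp add: W_def I_def d_def)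
  have W0: "0 \<le> W" using w(2) by (simp add: W_def Bochner_Integration.integral_nonneg)
  have 3: "\<bar>GW\<bar> \<le> b * W" using bG[OF w(1)] w(2) by (simp add: GW_def W_def)
  have "\<bar>GW / W - GI / I\<bar> \<le> 2 * b * d / I"
  proof (cases "W = 0")
    \<comment> \<open>A quotient with denominator 0 is 0; the L1 distance is then at least I, which
      makes the bound hold trivially.\<close>
    case True
    have "\<bar>GI\<bar> \<le> b * I" using bG[OF \<phi>(1)] \<phi>(2) by (simp add: GI_def I_def)
    also have "\<dots> \<le> b * d" using 2 True I b by (intro mult_left_mono) auto
    finally have "\<bar>GI\<bar> \<le> 2 * b * d" using mult_nonneg_nonneg[OF b, of d] 2 by (simp add: abs_le_iff)
    then show ?thesis using True I by (simp add: abs_divide divide_right_mono)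
  next
    case False
    then have W: "0 < W" using W0 by simp
    have "GW / W - GI / I = (GW - GI) / I + (GW / W) * ((I - W) / I)" using W I by (simp add: field_simps)
    also have "\<bar>\<dots>\<bar> \<le> b * d / I + b * (d / I)"
    proof (intro order_trans[OF abs_triangle_ineq] add_mono)
      show "\<bar>(GW - GI) / I\<bar> \<le> b * d / I" using 1 I by (simp add: abs_divide divide_right_mono)
      have "\<bar>GW / W\<bar> \<le> b" using 3 W by (simp add: abs_divide pos_divide_le_eq)
      moreover have "\<bar>(I - W) / I\<bar> \<le> d / I" using 2 I by (simp add: abs_divide divide_right_mono abs_minus_commute)
      ultimately show "\<bar>GW / W * ((I - W) / I)\<bar> \<le> b * (d / I)" unfolding abs_mult using b by (intro mult_mono) auto
    qed
    finally show ?thesis by simp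
  qed
  then show ?thesis by (simp add: GW_def GI_def W_def I_def d_def)
qed

text \<open>Up to C the logarithm of w is close to - q (h - hh) / 2. Beyond C, \<phi> is at most exp
  (- c' |h|^2), because 2 C0 \<le> C gives |h - hh| \<ge> |h| / 2 and c' \<le> \<alpha> / 8; up to
  \<delta> r the ratio obeys the same Gaussian bound by c' \<le> c. Beyond \<delta> r the ratio is
  uniformly tiny, and the prior has total mass r to the power of the dimension in magnified
  coordinates.\<close>

lemma laplace_approximation:
  fixes p R q :: "'a::euclidean_space \<Rightarrow> real"
  assumes p: "p \<in> borel_measurable borel" "\<And>\<zeta>. 0 \<le> p \<zeta>" "integrable lborel p" "(\<integral>\<zeta>. p \<zeta> \<partial>lborel) = 1" "0 < p \<zeta>0"
    and R: "R \<in> borel_measurable borel" "\<And>\<zeta>. 0 \<le> R \<zeta>" "\<And>\<zeta>. R \<zeta> \<le> 1"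
    and q: "q \<in> borel_measurable borel" "0 < \<alpha>" "\<And>h. \<alpha> * (norm h)\<^sup>2 \<le> q h"
    and Rh: "exp (- 1) \<le> Rh" and hh: "norm hh \<le> C0" and C: "2 * C0 \<le> C" "0 < C" and r: "0 < r" and \<epsilon>: "\<epsilon> \<le> 1/2"
    and near: "\<And>h. norm h \<le> C \<Longrightarrow> 0 < p (\<zeta>0 + (1 / r) *\<^sub>R h) * R (\<zeta>0 + (1 / r) *\<^sub>R h) \<and>
        \<bar>ln (p (\<zeta>0 + (1 / r) *\<^sub>R h) * R (\<zeta>0 + (1 / r) *\<^sub>R h) / (p \<zeta>0 * Rh)) + q (h - hh) / 2\<bar> \<le> \<epsilon>"
    and far: "\<And>\<zeta>. C0 / r \<le> norm (\<zeta> - \<zeta>0) \<Longrightarrow> R \<zeta> \<le> exp (- c * r\<^sup>2 * (min (norm (\<zeta> - \<zeta>0)) \<delta>)\<^sup>2)"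
    and pd: "0 < \<delta>" "\<And>\<zeta>. norm (\<zeta> - \<zeta>0) \<le> \<delta> \<Longrightarrow> p \<zeta> \<le> 2 * p \<zeta>0"
    and c': "0 < c'" "c' \<le> c" "c' \<le> \<alpha> / 8"
  defines "w \<equiv> (\<lambda>h. p (\<zeta>0 + (1 / r) *\<^sub>R h) * R (\<zeta>0 + (1 / r) *\<^sub>R h) / (p \<zeta>0 * Rh))"
    and "\<phi> \<equiv> (\<lambda>h. exp (- q (h - hh) / 2))"
  shows "integrable lborel w" and "integrable lborel \<phi>"
    and "(\<integral>h. \<bar>w h - \<phi> h\<bar> \<partial>lborel) \<le> 2 * \<epsilon> * measure lborel (cball (0::'a) C)
      + (2 * exp 1 + 1) * (\<integral>h. indicator {h. C < norm h} h * exp (- c' * (norm (h::'a))\<^sup>2) \<partial>lborel)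
      + exp 1 * exp (- c * r\<^sup>2 * \<delta>\<^sup>2) * r ^ DIM('a) / p \<zeta>0"
proof -
  note [measurable] = p(1) R(1) q(1)
  have Rh0: "0 < Rh" using Rh exp_gt_zero less_le_trans by blast
  have Rhi: "1 / Rh \<le> exp 1" using Rh Rh0 by (simp add: exp_minus field_simps)
  define P where "P = (\<lambda>h. p (\<zeta>0 + (1 / r) *\<^sub>R h))"
  define Q where "Q = (\<lambda>h. R (\<zeta>0 + (1 / r) *\<^sub>R h))"
  have Pm[measurable]: "P \<in> borel_measurable borel" unfolding P_def by measurable
  have Qm[measurable]: "Q \<in> borel_measurable borel" unfolding Q_def by measurable
  have iP: "integrable lborel P" unfolding P_def using integrable_lborel_rescale[OF p(1) r] p(3) by simp
  have IP: "(\<integral>h. P h \<partial>lborel) = r ^ DIM('a)" unfolding P_def using integral_lborel_rescale[OF p(1) r, of \<zeta>0] p(4) r by (simp add: field_simps)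
  have P0: "0 \<le> P h" and Q0: "0 \<le> Q h" and Q1: "Q h \<le> 1" for h by (auto simp: P_def Q_def p R)
  have w: "w = (\<lambda>h. P h * Q h / (p \<zeta>0 * Rh))" by (simp add: w_def P_def Q_def)
  have w0: "0 \<le> w h" for h unfolding w using P0 Q0 p(5) Rh0 by simp
  have wm[measurable]: "w \<in> borel_measurable borel" unfolding w by measurable
  have \<phi>m[measurable]: "\<phi> \<in> borel_measurable borel" unfolding \<phi>_def by measurable
  have \<phi>0: "0 \<le> \<phi> h" for h by (simp add: \<phi>_def)
  have q0: "0 \<le> q h" for h using q(3)[of h] q(2) by (meson mult_nonneg_nonneg less_imp_le order_trans zero_le_power2)
  have \<phi>1: "\<phi> h \<le> 1" for h using q0[of "h - hh"] by (simp add: \<phi>_def)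
  have \<phi>far: "\<phi> h \<le> exp (- c' * (norm h)\<^sup>2)" if "C < norm h" for h
  proof -
    have "norm h / 2 \<le> norm (h - hh)" using norm_triangle_ineq2[of h hh] hh that C by linarith
    then have "(norm h / 2)\<^sup>2 \<le> (norm (h - hh))\<^sup>2" by (intro power_mono) auto
    then have "\<alpha> * (norm h / 2)\<^sup>2 \<le> q (h - hh)" using q(3)[of "h - hh"] q(2) by (meson mult_left_mono less_imp_le order_trans)
    moreover have "c' * (norm h)\<^sup>2 \<le> \<alpha> / 8 * (norm h)\<^sup>2" using c' by (intro mult_right_mono) auto
    ultimately have "c' * (norm h)\<^sup>2 \<le> q (h - hh) / 2" by (simp add: power_divide)
    then show ?thesis by (simp add: \<phi>_def)
  qed
  have wle: "w h \<le> P h * Q h * exp 1 / p \<zeta>0" for h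
  proof -
    have "w h = (P h * Q h / p \<zeta>0) * (1 / Rh)" by (simp add: w)
    also have "\<dots> \<le> (P h * Q h / p \<zeta>0) * exp 1" using Rhi P0 Q0 p(5) by (intro mult_left_mono) auto
    finally show ?thesis by simp
  qed
  have nd: "norm (\<zeta>0 + (1 / r) *\<^sub>R h - \<zeta>0) = norm h / r" for h using r by simp
  \<comment> \<open>\<open>exp 1\<close> bounds 1 / Rh and 2 is the bound on p relative to its value
    at \<zeta>0; the two summands belong to distances up to \<delta> r and beyond.\<close>
  have wfar: "w h \<le> 2 * exp 1 * exp (- c' * (norm h)\<^sup>2) + exp 1 * exp (- c * r\<^sup>2 * \<delta>\<^sup>2) / p \<zeta>0 * P h" if "C < norm h" for h
  proof -
    have C0C: "C0 \<le> norm h" using that C hh norm_ge_zero[of hh] by linarith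
    then have "C0 / r \<le> norm (\<zeta>0 + (1 / r) *\<^sub>R h - \<zeta>0)" unfolding nd using r by (intro divide_right_mono) auto
    from far[OF this] have Qb: "Q h \<le> exp (- c * r\<^sup>2 * (min (norm h / r) \<delta>)\<^sup>2)" unfolding nd Q_def .
    show ?thesis
    proof (cases "norm h / r \<le> \<delta>")
      case True
      have "r\<^sup>2 * (norm h / r)\<^sup>2 = (norm h)\<^sup>2" using r by (simp add: power_divide)
      then have "Q h \<le> exp (- c * (norm h)\<^sup>2)" using Qb True by (simp add: min_absorb1 mult.assoc)
      also have "\<dots> \<le> exp (- c' * (norm h)\<^sup>2)" using c'(2) by (simp add: mult_right_mono)
      finally have Qc: "Q h \<le> exp (- c' * (norm h)\<^sup>2)" .
      have Pb: "P h \<le> 2 * p \<zeta>0" unfolding P_def by (rule pd(2)) (unfold nd, rule True)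
      have "w h \<le> (2 * p \<zeta>0) * exp (- c' * (norm h)\<^sup>2) * exp 1 / p \<zeta>0"
        by (rule order_trans[OF wle], intro divide_right_mono mult_right_mono mult_mono Pb Qc) (use p(5) Q0 in auto)
      also have "\<dots> = 2 * exp 1 * exp (- c' * (norm h)\<^sup>2)" using p(5) by simp
      moreover have "0 \<le> exp 1 * exp (- c * r\<^sup>2 * \<delta>\<^sup>2) / p \<zeta>0 * P h" using p(5) P0 by simp
      ultimately show ?thesis by linarith
    next
      case False
      then have Qc: "Q h \<le> exp (- c * r\<^sup>2 * \<delta>\<^sup>2)" using Qb by (simp add: min_absorb2)
      have "w h \<le> P h * exp (- c * r\<^sup>2 * \<delta>\<^sup>2) * exp 1 / p \<zeta>0"
        by (rule order_trans[OF wle], intro divide_right_mono mult_right_mono mult_left_mono Qc) (use p(5) P0 in auto)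
      also have "\<dots> = exp 1 * exp (- c * r\<^sup>2 * \<delta>\<^sup>2) / p \<zeta>0 * P h" by simp
      moreover have "0 \<le> 2 * exp 1 * exp (- c' * (norm h)\<^sup>2)" by simp
      ultimately show ?thesis by linarith
    qed
  qed
  have wnear: "\<bar>w h - \<phi> h\<bar> \<le> 2 * \<epsilon>" if h: "norm h \<le> C" for h
  proof -
    define x where "x = ln (w h) + q (h - hh) / 2"
    have pos: "0 < w h" using near[OF h] p(5) Rh0 unfolding w_def by (intro divide_pos_pos) auto
    have x: "\<bar>x\<bar> \<le> \<epsilon>" using near[OF h] by (simp add: x_def w_def)
    have "w h = exp (x - q (h - hh) / 2)" using pos by (simp add: x_def)
    also have "\<dots> = \<phi> h * exp x" by (simp add: \<phi>_def flip: exp_add)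
    finally have "w h - \<phi> h = \<phi> h * (exp x - 1)" by (simp add: right_diff_distrib)
    then have "\<bar>w h - \<phi> h\<bar> = \<phi> h * \<bar>exp x - 1\<bar>" using \<phi>0 by (simp add: abs_mult)
    also have "\<dots> \<le> 1 * \<bar>exp x - 1\<bar>" using \<phi>1 by (intro mult_right_mono) auto
    also have "\<dots> \<le> 2 * \<bar>x\<bar>" using abs_exp_minus_one_le[of x] x \<epsilon> by simp
    finally show ?thesis using x by simp
  qed
  show iw: "integrable lborel w"
  proof (rule Bochner_Integration.integrable_bound[of _ "\<lambda>h. exp 1 / p \<zeta>0 * P h"])
    show "integrable lborel (\<lambda>h. exp 1 / p \<zeta>0 * P h)" using iP by simp
    have "w h \<le> exp 1 / p \<zeta>0 * P h" for h
    proof -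
      have "P h * Q h * exp 1 / p \<zeta>0 \<le> P h * 1 * exp 1 / p \<zeta>0"
        using P0 Q1 p(5) by (intro divide_right_mono mult_right_mono mult_left_mono) auto
      then show ?thesis using wle[of h] by (simp add: mult.commute)
    qed
    then show "AE h in lborel. norm (w h) \<le> norm (exp 1 / p \<zeta>0 * P h)" using w0 P0 p(5) by (auto simp: abs_mult)
  qed simp
  have icb: "integrable lborel (\<lambda>h::'a. indicator (cball 0 C) h :: real)"
    using emeasure_lborel_cball_finite[of "0::'a" C] by (intro integrable_real_indicator) auto
  have it: "integrable lborel (\<lambda>h::'a. indicator {h. C < norm h} h * exp (- c' * (norm h)\<^sup>2) :: real)"
    by (rule Bochner_Integration.integrable_bound[OF integrable_gauss[OF c'(1)]]) (auto simp: indicator_def)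
  show i\<phi>: "integrable lborel \<phi>"
  proof (rule Bochner_Integration.integrable_bound[of _ "\<lambda>h::'a. indicator (cball 0 C) h + indicator {h. C < norm h} h * exp (- c' * (norm h)\<^sup>2)"])
    show "integrable lborel (\<lambda>h::'a. indicator (cball 0 C) h + indicator {h. C < norm h} h * exp (- c' * (norm h)\<^sup>2) :: real)"
      using icb it by simp
    show "AE h in lborel. norm (\<phi> h) \<le> norm (indicator (cball 0 C) h + indicator {h. C < norm h} h * exp (- c' * (norm h)\<^sup>2) :: real)"
    proof (rule AE_I2)
      fix h :: 'a
      show "norm (\<phi> h) \<le> norm (indicator (cball 0 C) h + indicator {h. C < norm h} h * exp (- c' * (norm h)\<^sup>2) :: real)"
        using \<phi>0[of h] \<phi>1[of h] \<phi>far[of h] by (cases "norm h \<le> C") auto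
    qed
  qed simp
  have "(\<integral>h. \<bar>w h - \<phi> h\<bar> \<partial>lborel) \<le> (\<integral>h. 2 * \<epsilon> * indicator (cball 0 C) h
      + (2 * exp 1 + 1) * (indicator {h. C < norm h} h * exp (- c' * (norm h)\<^sup>2))
      + exp 1 * exp (- c * r\<^sup>2 * \<delta>\<^sup>2) / p \<zeta>0 * P h \<partial>lborel)"
  proof (rule integral_mono)
    show "integrable lborel (\<lambda>h. \<bar>w h - \<phi> h\<bar>)" using iw i\<phi> by simp
    show "integrable lborel (\<lambda>h. 2 * \<epsilon> * indicator (cball 0 C) h
      + (2 * exp 1 + 1) * (indicator {h. C < norm h} h * exp (- c' * (norm h)\<^sup>2))
      + exp 1 * exp (- c * r\<^sup>2 * \<delta>\<^sup>2) / p \<zeta>0 * P h)"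
      using icb it iP by (intro Bochner_Integration.integrable_add integrable_mult_right) auto
    fix h :: 'a
    have P': "0 \<le> exp 1 * exp (- c * r\<^sup>2 * \<delta>\<^sup>2) / p \<zeta>0 * P h" using p(5) P0 by simp
    show "\<bar>w h - \<phi> h\<bar> \<le> 2 * \<epsilon> * indicator (cball 0 C) h
      + (2 * exp 1 + 1) * (indicator {h. C < norm h} h * exp (- c' * (norm h)\<^sup>2))
      + exp 1 * exp (- c * r\<^sup>2 * \<delta>\<^sup>2) / p \<zeta>0 * P h"
    proof (cases "norm h \<le> C")
      case True
      then show ?thesis using wnear[OF True] P' by simp
    next
      case False
      then have "\<bar>w h - \<phi> h\<bar> \<le> w h + \<phi> h" using w0[of h] \<phi>0[of h] by (simp add: abs_le_iff)
      also have "\<dots> \<le> (2 * exp 1 + 1) * exp (- c' * (norm h)\<^sup>2) + exp 1 * exp (- c * r\<^sup>2 * \<delta>\<^sup>2) / p \<zeta>0 * P h"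
        using wfar[of h] \<phi>far[of h] False unfolding distrib_right mult_1_left by linarith
      finally show ?thesis using False by simp
    qed
  qed
  also have "\<dots> = 2 * \<epsilon> * measure lborel (cball (0::'a) C)
      + (2 * exp 1 + 1) * (\<integral>h. indicator {h. C < norm h} h * exp (- c' * (norm (h::'a))\<^sup>2) \<partial>lborel)
      + exp 1 * exp (- c * r\<^sup>2 * \<delta>\<^sup>2) / p \<zeta>0 * r ^ DIM('a)"
    using icb it iP by (simp add: IP)
  finally show "(\<integral>h. \<bar>w h - \<phi> h\<bar> \<partial>lborel) \<le> 2 * \<epsilon> * measure lborel (cball (0::'a) C)
      + (2 * exp 1 + 1) * (\<integral>h. indicator {h. C < norm h} h * exp (- c' * (norm (h::'a))\<^sup>2) \<partial>lborel)
      + exp 1 * exp (- c * r\<^sup>2 * \<delta>\<^sup>2) * r ^ DIM('a) / p \<zeta>0" by simp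
qed

text \<open>The normalising integral, the volume factor and k all cancel, so any constant multiple
  of the unnormalised density may be used in magnified coordinates. If the normalising integral is
  0, both sides are 0.\<close>

lemma integral_distr_density_rescale:
  fixes p :: "'a::euclidean_space \<Rightarrow> real" and T :: "'a \<Rightarrow> 'b::euclidean_space" and g :: "'b \<Rightarrow> real"
  assumes p: "p \<in> borel_measurable borel" "\<And>\<zeta>. 0 \<le> p \<zeta>" and T: "T \<in> borel_measurable borel"
    and g: "g \<in> borel_measurable borel" and r: "0 < r" and k: "k \<noteq> 0"
  shows "(\<integral>z. g z \<partial>distr (density lborel (\<lambda>\<zeta>. ennreal (p \<zeta> / (\<integral>\<xi>. p \<xi> \<partial>lborel)))) borel T)
     = (\<integral>h. g (T (a + (1 / r) *\<^sub>R h)) * (p (a + (1 / r) *\<^sub>R h) / k) \<partial>lborel) / (\<integral>h. p (a + (1 / r) *\<^sub>R h) / k \<partial>lborel)"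
proof -
  note [measurable] = p(1) T g
  define I where "I = (\<integral>\<xi>. p \<xi> \<partial>lborel)"
  have I: "0 \<le> I" using p(2) by (simp add: I_def Bochner_Integration.integral_nonneg)
  have "(\<integral>z. g z \<partial>distr (density lborel (\<lambda>\<zeta>. ennreal (p \<zeta> / I))) borel T) = (\<integral>\<zeta>. g (T \<zeta>) \<partial>density lborel (\<lambda>\<zeta>. ennreal (p \<zeta> / I)))"
    by (rule integral_distr) measurable
  also have "\<dots> = (\<integral>\<zeta>. (p \<zeta> / I) * g (T \<zeta>) \<partial>lborel)"
    by (rule integral_real_density) (use p(2) I in auto)
  also have "\<dots> = (\<integral>\<zeta>. g (T \<zeta>) * p \<zeta> \<partial>lborel) / I" by (simp add: mult.commute)
  also have "(\<integral>\<zeta>. g (T \<zeta>) * p \<zeta> \<partial>lborel) = (\<integral>h. g (T (a + (1 / r) *\<^sub>R h)) * p (a + (1 / r) *\<^sub>R h) \<partial>lborel) / r ^ DIM('a)"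
    by (rule integral_lborel_rescale[OF _ r]) measurable
  finally have e: "(\<integral>z. g z \<partial>distr (density lborel (\<lambda>\<zeta>. ennreal (p \<zeta> / I))) borel T)
      = (\<integral>h. g (T (a + (1 / r) *\<^sub>R h)) * p (a + (1 / r) *\<^sub>R h) \<partial>lborel) / r ^ DIM('a) / I" .
  have "I = (\<integral>h. p (a + (1 / r) *\<^sub>R h) \<partial>lborel) / r ^ DIM('a)"
    unfolding I_def by (rule integral_lborel_rescale[OF _ r]) measurable
  then show ?thesis unfolding I_def[symmetric] e using r k by simp
qed

section \<open>Square roots of positive semidefinite matrices\<close>

text \<open>Take a maximiser v of x . f x on the unit sphere of U, with value l. The residual z = f
  v - l v belongs to U by invariance, and moving from v in direction z would increase the Rayleigh
  quotient unless z = 0.\<close>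

lemma self_adjoint_eigenvector:
  fixes f :: "'a::euclidean_space \<Rightarrow> 'a"
  assumes f: "linear f" "\<And>x y. x \<bullet> f y = f x \<bullet> y"
    and U: "subspace U" "\<And>x. x \<in> U \<Longrightarrow> f x \<in> U" and nz: "u \<in> U" "u \<noteq> 0"
  obtains v l where "v \<in> U" "norm v = 1" "f v = l *\<^sub>R v"
proof -
  have contf: "continuous_on S f" for S using f(1) by (simp add: linear_continuous_on linear_conv_bounded_linear)
  define S where "S = U \<inter> sphere 0 1"
  have "compact S" unfolding S_def using closed_subspace[OF U(1)] by (simp add: closed_Int_compact)
  moreover have "(1 / norm u) *\<^sub>R u \<in> S" using nz subspace_scale[OF U(1) nz(1)] by (simp add: S_def)
  moreover have "continuous_on S (\<lambda>x. x \<bullet> f x)" by (intro continuous_intros contf)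
  ultimately obtain v where v: "v \<in> S" "\<And>w. w \<in> S \<Longrightarrow> w \<bullet> f w \<le> v \<bullet> f v"
    using continuous_attains_sup[of S "\<lambda>x. x \<bullet> f x"] by blast
  define l where "l = v \<bullet> f v"
  have vU: "v \<in> U" and v1: "norm v = 1" using v(1) by (auto simp: S_def)
  have vv: "v \<bullet> v = 1" using v1 by (simp add: norm_eq_1)
  have max: "w \<bullet> f w \<le> l * (w \<bullet> w)" if "w \<in> U" for w
  proof (cases "w = 0")
    case False
    have "(1 / norm w) *\<^sub>R w \<in> S" using False subspace_scale[OF U(1) that] by (simp add: S_def)
    from v(2)[OF this] have "(w \<bullet> f w) / (norm w)\<^sup>2 \<le> l"
      by (simp add: l_def linear_cmul[OF f(1)] power2_eq_square)
    then show ?thesis using False by (simp add: pos_divide_le_eq power2_norm_eq_inner)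
  qed (simp add: linear_0[OF f(1)])
  define z where "z = f v - l *\<^sub>R v"
  have zU: "z \<in> U" using U vU by (simp add: z_def subspace_diff subspace_scale)
  define c where "c = z \<bullet> f z - l * (z \<bullet> z)"
  \<comment> \<open>Maximality tested at v + t z: the term linear in t is 2 t (z . z) because z is
    the residual.\<close>
  have key: "2 * t * (z \<bullet> z) + t\<^sup>2 * c \<le> 0" for t
  proof -
    have "v + t *\<^sub>R z \<in> U" using U vU zU by (simp add: subspace_add subspace_scale)
    from max[OF this] have 0: "(v + t *\<^sub>R z) \<bullet> f (v + t *\<^sub>R z) - l * ((v + t *\<^sub>R z) \<bullet> (v + t *\<^sub>R z)) \<le> 0" by simp
    have "z \<bullet> z = z \<bullet> (f v - l *\<^sub>R v)" by (simp only: z_def)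
    then have 1: "z \<bullet> f v = z \<bullet> z + l * (z \<bullet> v)" by (simp add: inner_diff_right)
    have 2: "v \<bullet> f z = z \<bullet> f v" using f(2)[of v z] by (simp add: inner_commute)
    have 3: "(v + t *\<^sub>R z) \<bullet> f (v + t *\<^sub>R z) = l + t * (z \<bullet> f v) + t * (v \<bullet> f z) + t\<^sup>2 * (z \<bullet> f z)"
      by (simp add: linear_add[OF f(1)] linear_cmul[OF f(1)] inner_add_left inner_add_right l_def power2_eq_square distrib_left)
    have 4: "(v + t *\<^sub>R z) \<bullet> (v + t *\<^sub>R z) = 1 + 2 * t * (z \<bullet> v) + t\<^sup>2 * (z \<bullet> z)"
      by (simp add: inner_add_left inner_add_right vv inner_commute power2_eq_square)
    have "2 * t * (z \<bullet> z) + t\<^sup>2 * c = (v + t *\<^sub>R z) \<bullet> f (v + t *\<^sub>R z) - l * ((v + t *\<^sub>R z) \<bullet> (v + t *\<^sub>R z))"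
      unfolding 3 4 2 1 c_def by (simp add: algebra_simps)
    then show ?thesis using 0 by simp
  qed
  have "z \<bullet> z = 0"
  proof (rule ccontr)
    assume "z \<bullet> z \<noteq> 0"
    then have zz: "0 < z \<bullet> z" by simp
    \<comment> \<open>Small enough for t |c| \<le> z . z, so that the linear term dominates.\<close>
    define t where "t = (z \<bullet> z) / (\<bar>c\<bar> + 1)"
    have t: "0 < t" using zz by (simp add: t_def)
    have "t * \<bar>c\<bar> \<le> z \<bullet> z" using zz by (simp add: t_def field_simps)
    then have "- (z \<bullet> z) \<le> t * c" using t by (smt (verit) abs_ge_minus_self mult_left_mono mult_minus_right)
    moreover have "t * (2 * (z \<bullet> z) + t * c) \<le> 0" using key[of t] by (simp add: power2_eq_square algebra_simps)
    then have "2 * (z \<bullet> z) + t * c \<le> 0" using t by (simp add: mult_le_0_iff)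
    ultimately show False using zz by simp
  qed
  then have "f v = l *\<^sub>R v" by (simp add: z_def)
  then show thesis using that vU v1 by blast
qed

text \<open>Self-adjointness makes the orthogonal complement of an eigenvector in U invariant, and
  its dimension is smaller; hence the induction runs over all invariant subspaces.\<close>

lemma spectral_subspace:
  fixes f :: "'a::euclidean_space \<Rightarrow> 'a"
  assumes f: "linear f" "\<And>x y. x \<bullet> f y = f x \<bullet> y"
  shows "subspace U \<Longrightarrow> (\<And>x. x \<in> U \<Longrightarrow> f x \<in> U) \<Longrightarrow>
    \<exists>B. finite B \<and> pairwise orthogonal B \<and> (\<forall>b\<in>B. norm b = 1 \<and> (\<exists>l. f b = l *\<^sub>R b)) \<and> B \<subseteq> U \<and> U \<subseteq> span B"
proof (induction "dim U" arbitrary: U rule: less_induct)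
  case less
  show ?case
  proof (cases "U \<subseteq> {0}")
    case True
    then show ?thesis by (intro exI[of _ "{}"]) auto
  next
    case False
    then obtain u where u: "u \<in> U" "u \<noteq> 0" by blast
    obtain v l where v: "v \<in> U" "norm v = 1" "f v = l *\<^sub>R v"
      using self_adjoint_eigenvector[OF f less.prems u] by blast
    have vv: "v \<bullet> v = 1" using v by (simp add: norm_eq_1)
    define W where "W = {w \<in> U. v \<bullet> w = 0}"
    have sW: "subspace W" using less.prems(1) unfolding W_def subspace_def by (auto simp: inner_add_right)
    have fW: "f x \<in> W" if "x \<in> W" for x
      using that less.prems(2)[of x] f(2)[of v x] v(3) by (simp add: W_def)
    have "v \<notin> W" using vv by (simp add: W_def)
    then have "W \<subset> U" using v(1) unfolding W_def by blast
    moreover have "span W = W" "span U = U" using sW less.prems(1) by (simp_all only: span_eq_iff)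
    ultimately have "span W \<subset> span U" by (simp only:)
    then have "dim W < dim U" by (rule dim_psubset)
    from less.hyps[OF this sW fW] obtain B where B: "finite B" "pairwise orthogonal B"
      "\<And>b. b \<in> B \<Longrightarrow> norm b = 1 \<and> (\<exists>l. f b = l *\<^sub>R b)" "B \<subseteq> W" "W \<subseteq> span B" by blast
    show ?thesis
    proof (intro exI[of _ "insert v B"] conjI ballI)
      show "pairwise orthogonal (insert v B)"
        using B(2,4) by (auto simp: pairwise_insert orthogonal_def W_def inner_commute)
      show "U \<subseteq> span (insert v B)"
      proof
        fix x assume x: "x \<in> U"
        have "x - (v \<bullet> x) *\<^sub>R v \<in> W"
          using x v(1) less.prems(1) vv by (simp add: W_def subspace_diff subspace_scale inner_diff_right)
        then have "x - (v \<bullet> x) *\<^sub>R v \<in> span B" using B(5) by blast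
        then have "x - (v \<bullet> x) *\<^sub>R v \<in> span (insert v B)" using span_mono[of B "insert v B"] by blast
        moreover have "(v \<bullet> x) *\<^sub>R v \<in> span (insert v B)" by (simp add: span_base span_scale)
        ultimately have "(x - (v \<bullet> x) *\<^sub>R v) + (v \<bullet> x) *\<^sub>R v \<in> span (insert v B)" by (rule span_add)
        then show "x \<in> span (insert v B)" by simp
      qed
      fix b assume "b \<in> insert v B"
      then show "norm b = 1" "\<exists>l. f b = l *\<^sub>R b" using B(3) v by auto
    qed (use B v in \<open>auto simp: W_def\<close>)
  qed
qed

lemma spectral:
  fixes f :: "'a::euclidean_space \<Rightarrow> 'a"
  assumes f: "linear f" "\<And>x y. x \<bullet> f y = f x \<bullet> y"
  obtains B l where "finite B" "pairwise orthogonal B" "\<And>b. b \<in> B \<Longrightarrow> norm b = 1" "\<And>b. b \<in> B \<Longrightarrow> f b = l b *\<^sub>R b"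
    "\<And>x. (\<Sum>b\<in>B. (x \<bullet> b) *\<^sub>R b) = x"
proof -
  obtain B where B: "finite B" "pairwise orthogonal B" "\<forall>b\<in>B. norm b = 1 \<and> (\<exists>l. f b = l *\<^sub>R b)" "UNIV \<subseteq> span B"
    using spectral_subspace[OF f, of UNIV] by auto
  obtain l where l: "\<And>b. b \<in> B \<Longrightarrow> f b = l b *\<^sub>R b" using B(3) by metis
  show thesis
  proof (rule that[of B l])
    show "(\<Sum>b\<in>B. (x \<bullet> b) *\<^sub>R b) = x" for x
      by (rule orthonormal_basis_expand) (use B in auto)
  qed (use B l in auto)
qed

section \<open>The positive semidefinite root\<close>

lemma symmetric_matrix_inner:
  fixes A :: "real ^ 'n ^ 'n"
  assumes "transpose A = A"
  shows "x \<bullet> (A *v y) = (A *v x) \<bullet> y"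
  using adjoint_works[of "\<lambda>x. A *v x" x y] assms by (simp add: adjoint_matrix)

text \<open>In an orthonormal eigenbasis take the roots of the eigenvalues, which semidefiniteness
  makes nonnegative.\<close>

lemma pos_semidef_sqrt_exists:
  fixes A :: "real ^ 'n ^ 'n"
  assumes A: "pos_semidef A"
  shows "\<exists>S. pos_semidef S \<and> S ** S = A"
proof -
  have sym: "transpose A = A" and psd: "\<And>v. 0 \<le> v \<bullet> (A *v v)" using A by (auto simp: pos_semidef_def)
  obtain B l where B: "finite B" "pairwise orthogonal B" "\<And>b. b \<in> B \<Longrightarrow> norm b = 1" "\<And>b. b \<in> B \<Longrightarrow> A *v b = l b *\<^sub>R b"
    "\<And>x. (\<Sum>b\<in>B. (x \<bullet> b) *\<^sub>R b) = x"
    using spectral[of "\<lambda>x. A *v x"] symmetric_matrix_inner[OF sym] by auto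
  have bb: "b \<bullet> c = (if b = c then 1 else 0)" if "b \<in> B" "c \<in> B" for b c
    using B(2,3) that by (auto simp: norm_eq_1 pairwise_def orthogonal_def)
  have l0: "0 \<le> l b" if "b \<in> B" for b using psd[of b] bb[OF that that] B(4)[OF that] by simp
  define s where "s = (\<lambda>x. \<Sum>b\<in>B. (sqrt (l b) * (x \<bullet> b)) *\<^sub>R b)"
  have lin: "linear s" unfolding s_def
    by (rule linearI) (simp_all add: inner_add_left distrib_left scaleR_add_left sum.distrib scaleR_sum_right mult.left_commute)
  have sb: "s x \<bullet> c = sqrt (l c) * (x \<bullet> c)" if "c \<in> B" for x c
  proof -
    have "s x \<bullet> c = (\<Sum>b\<in>B. (sqrt (l b) * (x \<bullet> b)) * (b \<bullet> c))" by (simp add: s_def inner_sum_left)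
    also have "\<dots> = (\<Sum>b\<in>B. if b = c then sqrt (l b) * (x \<bullet> b) else 0)" by (rule sum.cong) (use bb that in auto)
    also have "\<dots> = sqrt (l c) * (x \<bullet> c)" using that B(1) by simp
    finally show ?thesis .
  qed
  have inn: "x \<bullet> s y = (\<Sum>b\<in>B. sqrt (l b) * (x \<bullet> b) * (y \<bullet> b))" for x y
    by (simp add: s_def inner_sum_right mult.commute mult.left_commute)
  have ss: "s (s x) = A *v x" for x
  proof -
    have "s (s x) = (\<Sum>b\<in>B. (l b * (x \<bullet> b)) *\<^sub>R b)"
    proof -
      have "s (s x) = (\<Sum>b\<in>B. (sqrt (l b) * (s x \<bullet> b)) *\<^sub>R b)" by (simp add: s_def)
      also have "\<dots> = (\<Sum>b\<in>B. (l b * (x \<bullet> b)) *\<^sub>R b)"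
        by (rule sum.cong) (use l0 in \<open>simp_all add: sb flip: mult.assoc\<close>)
      finally show ?thesis .
    qed
    also have "\<dots> = (\<Sum>b\<in>B. (x \<bullet> b) *\<^sub>R (A *v b))" by (rule sum.cong) (simp_all add: B(4) mult.commute)
    also have "\<dots> = A *v (\<Sum>b\<in>B. (x \<bullet> b) *\<^sub>R b)"
      by (simp add: linear_sum[OF matrix_vector_mul_linear] matrix_vector_mult_scaleR)
    finally show ?thesis by (simp add: B(5))
  qed
  define S where "S = matrix s"
  have Sv: "S *v x = s x" for x using matrix_vector_mul(2)[OF lin] unfolding S_def by metis
  show ?thesis
  proof (intro exI[of _ S] conjI)
    have "adjoint s = s" by (rule adjoint_unique) (simp add: inn inner_commute[of "s _"] mult.commute mult.left_commute)
    then have "transpose S = S" using matrix_adjoint[OF lin] by (simp add: S_def)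
    moreover have "0 \<le> v \<bullet> (S *v v)" for v
      unfolding Sv inn by (rule sum_nonneg) (use l0 in \<open>simp add: mult.assoc\<close>)
    ultimately show "pos_semidef S" by (simp add: pos_semidef_def)
    show "S ** S = A" unfolding matrix_eq by (simp add: Sv ss flip: matrix_vector_mul_assoc)
  qed
qed

text \<open>For a root T of S the form v . S v is the squared norm of T v, and S v = T (T
  v).\<close>

lemma pos_semidef_zero_form:
  fixes S :: "real ^ 'n ^ 'n"
  assumes S: "pos_semidef S" and v: "v \<bullet> (S *v v) = 0"
  shows "S *v v = 0"
proof -
  obtain T where T: "pos_semidef T" "T ** T = S" using pos_semidef_sqrt_exists[OF S] by blast
  have "v \<bullet> (T *v (T *v v)) = 0" using v T(2) by (simp add: matrix_vector_mul_assoc)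
  then have "(T *v v) \<bullet> (T *v v) = 0" using T(1) symmetric_matrix_inner[of T v "T *v v"] by (simp add: pos_semidef_def)
  then have "T *v v = 0" by simp
  then have "T *v (T *v v) = 0" by simp
  then show ?thesis using T(2) by (simp add: matrix_vector_mul_assoc)
qed

text \<open>The difference D = S - T satisfies S D + D T = S^2 - T^2 = 0. Paired with an eigenvector
  b of D for an eigenvalue l \<noteq> 0 this reads l (b . S b + b . T b) = 0. Both forms then vanish
  at b, and with them S b and T b, so D vanishes on a whole eigenbasis.\<close>

lemma pos_semidef_sqrt_unique:
  fixes S T :: "real ^ 'n ^ 'n"
  assumes S: "pos_semidef S" and T: "pos_semidef T" and eq: "S ** S = T ** T"
  shows "S = T"
proof -
  define D where "D = (\<lambda>x. S *v x - T *v x)"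
  have sy: "x \<bullet> (S *v y) = (S *v x) \<bullet> y" "x \<bullet> (T *v y) = (T *v x) \<bullet> y" for x y
    using S T symmetric_matrix_inner by (auto simp: pos_semidef_def)
  have lin: "linear D" unfolding D_def by (intro linear_compose_sub matrix_vector_mul_linear)
  have symD: "x \<bullet> D y = D x \<bullet> y" for x y by (simp add: D_def inner_diff_left inner_diff_right sy)
  obtain B l where B: "finite B" "pairwise orthogonal B" "\<And>b. b \<in> B \<Longrightarrow> norm b = 1" "\<And>b. b \<in> B \<Longrightarrow> D b = l b *\<^sub>R b"
    "\<And>x. (\<Sum>b\<in>B. (x \<bullet> b) *\<^sub>R b) = x"
    using spectral[OF lin symD] by blast
  have Db: "D b = 0" if b: "b \<in> B" for b
  proof (cases "l b = 0")
    case False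
    have e: "S *v (S *v b) = T *v (T *v b)" using eq by (simp add: matrix_vector_mul_assoc)
    have SD: "S *v D b + D (T *v b) = 0"
      by (simp add: D_def matrix_vector_mult_diff_distrib e)
    have "b \<bullet> (S *v D b) + b \<bullet> D (T *v b) = b \<bullet> (S *v D b + D (T *v b))" by (simp add: inner_add_right)
    also have "\<dots> = 0" unfolding SD by simp
    finally have "l b * (b \<bullet> (S *v b) + b \<bullet> (T *v b)) = 0"
      by (simp add: symD B(4)[OF b] matrix_vector_mult_scaleR distrib_left)
    then have "b \<bullet> (S *v b) + b \<bullet> (T *v b) = 0" using False by simp
    moreover have "0 \<le> b \<bullet> (S *v b)" "0 \<le> b \<bullet> (T *v b)" using S T by (auto simp: pos_semidef_def)
    ultimately have z: "b \<bullet> (S *v b) = 0" "b \<bullet> (T *v b) = 0" by linarith+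
    show ?thesis using pos_semidef_zero_form[OF S z(1)] pos_semidef_zero_form[OF T z(2)] by (simp add: D_def)
  qed (simp add: B(4)[OF b])
  have "D x = 0" for x
  proof -
    have "D x = D (\<Sum>b\<in>B. (x \<bullet> b) *\<^sub>R b)" by (simp add: B(5))
    also have "\<dots> = (\<Sum>b\<in>B. (x \<bullet> b) *\<^sub>R D b)" by (simp add: linear_sum[OF lin] linear_cmul[OF lin])
    finally show ?thesis by (simp add: Db)
  qed
  then show ?thesis by (simp add: matrix_eq D_def)
qed

lemma matrix_sqrt:
  fixes A :: "real ^ 'n ^ 'n"
  assumes "pos_semidef A"
  shows "pos_semidef (matrix_sqrt A) \<and> matrix_sqrt A ** matrix_sqrt A = A"
  unfolding matrix_sqrt_def
  by (rule theI') (use pos_semidef_sqrt_exists[OF assms] pos_semidef_sqrt_unique in blast)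

lemma matrix_sqrt_eqI:
  fixes A :: "real ^ 'n ^ 'n"
  assumes "pos_semidef S" "S ** S = A"
  shows "matrix_sqrt A = S"
  unfolding matrix_sqrt_def
proof (rule the_equality)
  fix T :: "real ^ 'n ^ 'n" assume T: "pos_semidef T \<and> T ** T = A"
  show "T = S" by (rule pos_semidef_sqrt_unique) (use T assms in simp_all)
qed (use assms in simp)

text \<open>Reduces the root of J n to sqrt n times a root that does not depend on n.\<close>

lemma matrix_sqrt_scale:
  fixes A :: "real ^ 'n ^ 'n"
  assumes A: "pos_semidef A" and r: "0 \<le> r"
  shows "matrix_sqrt (r *\<^sub>R A) = sqrt r *\<^sub>R matrix_sqrt A"
proof (rule matrix_sqrt_eqI)
  have S: "pos_semidef (matrix_sqrt A)" "matrix_sqrt A ** matrix_sqrt A = A" using matrix_sqrt[OF A] by auto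
  show "pos_semidef (sqrt r *\<^sub>R matrix_sqrt A)"
    using S(1) r by (auto simp: pos_semidef_def transpose_def vec_eq_iff simp flip: scaleR_matrix_vector_assoc)
  show "(sqrt r *\<^sub>R matrix_sqrt A) ** (sqrt r *\<^sub>R matrix_sqrt A) = r *\<^sub>R A"
    using r S(2) by (simp add: matrix_eq flip: matrix_vector_mul_assoc scaleR_matrix_vector_assoc)
      (simp add: matrix_vector_mult_scaleR matrix_vector_mul_assoc)
qed

section \<open>Asymptotics of the posterior density\<close>

text \<open>Outer measure is dominated by the measure of any covering event. Q itself may thus
  involve uncountably many parameters or an arbitrary maximiser, as long as the exceptional A is an
  event.\<close>

lemma prob_vanishesI:
  assumes M: "prob_space M"
    and ev: "\<And>\<eta>. 0 < \<eta> \<Longrightarrow> \<forall>\<^sub>F n in sequentially. \<exists>A\<in>sets M. measure M A < \<eta> \<and> (\<forall>\<omega>\<in>space M - A. \<not> Q n \<omega>)"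
  shows "prob_vanishes M Q"
  unfolding prob_vanishes_def
proof (rule order_tendstoI)
  interpret prob_space M by (rule M)
  fix a :: ennreal assume a: "0 < a"
  obtain \<eta> where \<eta>: "0 < \<eta>" "ennreal \<eta> < a"
  proof (cases a rule: ennreal_cases)
    case (real r)
    then have "0 < r" using a by simp
    then show thesis using that[of "r / 2"] real by (simp add: ennreal_lessI)
  next
    case top
    then show thesis using that[of 1] by simp
  qed
  from ev[OF \<eta>(1)] show "\<forall>\<^sub>F n in sequentially. outer_measure_of M {\<omega> \<in> space M. Q n \<omega>} < a"
  proof eventually_elim
    case (elim n)
    then obtain A where A: "A \<in> sets M" "measure M A < \<eta>" "\<forall>\<omega>\<in>space M - A. \<not> Q n \<omega>" by blast
    have "outer_measure_of M {\<omega> \<in> space M. Q n \<omega>} \<le> emeasure M A"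
      unfolding outer_measure_of_def by (rule INF_lower) (use A in auto)
    also have "\<dots> = ennreal (measure M A)" by (rule emeasure_eq_measure)
    also have "\<dots> \<le> ennreal \<eta>" using A(2) by (intro ennreal_leI) simp
    finally show ?case using \<eta>(2) by simp
  qed
qed simp

text \<open>Disposes of the far zone in Laplace's method, where magnification multiplies the prior
  mass by n^(d/2).\<close>

lemma power_exp_decay:
  assumes a: "0 < a" and e: "0 < e"
  shows "\<forall>\<^sub>F n in sequentially. exp (- a * (sqrt (real n))\<^sup>2) * sqrt (real n) ^ d \<le> e"
proof -
  have "((\<lambda>x::real. x ^ d / exp x) \<longlongrightarrow> 0) at_top" by (rule tendsto_power_div_exp_0)
  moreover have "filterlim (\<lambda>n. a * real n) at_top sequentially"
    using a by (intro filterlim_tendsto_pos_mult_at_top[OF tendsto_const] filterlim_real_sequentially)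
  ultimately have "(\<lambda>n. (a * real n) ^ d / exp (a * real n)) \<longlonglongrightarrow> 0" by (rule filterlim_compose)
  then have "\<forall>\<^sub>F n in sequentially. (a * real n) ^ d / exp (a * real n) < e * a ^ d"
    using e a by (intro order_tendstoD) auto
  then show ?thesis using eventually_gt_at_top[of 0]
  proof eventually_elim
    case (elim n)
    have "real n \<le> real n * real n" using elim(2) mult_left_mono[of 1 "real n" "real n"] by simp
    then have "sqrt (real n) \<le> real n" by (intro real_le_lsqrt) (auto simp: power2_eq_square)
    then have "sqrt (real n) ^ d \<le> real n ^ d" by (intro power_mono) auto
    then have "exp (- a * real n) * sqrt (real n) ^ d \<le> exp (- a * real n) * real n ^ d" by (intro mult_left_mono) auto
    moreover have "real n ^ d / exp (a * real n) < e"
      using elim(1) a by (simp add: power_mult_distrib mult.commute[of e] flip: times_divide_eq_right)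
    moreover have "exp (- a * real n) * real n ^ d = real n ^ d / exp (a * real n)"
      by (simp add: exp_minus divide_inverse mult.commute)
    moreover have sq: "(sqrt (real n))\<^sup>2 = real n" by simp
    ultimately show ?case unfolding sq by linarith
  qed
qed

lemma integral_pos_if_pos_on_ball:
  fixes f :: "'a::euclidean_space \<Rightarrow> real"
  assumes f: "integrable lborel f" "\<And>x. 0 \<le> f x" and s: "0 < s" "\<And>x. x \<in> ball a s \<Longrightarrow> 0 < f x"
  shows "0 < (\<integral>x. f x \<partial>lborel)"
proof (rule ccontr)
  assume "\<not> 0 < (\<integral>x. f x \<partial>lborel)"
  then have "(\<integral>x. f x \<partial>lborel) = 0" using Bochner_Integration.integral_nonneg[of lborel f] f(2) by (simp add: order_antisym_conv)
  then have "AE x in lborel. f x = 0" using f by (simp add: integral_nonneg_eq_0_iff_AE)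
  then have "AE x in lborel. x \<notin> ball a s" by (rule eventually_mono) (metis less_irrefl s(2))
  then have "emeasure lborel (ball a s) = 0" by (subst (asm) AE_iff_measurable[OF _ refl]) (auto simp: ball_def)
  moreover have "0 < measure lborel (ball a s)" using s(1) content_ball_pos[of s a] by simp
  ultimately show False by (simp add: measure_def)
qed

text \<open>Coding the tuple as a list makes any function of n simple functions simple by
  composition.\<close>

lemma simple_function_tuple:
  assumes "\<And>i. i < n \<Longrightarrow> simple_function M (f i)"
  shows "simple_function M (\<lambda>x. map (\<lambda>i. f i x) [0..<n])"
  using assms
proof (induction n)
  case (Suc n)
  then have "simple_function M (\<lambda>x. map (\<lambda>i. f i x) [0..<n])" "simple_function M (f n)" by auto
  then have "simple_function M (\<lambda>x. map (\<lambda>i. f i x) [0..<n] @ [f n x])"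
    by (rule simple_function_compose2[where h = "\<lambda>xs y. xs @ [y]"])
  then show ?case by simp
qed simp

section \<open>The posterior for an abstract estimating function\<close>

text \<open>The prior enters through its total mass and its behaviour near \<zeta>0.
  \<open>simple\<close> records that \<open>m z\<close> is a step function of the parameter, from
  which measurability of the ratio follows.\<close>

locale el_posterior = el_sample M N P Z m osc G B Bo L \<zeta>0 D V Vi \<kappa> \<kappa>V
  for M :: "'w measure" and N P :: "'z measure" and Z and m :: "'z \<Rightarrow> 'a::euclidean_space \<Rightarrow> 'a"
    and osc G B Bo L \<zeta>0 D V Vi \<kappa> \<kappa>V +
  fixes p0 :: "'a \<Rightarrow> real" and zhat :: "nat \<Rightarrow> 'w \<Rightarrow> 'a" and U :: "'a set"
  assumes simple: "\<And>z. simple_function borel (m z)"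
    and p0: "p0 \<in> borel_measurable borel" "\<And>\<zeta>. 0 \<le> p0 \<zeta>" "integrable lborel p0" "(\<integral>\<zeta>. p0 \<zeta> \<partial>lborel) = 1"
    and p0_pos: "\<forall>\<^sub>F \<zeta> in nhds \<zeta>0. 0 < p0 \<zeta>" and p0_cont: "isCont (\<lambda>\<zeta>. ln (p0 \<zeta>)) \<zeta>0"
    and U: "\<zeta>0 \<in> interior U" "\<forall>n. \<forall>\<omega>\<in>space M. \<forall>\<zeta>\<in>U. ratio n \<omega> \<zeta> \<le> ratio n \<omega> (zhat n \<omega>)"
begin

declare p0(1) [measurable]

text \<open>\<zeta> enters only through n vectors, each of which takes finitely many values; the
  ratio is therefore a simple function of \<zeta>, whatever the regularity of \<open>elr\<close> in
  its vectors.\<close>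

lemma ratio_measurable [measurable]: "ratio n \<omega> \<in> borel_measurable borel"
proof -
  have "simple_function borel (\<lambda>\<zeta>. map (\<lambda>i. m (Z i \<omega>) \<zeta>) [0..<n])"
    by (rule simple_function_tuple) (rule simple)
  then have "simple_function borel ((\<lambda>xs. elr n (\<lambda>i. xs ! i)) \<circ> (\<lambda>\<zeta>. map (\<lambda>i. m (Z i \<omega>) \<zeta>) [0..<n]))"
    by (rule simple_function_compose)
  moreover have "(\<lambda>xs. elr n (\<lambda>i. xs ! i)) \<circ> (\<lambda>\<zeta>. map (\<lambda>i. m (Z i \<omega>) \<zeta>) [0..<n]) = ratio n \<omega>"
    by (auto simp: fun_eq_iff ratio_def intro!: elr_cong)
  ultimately show ?thesis by (metis borel_measurable_simple_function)
qed

lemma ratio_bounds: "0 \<le> ratio n \<omega> \<zeta>" "ratio n \<omega> \<zeta> \<le> 1"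
  by (simp_all add: ratio_def elr_nonneg elr_le_1)

lemma integrable_p0_ratio: "integrable lborel (\<lambda>\<zeta>. p0 \<zeta> * ratio n \<omega> \<zeta>)"
proof (rule Bochner_Integration.integrable_bound[OF p0(3)])
  show "AE \<zeta> in lborel. norm (p0 \<zeta> * ratio n \<omega> \<zeta>) \<le> norm (p0 \<zeta>)"
    using p0(2) ratio_bounds by (auto simp: abs_mult intro!: mult_left_le)
qed measurable

lemma prior_near:
  assumes "0 < e"
  shows "\<exists>\<delta>>0. \<forall>\<zeta>. norm (\<zeta> - \<zeta>0) \<le> \<delta> \<longrightarrow> 0 < p0 \<zeta> \<and> \<bar>ln (p0 \<zeta>) - ln (p0 \<zeta>0)\<bar> \<le> e"
proof -
  have "\<forall>\<^sub>F \<zeta> in nhds \<zeta>0. dist (ln (p0 \<zeta>)) (ln (p0 \<zeta>0)) < e"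
  proof (rule tendstoD[OF _ assms])
    show "((\<lambda>\<zeta>. ln (p0 \<zeta>)) \<longlongrightarrow> ln (p0 \<zeta>0)) (nhds \<zeta>0)"
      using p0_cont tendsto_at_iff_tendsto_nhds[of "\<lambda>\<zeta>. ln (p0 \<zeta>)" \<zeta>0] by (simp add: isCont_def)
  qed
  with p0_pos have "\<forall>\<^sub>F \<zeta> in nhds \<zeta>0. 0 < p0 \<zeta> \<and> dist (ln (p0 \<zeta>)) (ln (p0 \<zeta>0)) < e" by (rule eventually_conj)
  then obtain d where d: "0 < d" "\<And>\<zeta>. dist \<zeta> \<zeta>0 < d \<Longrightarrow> 0 < p0 \<zeta> \<and> dist (ln (p0 \<zeta>)) (ln (p0 \<zeta>0)) < e"
    unfolding eventually_nhds_metric by blast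
  show ?thesis
  proof (intro exI[of _ "d / 2"] conjI allI impI)
    fix \<zeta> assume "norm (\<zeta> - \<zeta>0) \<le> d / 2"
    then have "dist \<zeta> \<zeta>0 < d" using d(1) unfolding dist_norm by linarith
    from d(2)[OF this] show "0 < p0 \<zeta>" "\<bar>ln (p0 \<zeta>) - ln (p0 \<zeta>0)\<bar> \<le> e" by (auto simp: dist_real_def)
  qed (use d(1) in simp)
qed

lemma p0_center: "0 < p0 \<zeta>0"
  using p0_pos by (rule eventually_nhds_x_imp_x)

lemma qf_scale: "qf (c *\<^sub>R h) = c\<^sup>2 * qf h"
  by (simp add: qf_def linear_cmul[OF bounded_linear.linear[OF bounded_linear_D]] linear_cmul[OF linear_Vi] power2_eq_square)

text \<open>The remainder is defined as the exact logarithmic discrepancy, so the identity holds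
  wherever the density is positive and only its size is at stake: \<epsilon>/2 for the variation of
  ln p0 over the shrinking set, \<epsilon>/2 for the local expansion. The same constant c serves all
  sequences S.\<close>

lemma posterior_expansion:
  assumes Z: "\<And>n \<omega>. pd n \<omega> = (\<lambda>\<zeta>. p0 \<zeta> * ratio n \<omega> \<zeta> / (\<integral>\<xi>. p0 \<xi> * ratio n \<omega> \<xi> \<partial>lborel))"
  shows "\<exists>c. (\<forall>n \<omega>. 0 < c n \<omega>) \<and>
    (\<forall>S. (\<exists>C. \<forall>\<^sub>F n in sequentially. \<forall>\<zeta>\<in>S n. norm (\<zeta> - \<zeta>0) \<le> C / sqrt (real n)) \<longrightarrow>
       (\<exists>Rem. small_op1_on M S Rem \<and>
          prob_vanishes M (\<lambda>n \<omega>. \<not> (\<forall>\<zeta>\<in>S n. pd n \<omega> \<zeta> =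
            c n \<omega> * exp (- 1 / 2 * (real n * qf (\<zeta> - zhat n \<omega>)) + Rem n \<omega> \<zeta>)))))"
proof -
  \<comment> \<open>The density at the maximiser with the prior frozen at \<zeta>0; the default 1
    keeps the constant positive on exceptional samples.\<close>
  define c where "c = (\<lambda>n \<omega>. let k = p0 \<zeta>0 * ratio n \<omega> (zhat n \<omega>) / (\<integral>\<xi>. p0 \<xi> * ratio n \<omega> \<xi> \<partial>lborel) in if 0 < k then k else 1)"
  define Rem where "Rem = (\<lambda>n \<omega> \<zeta>. ln (pd n \<omega> \<zeta> / c n \<omega>) + 1 / 2 * (real n * qf (\<zeta> - zhat n \<omega>)))"
  obtain \<kappa>t \<delta>t where ing: "\<forall>\<eta>>0. \<exists>C0>0. mostly_localised zhat \<kappa>t \<delta>t \<eta> C0"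
    using posterior_ingredients[OF U] by (elim exE conjE) (rule that)
  have cpos: "0 < c n \<omega>" for n \<omega> by (simp add: c_def Let_def)
  have key: "\<forall>\<^sub>F n in sequentially. \<exists>A\<in>events. prob A < \<eta> \<and> (\<forall>\<omega>\<in>space M - A. \<forall>\<zeta>\<in>S n.
      pd n \<omega> \<zeta> = c n \<omega> * exp (- 1 / 2 * (real n * qf (\<zeta> - zhat n \<omega>)) + Rem n \<omega> \<zeta>) \<and> \<bar>Rem n \<omega> \<zeta>\<bar> \<le> \<epsilon>)"
    if S: "\<forall>\<^sub>F n in sequentially. \<forall>\<zeta>\<in>S n. norm (\<zeta> - \<zeta>0) \<le> C / sqrt (real n)" and \<epsilon>: "0 < \<epsilon>" and \<eta>: "0 < \<eta>" for S C \<epsilon> \<eta>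
  proof -
    \<comment> \<open>A positive radius, needed for the localisation and for the ball on which the
      normalising integrand is positive.\<close>
    define C' where "C' = max C 1"
    have C': "0 < C'" "C \<le> C'" by (auto simp: C'_def)
    have \<epsilon>2: "0 < \<epsilon> / 2" using \<epsilon> by simp
    obtain \<delta> where \<delta>: "0 < \<delta>" "\<And>\<zeta>. norm (\<zeta> - \<zeta>0) \<le> \<delta> \<Longrightarrow> 0 < p0 \<zeta> \<and> \<bar>ln (p0 \<zeta>) - ln (p0 \<zeta>0)\<bar> \<le> \<epsilon> / 2"
      using prior_near[OF \<epsilon>2] by blast
    obtain C0 where C0: "mostly_localised zhat \<kappa>t \<delta>t \<eta> C0"
      using ing[rule_format, OF \<eta>] by (elim exE conjE) (rule that)
    from C0[rule_format, OF C'(1) \<epsilon>2] S eventually_gt_at_top[of 0] eventually_div_sqrt_le[OF \<delta>(1), of C']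
    show ?thesis
    proof eventually_elim
      case (elim n)
      define r where "r = sqrt (real n)"
      have r0: "0 < r" and rr: "r\<^sup>2 = real n" using elim(3) by (auto simp: r_def)
      obtain A where A: "A \<in> events" "prob A < \<eta>" and
        AR: "\<And>\<omega>. \<omega> \<in> space M - A \<Longrightarrow> exp (- 1) \<le> ratio n \<omega> (zhat n \<omega>)" and
        AL: "\<And>\<omega> h. \<omega> \<in> space M - A \<Longrightarrow> norm h \<le> C' \<Longrightarrow> 0 < ratio n \<omega> (\<zeta>0 + (1 / r) *\<^sub>R h) \<and>
          \<bar>ln (ratio n \<omega> (\<zeta>0 + (1 / r) *\<^sub>R h)) - ln (ratio n \<omega> (zhat n \<omega>)) + qf (h - r *\<^sub>R (zhat n \<omega> - \<zeta>0)) / 2\<bar> \<le> \<epsilon> / 2"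
        using elim(1) unfolding r_def by blast
      have main: "pd n \<omega> \<zeta> = c n \<omega> * exp (- 1 / 2 * (real n * qf (\<zeta> - zhat n \<omega>)) + Rem n \<omega> \<zeta>) \<and> \<bar>Rem n \<omega> \<zeta>\<bar> \<le> \<epsilon>"
        if \<omega>: "\<omega> \<in> space M - A" and \<zeta>: "\<zeta> \<in> S n" for \<omega> \<zeta>
      proof -
        have loc: "0 < p0 \<xi> \<and> 0 < ratio n \<omega> \<xi> \<and> \<bar>ln (p0 \<xi>) - ln (p0 \<zeta>0)\<bar> \<le> \<epsilon> / 2 \<and>
           \<bar>ln (ratio n \<omega> \<xi>) - ln (ratio n \<omega> (zhat n \<omega>)) + real n * qf (\<xi> - zhat n \<omega>) / 2\<bar> \<le> \<epsilon> / 2"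
          if \<xi>: "norm (\<xi> - \<zeta>0) \<le> C' / r" for \<xi>
        proof -
          define h where "h = r *\<^sub>R (\<xi> - \<zeta>0)"
          have h: "\<zeta>0 + (1 / r) *\<^sub>R h = \<xi>" "h - r *\<^sub>R (zhat n \<omega> - \<zeta>0) = r *\<^sub>R (\<xi> - zhat n \<omega>)"
            using r0 by (simp_all add: h_def scaleR_diff_right)
          have "norm h = r * norm (\<xi> - \<zeta>0)" using r0 by (simp add: h_def)
          then have nh: "norm h \<le> C'" using \<xi> r0 by (simp add: pos_le_divide_eq mult.commute)
          have "norm (\<xi> - \<zeta>0) \<le> \<delta>" using \<xi> elim(4) by (simp add: r_def)
          then show ?thesis using \<delta>(2) AL[OF \<omega> nh] unfolding h qf_scale rr by simp
        qed
        have Zpos: "0 < (\<integral>\<xi>. p0 \<xi> * ratio n \<omega> \<xi> \<partial>lborel)"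
        proof (rule integral_pos_if_pos_on_ball[OF integrable_p0_ratio])
          show "0 \<le> p0 \<xi> * ratio n \<omega> \<xi>" for \<xi> using p0(2) ratio_bounds(1) by simp
          show "0 < C' / r" using C' r0 by simp
          show "0 < p0 \<xi> * ratio n \<omega> \<xi>" if "\<xi> \<in> ball \<zeta>0 (C' / r)" for \<xi>
            using loc[of \<xi>] that by (simp add: dist_norm norm_minus_commute)
        qed
        have Rh: "0 < ratio n \<omega> (zhat n \<omega>)" using AR[OF \<omega>] exp_gt_zero less_le_trans by blast
        have cn: "c n \<omega> = p0 \<zeta>0 * ratio n \<omega> (zhat n \<omega>) / (\<integral>\<xi>. p0 \<xi> * ratio n \<omega> \<xi> \<partial>lborel)"
          using Zpos Rh p0_center by (simp add: c_def Let_def)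
        have "C / r \<le> C' / r" using C'(2) r0 by (intro divide_right_mono) auto
        then have "norm (\<zeta> - \<zeta>0) \<le> C' / r" using elim(2) \<zeta> unfolding r_def by force
        note l = loc[OF this]
        have q: "pd n \<omega> \<zeta> / c n \<omega> = (p0 \<zeta> * ratio n \<omega> \<zeta>) / (p0 \<zeta>0 * ratio n \<omega> (zhat n \<omega>))"
          unfolding Z cn using Zpos by simp
        have qpos: "0 < pd n \<omega> \<zeta> / c n \<omega>" unfolding q using l Rh p0_center by simp
        have "ln (pd n \<omega> \<zeta> / c n \<omega>) = ln (p0 \<zeta>) + ln (ratio n \<omega> \<zeta>) - (ln (p0 \<zeta>0) + ln (ratio n \<omega> (zhat n \<omega>)))"
          unfolding q using l Rh p0_center by (simp add: ln_div ln_mult)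
        then have "\<bar>Rem n \<omega> \<zeta>\<bar> \<le> \<epsilon>" using l unfolding Rem_def abs_le_iff by (simp add: algebra_simps)
        moreover have "pd n \<omega> \<zeta> = c n \<omega> * exp (- 1 / 2 * (real n * qf (\<zeta> - zhat n \<omega>)) + Rem n \<omega> \<zeta>)"
          using qpos cpos[of n \<omega>] by (simp add: Rem_def)
        ultimately show ?thesis by blast
      qed
      show ?case by (rule bexI[OF _ A(1)], rule conjI[OF A(2)]) (intro ballI main)
    qed
  qed
  show ?thesis
  proof (intro exI[of _ c] conjI allI impI cpos)
    fix S assume "\<exists>C. \<forall>\<^sub>F n in sequentially. \<forall>\<zeta>\<in>S n. norm (\<zeta> - \<zeta>0) \<le> C / sqrt (real n)"
    then obtain C where S: "\<forall>\<^sub>F n in sequentially. \<forall>\<zeta>\<in>S n. norm (\<zeta> - \<zeta>0) \<le> C / sqrt (real n)" by blast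
    show "\<exists>Rem. small_op1_on M S Rem \<and> prob_vanishes M (\<lambda>n \<omega>. \<not> (\<forall>\<zeta>\<in>S n. pd n \<omega> \<zeta> =
            c n \<omega> * exp (- 1 / 2 * (real n * qf (\<zeta> - zhat n \<omega>)) + Rem n \<omega> \<zeta>)))"
    proof (intro exI[of _ Rem] conjI)
      show "small_op1_on M S Rem" unfolding small_op1_on_def
      proof (intro allI impI prob_vanishesI[OF prob_space_axioms])
        fix \<epsilon> \<eta> :: real assume e: "0 < \<epsilon>" "0 < \<eta>"
        show "\<forall>\<^sub>F n in sequentially. \<exists>A\<in>events. prob A < \<eta> \<and> (\<forall>\<omega>\<in>space M - A. \<not> (\<exists>z\<in>S n. \<epsilon> < \<bar>Rem n \<omega> z\<bar>))"
          by (rule eventually_mono[OF key[OF S e]]) (meson not_less)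
      qed
      show "prob_vanishes M (\<lambda>n \<omega>. \<not> (\<forall>\<zeta>\<in>S n. pd n \<omega> \<zeta> =
            c n \<omega> * exp (- 1 / 2 * (real n * qf (\<zeta> - zhat n \<omega>)) + Rem n \<omega> \<zeta>)))"
      proof (rule prob_vanishesI[OF prob_space_axioms])
        fix \<eta> :: real assume e: "0 < \<eta>"
        show "\<forall>\<^sub>F n in sequentially. \<exists>A\<in>events. prob A < \<eta> \<and> (\<forall>\<omega>\<in>space M - A. \<not> \<not> (\<forall>\<zeta>\<in>S n. pd n \<omega> \<zeta> =
            c n \<omega> * exp (- 1 / 2 * (real n * qf (\<zeta> - zhat n \<omega>)) + Rem n \<omega> \<zeta>)))"
          by (rule eventually_mono[OF key[OF S zero_less_one e]]) blast
      qed
    qed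
  qed
qed

text \<open>In magnified coordinates the weight is compared in L1 with a Gaussian centred at the
  random point \<open>hh\<close>, while the test function becomes g (S (h - hh)); translation
  invariance then removes \<open>hh\<close> from the limit. Turning that limit into a standard
  normal integral is a separate change of variables.\<close>

lemma posterior_weak_convergence:
  fixes S :: "'a \<Rightarrow> 'a" and g :: "'a \<Rightarrow> real"
  assumes S: "S \<in> borel_measurable borel" and Sn: "\<And>n h. T n (h::'a) = sqrt (real n) *\<^sub>R S h"
    and lin: "linear S"
    and g: "g \<in> borel_measurable borel" "\<And>x. \<bar>g x\<bar> \<le> b" and \<epsilon>: "0 < \<epsilon>"
  shows "prob_vanishes M (\<lambda>n \<omega>. \<epsilon> < \<bar>(\<integral>z. g z \<partial>distr (density lborel
      (\<lambda>\<zeta>. ennreal (p0 \<zeta> * ratio n \<omega> \<zeta> / (\<integral>\<xi>. p0 \<xi> * ratio n \<omega> \<xi> \<partial>lborel)))) borel (\<lambda>\<zeta>. T n (\<zeta> - zhat n \<omega>)))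
      - (\<integral>h. g (S h) * exp (- qf h / 2) \<partial>lborel) / (\<integral>h. exp (- qf h / 2) \<partial>lborel)\<bar>)"
proof (rule prob_vanishesI[OF prob_space_axioms])
  fix \<eta> :: real assume \<eta>: "0 < \<eta>"
  note [measurable] = S g(1)
  obtain \<alpha> where \<alpha>: "\<alpha> > 0" "\<And>h. \<alpha> * (norm h)\<^sup>2 \<le> qf h" using qf_bounds by blast
  have qfm[measurable]: "qf \<in> borel_measurable borel"
  proof -
    have [measurable]: "D \<in> borel_measurable borel" "Vi \<in> borel_measurable borel"
      using bounded_linear_D linear_Vi
      by (auto intro!: borel_measurable_continuous_onI linear_continuous_on simp: linear_conv_bounded_linear)
    show ?thesis unfolding qf_def by measurable
  qed
  have b: "0 \<le> b" using g(2)[of 0] by simp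
  have i\<phi>: "integrable lborel (\<lambda>h. exp (- qf h / 2))"
  proof (rule Bochner_Integration.integrable_bound[OF integrable_gauss[of "\<alpha> / 2"]])
    show "AE h in lborel. norm (exp (- qf h / 2)) \<le> norm (exp (- (\<alpha> / 2) * (norm h)\<^sup>2))"
      using \<alpha>(2) by (intro AE_I2) simp
  qed (use \<alpha>(1) in auto)
  define I where "I = (\<integral>h. exp (- qf h / 2) \<partial>lborel)"
  have I: "0 < I" unfolding I_def by (rule integral_pos_if_pos_on_ball[OF i\<phi>, of 1 0]) auto
  \<comment> \<open>\<open>ratio_of_integrals\<close> turns an L1 error d into 2 b d / I; the + 1
    avoids a division by 0 when b = 0. Each of the three zones gets d0 / 3.\<close>
  define d0 where "d0 = \<epsilon> * I / (2 * b + 1)"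
  have d0: "0 < d0" using \<epsilon> I b by (simp add: d0_def)
  obtain c \<delta>t where c: "c > 0" and \<delta>t: "\<delta>t > 0" and ing: "\<forall>\<eta>>0. \<exists>C0>0. mostly_localised zhat c \<delta>t \<eta> C0"
    using posterior_ingredients[OF U] by (elim exE conjE) (rule that)
  \<comment> \<open>Accuracy ln 2 on the logarithmic scale is the bound of the prior by twice its
    value at \<zeta>0.\<close>
  obtain \<delta>p where \<delta>p: "0 < \<delta>p" "\<And>\<zeta>. norm (\<zeta> - \<zeta>0) \<le> \<delta>p \<Longrightarrow> 0 < p0 \<zeta> \<and> \<bar>ln (p0 \<zeta>) - ln (p0 \<zeta>0)\<bar> \<le> ln 2"
    using prior_near[of "ln 2"] by auto
  define \<delta> where "\<delta> = min \<delta>t \<delta>p"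
  have \<delta>: "0 < \<delta>" "\<delta> \<le> \<delta>t" "\<delta> \<le> \<delta>p" using \<delta>t \<delta>p by (auto simp: \<delta>_def)
  have pd: "p0 \<zeta> \<le> 2 * p0 \<zeta>0" if "norm (\<zeta> - \<zeta>0) \<le> \<delta>" for \<zeta>
  proof -
    have p: "0 < p0 \<zeta>" "\<bar>ln (p0 \<zeta>) - ln (p0 \<zeta>0)\<bar> \<le> ln 2" using \<delta>p(2)[of \<zeta>] that \<delta>(3) by auto
    then have "ln (p0 \<zeta>) \<le> ln (2 * p0 \<zeta>0)" using p0_center by (simp add: ln_mult abs_le_iff)
    then show ?thesis using p(1) p0_center by simp
  qed
  obtain C0 where C0pos: "C0 > 0" and C0: "mostly_localised zhat c \<delta>t \<eta> C0"
    using ing[rule_format, OF \<eta>] by (elim exE conjE) (rule that)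
  define c' where "c' = min c (\<alpha> / 8)"
  have c': "0 < c'" "c' \<le> c" "c' \<le> \<alpha> / 8" using c \<alpha>(1) by (auto simp: c'_def)
  define E where "E = (2 * exp 1 + 1 :: real)"
  have E: "0 < E" unfolding E_def by (simp add: add_pos_pos)
  have d3: "0 < d0 / (3 * E)" using d0 E by simp
  obtain Ct where Ct: "\<And>C. Ct \<le> C \<Longrightarrow> (\<integral>h. indicator {h. C < norm h} h * exp (- c' * (norm (h::'a))\<^sup>2) \<partial>lborel) \<le> d0 / (3 * E)"
    using gauss_tail[OF c'(1) d3, where 'a = 'a] by blast
  \<comment> \<open>2 C0 for the comparison of |h - hh| with |h|, \<open>Ct\<close> for the Gaussian
    tail. The accuracy \<open>e1\<close> comes after C because it has to beat the volume of the ball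
    of radius C.\<close>
  define C where "C = max (2 * C0) (max Ct 1)"
  have C: "2 * C0 \<le> C" "0 < C" "Ct \<le> C" by (auto simp: C_def)
  define vol where "vol = measure lborel (cball (0::'a) C)"
  have vol: "0 \<le> vol" by (simp add: vol_def)
  define e1 where "e1 = min (1/2) (d0 / (6 * (vol + 1)))"
  have e1: "0 < e1" "e1 \<le> 1/2" "2 * e1 * vol \<le> d0 / 3"
  proof -
    show "0 < e1" using d0 vol by (auto simp: e1_def)
    show "e1 \<le> 1/2" unfolding e1_def by (rule min.cobounded1)
    have "e1 \<le> d0 / (6 * (vol + 1))" by (simp add: e1_def)
    then have "e1 * vol \<le> d0 / (6 * (vol + 1)) * vol" using vol by (intro mult_right_mono) auto
    also have "\<dots> \<le> d0 / 6" using vol d0 by (simp add: field_simps)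
    finally show "2 * e1 * vol \<le> d0 / 3" by simp
  qed
  have e12: "0 < e1 / 2" using e1 by simp
  obtain \<delta>1 where \<delta>1: "0 < \<delta>1" "\<And>\<zeta>. norm (\<zeta> - \<zeta>0) \<le> \<delta>1 \<Longrightarrow> 0 < p0 \<zeta> \<and> \<bar>ln (p0 \<zeta>) - ln (p0 \<zeta>0)\<bar> \<le> e1 / 2"
    using prior_near[OF e12] by blast
  have d4: "0 < d0 / 3 * p0 \<zeta>0 / exp 1" using d0 p0_center by simp
  have a4: "0 < c * \<delta>\<^sup>2" using c \<delta>(1) by simp
  from C0[rule_format, OF C(2) e12] eventually_gt_at_top[of 0] eventually_div_sqrt_le[OF \<delta>1(1), of C] power_exp_decay[OF a4 d4, of "DIM('a)"]
  show "\<forall>\<^sub>F n in sequentially. \<exists>A\<in>events. prob A < \<eta> \<and> (\<forall>\<omega>\<in>space M - A. \<not> \<epsilon> < \<bar>(\<integral>z. g z \<partial>distr (density lborel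
      (\<lambda>\<zeta>. ennreal (p0 \<zeta> * ratio n \<omega> \<zeta> / (\<integral>\<xi>. p0 \<xi> * ratio n \<omega> \<xi> \<partial>lborel)))) borel (\<lambda>\<zeta>. T n (\<zeta> - zhat n \<omega>)))
      - (\<integral>h. g (S h) * exp (- qf h / 2) \<partial>lborel) / (\<integral>h. exp (- qf h / 2) \<partial>lborel)\<bar>)"
  proof eventually_elim
    case (elim n)
    define r where "r = sqrt (real n)"
    have r0: "0 < r" and rr: "r\<^sup>2 = real n" using elim(2) by (auto simp: r_def)
    obtain A where A: "A \<in> events" "prob A < \<eta>" and
      AR: "\<And>\<omega>. \<omega> \<in> space M - A \<Longrightarrow> norm (zhat n \<omega> - \<zeta>0) \<le> C0 / r \<and> exp (- 1) \<le> ratio n \<omega> (zhat n \<omega>)" and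
      AL: "\<And>\<omega> h. \<omega> \<in> space M - A \<Longrightarrow> norm h \<le> C \<Longrightarrow> 0 < ratio n \<omega> (\<zeta>0 + (1 / r) *\<^sub>R h) \<and>
          \<bar>ln (ratio n \<omega> (\<zeta>0 + (1 / r) *\<^sub>R h)) - ln (ratio n \<omega> (zhat n \<omega>)) + qf (h - r *\<^sub>R (zhat n \<omega> - \<zeta>0)) / 2\<bar> \<le> e1 / 2" and
      AT: "\<And>\<omega> \<zeta>. \<omega> \<in> space M - A \<Longrightarrow> C0 / r \<le> norm (\<zeta> - \<zeta>0) \<Longrightarrow> ratio n \<omega> \<zeta> \<le> exp (- c * real n * (min (norm (\<zeta> - \<zeta>0)) \<delta>t)\<^sup>2)"
      using elim(1) unfolding r_def by blast
    have main: "\<bar>(\<integral>z. g z \<partial>distr (density lborel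
      (\<lambda>\<zeta>. ennreal (p0 \<zeta> * ratio n \<omega> \<zeta> / (\<integral>\<xi>. p0 \<xi> * ratio n \<omega> \<xi> \<partial>lborel)))) borel (\<lambda>\<zeta>. T n (\<zeta> - zhat n \<omega>)))
      - (\<integral>h. g (S h) * exp (- qf h / 2) \<partial>lborel) / I\<bar> \<le> \<epsilon>"
      if \<omega>: "\<omega> \<in> space M - A" for \<omega>
    proof -
      define hh where "hh = r *\<^sub>R (zhat n \<omega> - \<zeta>0)"
      define Rh where "Rh = ratio n \<omega> (zhat n \<omega>)"
      have Rh: "exp (- 1) \<le> Rh" using AR[OF \<omega>] by (simp add: Rh_def)
      then have Rh0: "0 < Rh" using exp_gt_zero less_le_trans by blast
      have "norm hh = r * norm (zhat n \<omega> - \<zeta>0)" using r0 by (simp add: hh_def)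
      then have nhh: "norm hh \<le> C0" using AR[OF \<omega>] r0 by (simp add: pos_le_divide_eq mult.commute)
      define w where "w = (\<lambda>h. p0 (\<zeta>0 + (1 / r) *\<^sub>R h) * ratio n \<omega> (\<zeta>0 + (1 / r) *\<^sub>R h) / (p0 \<zeta>0 * Rh))"
      define \<phi> where "\<phi> = (\<lambda>h. exp (- qf (h - hh) / 2))"
      have near: "0 < p0 (\<zeta>0 + (1 / r) *\<^sub>R h) * ratio n \<omega> (\<zeta>0 + (1 / r) *\<^sub>R h) \<and>
        \<bar>ln (p0 (\<zeta>0 + (1 / r) *\<^sub>R h) * ratio n \<omega> (\<zeta>0 + (1 / r) *\<^sub>R h) / (p0 \<zeta>0 * Rh)) + qf (h - hh) / 2\<bar> \<le> e1"
        if h: "norm h \<le> C" for h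
      proof -
        have "norm (\<zeta>0 + (1 / r) *\<^sub>R h - \<zeta>0) = norm h / r" using r0 by simp
        also have "\<dots> \<le> C / r" using h r0 by (intro divide_right_mono) auto
        also have "\<dots> \<le> \<delta>1" using elim(3) by (simp add: r_def)
        finally have p: "0 < p0 (\<zeta>0 + (1 / r) *\<^sub>R h)" "\<bar>ln (p0 (\<zeta>0 + (1 / r) *\<^sub>R h)) - ln (p0 \<zeta>0)\<bar> \<le> e1 / 2" using \<delta>1(2) by auto
        have l: "0 < ratio n \<omega> (\<zeta>0 + (1 / r) *\<^sub>R h)"
          "\<bar>ln (ratio n \<omega> (\<zeta>0 + (1 / r) *\<^sub>R h)) - ln Rh + qf (h - hh) / 2\<bar> \<le> e1 / 2"
          using AL[OF \<omega> h] by (auto simp: Rh_def hh_def)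
        have "ln (p0 (\<zeta>0 + (1 / r) *\<^sub>R h) * ratio n \<omega> (\<zeta>0 + (1 / r) *\<^sub>R h) / (p0 \<zeta>0 * Rh))
          = ln (p0 (\<zeta>0 + (1 / r) *\<^sub>R h)) + ln (ratio n \<omega> (\<zeta>0 + (1 / r) *\<^sub>R h)) - (ln (p0 \<zeta>0) + ln Rh)"
          using p(1) l(1) Rh0 p0_center by (simp add: ln_div ln_mult)
        then show ?thesis using p l mult_pos_pos[OF p(1) l(1)] unfolding abs_le_iff by linarith
      qed
      have far: "ratio n \<omega> \<zeta> \<le> exp (- c * r\<^sup>2 * (min (norm (\<zeta> - \<zeta>0)) \<delta>)\<^sup>2)" if "C0 / r \<le> norm (\<zeta> - \<zeta>0)" for \<zeta>
      proof -
        have "(min (norm (\<zeta> - \<zeta>0)) \<delta>)\<^sup>2 \<le> (min (norm (\<zeta> - \<zeta>0)) \<delta>t)\<^sup>2" using \<delta> by (intro power_mono) auto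
        then have "c * real n * (min (norm (\<zeta> - \<zeta>0)) \<delta>)\<^sup>2 \<le> c * real n * (min (norm (\<zeta> - \<zeta>0)) \<delta>t)\<^sup>2" using c by (intro mult_left_mono) auto
        then have "exp (- c * real n * (min (norm (\<zeta> - \<zeta>0)) \<delta>t)\<^sup>2) \<le> exp (- c * r\<^sup>2 * (min (norm (\<zeta> - \<zeta>0)) \<delta>)\<^sup>2)" by (simp add: rr)
        then show ?thesis using AT[OF \<omega> that] by linarith
      qed
      note la = laplace_approximation[of p0 \<zeta>0 "ratio n \<omega>" qf, OF p0 p0_center ratio_measurable ratio_bounds qfm \<alpha> Rh nhh C(1,2) r0 e1(2) near far \<delta>(1) pd c']
      have la1: "integrable lborel w" unfolding w_def by (rule la(1))
      have la2: "integrable lborel \<phi>" unfolding \<phi>_def by (rule la(2))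
      define d where "d = (\<integral>h. \<bar>w h - \<phi> h\<bar> \<partial>lborel)"
      have d: "d \<le> d0"
      proof -
        have "d \<le> 2 * e1 * vol + E * (\<integral>h. indicator {h. C < norm h} h * exp (- c' * (norm (h::'a))\<^sup>2) \<partial>lborel)
            + exp 1 * exp (- c * r\<^sup>2 * \<delta>\<^sup>2) * r ^ DIM('a) / p0 \<zeta>0"
          unfolding d_def vol_def E_def w_def \<phi>_def by (rule la(3))
        also have "\<dots> \<le> d0 / 3 + d0 / 3 + d0 / 3"
        proof (intro add_mono e1(3))
          have "E * (\<integral>h. indicator {h. C < norm h} h * exp (- c' * (norm (h::'a))\<^sup>2) \<partial>lborel) \<le> E * (d0 / (3 * E))"
            using Ct[OF C(3)] E by (intro mult_left_mono) auto
          then show "E * (\<integral>h. indicator {h. C < norm h} h * exp (- c' * (norm (h::'a))\<^sup>2) \<partial>lborel) \<le> d0 / 3" using E by simp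
          have "exp (- c * r\<^sup>2 * \<delta>\<^sup>2) * r ^ DIM('a) \<le> d0 / 3 * p0 \<zeta>0 / exp 1"
            using elim(4) unfolding r_def[symmetric] by (simp add: mult.commute mult.left_commute)
          then have "exp 1 * (exp (- c * r\<^sup>2 * \<delta>\<^sup>2) * r ^ DIM('a)) / p0 \<zeta>0 \<le> exp 1 * (d0 / 3 * p0 \<zeta>0 / exp 1) / p0 \<zeta>0"
            using p0_center by (intro divide_right_mono mult_left_mono) auto
          then show "exp 1 * exp (- c * r\<^sup>2 * \<delta>\<^sup>2) * r ^ DIM('a) / p0 \<zeta>0 \<le> d0 / 3" using p0_center by (simp add: mult.assoc)
        qed
        finally show ?thesis by simp
      qed
      have shift: "(\<integral>h. f (h - hh) \<partial>lborel) = (\<integral>h. f h \<partial>lborel)" if [measurable]: "f \<in> borel_measurable borel" for f :: "'a \<Rightarrow> real"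
        using integral_lborel_rescale[of f 1 "- hh"] that by simp
      have I\<phi>: "(\<integral>h. \<phi> h \<partial>lborel) = I" unfolding \<phi>_def I_def by (rule shift) measurable
      have G\<phi>: "(\<integral>h. g (S (h - hh)) * \<phi> h \<partial>lborel) = (\<integral>h. g (S h) * exp (- qf h / 2) \<partial>lborel)"
        unfolding \<phi>_def by (rule shift) measurable
      have Tm: "(\<lambda>\<zeta>. T n (\<zeta> - zhat n \<omega>)) \<in> borel_measurable borel" unfolding Sn by measurable
      have TS: "T n (\<zeta>0 + (1 / r) *\<^sub>R h - zhat n \<omega>) = S (h - hh)" for h
      proof -
        have "T n (\<zeta>0 + (1 / r) *\<^sub>R h - zhat n \<omega>) = S (r *\<^sub>R (\<zeta>0 + (1 / r) *\<^sub>R h - zhat n \<omega>))"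
          by (simp add: Sn r_def linear_cmul[OF lin])
        also have "r *\<^sub>R (\<zeta>0 + (1 / r) *\<^sub>R h - zhat n \<omega>) = h - hh"
          using r0 by (simp add: hh_def scaleR_diff_right scaleR_add_right)
        finally show ?thesis .
      qed
      have "(\<integral>z. g z \<partial>distr (density lborel
          (\<lambda>\<zeta>. ennreal (p0 \<zeta> * ratio n \<omega> \<zeta> / (\<integral>\<xi>. p0 \<xi> * ratio n \<omega> \<xi> \<partial>lborel)))) borel (\<lambda>\<zeta>. T n (\<zeta> - zhat n \<omega>)))
          = (\<integral>h. g (S (h - hh)) * w h \<partial>lborel) / (\<integral>h. w h \<partial>lborel)"
        unfolding w_def TS[symmetric]
        by (rule integral_distr_density_rescale[of "\<lambda>\<zeta>. p0 \<zeta> * ratio n \<omega> \<zeta>", OF _ _ Tm g(1) r0])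
          (use p0(2) ratio_bounds p0_center Rh0 in auto)
      moreover have "\<bar>(\<integral>h. g (S (h - hh)) * w h \<partial>lborel) / (\<integral>h. w h \<partial>lborel) - (\<integral>h. g (S (h - hh)) * \<phi> h \<partial>lborel) / (\<integral>h. \<phi> h \<partial>lborel)\<bar>
         \<le> 2 * b * d / (\<integral>h. \<phi> h \<partial>lborel)"
        unfolding d_def
      proof (rule ratio_of_integrals)
        show "0 \<le> w h" for h using p0(2) ratio_bounds(1) Rh0 p0_center by (simp add: w_def)
      next
        show "(\<lambda>h. g (S (h - hh))) \<in> borel_measurable lborel" by measurable
        show "0 < (\<integral>h. \<phi> h \<partial>lborel)" using I by (simp add: I\<phi>)
        show "0 \<le> \<phi> h" for h by (simp add: \<phi>_def)
      qed (rule g(2) la1 la2)+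
      moreover have "2 * b * d / I \<le> \<epsilon>"
      proof -
        have "2 * b * d \<le> 2 * b * d0" using d b by (intro mult_left_mono) auto
        also have "\<dots> \<le> (2 * b + 1) * d0" using d0 by (intro mult_right_mono) auto
        also have "\<dots> = \<epsilon> * I" using b by (simp add: d0_def)
        finally show ?thesis using I by (simp add: pos_divide_le_eq)
      qed
      ultimately show ?thesis unfolding I\<phi> G\<phi> by linarith
    qed
    show ?case unfolding I_def[symmetric]
      by (rule bexI[OF _ A(1)], rule conjI[OF A(2)]) (use main in \<open>auto simp: not_less\<close>)
  qed
qed

end

section \<open>Quantile regression\<close>

lemma borel_measurable_vec:
  fixes f :: "'a \<Rightarrow> 'b::euclidean_space ^ 'n"
  assumes "\<And>i. (\<lambda>x. f x $ i) \<in> borel_measurable M"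
  shows "f \<in> borel_measurable M"
proof (rule borel_measurable_euclidean_space[THEN iffD2], rule ballI)
  fix b :: "'b ^ 'n" assume "b \<in> Basis"
  then obtain i u where "b = axis i u" by (auto simp: Basis_vec_def)
  moreover note assms[of i, measurable]
  ultimately show "(\<lambda>x. f x \<bullet> b) \<in> borel_measurable M" by (simp add: inner_axis)
qed

lemma vec_nth_measurable: "(\<lambda>x :: 'b::euclidean_space ^ 'n. x $ i) \<in> borel_measurable borel"
  by (intro borel_measurable_continuous_onI continuous_intros)

text \<open>\<kappa> is the minimum of the form over the compact unit sphere; homogeneity does the
  rest.\<close>

lemma linear_form_coercive:
  fixes f :: "'a::euclidean_space \<Rightarrow> 'a"
  assumes f: "linear f" and pos: "\<And>v. v \<noteq> 0 \<Longrightarrow> 0 < v \<bullet> f v"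
  shows "\<exists>\<kappa>>0. \<forall>v. \<kappa> * (norm v)\<^sup>2 \<le> v \<bullet> f v"
proof -
  have "compact (sphere (0::'a) 1)" by simp
  moreover have "sphere (0::'a) 1 \<noteq> {}" by simp
  moreover have "continuous_on (sphere 0 1) (\<lambda>x. x \<bullet> f x)"
    using f by (intro continuous_intros) (simp add: linear_continuous_on linear_conv_bounded_linear)
  ultimately obtain v where v: "v \<in> sphere 0 1" "\<And>w. w \<in> sphere 0 1 \<Longrightarrow> v \<bullet> f v \<le> w \<bullet> f w"
    using continuous_attains_inf[of "sphere (0::'a) 1" "\<lambda>x. x \<bullet> f x"] by blast
  have "v \<noteq> 0" using v(1) by auto
  then have "0 < v \<bullet> f v" by (rule pos)
  moreover have "v \<bullet> f v * (norm w)\<^sup>2 \<le> w \<bullet> f w" for w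
  proof (cases "w = 0")
    case False
    have "v \<bullet> f v \<le> ((1 / norm w) *\<^sub>R w) \<bullet> f ((1 / norm w) *\<^sub>R w)" by (rule v(2)) (use False in simp)
    also have "\<dots> = (w \<bullet> f w) / (norm w)\<^sup>2" by (simp add: linear_cmul[OF f] power2_eq_square)
    finally show ?thesis using False by (simp add: pos_le_divide_eq)
  qed (simp add: linear_0[OF f])
  ultimately show ?thesis by blast
qed

text \<open>The null members of a countable base have a null union, and every neighbourhood of a
  point outside that union has positive measure.\<close>

lemma AE_msupport:
  fixes \<mu> :: "'a::second_countable_topology measure"
  assumes "sets \<mu> = sets borel"
  shows "AE x in \<mu>. x \<in> msupport \<mu>"
proof -
  obtain \<B> :: "'a set set" where \<B>: "countable \<B>" "\<And>S. S \<in> \<B> \<Longrightarrow> open S" "\<And>U x. open U \<Longrightarrow> x \<in> U \<Longrightarrow> \<exists>S\<in>\<B>. x \<in> S \<and> S \<subseteq> U"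
    using ex_countable_basis topological_basisE unfolding topological_basis_def by (metis (mono_tags, lifting) ex_countable_basis topological_basisE topological_basis_open)
  define N where "N = \<Union>{S \<in> \<B>. emeasure \<mu> S = 0}"
  have "N \<in> null_sets \<mu>"
    unfolding N_def by (rule null_sets_UN'[of "{S \<in> \<B>. emeasure \<mu> S = 0}" "\<lambda>S. S", simplified])
      (use \<B> assms in \<open>auto intro: countable_subset simp: null_sets_def\<close>)
  moreover have "x \<in> msupport \<mu>" if "x \<notin> N" for x
    unfolding msupport_def
  proof (intro CollectI allI impI)
    fix U assume U: "open U \<and> x \<in> U"
    then obtain S where S: "S \<in> \<B>" "x \<in> S" "S \<subseteq> U" using \<B>(3) by blast
    then have "0 < emeasure \<mu> S" using that by (auto simp: N_def zero_less_iff_neq_zero)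
    also have "\<dots> \<le> emeasure \<mu> U" using S U assms by (intro emeasure_mono) auto
    finally show "0 < emeasure \<mu> U" .
  qed
  ultimately show ?thesis by (auto intro: AE_I' simp: eventually_ae_filter)
qed

text \<open>By continuity the superlevel set is closed and contains its infimum, while the
  intermediate value theorem gives a point with cdf exactly \<tau>, which bounds that infimum from
  above.\<close>

lemma cdf_quantile:
  assumes \<mu>: "real_distribution \<mu>" and cont: "\<And>t. isCont (cdf \<mu>) t" and \<tau>: "0 < \<tau>" "\<tau> < 1"
  shows "cdf \<mu> (quantile \<mu> \<tau>) = \<tau>"
proof -
  interpret real_distribution \<mu> by (rule \<mu>)
  define S where "S = {t. \<tau> \<le> cdf \<mu> t}"
  have "\<forall>\<^sub>F t in at_bot. cdf \<mu> t < \<tau>" using cdf_lim_at_bot \<tau>(1) by (rule order_tendstoD)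
  then obtain a where a: "cdf \<mu> a < \<tau>" by (metis eventually_at_bot_linorder order_refl)
  have "\<forall>\<^sub>F t in at_top. \<tau> < cdf \<mu> t" using cdf_lim_at_top_prob \<tau>(2) by (rule order_tendstoD)
  then obtain b where b: "\<tau> < cdf \<mu> b" by (metis eventually_at_top_linorder order_refl)
  have aS: "a \<le> t" if "t \<in> S" for t
    using that a cdf_nondecreasing[of t a] by (auto simp: S_def not_le intro: leI)
  have ab: "a \<le> b" using aS[of b] b by (simp add: S_def)
  obtain t where t: "cdf \<mu> t = \<tau>"
    using IVT[of "cdf \<mu>" a \<tau> b] a b ab cont by auto
  have bdd: "bdd_below S" by (rule bdd_belowI[of _ a]) (rule aS)
  have ne: "t \<in> S" using t by (simp add: S_def)
  have "closed S" unfolding S_def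
    using cont by (intro closed_Collect_le continuous_intros continuous_at_imp_continuous_on) auto
  then have "Inf S \<in> S" using bdd ne by (intro closed_contains_Inf) auto
  then have 1: "\<tau> \<le> cdf \<mu> (quantile \<mu> \<tau>)" by (simp add: S_def quantile_def)
  have "quantile \<mu> \<tau> \<le> t" unfolding quantile_def using cInf_lower[OF ne bdd] by (simp add: S_def)
  then show ?thesis using 1 cdf_nondecreasing[of "quantile \<mu> \<tau>" t] t by simp
qed

section \<open>The score function of a quantile\<close>

lemma psi_measurable [measurable]: "\<psi> \<tau> \<in> borel_measurable borel"
  unfolding \<psi>_def by measurable

lemma psi_antimono: "0 < \<tau> \<Longrightarrow> \<tau> < 1 \<Longrightarrow> u \<le> v \<Longrightarrow> \<psi> \<tau> v \<le> \<psi> \<tau> u"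
  by (auto simp: \<psi>_def)

lemma abs_psi_le: "0 < \<tau> \<Longrightarrow> \<tau> < 1 \<Longrightarrow> \<bar>\<psi> \<tau> u\<bar> \<le> 1"
  by (auto simp: \<psi>_def)

text \<open>\<psi> is constant on either side of 0 with total jump 1; if |u| > \<rho>, a shift by at
  most \<rho> cannot reach 0.\<close>

lemma psi_increment:
  assumes "0 < \<tau>" "\<tau> < 1" "\<bar>u' - u\<bar> \<le> \<rho>"
  shows "\<bar>\<psi> \<tau> u' - \<psi> \<tau> u\<bar> \<le> indicator {v. \<bar>v\<bar> \<le> \<rho>} u"
  using assms by (auto simp: \<psi>_def indicator_def abs_if split: if_splits)

text \<open>The shift is 2 \<rho> and not \<rho>, so that both arguments stay off 0 even for |u| =
  \<rho>, where the exceptional value 0 of \<psi> would spoil the full jump.\<close>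

lemma psi_jump:
  assumes "0 < \<tau>" "\<tau> < 1" "0 < \<rho>"
  shows "indicator {v. \<bar>v\<bar> \<le> \<rho>} u \<le> \<psi> \<tau> (u - 2 * \<rho>) - \<psi> \<tau> (u + 2 * \<rho>)"
  using assms by (auto simp: \<psi>_def indicator_def abs_if split: if_splits)

context
  fixes \<mu> :: "real measure"
  assumes \<mu>: "real_distribution \<mu>" and cont: "\<And>t. isCont (cdf \<mu>) t"
begin

interpretation real_distribution \<mu> by (rule \<mu>)

text \<open>A continuous cdf leaves no atom at b, so \<mu> does not see the exceptional value of
  \<psi> at 0.\<close>

lemma psi_AE: "AE y in \<mu>. \<psi> \<tau> (y - b) = indicator {..b} y - \<tau>"
proof -
  have "measure \<mu> {b} = 0" using cont isCont_cdf by blast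
  then have "AE y in \<mu>. y \<notin> {b}" using prob_eq_0[of "{b}"] by simp
  then show ?thesis by (rule AE_mp) (auto simp: \<psi>_def indicator_def intro!: AE_I2)
qed

lemma integrable_indicator_atMost: "integrable \<mu> (indicator {..c} :: real \<Rightarrow> real)"
  by (rule integrable_real_indicator) (auto simp: emeasure_eq_measure)

lemma prob_UNIV: "prob UNIV = 1"
  using prob_space by simp

lemma integral_psi: "(\<integral>y. \<psi> \<tau> (y - b) \<partial>\<mu>) = cdf \<mu> b - \<tau>"
proof -
  have "(\<integral>y. \<psi> \<tau> (y - b) \<partial>\<mu>) = (\<integral>y. indicator {..b} y - \<tau> \<partial>\<mu>)"
    by (rule integral_cong_AE) (use psi_AE in auto)
  then show ?thesis using integrable_indicator_atMost[of b] by (simp add: prob_UNIV cdf_def2)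
qed

text \<open>Source of the entries of \<open>Psi_mat\<close>: the two indicators multiply to that of
  \<open>{..min b c}\<close>.\<close>

lemma integral_psi_mult:
  assumes "cdf \<mu> b = \<tau>" "cdf \<mu> c = \<sigma>"
  shows "(\<integral>y. \<psi> \<tau> (y - b) * \<psi> \<sigma> (y - c) \<partial>\<mu>) = min \<tau> \<sigma> - \<tau> * \<sigma>"
proof -
  have "(\<integral>y. \<psi> \<tau> (y - b) * \<psi> \<sigma> (y - c) \<partial>\<mu>) = (\<integral>y. (indicator {..b} y - \<tau>) * (indicator {..c} y - \<sigma>) \<partial>\<mu>)"
  proof (rule integral_cong_AE)
    show "AE y in \<mu>. \<psi> \<tau> (y - b) * \<psi> \<sigma> (y - c) = (indicator {..b} y - \<tau>) * (indicator {..c} y - \<sigma>)"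
      using psi_AE[of \<tau> b] psi_AE[of \<sigma> c] by eventually_elim simp
  qed auto
  also have "\<dots> = (\<integral>y. indicator {..min b c} y - \<sigma> * indicator {..b} y - \<tau> * indicator {..c} y + \<tau> * \<sigma> \<partial>\<mu>)"
    by (rule Bochner_Integration.integral_cong) (auto simp: indicator_def algebra_simps)
  also have "\<dots> = cdf \<mu> (min b c) - \<sigma> * cdf \<mu> b - \<tau> * cdf \<mu> c + \<tau> * \<sigma>"
    using integrable_indicator_atMost by (simp add: prob_UNIV cdf_def2)
  also have "cdf \<mu> (min b c) = min \<tau> \<sigma>"
    using cdf_nondecreasing[of b c] cdf_nondecreasing[of c b] assms by (auto simp: min_def)
  finally show ?thesis using assms by (simp add: mult.commute)
qed

end

section \<open>Disintegration along the covariates\<close>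

text \<open>\<open>is_cond_dist\<close> speaks of rectangles only. They form an intersection-stable
  generator, so P is the bind of its marginal with the kernel k that places PY x on the fibre over
  x; the formula for integrals follows from the one for the bind.\<close>

lemma
  fixes P :: "(('a::second_countable_topology) \<times> real) measure"
  assumes P: "prob_space P" "sets P = sets borel" and c: "is_cond_dist P PY"
    and f: "f \<in> borel_measurable borel" and A: "A \<in> sets borel" "AE x in distr P borel fst. x \<in> A"
    and b: "\<And>x y. x \<in> A \<Longrightarrow> \<bar>f (x, y)\<bar> \<le> (C0::real)"
  shows disintegration: "(\<integral>z. f z \<partial>P) = (\<integral>x. (\<integral>y. f (x, y) \<partial>PY x) \<partial>distr P borel fst)"
    and disintegration_integrable: "integrable (distr P borel fst) (\<lambda>x. \<integral>y. f (x, y) \<partial>PY x)"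
proof -
  interpret P: prob_space P by (rule P(1))
  have bp: "(borel :: 'a measure) \<Otimes>\<^sub>M (borel :: real measure) = borel" by (rule borel_prod)
  have mP: "sets P = sets (borel \<Otimes>\<^sub>M borel)" unfolding bp by (rule P(2))
  define GX where "GX = distr P borel fst"
  have fstm: "fst \<in> P \<rightarrow>\<^sub>M borel" by (subst measurable_cong_sets[OF mP refl]) (rule measurable_fst)
  interpret GX: prob_space GX unfolding GX_def by (rule P.prob_space_distr[OF fstm])
  have sGX: "sets GX = sets borel" by (simp add: GX_def)
  have PY: "PY \<in> borel \<rightarrow>\<^sub>M prob_algebra borel" using c by (simp add: is_cond_dist_def)
  have PYd: "prob_space (PY x)" "sets (PY x) = sets borel" for x
    using measurable_space[OF PY, of x] by (auto simp: space_prob_algebra)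
  define k where "k = (\<lambda>x. distr (PY x) (borel \<Otimes>\<^sub>M borel) (Pair x))"
  have k: "k \<in> borel \<rightarrow>\<^sub>M prob_algebra (borel \<Otimes>\<^sub>M borel)"
    unfolding k_def by (rule measurable_distr_prob_space2[OF PY]) simp
  have Pm: "Pair x \<in> PY x \<rightarrow>\<^sub>M borel \<Otimes>\<^sub>M borel" for x
    by (subst measurable_cong_sets[OF PYd(2) refl]) (rule measurable_Pair1', simp)
  have kG: "k \<in> GX \<rightarrow>\<^sub>M subprob_algebra (borel \<Otimes>\<^sub>M borel)"
    by (subst measurable_cong_sets[OF sGX refl]) (rule measurable_prob_algebraD[OF k])
  have neG: "space GX \<noteq> {}" by (rule GX.not_empty)
  have eq: "P = GX \<bind> k"
  proof (rule measure_eqI_generator_eq[where E = "{a \<times> b |a b. a \<in> sets borel \<and> b \<in> sets borel}" and \<Omega> = UNIV and A = "\<lambda>_. UNIV"])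
    show "Int_stable {a \<times> b |a b. a \<in> sets (borel::'a measure) \<and> b \<in> sets (borel::real measure)}"
      by (rule Int_stable_pair_measure_generator)
    show "sets P = sigma_sets UNIV {a \<times> b |a b. a \<in> sets borel \<and> b \<in> sets borel}"
      unfolding mP sets_pair_measure by simp
    have "sets (GX \<bind> k) = sets (borel \<Otimes>\<^sub>M borel)" by (rule sets_bind[OF _ neG]) (simp add: k_def)
    then show "sets (GX \<bind> k) = sigma_sets UNIV {a \<times> b |a b. a \<in> sets borel \<and> b \<in> sets borel}"
      unfolding sets_pair_measure by simp
    fix X :: "('a \<times> real) set" assume "X \<in> {a \<times> b |a b. a \<in> sets borel \<and> b \<in> sets borel}"
    then obtain a b where X: "X = a \<times> b" "a \<in> sets borel" "b \<in> sets borel" by auto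
    have "emeasure (GX \<bind> k) X = (\<integral>\<^sup>+x. emeasure (k x) X \<partial>GX)"
      by (rule emeasure_bind[OF neG kG]) (use X in auto)
    also have "\<dots> = (\<integral>\<^sup>+x. emeasure (PY x) b * indicator a x \<partial>GX)"
    proof (rule nn_integral_cong)
      fix x
      have "emeasure (k x) X = emeasure (PY x) (Pair x -` X \<inter> space (PY x))"
        unfolding k_def by (rule emeasure_distr[OF Pm]) (use X in auto)
      also have "Pair x -` X \<inter> space (PY x) = (if x \<in> a then b else {})"
        using X sets_eq_imp_space_eq[OF PYd(2)] by auto
      finally show "emeasure (k x) X = emeasure (PY x) b * indicator a x" by (simp add: indicator_def)
    qed
    also have "\<dots> = emeasure P X" using c X unfolding is_cond_dist_def GX_def by simp
    finally show "emeasure P X = emeasure (GX \<bind> k) X" by simp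
  qed (auto intro!: exI[of _ UNIV])
  have fm: "f \<in> borel_measurable (borel \<Otimes>\<^sub>M borel)" unfolding bp by (rule f)
  \<comment> \<open>f is bounded over A only; the cut-off is bounded everywhere and equals f almost
    everywhere.\<close>
  define h where "h = (\<lambda>z. indicator A (fst z) * f z)"
  have hm: "h \<in> borel_measurable (borel \<Otimes>\<^sub>M borel)" unfolding h_def
    by (rule borel_measurable_times[OF measurable_compose[OF measurable_fst borel_measurable_indicator[OF A(1)]] fm])
  define C where "C = max C0 0"
  have C: "0 \<le> C" "C0 \<le> C" by (auto simp: C_def)
  have hC: "\<bar>h z\<bar> \<le> C" for z using b[of "fst z" "snd z"] C by (cases "fst z \<in> A") (auto simp: h_def)
  have hb: "h z \<le> C" "- C \<le> h z" for z using hC[of z] by (auto simp: abs_le_iff)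
  have hb0: "0 \<le> h z + C" for z using hb(2)[of z] by linarith
  have hx: "(\<lambda>y. h (x, y)) \<in> borel_measurable (PY x)" for x
    by (rule measurable_compose[OF Pm hm])
  have ihx: "integrable (PY x) (\<lambda>y. h (x, y))" for x
  proof -
    interpret PYx: prob_space "PY x" by (rule PYd(1))
    show ?thesis by (rule PYx.integrable_const_bound[of _ C, OF AE_I2 hx]) (simp add: hC)
  qed
  define H where "H = (\<lambda>x. \<integral>y. h (x, y) \<partial>PY x)"
  have Hm: "H \<in> borel_measurable borel"
  proof -
    have "(\<lambda>x. integral\<^sup>L (k x) h) \<in> borel_measurable borel"
      by (rule measurable_compose[OF measurable_prob_algebraD[OF k] integral_measurable_subprob_algebra[OF hm]])
    moreover have "integral\<^sup>L (k x) h = H x" for x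
      unfolding k_def H_def by (rule integral_distr[OF Pm hm])
    ultimately show ?thesis by simp
  qed
  have HC: "\<bar>H x\<bar> \<le> C" for x
  proof -
    interpret PYx: prob_space "PY x" by (rule PYd(1))
    have "\<bar>H x\<bar> \<le> (\<integral>y. \<bar>h (x, y)\<bar> \<partial>PY x)" unfolding H_def by (rule integral_abs_bound)
    also have "\<dots> \<le> (\<integral>y. C \<partial>PY x)"       by (intro integral_mono integrable_abs ihx PYx.integrable_const hC)
    finally show ?thesis by (simp add: PYx.prob_space)
  qed
  have HmG: "H \<in> borel_measurable GX" by (subst measurable_cong_sets[OF sGX refl]) (rule Hm)
  have iH: "integrable GX H" by (rule GX.integrable_const_bound[of _ C, OF AE_I2 HmG]) (simp add: HC)
  have hmP: "h \<in> borel_measurable P" and fmP: "f \<in> borel_measurable P"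
    by (subst measurable_cong_sets[OF mP refl], rule hm fm)+
  have ih: "integrable P h" by (rule P.integrable_const_bound[of _ C, OF AE_I2 hmP]) (simp add: hC)
  \<comment> \<open>Adding C makes the integrand nonnegative, as the integral against a bind
    requires.\<close>
  have "ennreal ((\<integral>z. h z \<partial>P) + C) = (\<integral>\<^sup>+z. ennreal (h z + C) \<partial>P)"
    using ih hb0 by (subst nn_integral_eq_integral) (simp_all add: P.prob_space)
  also have "\<dots> = (\<integral>\<^sup>+x. (\<integral>\<^sup>+z. ennreal (h z + C) \<partial>k x) \<partial>GX)"
    unfolding eq by (rule nn_integral_bind[OF _ kG])
      (intro measurable_compose[OF _ measurable_ennreal] borel_measurable_add hm borel_measurable_const)
  also have "\<dots> = (\<integral>\<^sup>+x. ennreal (H x + C) \<partial>GX)"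
  proof (rule nn_integral_cong)
    fix x
    interpret PYx: prob_space "PY x" by (rule PYd(1))
    have "(\<integral>\<^sup>+z. ennreal (h z + C) \<partial>k x) = (\<integral>\<^sup>+y. ennreal (h (x, y) + C) \<partial>PY x)"
      unfolding k_def by (rule nn_integral_distr[OF Pm])
        (simp, intro measurable_compose[OF _ measurable_ennreal] borel_measurable_add hm borel_measurable_const)
    also have "\<dots> = ennreal (H x + C)"
      using ihx[of x] hb0 by (subst nn_integral_eq_integral) (simp_all add: PYx.prob_space H_def)
    finally show "(\<integral>\<^sup>+z. ennreal (h z + C) \<partial>k x) = ennreal (H x + C)" .
  qed
  also have "\<dots> = ennreal ((\<integral>x. H x \<partial>GX) + C)"
  proof (subst nn_integral_eq_integral)
    show "AE x in GX. 0 \<le> H x + C"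
    proof (rule AE_I2)
      show "0 \<le> H x + C" for x using HC[of x] by (simp add: abs_le_iff)
    qed
  qed (use iH in \<open>simp_all add: GX.prob_space\<close>)
  finally have e: "(\<integral>z. h z \<partial>P) + C = (\<integral>x. H x \<partial>GX) + C"
  proof (rule ennreal_inj[THEN iffD1, rotated 2])
    have "- C = (\<integral>z. - C \<partial>P)" by (simp add: P.prob_space)
    also have "\<dots> \<le> (\<integral>z. h z \<partial>P)" by (intro integral_mono ih hb P.integrable_const)
    finally show "0 \<le> (\<integral>z. h z \<partial>P) + C" by simp
    have "- C = (\<integral>z. - C \<partial>GX)" by (simp add: GX.prob_space)
    also have "\<dots> \<le> (\<integral>z. H z \<partial>GX)"
    proof (intro integral_mono iH GX.integrable_const)
      show "- C \<le> H x" for x using HC[of x] by (simp add: abs_le_iff)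
    qed
    finally show "0 \<le> (\<integral>x. H x \<partial>GX) + C" by simp
  qed
  have AP: "AE z in P. fst z \<in> A" using A by (subst (asm) AE_distr_iff[OF fstm]) auto
  have 1: "(\<integral>z. f z \<partial>P) = (\<integral>z. h z \<partial>P)"
  proof (rule integral_cong_AE[OF fmP hmP])
    show "AE z in P. f z = h z" using AP by (rule eventually_mono) (simp add: h_def)
  qed
  have HA: "H x = (\<integral>y. f (x, y) \<partial>PY x)" if "x \<in> A" for x using that by (simp add: H_def h_def)
  have fx: "(\<lambda>x. \<integral>y. f (x, y) \<partial>PY x) \<in> borel_measurable GX"
  proof -
    have "(\<lambda>x. integral\<^sup>L (k x) f) \<in> borel_measurable borel"
      by (rule measurable_compose[OF measurable_prob_algebraD[OF k] integral_measurable_subprob_algebra[OF fm]])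
    moreover have "integral\<^sup>L (k x) f = (\<integral>y. f (x, y) \<partial>PY x)" for x
      unfolding k_def by (rule integral_distr[OF Pm fm])
    ultimately have "(\<lambda>x. \<integral>y. f (x, y) \<partial>PY x) \<in> borel_measurable borel" by simp
    then show ?thesis by (subst measurable_cong_sets[OF sGX refl])
  qed
  have AEH: "AE x in GX. H x = (\<integral>y. f (x, y) \<partial>PY x)" using A(2) unfolding GX_def by (rule eventually_mono) (rule HA)
  have 2: "(\<integral>x. H x \<partial>GX) = (\<integral>x. (\<integral>y. f (x, y) \<partial>PY x) \<partial>GX)"
    by (rule integral_cong_AE[OF HmG fx AEH])
  show "(\<integral>z. f z \<partial>P) = (\<integral>x. (\<integral>y. f (x, y) \<partial>PY x) \<partial>distr P borel fst)"
    using 1 2 e by (simp add: GX_def)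
  have "integrable GX H \<longleftrightarrow> integrable GX (\<lambda>x. \<integral>y. f (x, y) \<partial>PY x)"
    by (rule integrable_cong_AE[OF HmG fx AEH])
  then show "integrable (distr P borel fst) (\<lambda>x. \<integral>y. f (x, y) \<partial>PY x)" using iH by (simp add: GX_def)
qed

section \<open>Algebra of the estimating function\<close>

text \<open>Groups the coordinates by quantile level: each level contributes the score of its
  residual times the rate at which direction u moves its linear predictor.\<close>

lemma inner_m_est:
  "u \<bullet> m_est \<tau> x y \<zeta> = (\<Sum>d\<in>UNIV. \<psi> (\<tau> d) (y - x \<bullet> beta \<zeta> d) * (x \<bullet> beta u d))"
proof -
  have "u \<bullet> m_est \<tau> x y \<zeta> = (\<Sum>(d, j)\<in>UNIV \<times> UNIV. u $ (d, j) * (\<psi> (\<tau> d) (y - x \<bullet> beta \<zeta> d) * x $ j))"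
    by (simp add: inner_vec_def m_est_def case_prod_unfold)
  also have "\<dots> = (\<Sum>d\<in>UNIV. \<Sum>j\<in>UNIV. u $ (d, j) * (\<psi> (\<tau> d) (y - x \<bullet> beta \<zeta> d) * x $ j))"
    by (rule sum.cartesian_product[symmetric])
  also have "\<dots> = (\<Sum>d\<in>UNIV. \<psi> (\<tau> d) (y - x \<bullet> beta \<zeta> d) * (x \<bullet> beta u d))"
  proof (rule sum.cong[OF refl])
    fix d
    define c where "c = \<psi> (\<tau> d) (y - x \<bullet> beta \<zeta> d)"
    have "x \<bullet> beta u d = (\<Sum>j\<in>UNIV. x $ j * u $ (d, j))" by (simp add: inner_vec_def beta_def)
    then show "(\<Sum>j\<in>UNIV. u $ (d, j) * (\<psi> (\<tau> d) (y - x \<bullet> beta \<zeta> d) * x $ j)) = \<psi> (\<tau> d) (y - x \<bullet> beta \<zeta> d) * (x \<bullet> beta u d)"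
      unfolding c_def[symmetric] by (simp add: sum_distrib_left mult.commute mult.left_commute)
  qed
  finally show ?thesis .
qed

lemma beta_add: "beta (a + b) d = beta a d + beta b d"
  by (simp add: beta_def vec_eq_iff)

lemma beta_scale: "beta (c *\<^sub>R a) d = c *\<^sub>R beta a d"
  by (simp add: beta_def vec_eq_iff)

lemma beta_diff: "beta (a - b) d = beta a d - beta b d"
  by (simp add: beta_def vec_eq_iff)

lemma abs_inner_beta_le:
  assumes "norm (x :: real ^ 'q) \<le> b"
  shows "\<bar>x \<bullet> beta h d\<bar> \<le> real CARD('q) * b * norm h"
proof -
  have b: "0 \<le> b" using assms norm_ge_zero[of x] by linarith
  have "\<bar>x \<bullet> beta h d\<bar> \<le> (\<Sum>j\<in>UNIV. \<bar>x $ j * h $ (d, j)\<bar>)"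
    unfolding inner_vec_def by (simp add: beta_def)
  also have "\<dots> \<le> (\<Sum>j\<in>(UNIV::'q set). b * norm h)"
    unfolding abs_mult using component_le_norm_cart[of x] component_le_norm_cart[of h] assms b
    by (intro sum_mono mult_mono) (auto intro: order_trans)
  finally show ?thesis by simp
qed

lemma norm_vec_le_sum: "norm (f :: 'b::real_normed_vector ^ 'n) \<le> (\<Sum>i\<in>UNIV. norm (f $ i))"
  unfolding norm_vec_def by (rule L2_set_le_sum) simp

lemma continuous_on_beta: "continuous_on S (\<lambda>\<zeta>. beta \<zeta> d)"
  unfolding beta_def by (intro continuous_intros)

lemma m_est_measurable:
  fixes \<tau> :: "'k::finite \<Rightarrow> real" and \<zeta> :: "real ^ ('k \<times> 'q::finite)"
  shows "(\<lambda>z. m_est \<tau> (fst z) (snd z) \<zeta>) \<in> borel_measurable (borel :: ((real ^ 'q) \<times> real) measure)"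
proof (rule borel_measurable_vec)
  fix r :: "'k \<times> 'q"
  have [measurable]: "(\<lambda>z :: (real ^ 'q) \<times> real. snd z - fst z \<bullet> beta \<zeta> (fst r)) \<in> borel_measurable borel"
    by (intro borel_measurable_continuous_onI continuous_intros)
  have [measurable]: "(\<lambda>z :: (real ^ 'q) \<times> real. fst z $ snd r) \<in> borel_measurable borel"
    by (intro borel_measurable_continuous_onI continuous_intros)
  show "(\<lambda>z :: (real ^ 'q) \<times> real. m_est \<tau> (fst z) (snd z) \<zeta> $ r) \<in> borel_measurable borel"
    unfolding m_est_def by simp
qed

text \<open>Each score takes three values, so for fixed x and y the vector is one of finitely many
  patterns over the levels.\<close>

lemma simple_function_m_est:
  fixes \<tau> :: "'k::finite \<Rightarrow> real" and x :: "real ^ 'q::finite"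
  shows "simple_function borel (m_est \<tau> x y)"
proof (rule simple_function_borel_measurable)
  show "m_est \<tau> x y \<in> borel_measurable borel"
  proof (rule borel_measurable_vec)
    fix r :: "'k \<times> 'q"
    have [measurable]: "(\<lambda>\<zeta>. y - x \<bullet> beta \<zeta> (fst r)) \<in> borel_measurable borel"
      by (intro borel_measurable_continuous_onI continuous_intros continuous_on_beta)
    show "(\<lambda>\<zeta>. m_est \<tau> x y \<zeta> $ r) \<in> borel_measurable borel" unfolding m_est_def by simp
  qed
  define F where "F = (UNIV :: 'k set) \<rightarrow>\<^sub>E (\<Union>d\<in>UNIV. {1 - \<tau> d, 0, - \<tau> d})"
  have "m_est \<tau> x y \<zeta> \<in> (\<lambda>s. \<chi> r. s (fst r) * x $ snd r) ` F" for \<zeta>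
    by (rule image_eqI[of _ _ "\<lambda>d. \<psi> (\<tau> d) (y - x \<bullet> beta \<zeta> d)"]) (auto simp: m_est_def F_def \<psi>_def)
  then have "m_est \<tau> x y ` space borel \<subseteq> (\<lambda>s. \<chi> r. s (fst r) * x $ snd r) ` F" by auto
  moreover have "finite F" unfolding F_def by (rule finite_PiE) auto
  ultimately show "finite (m_est \<tau> x y ` space borel)" by (rule finite_subset[OF _ finite_imageI])
qed

text \<open>In direction u the residual of level d decreases at rate c = x . beta u d, \<psi> is
  antitone, and the factor in front is the same c; the term increases for either sign of c. This is
  the convexity of the check loss in disguise.\<close>

lemma m_est_mono:
  assumes \<tau>: "\<And>d. 0 < \<tau> d \<and> \<tau> d < 1" and st: "s \<le> t"
  shows "u \<bullet> m_est \<tau> x y (\<zeta> + s *\<^sub>R u) \<le> u \<bullet> m_est \<tau> x y (\<zeta> + t *\<^sub>R u)"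
  unfolding inner_m_est
proof (rule sum_mono)
  fix d
  define c where "c = x \<bullet> beta u d"
  have e: "y - x \<bullet> beta (\<zeta> + s *\<^sub>R u) d = y - x \<bullet> beta \<zeta> d - s * c" for s
    by (simp add: beta_add beta_scale inner_add_right c_def)
  show "\<psi> (\<tau> d) (y - x \<bullet> beta (\<zeta> + s *\<^sub>R u) d) * (x \<bullet> beta u d) \<le> \<psi> (\<tau> d) (y - x \<bullet> beta (\<zeta> + t *\<^sub>R u) d) * (x \<bullet> beta u d)"
    unfolding e c_def[symmetric]
  proof (cases "0 \<le> c")
    case True
    then show "\<psi> (\<tau> d) (y - x \<bullet> beta \<zeta> d - s * c) * c \<le> \<psi> (\<tau> d) (y - x \<bullet> beta \<zeta> d - t * c) * c"
      using \<tau>[of d] mult_right_mono[OF st True] by (intro mult_right_mono psi_antimono) auto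
  next
    case False
    then show "\<psi> (\<tau> d) (y - x \<bullet> beta \<zeta> d - s * c) * c \<le> \<psi> (\<tau> d) (y - x \<bullet> beta \<zeta> d - t * c) * c"
      using \<tau>[of d] mult_right_mono_neg[OF st, of c] by (intro mult_right_mono_neg psi_antimono) auto
  qed
qed

section \<open>The model for a single observation\<close>

locale quantile_regression =
  fixes P :: "((real ^ 'q) \<times> real) measure" and icpt :: 'q and PY :: "real ^ 'q \<Rightarrow> real measure"
    and \<tau> :: "'k::finite \<Rightarrow> real" and \<zeta>0 :: "real ^ ('k \<times> 'q)" and V12 :: "real ^ ('k \<times> 'q) ^ ('k \<times> 'q)" and Bx :: real
  assumes P: "prob_space P" "sets P = sets borel"
    and icpt: "AE x in distr P borel fst. x $ icpt = 1"
    and \<tau>: "\<And>d. 0 < \<tau> d \<and> \<tau> d < 1"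
    and cond: "is_cond_dist P PY"
    and quantiles: "\<And>d. AE x in distr P borel fst. quantile (PY x) (\<tau> d) = x \<bullet> beta \<zeta>0 d"
    and mean_deriv: "((\<lambda>\<zeta>. \<integral>z. m_est \<tau> (fst z) (snd z) \<zeta> \<partial>P) has_derivative (\<lambda>h. - (V12 *v h))) (at \<zeta>0)"
    and Bx: "0 < Bx" "\<And>x. x \<in> msupport (distr P borel fst) \<Longrightarrow> norm x \<le> Bx"
    and cdf_smooth: "\<And>x. x \<in> msupport (distr P borel fst) \<Longrightarrow> twice_cont_diff (cdf (PY x))"
    and density_pos: "\<And>x d. x \<in> msupport (distr P borel fst) \<Longrightarrow> 0 < deriv (cdf (PY x)) (quantile (PY x) (\<tau> d))"
    and pd: "pos_def (\<integral>z. outer (m_est \<tau> (fst z) (snd z) \<zeta>0) (m_est \<tau> (fst z) (snd z) \<zeta>0) \<partial>P)"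
begin

interpretation P: prob_space P by (rule P(1))

abbreviation GX :: "(real ^ 'q) measure" where "GX \<equiv> distr P borel fst"
abbreviation m :: "(real ^ 'q) \<times> real \<Rightarrow> real ^ ('k \<times> 'q) \<Rightarrow> real ^ ('k \<times> 'q)" where "m z \<zeta> \<equiv> m_est \<tau> (fst z) (snd z) \<zeta>"

definition good :: "((real ^ 'q) \<times> real) set" where
  "good = {z. norm (fst z) \<le> Bx \<and> fst z $ icpt = 1}"

text \<open>Lipschitz constant of the linear predictors in \<zeta>, and at the same time the bound
  Bx summed over the coordinates of x.\<close>

definition Bq :: real where "Bq = real CARD('q) * Bx"

text \<open>Moving \<zeta> by r shifts a residual by at most Bq r, so the score of level d can
  change only if its residual is within Bq r of 0. The factor Bq in front bounds the effect of such
  a level on the norm.\<close>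

definition osc :: "(real ^ 'q) \<times> real \<Rightarrow> real ^ ('k \<times> 'q) \<Rightarrow> real \<Rightarrow> real" where
  "osc z \<zeta> r = Bq * (\<Sum>d\<in>UNIV. indicator {v. \<bar>v\<bar> \<le> Bq * r} (snd z - fst z \<bullet> beta \<zeta> d))"

lemma Bq: "0 < Bq" using Bx(1) by (simp add: Bq_def)

lemma fst_measurable: "fst \<in> P \<rightarrow>\<^sub>M borel"
  unfolding measurable_cong_sets[OF P(2) refl] by (intro borel_measurable_continuous_onI continuous_intros)

lemma AE_GX: "AE x in GX. norm x \<le> Bx \<and> x $ icpt = 1 \<and> x \<in> msupport GX \<and> (\<forall>d. quantile (PY x) (\<tau> d) = x \<bullet> beta \<zeta>0 d)"
proof -
  have "AE x in GX. \<forall>d. quantile (PY x) (\<tau> d) = x \<bullet> beta \<zeta>0 d" using quantiles by (simp add: AE_all_countable)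
  moreover have "AE x in GX. x \<in> msupport GX" by (rule AE_msupport) simp
  ultimately show ?thesis using icpt by eventually_elim (use Bx(2) in auto)
qed

lemma good_sets: "good \<in> sets borel"
proof -
  have "closed good" unfolding good_def
    by (intro closed_Collect_conj closed_Collect_le closed_Collect_eq continuous_intros)
  then show ?thesis by (rule borel_closed)
qed

lemma AE_good: "AE z in P. z \<in> good"
proof -
  have "AE x in GX. norm x \<le> Bx \<and> x $ icpt = 1" using AE_GX by (rule eventually_mono) auto
  then have "AE z in P. norm (fst z) \<le> Bx \<and> fst z $ icpt = 1"
    by (subst (asm) AE_distr_iff[OF fst_measurable]) (auto intro!: borel_closed closed_Collect_conj closed_Collect_le closed_Collect_eq continuous_intros)
  then show ?thesis by (simp add: good_def)
qed

lemma m_component_le: "norm (fst z) \<le> Bx \<Longrightarrow> \<bar>m z \<zeta> $ r\<bar> \<le> Bx"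
proof -
  assume x: "norm (fst z) \<le> Bx"
  have "\<bar>m z \<zeta> $ r\<bar> = \<bar>\<psi> (\<tau> (fst r)) (snd z - fst z \<bullet> beta \<zeta> (fst r))\<bar> * \<bar>fst z $ snd r\<bar>"
    by (simp add: m_est_def abs_mult)
  also have "\<dots> \<le> 1 * Bx"
    using abs_psi_le \<tau> x component_le_norm_cart[of "fst z" "snd r"] by (intro mult_mono) auto
  finally show ?thesis by simp
qed

lemma norm_m_le: "norm (fst z) \<le> Bx \<Longrightarrow> norm (m z \<zeta>) \<le> real CARD('k \<times> 'q) * Bx"
  using norm_vec_le_sum[of "m z \<zeta>"] sum_bounded_above[of UNIV "\<lambda>r. norm (m z \<zeta> $ r)" Bx] m_component_le[of z \<zeta>] by simp

lemma osc_bounds: "0 \<le> osc z \<zeta> r" "osc z \<zeta> r \<le> Bq * real CARD('k)"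
proof -
  show "0 \<le> osc z \<zeta> r" using Bq by (simp add: osc_def sum_nonneg)
  have "(\<Sum>d\<in>(UNIV::'k set). indicator {v. \<bar>v\<bar> \<le> Bq * r} (snd z - fst z \<bullet> beta \<zeta> d) :: real) \<le> (\<Sum>d\<in>(UNIV::'k set). 1)"
    by (rule sum_mono) (simp add: indicator_def)
  then show "osc z \<zeta> r \<le> Bq * real CARD('k)" using Bq by (simp add: osc_def)
qed

lemma osc_measurable: "(\<lambda>z. osc z \<zeta> r) \<in> borel_measurable borel"
proof -
  have [measurable]: "(\<lambda>z :: (real ^ 'q) \<times> real. snd z - fst z \<bullet> beta \<zeta> d) \<in> borel_measurable borel" for d
    by (intro borel_measurable_continuous_onI continuous_intros)
  have [measurable]: "{v::real. \<bar>v\<bar> \<le> Bq * r} \<in> sets borel" by measurable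
  show ?thesis unfolding osc_def by measurable
qed

lemma osc:
  assumes z: "z \<in> good" and r: "norm (\<zeta>' - \<zeta>) \<le> r"
  shows "norm (m z \<zeta>' - m z \<zeta>) \<le> osc z \<zeta> r"
proof -
  have x: "norm (fst z) \<le> Bx" using z by (simp add: good_def)
  define I where "I = (\<lambda>d. indicator {v. \<bar>v\<bar> \<le> Bq * r} (snd z - fst z \<bullet> beta \<zeta> d) :: real)"
  have comp: "norm ((m z \<zeta>' - m z \<zeta>) $ q) \<le> I (fst q) * Bx" for q
  proof -
    define u where "u = snd z - fst z \<bullet> beta \<zeta> (fst q)"
    define u' where "u' = snd z - fst z \<bullet> beta \<zeta>' (fst q)"
    have "\<bar>u' - u\<bar> = \<bar>fst z \<bullet> beta (\<zeta>' - \<zeta>) (fst q)\<bar>" by (simp add: u_def u'_def beta_diff inner_diff_right)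
    also have "\<dots> \<le> Bq * norm (\<zeta>' - \<zeta>)" unfolding Bq_def by (rule abs_inner_beta_le[OF x])
    also have "\<dots> \<le> Bq * r" using r Bq by (intro mult_left_mono) auto
    finally have "\<bar>\<psi> (\<tau> (fst q)) u' - \<psi> (\<tau> (fst q)) u\<bar> \<le> I (fst q)"
      unfolding I_def u_def[symmetric] by (intro psi_increment) (use \<tau> in auto)
    moreover have "\<bar>fst z $ snd q\<bar> \<le> Bx" using component_le_norm_cart[of "fst z" "snd q"] x by simp
    moreover have "(m z \<zeta>' - m z \<zeta>) $ q = (\<psi> (\<tau> (fst q)) u' - \<psi> (\<tau> (fst q)) u) * fst z $ snd q"
      by (simp add: m_est_def u_def u'_def left_diff_distrib)
    ultimately show ?thesis by (simp add: abs_mult mult_mono)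
  qed
  have "norm (m z \<zeta>' - m z \<zeta>) \<le> (\<Sum>q\<in>UNIV. norm ((m z \<zeta>' - m z \<zeta>) $ q))" by (rule norm_vec_le_sum)
  also have "\<dots> \<le> (\<Sum>q\<in>(UNIV :: ('k \<times> 'q) set). I (fst q) * Bx)" by (rule sum_mono) (rule comp)
  also have "\<dots> = (\<Sum>(d, j)\<in>(UNIV :: 'k set) \<times> (UNIV :: 'q set). I d * Bx)" by (simp add: case_prod_unfold)
  also have "\<dots> = (\<Sum>d\<in>UNIV. \<Sum>j\<in>(UNIV :: 'q set). I d * Bx)" by (rule sum.cartesian_product[symmetric])
  also have "\<dots> = Bq * (\<Sum>d\<in>UNIV. I d)"
    by (simp add: Bq_def mult.commute mult.left_commute flip: sum_distrib_left sum_distrib_right)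
  also have "\<dots> = osc z \<zeta> r" by (simp only: osc_def I_def)
  finally show ?thesis .
qed

lemma m_measurable_P [measurable]: "(\<lambda>z. m z \<zeta>) \<in> borel_measurable P"
  unfolding measurable_cong_sets[OF P(2) refl] by (rule m_est_measurable)

lemma integrable_P:
  fixes f :: "(real ^ 'q) \<times> real \<Rightarrow> 'b::{banach, second_countable_topology}"
  assumes "f \<in> borel_measurable borel" "\<And>z. z \<in> good \<Longrightarrow> norm (f z) \<le> C"
  shows "integrable P f"
proof (rule P.integrable_const_bound)
  show "AE z in P. norm (f z) \<le> C" by (rule eventually_mono[OF AE_good assms(2)])
  show "f \<in> borel_measurable P" unfolding measurable_cong_sets[OF P(2) refl] by (rule assms(1))
qed

lemma integrable_m: "integrable P (\<lambda>z. m z \<zeta>)"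
  by (rule integrable_P[OF m_est_measurable norm_m_le]) (simp add: good_def)

definition mu :: "real ^ ('k \<times> 'q) \<Rightarrow> real ^ ('k \<times> 'q)" where "mu \<zeta> = (\<integral>z. m z \<zeta> \<partial>P)"

lemma inner_mu: "u \<bullet> mu \<zeta> = (\<integral>z. u \<bullet> m z \<zeta> \<partial>P)"
  using integrable_m by (simp add: mu_def)

text \<open>The indicator of \<open>\<bar>Y - X\<^sup>T\<beta>\<bar> \<le> \<rho>\<close> is dominated by the increment of \<open>m\<close> between two parameters whose
  intercepts differ by \<open>4\<rho>\<close>, so differentiability of the mean controls its expectation.\<close>
lemma osc_mean:
  "\<exists>L>0. \<forall>\<epsilon>>0. \<epsilon> \<le> 1 \<longrightarrow> (\<exists>\<delta>>0. \<forall>s c. 0 < s \<longrightarrow> s \<le> \<delta> \<longrightarrow> norm c \<le> 1 \<longrightarrow>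
     (\<integral>z. osc z (\<zeta>0 + s *\<^sub>R c) (\<epsilon> * s) \<partial>P) \<le> L * \<epsilon> * s)"
proof -
  define D where "D = (\<lambda>h. - (V12 *v h))"
  have der: "(mu has_derivative D) (at \<zeta>0)" using mean_deriv unfolding mu_def[abs_def] D_def .
  have bD: "bounded_linear D" using der by (rule has_derivative_bounded_linear)
  obtain KD where KD: "KD > 0" "\<And>x. norm (D x) \<le> norm x * KD" using bounded_linear.pos_bounded[OF bD] by blast
  \<comment> \<open>4 Bq KD comes from the linear part of the increment over intercept distance 4
    \<rho>, and the 2 from two linearisation errors \<epsilon> s.\<close>
  define L where "L = Bq * (real CARD('k) * (4 * Bq * KD + 2))"
  have L: "0 < L" unfolding L_def using Bq KD(1) by (intro mult_pos_pos add_pos_pos) auto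
  show ?thesis
  proof (rule exI[of _ L], rule conjI[OF L], intro allI impI)
    fix \<epsilon> :: real assume \<epsilon>: "0 < \<epsilon>" "\<epsilon> \<le> 1"
    \<comment> \<open>All points compared lie within (1 + 2 Bq) s of \<zeta>0; dividing by that
      factor makes each linearisation error at most \<epsilon> s.\<close>
    define e where "e = \<epsilon> / (1 + 2 * Bq)"
    have e: "0 < e" using \<epsilon> Bq by (simp add: e_def)
    obtain \<delta>0 where \<delta>0: "0 < \<delta>0" "\<And>y. norm (y - \<zeta>0) < \<delta>0 \<Longrightarrow> norm (mu y - mu \<zeta>0 - D (y - \<zeta>0)) \<le> e * norm (y - \<zeta>0)"
      using der[unfolded has_derivative_at_alt] e by blast
    define \<delta> where "\<delta> = \<delta>0 / (2 * (1 + 2 * Bq))"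
    have \<delta>: "0 < \<delta>" using \<delta>0 Bq by (simp add: \<delta>_def)
    show "\<exists>\<delta>>0. \<forall>s c. 0 < s \<longrightarrow> s \<le> \<delta> \<longrightarrow> norm c \<le> 1 \<longrightarrow> (\<integral>z. osc z (\<zeta>0 + s *\<^sub>R c) (\<epsilon> * s) \<partial>P) \<le> L * \<epsilon> * s"
    proof (rule exI[of _ \<delta>], rule conjI[OF \<delta>], intro allI impI)
      fix s :: real and c :: "real ^ ('k \<times> 'q)" assume s: "0 < s" "s \<le> \<delta>" and c: "norm c \<le> 1"
      define \<rho> where "\<rho> = Bq * (\<epsilon> * s)"
      have \<rho>: "0 < \<rho>" "\<rho> \<le> Bq * s" using Bq \<epsilon> s by (auto simp: \<rho>_def)
      define \<zeta> where "\<zeta> = \<zeta>0 + s *\<^sub>R c"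
      have near: "norm (mu (\<zeta> + v) - mu \<zeta>0 - D (s *\<^sub>R c + v)) \<le> \<epsilon> * s" if v: "norm v \<le> 2 * \<rho>" for v
      proof -
        have "norm (s *\<^sub>R c + v) \<le> s * norm c + norm v" using norm_triangle_ineq[of "s *\<^sub>R c" v] s by simp
        also have "\<dots> \<le> s * 1 + 2 * (Bq * s)" using v \<rho> c s by (intro add_mono mult_left_mono) auto
        finally have n: "norm (s *\<^sub>R c + v) \<le> (1 + 2 * Bq) * s" by (simp add: algebra_simps)
        also have "\<dots> \<le> (1 + 2 * Bq) * \<delta>" using s Bq by (intro mult_left_mono) auto
        also have "\<dots> = \<delta>0 / 2" using Bq by (simp add: \<delta>_def field_simps)
        finally have "norm (s *\<^sub>R c + v) < \<delta>0" using \<delta>0(1) by simp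
        then have "norm (mu (\<zeta> + v) - mu \<zeta>0 - D (s *\<^sub>R c + v)) \<le> e * norm (s *\<^sub>R c + v)"
          using \<delta>0(2)[of "\<zeta> + v"] by (simp add: \<zeta>_def add.assoc)
        also have "\<dots> \<le> e * ((1 + 2 * Bq) * s)" using n e by (intro mult_left_mono) auto
        also have "\<dots> = \<epsilon> * s" using Bq by (simp add: e_def)
        finally show ?thesis .
      qed
      have one: "(\<integral>z. indicator {v. \<bar>v\<bar> \<le> \<rho>} (snd z - fst z \<bullet> beta \<zeta> d) \<partial>P) \<le> (4 * Bq * KD + 2) * (\<epsilon> * s)" for d
      proof -
        \<comment> \<open>Unit vector of the intercept at level d. Since x has intercept 1, a . m is
          the score itself, and moving along a shifts its residual by a constant.\<close>
        define a where "a = (axis (d, icpt) 1 :: real ^ ('k \<times> 'q))"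
        have na: "norm a = 1" by (simp add: a_def)
        have ba: "x \<bullet> beta (t *\<^sub>R a) d = t * x $ icpt" for x :: "real ^ 'q" and t
          by (simp add: beta_def a_def inner_vec_def axis_def if_distrib[of "\<lambda>v. _ * v"] cong: if_cong)
        have am: "a \<bullet> m z \<xi> = \<psi> (\<tau> d) (snd z - fst z \<bullet> beta \<xi> d)" if "z \<in> good" for z \<xi>
          using that by (simp add: a_def inner_axis' m_est_def good_def)
        have le: "indicator {v. \<bar>v\<bar> \<le> \<rho>} (snd z - fst z \<bullet> beta \<zeta> d) \<le> a \<bullet> m z (\<zeta> + (2 * \<rho>) *\<^sub>R a) - a \<bullet> m z (\<zeta> + (- (2 * \<rho>)) *\<^sub>R a)"
          if z: "z \<in> good" for z
        proof -
          have x1: "fst z $ icpt = 1" using z by (simp add: good_def)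
          show ?thesis unfolding am[OF z] beta_add inner_add_right ba x1
            using psi_jump[of "\<tau> d" \<rho> "snd z - fst z \<bullet> beta \<zeta> d"] \<tau> \<rho>(1) by (simp add: algebra_simps)
        qed
        have "(\<integral>z. indicator {v. \<bar>v\<bar> \<le> \<rho>} (snd z - fst z \<bullet> beta \<zeta> d) \<partial>P)
            \<le> (\<integral>z. a \<bullet> m z (\<zeta> + (2 * \<rho>) *\<^sub>R a) - a \<bullet> m z (\<zeta> + (- (2 * \<rho>)) *\<^sub>R a) \<partial>P)"
        proof (rule integral_mono_AE)
          have [measurable]: "(\<lambda>z :: (real ^ 'q) \<times> real. snd z - fst z \<bullet> beta \<zeta> d) \<in> borel_measurable borel"
            by (intro borel_measurable_continuous_onI continuous_intros)
          show "integrable P (\<lambda>z. indicator {v. \<bar>v\<bar> \<le> \<rho>} (snd z - fst z \<bullet> beta \<zeta> d) :: real)"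
            by (rule integrable_P[of _ 1]) (auto simp: indicator_def)
          show "integrable P (\<lambda>z. a \<bullet> m z (\<zeta> + (2 * \<rho>) *\<^sub>R a) - a \<bullet> m z (\<zeta> + (- (2 * \<rho>)) *\<^sub>R a))"
            using integrable_m by simp
          show "AE z in P. indicator {v. \<bar>v\<bar> \<le> \<rho>} (snd z - fst z \<bullet> beta \<zeta> d) \<le> a \<bullet> m z (\<zeta> + (2 * \<rho>) *\<^sub>R a) - a \<bullet> m z (\<zeta> + (- (2 * \<rho>)) *\<^sub>R a)"
            by (rule eventually_mono[OF AE_good le])
        qed
        also have "\<dots> = a \<bullet> mu (\<zeta> + (2 * \<rho>) *\<^sub>R a) - a \<bullet> mu (\<zeta> + (- (2 * \<rho>)) *\<^sub>R a)"
          unfolding inner_mu by (rule Bochner_Integration.integral_diff) (use integrable_m in auto)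
        also have "\<dots> = a \<bullet> (mu (\<zeta> + (2 * \<rho>) *\<^sub>R a) - mu (\<zeta> + (- (2 * \<rho>)) *\<^sub>R a))" by (simp add: inner_diff_right)
        also have "\<dots> \<le> norm (mu (\<zeta> + (2 * \<rho>) *\<^sub>R a) - mu (\<zeta> + (- (2 * \<rho>)) *\<^sub>R a))"
          using norm_cauchy_schwarz[of a] na by (metis mult_1)
        also have "mu (\<zeta> + (2 * \<rho>) *\<^sub>R a) - mu (\<zeta> + (- (2 * \<rho>)) *\<^sub>R a)
          = (mu (\<zeta> + (2 * \<rho>) *\<^sub>R a) - mu \<zeta>0 - D (s *\<^sub>R c + (2 * \<rho>) *\<^sub>R a))
            - (mu (\<zeta> + (- (2 * \<rho>)) *\<^sub>R a) - mu \<zeta>0 - D (s *\<^sub>R c + (- (2 * \<rho>)) *\<^sub>R a)) + D ((4 * \<rho>) *\<^sub>R a)"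
        proof -
          have "D (s *\<^sub>R c + (2 * \<rho>) *\<^sub>R a) - D (s *\<^sub>R c + (- (2 * \<rho>)) *\<^sub>R a) = D ((s *\<^sub>R c + (2 * \<rho>) *\<^sub>R a) - (s *\<^sub>R c + (- (2 * \<rho>)) *\<^sub>R a))"
            by (simp only: linear_diff[OF bounded_linear.linear[OF bD]])
          also have "(s *\<^sub>R c + (2 * \<rho>) *\<^sub>R a) - (s *\<^sub>R c + (- (2 * \<rho>)) *\<^sub>R a) = (4 * \<rho>) *\<^sub>R a"
            by (simp flip: scaleR_add_left)
          finally show ?thesis by (simp add: algebra_simps)
        qed
        also have "norm \<dots> \<le> \<epsilon> * s + \<epsilon> * s + 4 * \<rho> * KD"
        proof (rule norm_triangle_le[OF add_mono[OF norm_triangle_le_diff[OF add_mono]]])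
          show "norm (mu (\<zeta> + (2 * \<rho>) *\<^sub>R a) - mu \<zeta>0 - D (s *\<^sub>R c + (2 * \<rho>) *\<^sub>R a)) \<le> \<epsilon> * s" by (rule near) (use na \<rho> in simp)
          show "norm (mu (\<zeta> + (- (2 * \<rho>)) *\<^sub>R a) - mu \<zeta>0 - D (s *\<^sub>R c + (- (2 * \<rho>)) *\<^sub>R a)) \<le> \<epsilon> * s" by (rule near) (use na \<rho> in simp)
          show "norm (D ((4 * \<rho>) *\<^sub>R a)) \<le> 4 * \<rho> * KD" using KD(2)[of "(4 * \<rho>) *\<^sub>R a"] na \<rho> by simp
        qed
        also have "\<dots> = (4 * Bq * KD + 2) * (\<epsilon> * s)" by (simp add: \<rho>_def algebra_simps)
        finally show ?thesis .
      qed
      have ii: "integrable P (\<lambda>z. indicator {v. \<bar>v\<bar> \<le> \<rho>} (snd z - fst z \<bullet> beta \<zeta> d) :: real)" for d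
      proof (rule integrable_P[of _ 1])
        have [measurable]: "(\<lambda>z :: (real ^ 'q) \<times> real. snd z - fst z \<bullet> beta \<zeta> d) \<in> borel_measurable borel"
          by (intro borel_measurable_continuous_onI continuous_intros)
        show "(\<lambda>z :: (real ^ 'q) \<times> real. indicator {v. \<bar>v\<bar> \<le> \<rho>} (snd z - fst z \<bullet> beta \<zeta> d) :: real) \<in> borel_measurable borel" by measurable
      qed (auto simp: indicator_def)
      have "(\<integral>z. osc z \<zeta> (\<epsilon> * s) \<partial>P) = Bq * (\<Sum>d\<in>UNIV. \<integral>z. indicator {v. \<bar>v\<bar> \<le> \<rho>} (snd z - fst z \<bullet> beta \<zeta> d) \<partial>P)"
        unfolding osc_def \<rho>_def[symmetric] using ii by simp
      also have "\<dots> \<le> Bq * (\<Sum>d\<in>(UNIV::'k set). (4 * Bq * KD + 2) * (\<epsilon> * s))"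
        using Bq by (intro mult_left_mono sum_mono one) auto
      also have "\<dots> = L * \<epsilon> * s" by (simp add: L_def)
      finally show "(\<integral>z. osc z (\<zeta>0 + s *\<^sub>R c) (\<epsilon> * s) \<partial>P) \<le> L * \<epsilon> * s" by (simp add: \<zeta>_def)
    qed
  qed
qed

lemma real_distribution_PY: "real_distribution (PY x)"
proof -
  have "PY \<in> borel \<rightarrow>\<^sub>M prob_algebra borel" using cond by (simp add: is_cond_dist_def)
  from measurable_space[OF this, of x] have "prob_space (PY x)" "sets (PY x) = sets borel"
    by (auto simp: space_prob_algebra)
  then show ?thesis by (simp add: real_distribution_def real_distribution_axioms_def)
qed

lemma isCont_cdf_PY:
  assumes "x \<in> msupport GX"
  shows "isCont (cdf (PY x)) t"
  using cdf_smooth[OF assms] unfolding twice_cont_diff_def by (meson differentiable_imp_continuous_within)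

lemma disintegrate:
  fixes f :: "(real ^ 'q) \<times> real \<Rightarrow> real"
  assumes "f \<in> borel_measurable borel" and "\<And>x y. norm x \<le> Bx \<Longrightarrow> \<bar>f (x, y)\<bar> \<le> C"
  shows "(\<integral>z. f z \<partial>P) = (\<integral>x. (\<integral>y. f (x, y) \<partial>PY x) \<partial>GX)"
    and "integrable GX (\<lambda>x. \<integral>y. f (x, y) \<partial>PY x)"
proof -
  have A: "{x :: real ^ 'q. norm x \<le> Bx} \<in> sets borel"
    by (intro borel_closed closed_Collect_le continuous_intros)
  have AE: "AE x in GX. x \<in> {x :: real ^ 'q. norm x \<le> Bx}" using AE_GX by (rule eventually_mono) simp
  show "(\<integral>z. f z \<partial>P) = (\<integral>x. (\<integral>y. f (x, y) \<partial>PY x) \<partial>GX)"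
    by (rule disintegration[OF P cond assms(1) A AE]) (rule assms(2), simp)
  show "integrable GX (\<lambda>x. \<integral>y. f (x, y) \<partial>PY x)"
    by (rule disintegration_integrable[OF P cond assms(1) A AE]) (rule assms(2), simp)
qed

lemma integrable_psi: "integrable (PY x) (\<lambda>y. \<psi> (\<tau> d) (y - b))"
proof -
  interpret real_distribution "PY x" by (rule real_distribution_PY)
  show ?thesis
    by (rule integrable_const_bound[of _ 1, OF AE_I2]) (use abs_psi_le \<tau> in auto)
qed

section \<open>Conditional moments at the true parameter\<close>

lemma inner_mean:
  assumes x: "x \<in> msupport GX"
  shows "(\<integral>y. u \<bullet> m_est \<tau> x y \<zeta> \<partial>PY x) = (\<Sum>d\<in>UNIV. (cdf (PY x) (x \<bullet> beta \<zeta> d) - \<tau> d) * (x \<bullet> beta u d))"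
  unfolding inner_m_est
  using integrable_psi integral_psi[OF real_distribution_PY isCont_cdf_PY[OF x]] by simp

lemma inner_m_measurable: "(\<lambda>z. u \<bullet> m z \<zeta>) \<in> borel_measurable borel"
  by (intro borel_measurable_inner borel_measurable_const m_est_measurable)

lemma inner_m_le: "norm (x :: real ^ 'q) \<le> Bx \<Longrightarrow> \<bar>u \<bullet> m_est \<tau> x y \<zeta>\<bar> \<le> norm u * (real CARD('k \<times> 'q) * Bx)"
  using Cauchy_Schwarz_ineq2[of u "m_est \<tau> x y \<zeta>"] mult_left_mono[OF norm_m_le[of "(x, y)" \<zeta>] norm_ge_zero[of u]] by simp

lemma AE_cdf: "AE x in GX. \<forall>d. cdf (PY x) (x \<bullet> beta \<zeta>0 d) = \<tau> d"
  using AE_GX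
proof (rule eventually_mono)
  fix x assume "norm x \<le> Bx \<and> x $ icpt = 1 \<and> x \<in> msupport GX \<and> (\<forall>d. quantile (PY x) (\<tau> d) = x \<bullet> beta \<zeta>0 d)"
  then have x: "x \<in> msupport GX" "\<And>d. quantile (PY x) (\<tau> d) = x \<bullet> beta \<zeta>0 d" by auto
  show "\<forall>d. cdf (PY x) (x \<bullet> beta \<zeta>0 d) = \<tau> d"
    using cdf_quantile[OF real_distribution_PY isCont_cdf_PY[OF x(1)]] \<tau> by (simp flip: x(2))
qed

text \<open>Disintegration is available for real functions, so the mean is paired with itself; the
  inner integrals vanish because the conditional cdf equals \<tau> d at the linear
  predictor.\<close>

lemma mean_zero: "mu \<zeta>0 = 0"
proof -
  have "mu \<zeta>0 \<bullet> mu \<zeta>0 = (\<integral>x. (\<integral>y. mu \<zeta>0 \<bullet> m (x, y) \<zeta>0 \<partial>PY x) \<partial>GX)"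
    unfolding inner_mu by (rule disintegrate(1)[OF inner_m_measurable]) (simp, rule inner_m_le)
  also have "\<dots> = 0"
  proof (rule integral_eq_zero_AE)
    show "AE x in GX. (\<integral>y. mu \<zeta>0 \<bullet> m (x, y) \<zeta>0 \<partial>PY x) = 0"
      using AE_GX AE_cdf by eventually_elim (simp add: inner_mean)
  qed
  finally show ?thesis by simp
qed

lemma integral_matrix_component:
  fixes F :: "'z \<Rightarrow> real ^ 'm ^ 'n"
  assumes "integrable N F"
  shows "(\<integral>z. F z \<partial>N) $ i $ j = (\<integral>z. F z $ i $ j \<partial>N)"
proof -
  have "bounded_linear (\<lambda>A :: real ^ 'm ^ 'n. A $ i $ j)"
    by (rule bounded_linear_compose[OF bounded_linear_vec_nth bounded_linear_vec_nth])
  from integral_bounded_linear[OF this assms] show ?thesis by simp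
qed

lemma integrable_outer:
  fixes F :: "(real ^ 'q) \<times> real \<Rightarrow> real ^ 'n"
  assumes F: "F \<in> borel_measurable borel" "\<And>z. z \<in> good \<Longrightarrow> norm (F z) \<le> C"
  shows "integrable P (\<lambda>z. outer (F z) (F z))"
proof (rule integrable_P)
  have [measurable]: "(\<lambda>z. F z $ i) \<in> borel_measurable borel" for i
    by (rule measurable_compose[OF F(1) vec_nth_measurable])
  show "(\<lambda>z. outer (F z) (F z)) \<in> borel_measurable borel"
    by (intro borel_measurable_vec) (simp add: outer_def)
  fix z assume z: "z \<in> good"
  have "norm (outer (F z) (F z)) \<le> (\<Sum>i\<in>UNIV. norm (outer (F z) (F z) $ i))" by (rule norm_vec_le_sum)
  also have "\<dots> \<le> (\<Sum>i\<in>(UNIV::'n set). C * C)"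
  proof (rule sum_mono)
    fix i
    have "outer (F z) (F z) $ i = (F z $ i) *\<^sub>R F z" by (simp add: outer_def vec_eq_iff)
    then have "norm (outer (F z) (F z) $ i) = \<bar>F z $ i\<bar> * norm (F z)" by simp
    also have "\<dots> \<le> C * C"
      using F(2)[OF z] component_le_norm_cart[of "F z" i] norm_ge_zero[of "F z"] by (intro mult_mono) linarith+
    finally show "norm (outer (F z) (F z) $ i) \<le> C * C" .
  qed
  finally show "norm (outer (F z) (F z)) \<le> (\<Sum>i\<in>(UNIV::'n set). C * C)" .
qed

text \<open>Given X = x, for almost every x, the scores have the mixed moments
  \<open>Psi_mat\<close> independently of x, and the covariates factor out. Averaging over x
  produces the Kronecker product.\<close>

lemma second_moment_entry: "(\<integral>z. m z \<zeta>0 $ r * m z \<zeta>0 $ s \<partial>P) = V11 P \<tau> $ r $ s"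
proof -
  have mr[measurable]: "(\<lambda>z. m z \<zeta>0 $ r) \<in> borel_measurable borel" for r
    by (rule measurable_compose[OF m_est_measurable vec_nth_measurable])
  have "(\<integral>z. m z \<zeta>0 $ r * m z \<zeta>0 $ s \<partial>P) = (\<integral>x. (\<integral>y. m (x, y) \<zeta>0 $ r * m (x, y) \<zeta>0 $ s \<partial>PY x) \<partial>GX)"
  proof (rule disintegrate(1)[of _ "Bx * Bx"])
    show "(\<lambda>z. m z \<zeta>0 $ r * m z \<zeta>0 $ s) \<in> borel_measurable borel" by measurable
    show "\<bar>m (x, y) \<zeta>0 $ r * m (x, y) \<zeta>0 $ s\<bar> \<le> Bx * Bx" if "norm x \<le> Bx" for x y
      unfolding abs_mult using m_component_le[of "(x, y)" \<zeta>0] that Bx(1) by (intro mult_mono) auto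
  qed
  also have "\<dots> = (\<integral>x. Psi_mat \<tau> $ fst r $ fst s * (x $ snd r * x $ snd s) \<partial>GX)"
  proof (rule integral_cong_AE)
    show "(\<lambda>x. \<integral>y. m (x, y) \<zeta>0 $ r * m (x, y) \<zeta>0 $ s \<partial>PY x) \<in> borel_measurable GX"
    proof (rule borel_measurable_integrable[OF disintegrate(2)[of _ "Bx * Bx"]])
      show "(\<lambda>z. m z \<zeta>0 $ r * m z \<zeta>0 $ s) \<in> borel_measurable borel" by measurable
      show "\<bar>m (x, y) \<zeta>0 $ r * m (x, y) \<zeta>0 $ s\<bar> \<le> Bx * Bx" if "norm x \<le> Bx" for x y
        unfolding abs_mult using m_component_le[of "(x, y)" \<zeta>0] that Bx(1) by (intro mult_mono) auto
    qed
    show "(\<lambda>x :: real ^ 'q. Psi_mat \<tau> $ fst r $ fst s * (x $ snd r * x $ snd s)) \<in> borel_measurable GX"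
      by (simp add: vec_nth_measurable)
    show "AE x in GX. (\<integral>y. m (x, y) \<zeta>0 $ r * m (x, y) \<zeta>0 $ s \<partial>PY x) = Psi_mat \<tau> $ fst r $ fst s * (x $ snd r * x $ snd s)"
      using AE_GX AE_cdf
    proof eventually_elim
      case (elim x)
      have "(\<integral>y. m (x, y) \<zeta>0 $ r * m (x, y) \<zeta>0 $ s \<partial>PY x)
        = (\<integral>y. (\<psi> (\<tau> (fst r)) (y - x \<bullet> beta \<zeta>0 (fst r)) * \<psi> (\<tau> (fst s)) (y - x \<bullet> beta \<zeta>0 (fst s))) * (x $ snd r * x $ snd s) \<partial>PY x)"
        by (rule Bochner_Integration.integral_cong) (simp_all add: m_est_def)
      also have "\<dots> = (\<integral>y. \<psi> (\<tau> (fst r)) (y - x \<bullet> beta \<zeta>0 (fst r)) * \<psi> (\<tau> (fst s)) (y - x \<bullet> beta \<zeta>0 (fst s)) \<partial>PY x) * (x $ snd r * x $ snd s)"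
        by simp
      also have "(\<integral>y. \<psi> (\<tau> (fst r)) (y - x \<bullet> beta \<zeta>0 (fst r)) * \<psi> (\<tau> (fst s)) (y - x \<bullet> beta \<zeta>0 (fst s)) \<partial>PY x) = Psi_mat \<tau> $ fst r $ fst s"
        using integral_psi_mult[OF real_distribution_PY isCont_cdf_PY] elim by (simp add: Psi_mat_def)
      finally show ?case .
    qed
  qed
  also have "\<dots> = Psi_mat \<tau> $ fst r $ fst s * (\<integral>x. x $ snd r * x $ snd s \<partial>GX)" by simp
  also have "(\<integral>x. x $ snd r * x $ snd s \<partial>GX) = (\<integral>z. fst z $ snd r * fst z $ snd s \<partial>P)"
    by (rule integral_distr[OF fst_measurable]) (simp add: vec_nth_measurable)
  also have "\<dots> = (\<integral>z. outer (fst z) (fst z) \<partial>P) $ snd r $ snd s"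
  proof -
    have "fst \<in> borel_measurable (borel :: ((real ^ 'q) \<times> real) measure)"
      by (intro borel_measurable_continuous_onI continuous_intros)
    then have "integrable P (\<lambda>z. outer (fst z) (fst z))" by (rule integrable_outer[of _ Bx]) (simp add: good_def)
    then show ?thesis by (simp add: integral_matrix_component outer_def)
  qed
  finally show ?thesis by (simp add: V11_def kronecker_def)
qed

text \<open>Through this identity condition (e) becomes definiteness of \<open>V11\<close>.\<close>

lemma V11_eq: "V11 P \<tau> = (\<integral>z. outer (m z \<zeta>0) (m z \<zeta>0) \<partial>P)"
proof -
  have "integrable P (\<lambda>z. outer (m z \<zeta>0) (m z \<zeta>0))"
    by (rule integrable_outer[OF m_est_measurable norm_m_le]) (simp add: good_def)
  then show ?thesis
    by (simp add: vec_eq_iff integral_matrix_component flip: second_moment_entry) (simp add: outer_def)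
qed

lemma V11_pos_def: "pos_def (V11 P \<tau>)"
  using pd by (simp add: V11_eq)

lemma second_moment: "(\<integral>z. (u \<bullet> m z \<zeta>0) * (v \<bullet> m z \<zeta>0) \<partial>P) = u \<bullet> (V11 P \<tau> *v v)"
proof -
  have mr[measurable]: "(\<lambda>z. m z \<zeta>0 $ r) \<in> borel_measurable borel" for r
    by (rule measurable_compose[OF m_est_measurable vec_nth_measurable])
  have i: "integrable P (\<lambda>z. m z \<zeta>0 $ r * m z \<zeta>0 $ s)" for r s
  proof (rule integrable_P[of _ "Bx * Bx"])
    show "norm (m z \<zeta>0 $ r * m z \<zeta>0 $ s) \<le> Bx * Bx" if "z \<in> good" for z
      unfolding norm_mult using m_component_le[of z \<zeta>0] that Bx(1) by (intro mult_mono) (auto simp: good_def)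
  qed measurable
  have "(u \<bullet> m z \<zeta>0) * (v \<bullet> m z \<zeta>0) = (\<Sum>r\<in>UNIV. \<Sum>s\<in>UNIV. u $ r * v $ s * (m z \<zeta>0 $ r * m z \<zeta>0 $ s))" for z
    by (simp add: inner_vec_def sum_product mult.assoc mult.left_commute)
  then have "(\<integral>z. (u \<bullet> m z \<zeta>0) * (v \<bullet> m z \<zeta>0) \<partial>P) = (\<Sum>r\<in>UNIV. \<Sum>s\<in>UNIV. u $ r * v $ s * V11 P \<tau> $ r $ s)"
    using i by (simp add: second_moment_entry)
  also have "\<dots> = u \<bullet> (V11 P \<tau> *v v)"
    by (simp add: inner_vec_def matrix_vector_mult_def sum_distrib_left mult.commute mult.left_commute)
  finally show ?thesis .
qed

section \<open>Coercivity of the derivative of the mean\<close>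

text \<open>Conditional difference quotients of h . m in direction h tend to the sum over d of f_x
  (x . beta h d)^2, with f_x the density at the quantile. Differentiating under the integral would
  need a dominating function; the quotients being nonnegative, Fatou bounds the integral of this
  limit by the derivative of the mean. Were that derivative nonpositive, x . beta h d would vanish
  almost surely for every d, contrary to the definiteness of V11.\<close>

lemma mean_derivative_pos:
  assumes h: "h \<noteq> 0"
  shows "0 < h \<bullet> (- (V12 *v h))"
proof (rule ccontr)
  assume neg: "\<not> 0 < h \<bullet> (- (V12 *v h))"
  define D where "D = (\<lambda>h. - (V12 *v h))"
  have der: "(mu has_derivative D) (at \<zeta>0)" using mean_deriv unfolding mu_def[abs_def] D_def .
  have linD: "linear D" using der by (simp add: has_derivative_linear)
  define t where "t = (\<lambda>n. 1 / (real n + 1))"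
  have t0: "0 < t n" for n by (simp add: t_def)
  have tlim: "filterlim t (at 0) sequentially"
  proof (rule filterlim_atI)
    show "t \<longlonglongrightarrow> 0" using LIMSEQ_inverse_real_of_nat by (simp add: t_def inverse_eq_divide add.commute)
    show "\<forall>\<^sub>F n in sequentially. t n \<noteq> 0" using t0 by (intro always_eventually allI) (metis less_irrefl)
  qed
  define z where "z = (\<lambda>n w. h \<bullet> m w (\<zeta>0 + t n *\<^sub>R h) - h \<bullet> m w \<zeta>0)"
  have z0: "0 \<le> z n w" for n w
    using m_est_mono[where \<tau> = \<tau> and u = h and x = "fst w" and y = "snd w" and \<zeta> = \<zeta>0, OF \<tau> less_imp_le[OF t0[of n]]]
    by (simp add: z_def)
  have zm: "z n \<in> borel_measurable borel" for n
    unfolding z_def by (intro borel_measurable_diff inner_m_measurable)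
  have zb: "\<bar>z n (x, y)\<bar> \<le> 2 * (norm h * (real CARD('k \<times> 'q) * Bx))" if "norm x \<le> Bx" for n x y
    using inner_m_le[OF that, of h y "\<zeta>0 + t n *\<^sub>R h"] inner_m_le[OF that, of h y \<zeta>0] by (simp add: z_def abs_le_iff)
  \<comment> \<open>The conditional difference quotients; monotonicity of m makes them nonnegative,
    as Fatou's lemma demands.\<close>
  define \<Psi> where "\<Psi> = (\<lambda>n x. (\<integral>y. z n (x, y) \<partial>PY x) / t n)"
  have \<Psi>0: "0 \<le> \<Psi> n x" for n x
    unfolding \<Psi>_def using z0 t0[of n] by (intro divide_nonneg_pos Bochner_Integration.integral_nonneg) auto
  have \<Psi>i: "integrable GX (\<Psi> n)" for n
    unfolding \<Psi>_def using disintegrate(2)[OF zm zb] by simp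
  have \<Psi>I: "(\<integral>x. \<Psi> n x \<partial>GX) = h \<bullet> mu (\<zeta>0 + t n *\<^sub>R h) / t n" for n
  proof -
    have "(\<integral>x. \<Psi> n x \<partial>GX) = (\<integral>w. z n w \<partial>P) / t n" unfolding \<Psi>_def using disintegrate(1)[OF zm zb] by simp
    also have "(\<integral>w. z n w \<partial>P) = h \<bullet> mu (\<zeta>0 + t n *\<^sub>R h) - h \<bullet> mu \<zeta>0"
      unfolding z_def inner_mu by (rule Bochner_Integration.integral_diff) (use integrable_m in auto)
    finally show ?thesis by (simp add: mean_zero)
  qed
  have lim: "(\<lambda>n. \<integral>x. \<Psi> n x \<partial>GX) \<longlonglongrightarrow> h \<bullet> D h"
  proof -
    have "((\<lambda>s. \<zeta>0 + s *\<^sub>R h) has_derivative (\<lambda>s. s *\<^sub>R h)) (at 0)" by (auto intro!: derivative_eq_intros)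
    moreover have "(mu has_derivative D) (at (\<zeta>0 + 0 *\<^sub>R h))" using der by simp
    ultimately have "((\<lambda>s. mu (\<zeta>0 + s *\<^sub>R h)) has_derivative (\<lambda>s. D (s *\<^sub>R h))) (at 0)"
      by (rule has_derivative_compose)
    then have "((\<lambda>s. h \<bullet> mu (\<zeta>0 + s *\<^sub>R h)) has_derivative (\<lambda>s. h \<bullet> D (s *\<^sub>R h))) (at 0)"
      by (rule has_derivative_inner_right)
    moreover have "(\<lambda>s. h \<bullet> D (s *\<^sub>R h)) = (*) (h \<bullet> D h)" by (simp add: fun_eq_iff linear_cmul[OF linD] mult.commute)
    ultimately have "((\<lambda>s. h \<bullet> mu (\<zeta>0 + s *\<^sub>R h)) has_real_derivative h \<bullet> D h) (at 0)"
      by (simp add: has_field_derivative_def)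
    then have "((\<lambda>s. h \<bullet> mu (\<zeta>0 + s *\<^sub>R h) / s) \<longlongrightarrow> h \<bullet> D h) (at 0)"
      by (simp add: DERIV_def mean_zero)
    from filterlim_compose[OF this tlim] show ?thesis by (simp add: \<Psi>I)
  qed
  define l where "l = (\<lambda>x. \<Sum>d\<in>UNIV. deriv (cdf (PY x)) (x \<bullet> beta \<zeta>0 d) * (x \<bullet> beta h d)\<^sup>2)"
  have plim: "(\<lambda>n. \<Psi> n x) \<longlonglongrightarrow> l x"
    if x: "x \<in> msupport GX" and q: "\<forall>d. cdf (PY x) (x \<bullet> beta \<zeta>0 d) = \<tau> d" for x
  proof -
    have yi: "integrable (PY x) (\<lambda>y. u \<bullet> m_est \<tau> x y \<zeta>)" for u \<zeta> unfolding inner_m_est using integrable_psi by simp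
    have "\<Psi> n x = (\<Sum>d\<in>UNIV. (cdf (PY x) (x \<bullet> beta \<zeta>0 d + t n * (x \<bullet> beta h d)) - cdf (PY x) (x \<bullet> beta \<zeta>0 d)) / t n * (x \<bullet> beta h d))" for n
    proof -
      have "(\<integral>y. z n (x, y) \<partial>PY x) = (\<integral>y. h \<bullet> m_est \<tau> x y (\<zeta>0 + t n *\<^sub>R h) \<partial>PY x) - (\<integral>y. h \<bullet> m_est \<tau> x y \<zeta>0 \<partial>PY x)"
        unfolding z_def using yi by simp
      also have "\<dots> = (\<Sum>d\<in>UNIV. (cdf (PY x) (x \<bullet> beta \<zeta>0 d + t n * (x \<bullet> beta h d)) - cdf (PY x) (x \<bullet> beta \<zeta>0 d)) * (x \<bullet> beta h d))"
        unfolding inner_mean[OF x] using q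
        by (simp add: beta_add beta_scale inner_add_right left_diff_distrib sum_subtractf)
      finally show ?thesis by (simp add: \<Psi>_def sum_divide_distrib)
    qed
    moreover have "(\<lambda>n. \<Sum>d\<in>UNIV. (cdf (PY x) (x \<bullet> beta \<zeta>0 d + t n * (x \<bullet> beta h d)) - cdf (PY x) (x \<bullet> beta \<zeta>0 d)) / t n * (x \<bullet> beta h d)) \<longlonglongrightarrow> l x"
      unfolding l_def
    proof (rule tendsto_sum)
      fix d
      define b where "b = x \<bullet> beta \<zeta>0 d"
      define c where "c = x \<bullet> beta h d"
      have "cdf (PY x) differentiable at b" using cdf_smooth[OF x] by (simp add: twice_cont_diff_def)
      then have "(cdf (PY x) has_real_derivative deriv (cdf (PY x)) b) (at (b + 0 * c))"
        by (simp add: DERIV_deriv_iff_real_differentiable)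
      then have "((\<lambda>s. cdf (PY x) (b + s * c)) has_real_derivative deriv (cdf (PY x)) b * c) (at 0)"
        by (rule DERIV_chain2) (auto intro!: derivative_eq_intros)
      then have "((\<lambda>s. (cdf (PY x) (b + s * c) - cdf (PY x) b) / s) \<longlongrightarrow> deriv (cdf (PY x)) b * c) (at 0)"
        by (simp add: DERIV_def)
      from tendsto_mult[OF filterlim_compose[OF this tlim] tendsto_const[of c]]
      show "(\<lambda>n. (cdf (PY x) (x \<bullet> beta \<zeta>0 d + t n * (x \<bullet> beta h d)) - cdf (PY x) (x \<bullet> beta \<zeta>0 d)) / t n * (x \<bullet> beta h d))
        \<longlonglongrightarrow> deriv (cdf (PY x)) (x \<bullet> beta \<zeta>0 d) * (x \<bullet> beta h d)\<^sup>2"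
        by (simp add: b_def c_def power2_eq_square mult.assoc)
    qed
    ultimately show ?thesis by simp
  qed
  have "(\<integral>\<^sup>+x. liminf (\<lambda>n. ennreal (\<Psi> n x)) \<partial>GX) \<le> liminf (\<lambda>n. \<integral>\<^sup>+x. ennreal (\<Psi> n x) \<partial>GX)"
    by (rule nn_integral_liminf) (use borel_measurable_integrable[OF \<Psi>i] in simp)
  also have "(\<lambda>n. \<integral>\<^sup>+x. ennreal (\<Psi> n x) \<partial>GX) = (\<lambda>n. ennreal (\<integral>x. \<Psi> n x \<partial>GX))"
    using nn_integral_eq_integral[OF \<Psi>i AE_I2[OF \<Psi>0]] by simp
  also have "liminf \<dots> = ennreal (h \<bullet> D h)"
    by (rule lim_imp_Liminf) (auto intro!: tendsto_ennrealI lim)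
  \<comment> \<open>\<open>ennreal\<close> truncates the supposedly nonpositive derivative to
    0.\<close>
  also have "\<dots> = 0" using neg by (simp add: D_def ennreal_neg)
  finally have "(\<integral>\<^sup>+x. liminf (\<lambda>n. ennreal (\<Psi> n x)) \<partial>GX) = 0" by simp
  then have "AE x in GX. liminf (\<lambda>n. ennreal (\<Psi> n x)) = 0"
    by (subst (asm) nn_integral_0_iff_AE) (use borel_measurable_integrable[OF \<Psi>i] in \<open>auto intro!: borel_measurable_liminf\<close>)
  with AE_GX AE_cdf have c0: "AE x in GX. \<forall>d. x \<bullet> beta h d = 0"
  proof eventually_elim
    case (elim x)
    have "liminf (\<lambda>n. ennreal (\<Psi> n x)) = ennreal (l x)"
      by (rule lim_imp_Liminf) (use plim elim in \<open>auto intro!: tendsto_ennrealI\<close>)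
    then have "l x \<le> 0" using elim(3) by (simp add: ennreal_eq_0_iff)
    moreover have fpos: "0 < deriv (cdf (PY x)) (x \<bullet> beta \<zeta>0 d)" for d
      using density_pos[of x d] elim(1) by auto
    moreover have "0 \<le> deriv (cdf (PY x)) (x \<bullet> beta \<zeta>0 d) * (x \<bullet> beta h d)\<^sup>2" for d
      using fpos[of d] by simp
    ultimately have "\<forall>d\<in>UNIV. deriv (cdf (PY x)) (x \<bullet> beta \<zeta>0 d) * (x \<bullet> beta h d)\<^sup>2 = 0"
      unfolding l_def by (subst sum_nonneg_eq_0_iff[symmetric]) (auto intro!: antisym sum_nonneg)
    then show ?case using fpos by (metis UNIV_I mult_eq_0_iff less_irrefl power2_eq_iff_nonneg power_eq_0_iff)
  qed
  \<comment> \<open>The second moment of h . m at \<zeta>0 vanishes with all x . beta h d.\<close>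
  have "h \<bullet> (V11 P \<tau> *v h) = (\<integral>w. (h \<bullet> m w \<zeta>0) * (h \<bullet> m w \<zeta>0) \<partial>P)" by (rule second_moment[symmetric])
  also have "\<dots> = (\<integral>x. (\<integral>y. (h \<bullet> m (x, y) \<zeta>0) * (h \<bullet> m (x, y) \<zeta>0) \<partial>PY x) \<partial>GX)"
  proof (rule disintegrate(1))
    show "(\<lambda>w. (h \<bullet> m w \<zeta>0) * (h \<bullet> m w \<zeta>0)) \<in> borel_measurable borel"
      by (intro borel_measurable_times inner_m_measurable)
    show "\<bar>(h \<bullet> m (x, y) \<zeta>0) * (h \<bullet> m (x, y) \<zeta>0)\<bar> \<le> (norm h * (real CARD('k \<times> 'q) * Bx)) * (norm h * (real CARD('k \<times> 'q) * Bx))"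
      if "norm x \<le> Bx" for x y
      unfolding abs_mult using inner_m_le[OF that, of h y \<zeta>0] Bx(1) by (intro mult_mono) auto
  qed
  also have "\<dots> = 0"
  proof (rule integral_eq_zero_AE)
    show "AE x in GX. (\<integral>y. (h \<bullet> m (x, y) \<zeta>0) * (h \<bullet> m (x, y) \<zeta>0) \<partial>PY x) = 0"
      using c0 by eventually_elim (simp add: inner_m_est)
  qed
  finally show False using V11_pos_def h by (auto simp: pos_def_def)
qed

end

section \<open>Posterior expansion and normality\<close>

theorem theorem3p2:
  fixes M :: "'w measure"
    and X :: "nat \<Rightarrow> 'w \<Rightarrow> real ^ 'q" and Y :: "nat \<Rightarrow> 'w \<Rightarrow> real"
    and P :: "((real ^ 'q) \<times> real) measure"
    and icpt :: 'q
    and PY :: "real ^ 'q \<Rightarrow> real measure"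
    and \<tau> :: "'k::{finite, linorder} \<Rightarrow> real"
    and \<zeta>0 :: "real ^ ('k \<times> 'q)"
    and K :: "(real ^ ('k \<times> 'q)) set"
    and \<zeta>hat :: "nat \<Rightarrow> 'w \<Rightarrow> real ^ ('k \<times> 'q)"
    and p0 :: "real ^ ('k \<times> 'q) \<Rightarrow> real"
    and V12 :: "real ^ ('k \<times> 'q) ^ ('k \<times> 'q)"
  defines "GX \<equiv> distr P borel fst"
  defines "R \<equiv> (\<lambda>n \<omega>. el_ratio \<tau> n (\<lambda>i. X i \<omega>) (\<lambda>i. Y i \<omega>))"
  defines "post_dens \<equiv> (\<lambda>n \<omega>. posterior_density p0 \<tau> n (\<lambda>i. X i \<omega>) (\<lambda>i. Y i \<omega>))"
  defines "post \<equiv> (\<lambda>n \<omega>. posterior p0 \<tau> n (\<lambda>i. X i \<omega>) (\<lambda>i. Y i \<omega>))"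
  defines "J \<equiv> J_mat P \<tau> V12"
  \<comment> \<open>i.i.d. sample from the law \<open>P\<close> of \<open>(X, Y)\<close>, with intercept\<close>
  assumes "prob_space M"
    and "prob_space.indep_vars M (\<lambda>_. borel) (\<lambda>i \<omega>. (X i \<omega>, Y i \<omega>)) UNIV"
    and "\<And>i. distr M borel (\<lambda>\<omega>. (X i \<omega>, Y i \<omega>)) = P"
    and "AE x in GX. x $ icpt = 1"
  \<comment> \<open>linear quantile regression model\<close>
    and "strict_mono \<tau>" and "\<And>d. 0 < \<tau> d \<and> \<tau> d < 1"
    and "is_cond_dist P PY"
    and "\<And>d. AE x in GX. quantile (PY x) (\<tau> d) = x \<bullet> beta \<zeta>0 d"
  \<comment> \<open>compact parameter set and maximum empirical likelihood estimator\<close>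
    and "compact K" and "\<zeta>0 \<in> interior K"
    and "\<And>n \<omega>. \<omega> \<in> space M \<Longrightarrow> is_arg_max (R n \<omega>) (\<lambda>\<zeta>. \<zeta> \<in> K) (\<zeta>hat n \<omega>)"
  \<comment> \<open>prior density\<close>
    and "p0 \<in> borel_measurable borel" and "\<And>\<zeta>. 0 \<le> p0 \<zeta>"
    and "prob_space (density lborel (\<lambda>\<zeta>. ennreal (p0 \<zeta>)))"
  \<comment> \<open>\<open>V12\<close> is minus the derivative of \<open>E m(X, Y, \<zeta>)\<close> at \<open>\<zeta>0\<close>\<close>
    and "((\<lambda>\<zeta>. \<integral>z. m_est \<tau> (fst z) (snd z) \<zeta> \<partial>P) has_derivative (\<lambda>h. - (V12 *v h))) (at \<zeta>0)"
  \<comment> \<open>conditions (a) to (f)\<close>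
    and a: "\<exists>N. open N \<and> \<zeta>0 \<in> N \<and>
              (\<forall>\<zeta>\<in>N. (\<lambda>n. measure M {\<omega> \<in> space M. 0 < R n \<omega> \<zeta>}) \<longlonglongrightarrow> 1)"
    and b: "bounded (msupport GX)"
    and c: "\<And>x. x \<in> msupport GX \<Longrightarrow> twice_cont_diff (cdf (PY x))"
    and d: "\<And>x d. x \<in> msupport GX \<Longrightarrow>
              \<forall>\<^sub>F t in nhds (quantile (PY x) (\<tau> d)). 0 < deriv (cdf (PY x)) t"
    and e: "pos_def (\<integral>z. outer (m_est \<tau> (fst z) (snd z) \<zeta>0) (m_est \<tau> (fst z) (snd z) \<zeta>0) \<partial>P)"
    and f: "\<exists>U B. open U \<and> \<zeta>0 \<in> U \<and>
              (\<forall>\<zeta>\<in>U. 0 < p0 \<zeta> \<and>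
                 (\<exists>D. ((\<lambda>\<xi>. ln (p0 \<xi>)) has_derivative D) (at \<zeta>) \<and> onorm D \<le> B))"
  shows "(\<exists>c. (\<forall>n \<omega>. 0 < c n \<omega>) \<and>
            (\<forall>S. (\<exists>C. \<forall>\<^sub>F n in sequentially. \<forall>\<zeta>\<in>S n. norm (\<zeta> - \<zeta>0) \<le> C / sqrt (real n)) \<longrightarrow>
               (\<exists>Rem. small_op1_on M S Rem \<and>
                  prob_vanishes M (\<lambda>n \<omega>. \<not> (\<forall>\<zeta>\<in>S n. post_dens n \<omega> \<zeta> =
                    c n \<omega> * exp (- 1 / 2 * ((\<zeta> - \<zeta>hat n \<omega>) \<bullet> (J n *v (\<zeta> - \<zeta>hat n \<omega>)))
                                  + Rem n \<omega> \<zeta>))))))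
         \<and> ((\<forall>\<^sub>F n in sequentially. pos_def (J n)) \<longrightarrow>
            weak_conv_in_prob M
              (\<lambda>n \<omega>. distr (post n \<omega>) borel (\<lambda>\<zeta>. matrix_sqrt (J n) *v (\<zeta> - \<zeta>hat n \<omega>)))
              std_normal_vec)"
proof -
  define Z where "Z = (\<lambda>i \<omega>. (X i \<omega>, Y i \<omega>))"
  interpret M: prob_space M by (rule \<open>prob_space M\<close>)
  have indep: "M.indep_vars (\<lambda>_. borel) Z UNIV" unfolding Z_def by fact
  have law: "distr M borel (Z i) = P" for i unfolding Z_def by fact
  have Zm: "Z i \<in> M \<rightarrow>\<^sub>M borel" for i using indep by (auto simp: M.indep_vars_def)
  have P: "prob_space P" "sets P = sets borel" using M.prob_space_distr[OF Zm[of 0]] law[of 0] by auto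
  obtain Bx where Bx: "0 < Bx" "\<And>x. x \<in> msupport GX \<Longrightarrow> norm x \<le> Bx"
    using b unfolding bounded_pos by blast
  interpret QR: quantile_regression P icpt PY \<tau> \<zeta>0 V12 Bx
  proof (rule quantile_regression.intro)
    show "AE x in distr P borel fst. x $ icpt = 1" using \<open>AE x in GX. x $ icpt = 1\<close> by (simp only: GX_def)
    show "AE x in distr P borel fst. quantile (PY x) (\<tau> d) = x \<bullet> beta \<zeta>0 d" for d
      using \<open>\<And>d. AE x in GX. quantile (PY x) (\<tau> d) = x \<bullet> beta \<zeta>0 d\<close>[of d] by (simp only: GX_def)
    show "0 < deriv (cdf (PY x)) (quantile (PY x) (\<tau> d))" if "x \<in> msupport (distr P borel fst)" for x d
      using d[of x d] that by (auto simp: GX_def dest: eventually_nhds_x_imp_x)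
    show "norm x \<le> Bx" "twice_cont_diff (cdf (PY x))" if "x \<in> msupport (distr P borel fst)" for x
      using that Bx(2) c by (simp_all add: GX_def)
  qed (rule P Bx(1) e | fact)+
  obtain L where L: "0 < L" "\<And>\<epsilon>. 0 < \<epsilon> \<Longrightarrow> \<epsilon> \<le> 1 \<Longrightarrow> \<exists>\<delta>>0. \<forall>s c. 0 < s \<longrightarrow> s \<le> \<delta> \<longrightarrow> norm c \<le> 1 \<longrightarrow>
      (\<integral>z. QR.osc z (\<zeta>0 + s *\<^sub>R c) (\<epsilon> * s) \<partial>P) \<le> L * \<epsilon> * s"
    using QR.osc_mean by blast
  \<comment> \<open>D is the derivative of the mean itself; its sign against V12 cancels in the
    quadratic form.\<close>
  define D where "D = (\<lambda>h. - (V12 *v h))"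
  have linD: "linear D" unfolding D_def by (intro linear_compose_neg matrix_vector_mul_linear)
  obtain \<kappa> where \<kappa>: "0 < \<kappa>" "\<And>h. \<kappa> * (norm h)\<^sup>2 \<le> h \<bullet> D h"
    using linear_form_coercive[OF linD] QR.mean_derivative_pos unfolding D_def by blast
  define V where "V = (\<lambda>v. V11 P \<tau> *v v)"
  define Vi where "Vi = (\<lambda>v. matrix_inv (V11 P \<tau>) *v v)"
  have linV: "linear V" unfolding V_def by (rule matrix_vector_mul_linear)
  obtain \<kappa>V where \<kappa>V: "0 < \<kappa>V" "\<And>v. \<kappa>V * (norm v)\<^sup>2 \<le> v \<bullet> V v"
    using linear_form_coercive[OF linV] QR.V11_pos_def unfolding V_def pos_def_def by blast
  have Vsym: "u \<bullet> V v = V u \<bullet> v" for u v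
    using symmetric_matrix_inner QR.V11_pos_def unfolding V_def pos_def_def by blast
  have Vinv: "V (Vi x) = x" for x
  proof -
    have "inj ((*v) (V11 P \<tau>))"
    proof (rule injI)
      fix v w assume "V11 P \<tau> *v v = V11 P \<tau> *v w"
      then have "(v - w) \<bullet> (V11 P \<tau> *v (v - w)) = 0" by (simp add: matrix_vector_mult_diff_distrib)
      then show "v = w" using QR.V11_pos_def unfolding pos_def_def by (metis eq_iff_diff_eq_0 less_irrefl)
    qed
    then have "invertible (V11 P \<tau>)" using matrix_left_invertible_injective invertible_left_inverse by blast
    then have "V11 P \<tau> ** matrix_inv (V11 P \<tau>) = mat 1" unfolding invertible_def matrix_inv_def by (metis (mono_tags, lifting) someI_ex)
    then show ?thesis by (simp add: V_def Vi_def matrix_vector_mul_assoc)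
  qed
  have p0: "p0 \<in> borel_measurable borel" "\<And>\<zeta>. 0 \<le> p0 \<zeta>" by fact+
  have nnp0: "(\<integral>\<^sup>+\<zeta>. ennreal (p0 \<zeta>) \<partial>lborel) = 1"
    using prob_space.emeasure_space_1[OF \<open>prob_space (density lborel (\<lambda>\<zeta>. ennreal (p0 \<zeta>)))\<close>] p0(1)
    by (simp add: emeasure_density)
  have ip0: "integrable lborel p0" by (rule integrableI_nonneg) (use p0 nnp0 in auto)
  have Ip0: "(\<integral>\<zeta>. p0 \<zeta> \<partial>lborel) = 1"
    by (subst integral_eq_nn_integral) (use p0 nnp0 in auto)
  obtain U b' where U: "open U" "\<zeta>0 \<in> U" "\<And>\<zeta>. \<zeta> \<in> U \<Longrightarrow> 0 < p0 \<zeta> \<and> (\<exists>D. ((\<lambda>\<xi>. ln (p0 \<xi>)) has_derivative D) (at \<zeta>) \<and> onorm D \<le> b')"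
    using f by blast
  have Rat: "R n \<omega> = (\<lambda>\<zeta>. elr n (\<lambda>i. m_est \<tau> (fst (Z i \<omega>)) (snd (Z i \<omega>)) \<zeta>))" for n \<omega>
    by (simp add: R_def el_ratio_eq_elr Z_def fun_eq_iff)
  interpret ES: el_sample M borel P Z "\<lambda>z \<zeta>. m_est \<tau> (fst z) (snd z) \<zeta>" QR.osc QR.good
    "real CARD('k \<times> 'q) * Bx" "QR.Bq * real CARD('k)" L \<zeta>0 D V Vi \<kappa> \<kappa>V
  proof
    show "M.indep_vars (\<lambda>_. borel) Z UNIV" by (rule indep)
    show "distr M borel (Z i) = P" for i by (rule law)
    show "QR.good \<in> sets borel" by (rule QR.good_sets)
    show "AE z in P. z \<in> QR.good" by (rule QR.AE_good)
    show "(\<lambda>z. m_est \<tau> (fst z) (snd z) \<zeta>) \<in> borel_measurable borel" for \<zeta> by (rule m_est_measurable)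
    show "0 < real CARD('k \<times> 'q) * Bx" using Bx(1) by simp
    show "norm (m_est \<tau> (fst z) (snd z) \<zeta>) \<le> real CARD('k \<times> 'q) * Bx" if "z \<in> QR.good" for z \<zeta>
      using that by (intro QR.norm_m_le) (simp add: QR.good_def)
    show "u \<bullet> m_est \<tau> (fst z) (snd z) (\<zeta> + s *\<^sub>R u) \<le> u \<bullet> m_est \<tau> (fst z) (snd z) (\<zeta> + t *\<^sub>R u)" if "s \<le> t" for z \<zeta> u s t
      by (rule m_est_mono[where \<tau> = \<tau>, OF QR.\<tau> that])
    show "(\<lambda>z. QR.osc z \<zeta> r) \<in> borel_measurable borel" for \<zeta> r by (rule QR.osc_measurable)
    show "norm (m_est \<tau> (fst z) (snd z) \<zeta>' - m_est \<tau> (fst z) (snd z) \<zeta>) \<le> QR.osc z \<zeta> r"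
      if "z \<in> QR.good" "norm (\<zeta>' - \<zeta>) \<le> r" for z \<zeta> \<zeta>' r using that by (rule QR.osc)
    show "0 < QR.Bq * real CARD('k)" using QR.Bq by simp
    show "0 \<le> QR.osc z \<zeta> r" "QR.osc z \<zeta> r \<le> QR.Bq * real CARD('k)" for z \<zeta> r by (rule QR.osc_bounds)+
    show "((\<lambda>\<zeta>. \<integral>z. m_est \<tau> (fst z) (snd z) \<zeta> \<partial>P) has_derivative D) (at \<zeta>0)" unfolding D_def by fact
    show "(\<integral>z. m_est \<tau> (fst z) (snd z) \<zeta>0 \<partial>P) = 0" using QR.mean_zero by (simp add: QR.mu_def)
    show "(\<integral>z. (u \<bullet> m_est \<tau> (fst z) (snd z) \<zeta>0) * (v \<bullet> m_est \<tau> (fst z) (snd z) \<zeta>0) \<partial>P) = u \<bullet> V v" for u v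
      unfolding V_def by (rule QR.second_moment)
    show "V (x + y) = V x + V y" "V (k *\<^sub>R x) = k *\<^sub>R V x" for x y k
      by (rule linear_add[OF linV] linear_cmul[OF linV])+
  qed (rule L \<kappa> \<kappa>V Vsym Vinv; assumption?)+
  have ratio: "ES.ratio n \<omega> = R n \<omega>" for n \<omega> by (simp add: Rat ES.ratio_def fun_eq_iff)
  interpret EP: el_posterior M borel P Z "\<lambda>z \<zeta>. m_est \<tau> (fst z) (snd z) \<zeta>" QR.osc QR.good
    "real CARD('k \<times> 'q) * Bx" "QR.Bq * real CARD('k)" L \<zeta>0 D V Vi \<kappa> \<kappa>V p0 \<zeta>hat K
  proof
    show "simple_function borel (m_est \<tau> (fst z) (snd z))" for z by (rule simple_function_m_est)
    show "\<forall>\<^sub>F \<zeta> in nhds \<zeta>0. 0 < p0 \<zeta>" using U unfolding eventually_nhds by blast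
    show "isCont (\<lambda>\<zeta>. ln (p0 \<zeta>)) \<zeta>0" using U(3)[OF U(2)] has_derivative_continuous by blast
    show "\<zeta>0 \<in> interior K" by fact
    show "\<forall>n. \<forall>\<omega>\<in>space M. \<forall>\<zeta>\<in>K. ES.ratio n \<omega> \<zeta> \<le> ES.ratio n \<omega> (\<zeta>hat n \<omega>)"
      using \<open>\<And>n \<omega>. \<omega> \<in> space M \<Longrightarrow> is_arg_max (R n \<omega>) (\<lambda>\<zeta>. \<zeta> \<in> K) (\<zeta>hat n \<omega>)\<close>
      unfolding ratio is_arg_max_def by (meson not_less)
  qed (fact p0 ip0 Ip0)+
  \<comment> \<open>J n = n A with A fixed, so a single root serves all n.\<close>
  define A where "A = transpose V12 ** matrix_inv (V11 P \<tau>) ** V12"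
  have JA: "J n = real n *\<^sub>R A" for n by (simp add: J_def J_mat_def A_def)
  have qf: "h \<bullet> (A *v h) = ES.qf h" for h
  proof -
    have "h \<bullet> (A *v h) = h \<bullet> (transpose V12 *v (matrix_inv (V11 P \<tau>) *v (V12 *v h)))"
      by (simp add: A_def matrix_vector_mul_assoc matrix_mul_assoc)
    also have "\<dots> = (V12 *v h) \<bullet> (matrix_inv (V11 P \<tau>) *v (V12 *v h))"
      using adjoint_works[of "\<lambda>x. V12 *v x" h] by (simp add: adjoint_matrix)
    also have "\<dots> = D h \<bullet> Vi (D h)"
      by (simp add: D_def Vi_def linear_neg[OF matrix_vector_mul_linear])
    finally show ?thesis by (simp only: ES.qf_def)
  qed
  have quad: "h \<bullet> (J n *v h) = real n * ES.qf h" for n h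
    by (simp add: JA qf flip: scaleR_matrix_vector_assoc)
  have pd: "post_dens n \<omega> = (\<lambda>\<zeta>. p0 \<zeta> * ES.ratio n \<omega> \<zeta> / (\<integral>\<xi>. p0 \<xi> * ES.ratio n \<omega> \<xi> \<partial>lborel))" for n \<omega>
    unfolding ratio by (simp add: post_dens_def posterior_density_def R_def fun_eq_iff)
  show ?thesis
  proof (intro conjI impI)
    show "\<exists>c. (\<forall>n \<omega>. 0 < c n \<omega>) \<and>
            (\<forall>S. (\<exists>C. \<forall>\<^sub>F n in sequentially. \<forall>\<zeta>\<in>S n. norm (\<zeta> - \<zeta>0) \<le> C / sqrt (real n)) \<longrightarrow>
               (\<exists>Rem. small_op1_on M S Rem \<and>
                  prob_vanishes M (\<lambda>n \<omega>. \<not> (\<forall>\<zeta>\<in>S n. post_dens n \<omega> \<zeta> =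
                    c n \<omega> * exp (- 1 / 2 * ((\<zeta> - \<zeta>hat n \<omega>) \<bullet> (J n *v (\<zeta> - \<zeta>hat n \<omega>)))
                                  + Rem n \<omega> \<zeta>)))))"
      unfolding quad by (rule EP.posterior_expansion[OF pd])
  next
    assume "\<forall>\<^sub>F n in sequentially. pos_def (J n)"
    then have "\<forall>\<^sub>F n in sequentially. pos_def (J n) \<and> 0 < n" using eventually_gt_at_top[of 0] by (rule eventually_conj)
    \<comment> \<open>One n > 0 is enough: it yields the symmetry of A, while semidefiniteness is
      read off from \<open>ES.qf\<close>.\<close>
    from eventually_happens'[OF sequentially_bot this] obtain n where "pos_def (J n)" "0 < n" by blast
    then have n: "pos_def (real n *\<^sub>R A)" "0 < n" by (simp_all only: JA)
    have "transpose A = A"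
      using n by (simp add: pos_def_def transpose_def vec_eq_iff)
    moreover have "0 \<le> h \<bullet> (A *v h)" for h
      using ES.qf_bounds unfolding qf by (meson mult_nonneg_nonneg less_imp_le order_trans zero_le_power2)
    ultimately have A: "pos_semidef A" by (simp add: pos_semidef_def)
    define S where "S = (\<lambda>h. matrix_sqrt A *v h)"
    have linS: "linear S" unfolding S_def by (rule matrix_vector_mul_linear)
    have Sm: "S \<in> borel_measurable borel"
      using linS by (intro borel_measurable_continuous_onI linear_continuous_on) (simp add: linear_conv_bounded_linear)
    \<comment> \<open>S carries the form \<open>ES.qf\<close> to the squared Euclidean norm, so the
      limiting weight in h is the standard Gaussian weight evaluated at S h.\<close>
    have normS: "(norm (S h))\<^sup>2 = ES.qf h" for h
    proof -
      have "(norm (S h))\<^sup>2 = S h \<bullet> S h" by (rule power2_norm_eq_inner)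
      also have "\<dots> = h \<bullet> (matrix_sqrt A *v (matrix_sqrt A *v h))"
        using matrix_sqrt[OF A] symmetric_matrix_inner[of "matrix_sqrt A" h "S h"] by (simp add: pos_semidef_def S_def)
      also have "\<dots> = ES.qf h" using matrix_sqrt[OF A] by (simp add: matrix_vector_mul_assoc qf)
      finally show ?thesis .
    qed
    obtain \<alpha> where \<alpha>: "0 < \<alpha>" "\<And>h. \<alpha> * (norm h)\<^sup>2 \<le> ES.qf h" using ES.qf_bounds by blast
    have "inj S" unfolding linear_injective_0[OF linS]
    proof (intro allI impI)
      fix h assume "S h = 0"
      then have "\<alpha> * (norm h)\<^sup>2 \<le> 0" using \<alpha>(2)[of h] normS[of h] by simp
      then show "h = 0" using \<alpha>(1) by (simp add: mult_le_0_iff)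
    qed
    then have "surj S" using linear_injective_imp_surjective[OF linS] by simp
    then have SS: "S (inv S y) = y" for y by (rule surj_f_inv_f)
    have TS: "matrix_sqrt (J n) *v h = sqrt (real n) *\<^sub>R S h" for n h
      by (simp add: JA matrix_sqrt_scale[OF A] S_def flip: scaleR_matrix_vector_assoc)
    define E where "E = (\<lambda>y :: real ^ ('k \<times> 'q). exp (- (1/2) * (norm y)\<^sup>2))"
    have Em: "E \<in> borel_measurable borel" unfolding E_def by measurable
    have ES_qf: "exp (- ES.qf h / 2) = E (S h)" for h by (simp add: E_def normS)
    have iE: "integrable lborel E" unfolding E_def by (rule integrable_gauss) simp
    have iES: "integrable lborel (\<lambda>h. E (S h))"
    proof (rule Bochner_Integration.integrable_bound[OF integrable_gauss[of "\<alpha> / 2"]])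
      show "AE h in lborel. norm (E (S h)) \<le> norm (exp (- (\<alpha> / 2) * (norm h)\<^sup>2))"
        using \<alpha>(2) by (intro AE_I2) (simp add: E_def normS)
      show "(\<lambda>h. E (S h)) \<in> borel_measurable lborel" using measurable_compose[OF Sm Em] by simp
    qed (use \<alpha>(1) in simp)
    have IE: "0 < (\<integral>y. E y \<partial>lborel)" by (rule integral_pos_if_pos_on_ball[OF iE, of 1 0]) (auto simp: E_def)
    have IES: "0 < (\<integral>h. E (S h) \<partial>lborel)" by (rule integral_pos_if_pos_on_ball[OF iES, of 1 0]) (auto simp: E_def)
    show "weak_conv_in_prob M
              (\<lambda>n \<omega>. distr (post n \<omega>) borel (\<lambda>\<zeta>. matrix_sqrt (J n) *v (\<zeta> - \<zeta>hat n \<omega>)))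
              std_normal_vec"
      unfolding weak_conv_in_prob_def
    proof (intro allI impI)
      fix g :: "real ^ ('k \<times> 'q) \<Rightarrow> real" and \<epsilon> :: real
      assume "continuous_on UNIV g \<and> bounded (range g)" and \<epsilon>: "0 < \<epsilon>"
      then obtain bg where g: "g \<in> borel_measurable borel" "\<And>x. \<bar>g x\<bar> \<le> bg"
        by (auto simp: bounded_iff intro: borel_measurable_continuous_onI)
      have "(\<integral>h. g (S h) * E (S h) \<partial>lborel) * (\<integral>y. E y \<partial>lborel) = (\<integral>y. g y * E y \<partial>lborel) * (\<integral>h. E (S h) \<partial>lborel)"
        by (rule linear_substitution_ratio_real[OF linS SS g Em _ _ iE iES]) (simp_all add: E_def)
      note substitution = this
      have lim: "(\<integral>z. g z \<partial>std_normal_vec) = (\<integral>h. g (S h) * exp (- ES.qf h / 2) \<partial>lborel) / (\<integral>h. exp (- ES.qf h / 2) \<partial>lborel)"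
      proof -
        have "(\<integral>z. g z \<partial>std_normal_vec) = (\<integral>y. g y * E y \<partial>lborel) / (\<integral>y. E y \<partial>lborel)"
          unfolding E_def by (rule integral_std_normal_vec[OF g(1)])
        also have "\<dots> = (\<integral>h. g (S h) * E (S h) \<partial>lborel) / (\<integral>h. E (S h) \<partial>lborel)"
          using substitution IE IES by (simp add: frac_eq_eq)
        finally show ?thesis unfolding ES_qf .
      qed
      have post: "post n \<omega> = density lborel (\<lambda>\<zeta>. ennreal (p0 \<zeta> * ES.ratio n \<omega> \<zeta> / (\<integral>\<xi>. p0 \<xi> * ES.ratio n \<omega> \<xi> \<partial>lborel)))" for n \<omega>
        using pd[of n \<omega>] by (simp add: post_def posterior_def post_dens_def)
      show "prob_vanishes M (\<lambda>n \<omega>. \<epsilon> < \<bar>(\<integral>z. g z \<partial>distr (post n \<omega>) borel (\<lambda>\<zeta>. matrix_sqrt (J n) *v (\<zeta> - \<zeta>hat n \<omega>)))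
          - (\<integral>z. g z \<partial>std_normal_vec)\<bar>)"
        unfolding lim post by (rule EP.posterior_weak_convergence[OF Sm TS linS g \<epsilon>])
    qed
  qed
qed

end
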